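(* Let $F:\mathbb{R}\to\mathbb{C}$ be given by $F(z)=\sum_{y\in A}a_y e^{\mathrm{i}zy}+\int_{\mathbb{R}}f(x)e^{\mathrm{i}zx}\,dx$, where $\emptyset\neq A\subset\mathbb{R}$ is discrete, $(a_y)_{y\in A}\subset\mathbb{C}$ is a sequence of coefficients such that $0<\sum_{y\in A}|a_y|<\infty$, and $f\in L^1(\mathbb{R};\mathbb{C})$. Then the following statements are equivalent. (i) $\inf_{z\in\mathbb{R}}|F(z)|>0$. (ii) $F(z)\neq 0$ for all $z\in\mathbb{R}$ and $\inf_{z\in\mathbb{R}}\left|\sum_{y\in A}a_y e^{\mathrm{i}zy}\right|>0$. (iii) There exist a discrete set $B\subset\mathbb{R}$, a sequence $(b_y)_{y\in B}\subset\mathbb{C}$ with $\sum_{y\in B}|b_y|<\infty$ and a function $g\in L^1(\mathbb{R};\mathbb{C})$ such that the function $G:\mathbb{R}\to\mathbb{C}$ defined by $G(z)=\sum_{y\in B}b_y e^{\mathrm{i}zy}+\int_{\mathbb{R}}g(x)e^{\mathrm{i}zx}\,dx$ for all $z\in\mathbb{R}$ satisfies $F(z)G(z)=1$ for all $z\in\mathbb{R}$. (iv) $F$ admits the representation $$F(z)=\exp\left(\mathrm{i}\gamma z+\sum_{y\in C}c_y e^{\mathrm{i}zy}+\int_{\mathbb{R}}h(x)e^{\mathrm{i}zx}\,dx+m\int_{\mathbb{R}}\frac{e^{-|x|}}{|x|}\operatorname{sgn}(x)(e^{\mathrm{i}zx}-1)\,dx\right)$$ for all $z\in\mathbb{R}$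 with some $\gamma\in\mathbb{C}$, a discrete set $C\subset\mathbb{R}$, a sequence $(c_y)_{y\in C}\subset\mathbb{C}$ such that $\sum_{y\in C}|c_y|<\infty$, $h\in L^1(\mathbb{R};\mathbb{C})$ and $m\in\mathbb{Z}$. (v) $F$ admits the representation $$F(z)=\exp\left(\mathrm{i}\gamma z-\frac{az^2}{2}+\int_{\mathbb{R}}\left(e^{\mathrm{i}zx}-1-\mathrm{i}zx\mathbf{1}_{(-1,1)}(x)\right)\nu(dx)\right)$$ for all $z\in\mathbb{R}$ with some $a,\gamma\in\mathbb{C}$ and a complex quasi-Lévy type measure $\nu$ on $\mathbb{R}$. If one, hence all, of these statements holds and additionally $f\in L^1_\omega(\mathbb{R};\mathbb{C})$ and $\sum_{y\in A}\omega(y)|a_y|<\infty$ for some weight $\omega$ on $\mathbb{R}$ that satisfies the GRS-condition, then $g$, $h$, $(b_y)_{y\in B}$ and $(c_y)_{y\in C}$ change accordingly, in the sense that $g,h\in L^1_\omega(\mathbb{R};\mathbb{C})$, $\sum_{y\in B}\omega(y)|b_y|<\infty$ and $\sum_{y\in C}\omega(y)|c_y|<\infty$.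
   Context: "Discrete set" here means an at most countable set (a set on which a discrete measure is concentrated). A weight on $\mathbb{R}$ is a locally bounded, measurable function $\omega:\mathbb{R}\to[1,\infty)$ with $\omega(x+y)\le\omega(x)\omega(y)$ for all $x,y\in\mathbb{R}$. For a weight $\omega$, $L^1_\omega(\mathbb{R};\mathbb{C})$ is the space of (measurable) $f:\mathbb{R}\to\mathbb{C}$ with $\int_{\mathbb{R}}\omega(x)|f(x)|\,dx<\infty$. A function $H:\mathbb{R}\to[0,\infty)$ satisfies the GRS-condition if $\lim_{|x|\to\infty}\frac{\log H(x)}{x}=0$. $\operatorname{sgn}(x)=x/|x|$ for $x\ne0$ and $\operatorname{sgn}(0)=0$; $\mathbf 1_{(-1,1)}$ is the indicator function of $(-1,1)$. A Lévy measure on $\mathbb{R}$ is a measure $\nu$ with $\nu(\{0\})=0$ and $\int_{\mathbb{R}}(x^2\wedge1)\,\nu(dx)<\infty$. A quasi-Lévy type measure $\nu$ is a (formal) difference $\nu=\nu_1-\nu_2$ of two Lévy measures $\nu_1,\nu_2$; as a set function it is defined on Borel sets bounded away from $0$, and on Borel subsets of $\mathbb{R}\setminus(-r,r)$ it is a finite signed measure for each $r>0$. For measurable $f$ with $|f(x)|\le K(1\wedge x^2)$ for some constant $K>0$, one sets $\int f\,d\nu=\int f\,d\nu_1-\int f\,d\nu_2$. A complex quasi-Lévy type measure is $\nu=\nu_1+\mathrm{i}\nu_2$ with quasi-Lévy type measures $\nu_1,\nu_2$, and integrals are extended by linearity.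
   Formalization: Statement (v) at z=0 forces F(0)=1, so it is not equivalent to (i)–(iv) in general (e.g. F=2). It is proved instead that (i) holds iff F(0)≠0 and F/F(0) has the representation (v), and that (v) for F itself holds iff (i) holds and F(0)=1. *)

theory Defs
  imports "HOL-Analysis.Analysis"
begin

definition trig_series :: "real set \<Rightarrow> (real \<Rightarrow> complex) \<Rightarrow> real \<Rightarrow> complex" where
  "trig_series A a z = (\<Sum>\<^sub>\<infinity>y\<in>A. a y * exp (\<i> * of_real (z * y)))"

definition fourier :: "(real \<Rightarrow> complex) \<Rightarrow> real \<Rightarrow> complex" where
  "fourier f z = (LINT x|lborel. f x * exp (\<i> * of_real (z * x)))"

text \<open>Coefficients are total functions; only their values on the index set matter.
  A discrete set is an at most countable one.\<close>

definition discrete_coeffs :: "real set \<Rightarrow> (real \<Rightarrow> complex) \<Rightarrow> bool" where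
  "discrete_coeffs A a \<longleftrightarrow> countable A \<and> (\<lambda>y. norm (a y)) summable_on A"

definition is_weight :: "(real \<Rightarrow> real) \<Rightarrow> bool" where
  "is_weight \<omega> \<longleftrightarrow>
     \<omega> \<in> borel_measurable borel \<and>
     (\<forall>K. compact K \<longrightarrow> bounded (\<omega> ` K)) \<and>
     (\<forall>x. 1 \<le> \<omega> x) \<and>
     (\<forall>x y. \<omega> (x + y) \<le> \<omega> x * \<omega> y)"

definition L1_weighted :: "(real \<Rightarrow> real) \<Rightarrow> (real \<Rightarrow> complex) set" where
  "L1_weighted \<omega> =
     {f. f \<in> borel_measurable borel \<and> integrable lborel (\<lambda>x. \<omega> x * norm (f x))}"

text \<open>Only used for weights, whose values are at least 1, so that the convention
  \<open>ln 0 = 0\<close> plays no role.\<close>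

definition GRS :: "(real \<Rightarrow> real) \<Rightarrow> bool" where
  "GRS H \<longleftrightarrow> ((\<lambda>x. ln (H x) / x) \<longlongrightarrow> 0) at_infinity"

definition levy_measure :: "real measure \<Rightarrow> bool" where
  "levy_measure \<nu> \<longleftrightarrow>
     sets \<nu> = sets borel \<and> emeasure \<nu> {0} = 0 \<and>
     (\<integral>\<^sup>+ x. ennreal (min (x\<^sup>2) 1) \<partial>\<nu>) < \<infinity>"

text \<open>A quasi-Levy type measure is the formal difference \<open>\<nu>\<^sub>1 - \<nu>\<^sub>2\<close> of two Levy
  measures, represented by the pair \<open>(\<nu>\<^sub>1, \<nu>\<^sub>2)\<close>; a complex one, \<open>\<nu>\<^sub>1 + \<i> \<nu>\<^sub>2\<close>, is a pair
  of quasi-Levy type measures. Different pairs may stand for the same formal difference;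
  integrals of functions bounded by a multiple of \<open>min 1 (x\<^sup>2)\<close> do not depend on the choice.\<close>

type_synonym qlevy = "real measure \<times> real measure"

definition quasi_levy :: "qlevy \<Rightarrow> bool" where
  "quasi_levy \<nu> \<longleftrightarrow> levy_measure (fst \<nu>) \<and> levy_measure (snd \<nu>)"

definition quasi_levy_integral :: "qlevy \<Rightarrow> (real \<Rightarrow> complex) \<Rightarrow> complex" where
  "quasi_levy_integral \<nu> f = (LINT x|fst \<nu>. f x) - (LINT x|snd \<nu>. f x)"

definition complex_quasi_levy :: "qlevy \<times> qlevy \<Rightarrow> bool" where
  "complex_quasi_levy \<nu> \<longleftrightarrow> quasi_levy (fst \<nu>) \<and> quasi_levy (snd \<nu>)"

definition complex_quasi_levy_integral ::
    "qlevy \<times> qlevy \<Rightarrow> (real \<Rightarrow> complex) \<Rightarrow> complex" where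
  "complex_quasi_levy_integral \<nu> f =
     quasi_levy_integral (fst \<nu>) f + \<i> * quasi_levy_integral (snd \<nu>) f"

definition inverse_rep ::
    "(real \<Rightarrow> complex) \<Rightarrow> real set \<Rightarrow> (real \<Rightarrow> complex) \<Rightarrow> (real \<Rightarrow> complex) \<Rightarrow> bool" where
  "inverse_rep F B b g \<longleftrightarrow>
     discrete_coeffs B b \<and> integrable lborel g \<and>
     (\<forall>z. F z * (trig_series B b z + fourier g z) = 1)"

definition exp_rep ::
    "(real \<Rightarrow> complex) \<Rightarrow> complex \<Rightarrow> real set \<Rightarrow> (real \<Rightarrow> complex) \<Rightarrow>
     (real \<Rightarrow> complex) \<Rightarrow> int \<Rightarrow> bool" where
  "exp_rep F \<gamma> C c h m \<longleftrightarrow>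
     discrete_coeffs C c \<and> integrable lborel h \<and>
     (\<forall>z. F z = exp (\<i> * \<gamma> * of_real z + trig_series C c z + fourier h z
        + of_int m * (LINT x|lborel. of_real (exp (- \<bar>x\<bar>) / \<bar>x\<bar> * sgn x)
                        * (exp (\<i> * of_real (z * x)) - 1))))"

definition levy_khintchine_rep :: "(real \<Rightarrow> complex) \<Rightarrow> bool" where
  "levy_khintchine_rep F \<longleftrightarrow>
     (\<exists>a \<gamma> \<nu>. complex_quasi_levy \<nu> \<and>
       (\<forall>z. F z = exp (\<i> * \<gamma> * of_real z - a * (of_real z)\<^sup>2 / 2
          + complex_quasi_levy_integral \<nu>
              (\<lambda>x. exp (\<i> * of_real (z * x)) - 1
                   - \<i> * of_real (z * x * indicator {-1<..<1} x)))))"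

text \<open>A function with such a representation is normalised, so for general \<open>F\<close> the
  representation is to be asked of \<open>F / F 0\<close>.\<close>

lemma levy_khintchine_rep_at_0:
  "levy_khintchine_rep F \<Longrightarrow> F 0 = 1"
  unfolding levy_khintchine_rep_def
  by (auto simp: complex_quasi_levy_integral_def quasi_levy_integral_def)

end

theory Submission
  imports Defs "HOL-Probability.Characteristic_Functions"
begin

text \<open>Let \<open>\<A>\<close> be the algebra of transforms of measures with a discrete and an absolutely
  continuous part, normed by \<open>\<omega>\<close>. The GRS condition makes the spectral radius of an element of
  \<open>\<A>\<close> at most its supremum norm. Hence an element within distance less than 1 of the constant 1 in
  supremum norm has an inverse (Neumann series) and a logarithm (power series) in \<open>\<A>\<close>. Applied to
  \<open>F\<close> times the conjugate of a truncation of \<open>F\<close>, this inverts every \<open>F\<close> that is bounded away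
  from 0; for the logarithm it leaves the task of approximating a continuous logarithm of \<open>F\<close>
  uniformly by \<open>\<i>\<gamma>z\<close>, an element of \<open>\<A>\<close> and an integer multiple of \<open>2\<i> arctan z\<close>, the closed form
  of the last integral in (iv). For the almost periodic part of \<open>F\<close> this is Bohr's theorem on the argument, and the
  quotient of \<open>F\<close> by it lives on the circle, where Stone-Weierstrass applies. Conversely, under a
  Levy-Khintchine representation the exponent has bounded second differences, which forces any
  decay of \<open>F\<close> to spread over long progressions.\<close>

section \<open>Weighted representations\<close>

text \<open>Three obstacles shape the argument. The weight is not assumed symmetric, so the
  conjugate of \<open>F\<close>, which belongs to the reflected measure, need not lie in the
  weighted algebra; for finitely many atoms and a bounded density of compact support it always does,
  and this is why the conjugate of a truncation is used. Next, the supremum norm controls the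
  coefficients of an almost periodic function but not the density behind a Fourier transform, unless
  that transform is integrable; hence the estimate of powers isolates the terms that contain the
  absolutely continuous part at least twice. Finally, a logarithm of \<open>F\<close> may leave the
  algebra in two ways: it may grow linearly, and once its almost periodic part is removed it may
  have different limits at the two ends of the line. The terms with \<open>\<gamma>\<close> and
  \<open>m\<close> in (iv) absorb exactly these two defects. Uniqueness of the measure behind a
  transform enters with the weighted claim, which concerns every representation as in (iii) and
  (iv), not just the constructed one.\<close>

lemma norm_fourier_le:
  "norm (fourier f z) \<le> (LINT x|lborel. norm (f x))"
proof -
  have "norm (fourier f z) \<le> (LINT x|lborel. norm (f x * iexp (z * x)))"
    unfolding fourier_def by (rule integral_norm_bound)
  then show ?thesis by (simp add: norm_mult)
qed

lemma integrable_mult_iexp: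
  assumes "integrable lborel f"
  shows "integrable lborel (\<lambda>x. f x * iexp (z * x))"
  by (rule Bochner_Integration.integrable_bound[OF assms]) (use assms in \<open>auto simp: norm_mult\<close>)

lemma fourier_add:
  assumes "integrable lborel f" "integrable lborel g"
  shows "fourier (\<lambda>x. f x + g x) z = fourier f z + fourier g z"
  unfolding fourier_def ring_distribs
  using integrable_mult_iexp[OF assms(1)] integrable_mult_iexp[OF assms(2)]
  by (rule Bochner_Integration.integral_add)

lemma fourier_diff:
  assumes "integrable lborel f" "integrable lborel g"
  shows "fourier (\<lambda>x. f x - g x) z = fourier f z - fourier g z"
  unfolding fourier_def ring_distribs
  using integrable_mult_iexp[OF assms(1)] integrable_mult_iexp[OF assms(2)]
  by (rule Bochner_Integration.integral_diff)

lemma fourier_cmult: "fourier (\<lambda>x. c * f x) z = c * fourier f z"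
  unfolding fourier_def by (simp add: mult.assoc)

lemma fourier_cong_AE:
  assumes "AE x in lborel. f x = g x" "f \<in> borel_measurable lborel" "g \<in> borel_measurable lborel"
  shows "fourier f z = fourier g z"
  unfolding fourier_def by (rule integral_cong_AE) (use assms in auto)

lemma fourier_shift: "fourier (\<lambda>x. f (x - s)) z = iexp (z * s) * fourier f z"
proof -
  have "fourier (\<lambda>x. f (x - s)) z = (LINT x|lborel. f (s + 1 * x - s) * iexp (z * (s + 1 * x)))"
    unfolding fourier_def by (subst lborel_integral_real_affine[where c=1 and t=s]) auto
  also have "\<dots> = (LINT x|lborel. iexp (z * s) * (f x * iexp (z * x)))"
    by (intro Bochner_Integration.integral_cong) (auto simp: ring_distribs exp_add)
  finally show ?thesis by (simp add: fourier_def)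
qed

lemma continuous_on_fourier:
  assumes "integrable lborel f"
  shows "continuous_on UNIV (fourier f)"
proof -
  have "continuous (at z) (fourier f)" for z
    unfolding continuous_at_sequentially
  proof safe
    fix u :: "nat \<Rightarrow> real" assume u: "u \<longlonglongrightarrow> z"
    have "(\<lambda>n. LINT x|lborel. f x * iexp (u n * x)) \<longlonglongrightarrow> (LINT x|lborel. f x * iexp (z * x))"
    proof (rule integral_dominated_convergence[where w="\<lambda>x. norm (f x)"])
      show "AE x in lborel. (\<lambda>n. f x * iexp (u n * x)) \<longlonglongrightarrow> f x * iexp (z * x)"
        using u by (intro AE_I2 tendsto_intros)
    qed (use assms in \<open>auto simp: norm_mult\<close>)
    then show "(fourier f \<circ> u) \<longlonglongrightarrow> fourier f z" by (simp add: fourier_def o_def)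
  qed
  then show ?thesis by (simp add: continuous_at_imp_continuous_on)
qed

section \<open>Elementary properties of weights\<close>

lemma weight_pos: "is_weight \<omega> \<Longrightarrow> 0 < \<omega> x"
  unfolding is_weight_def by (meson less_le_trans zero_less_one)

lemma weight_ge1: "is_weight \<omega> \<Longrightarrow> 1 \<le> \<omega> x"
  unfolding is_weight_def by blast

lemma weight_nonneg: "is_weight \<omega> \<Longrightarrow> 0 \<le> \<omega> x"
  using weight_pos[of \<omega> x] by simp

lemma weight_add: "is_weight \<omega> \<Longrightarrow> \<omega> (x + y) \<le> \<omega> x * \<omega> y"
  unfolding is_weight_def by blast

lemma weight_measurable: "is_weight \<omega> \<Longrightarrow> \<omega> \<in> borel_measurable borel"
  unfolding is_weight_def by blast

lemma weight_one: "is_weight (\<lambda>_. 1)"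
  unfolding is_weight_def by (auto intro!: boundedI[of _ 1])

lemma infsum_nat_eq_suminf:
  fixes f :: "nat \<Rightarrow> 'a::{t2_space,comm_monoid_add,topological_space}"
  shows "f summable_on UNIV \<Longrightarrow> infsum f UNIV = suminf f"
  using has_sum_imp_sums[OF has_sum_infsum] sums_unique by metis

text \<open>Elements of the weighted algebra of discrete and absolutely continuous measures, described
  through their Fourier transforms together with a bound on the weighted norm.\<close>

definition D_rep :: "(real \<Rightarrow> real) \<Rightarrow> (real \<Rightarrow> complex) \<Rightarrow> real \<Rightarrow> bool" where
  "D_rep \<omega> P C \<longleftrightarrow> (\<exists>a. (\<lambda>y. \<omega> y * norm (a y)) summable_on UNIV \<and>
     (\<Sum>\<^sub>\<infinity>y. \<omega> y * norm (a y)) \<le> C \<and> P = trig_series UNIV a)"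

definition L_rep :: "(real \<Rightarrow> real) \<Rightarrow> (real \<Rightarrow> complex) \<Rightarrow> real \<Rightarrow> bool" where
  "L_rep \<omega> G C \<longleftrightarrow> (\<exists>g. g \<in> L1_weighted \<omega> \<and>
     (LINT x|lborel. \<omega> x * norm (g x)) \<le> C \<and> G = fourier g)"

text \<open>The number \<open>C\<close> bounds the norms of some decomposition and is not a norm
  itself, so bounds can be added and multiplied before the two parts are known to be determined by
  \<open>F\<close>.\<close>

definition R_rep :: "(real \<Rightarrow> real) \<Rightarrow> (real \<Rightarrow> complex) \<Rightarrow> real \<Rightarrow> bool" where
  "R_rep \<omega> F C \<longleftrightarrow> (\<exists>P G c d. D_rep \<omega> P c \<and> L_rep \<omega> G d \<and> c + d \<le> C \<and> F = (\<lambda>z. P z + G z))"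

lemma L1_weighted_integrable:
  assumes "is_weight \<omega>" "g \<in> L1_weighted \<omega>"
  shows "integrable lborel g"
proof (rule Bochner_Integration.integrable_bound)
  show "integrable lborel (\<lambda>x. \<omega> x * norm (g x))" "g \<in> borel_measurable lborel"
    using assms(2) by (auto simp: L1_weighted_def)
  show "AE x in lborel. norm (g x) \<le> norm (\<omega> x * norm (g x))"
    using weight_ge1[OF assms(1)] mult_right_mono[of 1 "\<omega> _" "norm (g _)"] weight_nonneg[OF assms(1)]
    by (auto simp: norm_mult)
qed

lemma L1_weighted_norm_le:
  assumes "is_weight \<omega>" "g \<in> L1_weighted \<omega>"
  shows "(LINT x|lborel. norm (g x)) \<le> (LINT x|lborel. \<omega> x * norm (g x))"
  using assms L1_weighted_integrable[OF assms] weight_ge1[OF assms(1)] mult_right_mono[of 1 "\<omega> _" "norm (g _)"]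
  by (intro integral_mono) (auto simp: L1_weighted_def)

lemma weighted_summable_norm:
  assumes "is_weight \<omega>" "(\<lambda>y. \<omega> y * norm (a y)) summable_on A"
  shows "(\<lambda>y. norm (a y)) summable_on A"
  using assms(2) by (rule summable_on_comparison_test)
     (use weight_ge1[OF assms(1)] mult_right_mono[of 1 "\<omega> _" "norm (a _)"] in auto)

lemma trig_series_terms_summable:
  assumes "(\<lambda>y. norm (a y)) summable_on A"
  shows "(\<lambda>y. a y * iexp (z * y)) summable_on A"
  by (rule abs_summable_summable) (use assms in \<open>auto simp: norm_mult\<close>)

lemma norm_trig_series_le:
  assumes "(\<lambda>y. norm (a y)) summable_on A"
  shows "norm (trig_series A a z) \<le> (\<Sum>\<^sub>\<infinity>y\<in>A. norm (a y))"
proof -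
  have "norm (trig_series A a z) \<le> (\<Sum>\<^sub>\<infinity>y\<in>A. norm (a y * iexp (z * y)))"
    unfolding trig_series_def
    by (rule norm_infsum_bound) (use assms in \<open>auto simp: norm_mult\<close>)
  then show ?thesis by (simp add: norm_mult)
qed

lemma trig_series_add:
  assumes "(\<lambda>y. norm (a y)) summable_on A" "(\<lambda>y. norm (b y)) summable_on A"
  shows "trig_series A (\<lambda>y. a y + b y) z = trig_series A a z + trig_series A b z"
  unfolding trig_series_def ring_distribs
  by (intro infsum_add trig_series_terms_summable assms)

lemma trig_series_diff:
  assumes "(\<lambda>y. norm (a y)) summable_on A" "(\<lambda>y. norm (b y)) summable_on A"
  shows "trig_series A (\<lambda>y. a y - b y) z = trig_series A a z - trig_series A b z"
proof -
  have "(\<lambda>y. norm (- b y)) summable_on A" using assms(2) by simp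
  from trig_series_add[OF assms(1) this]
  show ?thesis by (simp add: trig_series_def infsum_uminus)
qed

lemma trig_series_restrict:
  "trig_series UNIV (\<lambda>y. if y \<in> A then a y else 0) = trig_series A a"
  unfolding trig_series_def
  by (rule ext, rule infsum_cong_neutral) auto

lemma D_rep_mono: "D_rep \<omega> P C \<Longrightarrow> C \<le> C' \<Longrightarrow> D_rep \<omega> P C'"
  unfolding D_rep_def by force

lemma L_rep_mono: "L_rep \<omega> P C \<Longrightarrow> C \<le> C' \<Longrightarrow> L_rep \<omega> P C'"
  unfolding L_rep_def by force

lemma R_rep_mono: "R_rep \<omega> P C \<Longrightarrow> C \<le> C' \<Longrightarrow> R_rep \<omega> P C'"
  unfolding R_rep_def by force

lemma D_rep_bound:
  assumes "is_weight \<omega>" "D_rep \<omega> P C"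
  shows "norm (P z) \<le> C"
proof -
  obtain a where a: "(\<lambda>y. \<omega> y * norm (a y)) summable_on UNIV"
     "(\<Sum>\<^sub>\<infinity>y. \<omega> y * norm (a y)) \<le> C" "P = trig_series UNIV a"
    using assms(2) unfolding D_rep_def by blast
  have s: "(\<lambda>y. norm (a y)) summable_on UNIV" by (rule weighted_summable_norm[OF assms(1) a(1)])
  have "(\<Sum>\<^sub>\<infinity>y. norm (a y)) \<le> (\<Sum>\<^sub>\<infinity>y. \<omega> y * norm (a y))"
    by (rule infsum_mono[OF s a(1)])
       (use weight_ge1[OF assms(1)] mult_right_mono[of 1 "\<omega> _" "norm (a _)"] in auto)
  then show ?thesis using norm_trig_series_le[OF s, of z] a by simp
qed

lemma L_rep_bound:
  assumes "is_weight \<omega>" "L_rep \<omega> P C"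
  shows "norm (P z) \<le> C"
proof -
  obtain g where g: "g \<in> L1_weighted \<omega>"
     "(LINT x|lborel. \<omega> x * norm (g x)) \<le> C" "P = fourier g"
    using assms(2) unfolding L_rep_def by blast
  show ?thesis using norm_fourier_le[of g z] L1_weighted_norm_le[OF assms(1) g(1)] g by simp
qed

lemma R_rep_bound:
  assumes "is_weight \<omega>" "R_rep \<omega> F C"
  shows "norm (F z) \<le> C"
  using assms(2) unfolding R_rep_def
  by (smt (verit) D_rep_bound[OF assms(1)] L_rep_bound[OF assms(1)] norm_triangle_ineq)

lemma R_rep_nonneg:
  assumes "is_weight \<omega>" "R_rep \<omega> F C" shows "0 \<le> C"
  using R_rep_bound[OF assms, of 0] norm_ge_zero[of "F 0"] by linarith

lemma D_rep_nonneg: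
  assumes "is_weight \<omega>" "D_rep \<omega> F C" shows "0 \<le> C"
  using D_rep_bound[OF assms, of 0] norm_ge_zero[of "F 0"] by linarith

lemma L_rep_nonneg:
  assumes "is_weight \<omega>" "L_rep \<omega> F C" shows "0 \<le> C"
  using L_rep_bound[OF assms, of 0] norm_ge_zero[of "F 0"] by linarith

lemma D_rep_atom: "D_rep \<omega> (\<lambda>z. c * iexp (z * s)) (\<omega> s * norm c)"
  unfolding D_rep_def
proof (intro exI conjI)
  let ?a = "\<lambda>y. if y = s then c else 0"
  have eq: "(\<lambda>y. \<omega> y * norm (?a y)) = (\<lambda>y. if y = s then \<omega> s * norm c else 0)" by auto
  show "(\<lambda>y. \<omega> y * norm (?a y)) summable_on UNIV"
    unfolding eq by (rule summable_on_cong_neutral[THEN iffD1, of _ "{s}" _ "\<lambda>y. \<omega> s * norm c"]) auto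
  have "(\<Sum>\<^sub>\<infinity>y. \<omega> y * norm (?a y)) = (\<Sum>\<^sub>\<infinity>y\<in>{s}. \<omega> s * norm c)"
    unfolding eq by (rule infsum_cong_neutral) auto
  then show "(\<Sum>\<^sub>\<infinity>y. \<omega> y * norm (?a y)) \<le> \<omega> s * norm c" by simp
  have "(\<Sum>\<^sub>\<infinity>y. ?a y * iexp (z * y)) = (\<Sum>\<^sub>\<infinity>y\<in>{s}. c * iexp (z * s))" for z
    by (rule infsum_cong_neutral) auto
  then show "(\<lambda>z. c * iexp (z * s)) = trig_series UNIV ?a"
    by (auto simp: trig_series_def)
qed

lemma D_rep_zero: "D_rep \<omega> (\<lambda>z. 0) 0"
  using D_rep_atom[of \<omega> 0 0] by simp

lemma L_rep_zero: "L_rep \<omega> (\<lambda>z. 0) 0"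
  unfolding L_rep_def by (rule exI[of _ "\<lambda>x. 0"]) (auto simp: L1_weighted_def fourier_def)

lemma R_rep_D: "D_rep \<omega> F C \<Longrightarrow> R_rep \<omega> F C"
  unfolding R_rep_def using L_rep_zero by force

lemma R_rep_L: "L_rep \<omega> F C \<Longrightarrow> R_rep \<omega> F C"
  unfolding R_rep_def using D_rep_zero by force

text \<open>Completeness of the discrete part: coefficients are added frequency by frequency, and
  Tonelli for the double series of weighted norms gives both the bound and the exchange of the sums.
  Closure under sums and under products with discrete elements is later derived from statements of
  this kind.\<close>

lemma D_rep_suminf:
  assumes w: "is_weight \<omega>" and P: "\<And>n. D_rep \<omega> (P n) (C n)" and C: "summable C"
  shows "D_rep \<omega> (\<lambda>z. \<Sum>n. P n z) (\<Sum>n. C n)"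
proof -
  obtain a where a: "\<And>n. (\<lambda>y. \<omega> y * norm (a n y)) summable_on UNIV"
     "\<And>n. (\<Sum>\<^sub>\<infinity>y. \<omega> y * norm (a n y)) \<le> C n" "\<And>n. P n = trig_series UNIV (a n)"
    using P unfolding D_rep_def by metis
  have C0: "0 \<le> C n" for n using D_rep_nonneg[OF w P] .
  have Cs: "C summable_on UNIV" using C C0
    by (simp add: norm_summable_imp_summable_on)
  have infs: "(\<lambda>n. \<Sum>\<^sub>\<infinity>y. \<omega> y * norm (a n y)) summable_on UNIV"
    by (rule summable_on_comparison_test[OF Cs]) (auto intro!: a infsum_nonneg mult_nonneg_nonneg weight_nonneg[OF w])
  have main: "(\<lambda>(n, y). \<omega> y * norm (a n y)) summable_on UNIV \<times> UNIV"
  proof -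
    have "(\<lambda>p. norm (case p of (n, y) \<Rightarrow> \<omega> y * norm (a n y))) summable_on UNIV \<times> UNIV"
      unfolding Infinite_Sum.abs_summable_on_Sigma_iff using a(1) infs
      by (auto simp: norm_mult weight_nonneg[OF w] infsum_nonneg)
    then show ?thesis by (rule abs_summable_summable)
  qed
  have main': "(\<lambda>(y, n). \<omega> y * norm (a n y)) summable_on UNIV \<times> UNIV"
    using main summable_on_reindex[of prod.swap "UNIV \<times> UNIV" "\<lambda>(n, y). \<omega> y * norm (a n y)"]
    by (simp add: o_def case_prod_unfold product_swap inj_on_def)
  have sn: "(\<lambda>n. \<omega> y * norm (a n y)) summable_on UNIV" for y
    using summable_on_SigmaD1[OF main'] by simp
  have sn': "(\<lambda>n. norm (a n y)) summable_on UNIV" for y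
  proof -
    have "(\<lambda>n. inverse (\<omega> y) * (\<omega> y * norm (a n y))) summable_on UNIV" by (rule summable_on_cmult_right[OF sn])
    then show ?thesis using weight_pos[OF w, of y] by (simp add: mult.assoc[symmetric])
  qed
  define b where "b y = (\<Sum>\<^sub>\<infinity>n. a n y)" for y
  have bn: "norm (b y) \<le> (\<Sum>\<^sub>\<infinity>n. norm (a n y))" for y
    unfolding b_def by (rule norm_infsum_bound) (rule sn')
  have bn': "\<omega> y * norm (b y) \<le> (\<Sum>\<^sub>\<infinity>n. \<omega> y * norm (a n y))" for y
    using mult_left_mono[OF bn weight_nonneg[OF w, of y], of y] sn'[of y] by (simp add: infsum_cmult_right)
  have so: "(\<lambda>y. \<Sum>\<^sub>\<infinity>n. \<omega> y * norm (a n y)) summable_on UNIV"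
    using summable_on_Sigma_banach[OF main'] by simp
  have sb: "(\<lambda>y. \<omega> y * norm (b y)) summable_on UNIV"
    by (rule summable_on_comparison_test[OF so]) (auto intro!: bn' mult_nonneg_nonneg weight_nonneg[OF w])
  have "(\<Sum>\<^sub>\<infinity>y. \<omega> y * norm (b y)) \<le> (\<Sum>\<^sub>\<infinity>y. \<Sum>\<^sub>\<infinity>n. \<omega> y * norm (a n y))"
    by (rule infsum_mono[OF sb so]) (rule bn')
  also have "\<dots> = (\<Sum>\<^sub>\<infinity>n. \<Sum>\<^sub>\<infinity>y. \<omega> y * norm (a n y))"
    by (rule infsum_swap_banach) (rule main')
  also have "\<dots> \<le> (\<Sum>\<^sub>\<infinity>n. C n)" by (rule infsum_mono[OF infs Cs]) (rule a)
  also have "\<dots> = (\<Sum>n. C n)"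
    by (rule infsum_nat_eq_suminf[OF Cs])
  finally have le: "(\<Sum>\<^sub>\<infinity>y. \<omega> y * norm (b y)) \<le> (\<Sum>n. C n)" .
  have "(\<Sum>n. P n z) = trig_series UNIV b z" for z
  proof -
    have s1: "(\<lambda>(n, y). a n y * iexp (z * y)) summable_on UNIV \<times> UNIV"
    proof (rule abs_summable_summable, rule summable_on_comparison_test[OF main])
      fix p :: "nat \<times> real"
      show "norm (case p of (n, y) \<Rightarrow> a n y * iexp (z * y)) \<le> (case p of (n, y) \<Rightarrow> \<omega> y * norm (a n y))"
        using mult_right_mono[OF weight_ge1[OF w, of "snd p"], of "norm (a (fst p) (snd p))"] 
        by (simp add: norm_mult case_prod_unfold)
    qed simp
    have Ps: "(\<lambda>n. P n z) summable_on UNIV"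
      using summable_on_Sigma_banach[OF s1] by (simp add: a(3) trig_series_def)
    have "(\<Sum>n. P n z) = (\<Sum>\<^sub>\<infinity>n. \<Sum>\<^sub>\<infinity>y. a n y * iexp (z * y))"
      using infsum_nat_eq_suminf[OF Ps] by (simp add: a(3) trig_series_def)
    also have "\<dots> = (\<Sum>\<^sub>\<infinity>y. \<Sum>\<^sub>\<infinity>n. a n y * iexp (z * y))"
      by (rule infsum_swap_banach) (rule s1)
    also have "\<dots> = trig_series UNIV b z"
      unfolding trig_series_def b_def
      by (intro infsum_cong) (rule infsum_cmult_left')
    finally show ?thesis .
  qed
  then show ?thesis unfolding D_rep_def using sb le by blast
qed

text \<open>Completeness for densities: the sum of the weighted absolute values has a finite
  integral, so the series of densities converges absolutely almost everywhere.\<close>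

lemma L_rep_suminf:
  assumes w: "is_weight \<omega>" and G: "\<And>n. L_rep \<omega> (G n) (C n)" and C: "summable C"
  shows "L_rep \<omega> (\<lambda>z. \<Sum>n. G n z) (\<Sum>n. C n)"
proof -
  obtain g where g: "\<And>n. g n \<in> L1_weighted \<omega>"
     "\<And>n. (LINT x|lborel. \<omega> x * norm (g n x)) \<le> C n" "\<And>n. G n = fourier (g n)"
    using G unfolding L_rep_def by metis
  have [measurable]: "g n \<in> borel_measurable borel" "\<omega> \<in> borel_measurable borel" for n
    using g(1)[of n] weight_measurable[OF w] by (auto simp: L1_weighted_def)
  have gi: "integrable lborel (\<lambda>x. \<omega> x * norm (g n x))" for n
    using g(1)[of n] by (auto simp: L1_weighted_def)
  have C0: "0 \<le> C n" for n using L_rep_nonneg[OF w G] .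
  define S where "S n = (LINT x|lborel. \<omega> x * norm (g n x))" for n
  have S0: "0 \<le> S n" for n
    unfolding S_def by (intro Bochner_Integration.integral_nonneg mult_nonneg_nonneg weight_nonneg[OF w]) auto
  have Ss: "summable S"
    by (rule summable_comparison_test'[OF C, of 0]) (use S0 g(2) in \<open>auto simp: S_def\<close>)
  have SC: "(\<Sum>n. S n) \<le> (\<Sum>n. C n)"
    by (rule suminf_le[OF _ Ss C]) (use g(2) in \<open>auto simp: S_def\<close>)
  have w0: "0 \<le> \<omega> x" for x by (rule weight_nonneg[OF w])
  have total: "(\<integral>\<^sup>+x. (\<Sum>n. ennreal (\<omega> x * norm (g n x))) \<partial>lborel) = ennreal (\<Sum>n. S n)"
  proof -
    have "(\<integral>\<^sup>+x. (\<Sum>n. ennreal (\<omega> x * norm (g n x))) \<partial>lborel)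
        = (\<Sum>n. \<integral>\<^sup>+x. ennreal (\<omega> x * norm (g n x)) \<partial>lborel)"
      by (rule nn_integral_suminf) measurable
    also have "\<dots> = (\<Sum>n. ennreal (S n))"
      unfolding S_def using gi w0 by (subst nn_integral_eq_integral) auto
    also have "\<dots> = ennreal (\<Sum>n. S n)" by (rule suminf_ennreal2[OF S0 Ss])
    finally show ?thesis .
  qed
  have "AE x in lborel. (\<Sum>n. ennreal (\<omega> x * norm (g n x))) \<noteq> \<infinity>"
    by (rule nn_integral_noteq_infinite) (use total in auto)
  then have AEs: "AE x in lborel. summable (\<lambda>n. \<omega> x * norm (g n x))"
  proof eventually_elim
    case (elim x)
    have "0 \<le> \<omega> x * norm (g n x)" for n using w0[of x] by simp
    then show ?case by (rule summable_suminf_not_top) (use elim in simp)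
  qed
  have AEn: "AE x in lborel. summable (\<lambda>n. norm (g n x))"
    using AEs
  proof eventually_elim
    fix x assume "summable (\<lambda>n. \<omega> x * norm (g n x))"
    then have "summable (\<lambda>n. inverse (\<omega> x) * (\<omega> x * norm (g n x)))" by (rule summable_mult)
    then show "summable (\<lambda>n. norm (g n x))"
      using weight_pos[OF w, of x] by (simp add: mult.assoc[symmetric])
  qed
  \<comment> \<open>On the null set where the series diverges, \<open>suminf\<close> has an
    arbitrary value; all that is used of \<open>h\<close> holds almost everywhere or under an
    integral.\<close>
  define h where "h x = (\<Sum>n. g n x)" for x
  have hm[measurable]: "h \<in> borel_measurable borel" unfolding h_def by measurable
  have hb: "AE x in lborel. ennreal (\<omega> x * norm (h x)) \<le> (\<Sum>n. ennreal (\<omega> x * norm (g n x)))"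
    using AEs AEn
  proof eventually_elim
    case (elim x)
    have "norm (h x) \<le> (\<Sum>n. norm (g n x))" unfolding h_def by (rule summable_norm[OF elim(2)])
    then have "\<omega> x * norm (h x) \<le> (\<Sum>n. \<omega> x * norm (g n x))"
      using elim(2) mult_left_mono[OF _ w0[of x]] by (simp add: suminf_mult)
    moreover have "(\<Sum>n. ennreal (\<omega> x * norm (g n x))) = ennreal (\<Sum>n. \<omega> x * norm (g n x))"
      by (rule suminf_ennreal2[OF _ elim(1)]) (simp add: w0)
    ultimately show ?case by (simp only: ennreal_leI)
  qed
  have hle: "(\<integral>\<^sup>+x. ennreal (\<omega> x * norm (h x)) \<partial>lborel) \<le> ennreal (\<Sum>n. S n)"
    unfolding total[symmetric] by (rule nn_integral_mono_AE) (rule hb)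
  have hi: "integrable lborel (\<lambda>x. \<omega> x * norm (h x))"
    by (rule integrableI_bounded) (use hle w0 in \<open>auto simp: abs_mult le_less_trans\<close>)
  have hS: "(LINT x|lborel. \<omega> x * norm (h x)) \<le> (\<Sum>n. S n)"
    by (rule integral_real_bounded) (use hle suminf_nonneg[OF Ss S0] in auto)
  have "fourier h z = (\<Sum>n. fourier (g n) z)" for z
  proof -
    have "(LINT x|lborel. (\<Sum>n. g n x * iexp (z * x))) = (\<Sum>n. LINT x|lborel. g n x * iexp (z * x))"
    proof (rule integral_suminf)
      show "integrable lborel (\<lambda>x. g n x * iexp (z * x))" for n
        by (rule integrable_mult_iexp[OF L1_weighted_integrable[OF w g(1)]])
      show "AE x in lborel. summable (\<lambda>n. norm (g n x * iexp (z * x)))"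
        using AEn by (simp add: norm_mult)
      show "summable (\<lambda>n. LINT x|lborel. norm (g n x * iexp (z * x)))"
        by (rule summable_comparison_test'[OF Ss, of 0])
           (use L1_weighted_norm_le[OF w g(1)] in \<open>auto simp: norm_mult S_def\<close>)
    qed
    moreover have "AE x in lborel. (\<Sum>n. g n x * iexp (z * x)) = h x * iexp (z * x)"
      using AEn
    proof eventually_elim
      case (elim x)
      show ?case unfolding h_def by (rule suminf_mult2[OF summable_norm_cancel[OF elim], symmetric])
    qed
    then have "(LINT x|lborel. (\<Sum>n. g n x * iexp (z * x))) = (LINT x|lborel. h x * iexp (z * x))"
      by (rule integral_cong_AE[rotated 2]) measurable
    ultimately show ?thesis by (simp add: fourier_def)
  qed
  then have "(\<lambda>z. \<Sum>n. G n z) = fourier h" by (auto simp: g(3))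
  then show ?thesis
    unfolding L_rep_def using hi hS SC by (intro exI[of _ h]) (auto simp: L1_weighted_def)
qed

lemma R_rep_suminf:
  assumes w: "is_weight \<omega>" and F: "\<And>n. R_rep \<omega> (F n) (C n)" and C: "summable C"
  shows "R_rep \<omega> (\<lambda>z. \<Sum>n. F n z) (\<Sum>n. C n)"
proof -
  obtain P G c d where *: "\<And>n. D_rep \<omega> (P n) (c n)" "\<And>n. L_rep \<omega> (G n) (d n)"
      "\<And>n. c n + d n \<le> C n" "\<And>n. F n = (\<lambda>z. P n z + G n z)"
  proof -
    have "\<forall>n. \<exists>t. D_rep \<omega> (fst t) (fst (snd (snd t))) \<and> L_rep \<omega> (fst (snd t)) (snd (snd (snd t)))
        \<and> fst (snd (snd t)) + snd (snd (snd t)) \<le> C n \<and> F n = (\<lambda>z. fst t z + fst (snd t) z)"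
      using F unfolding R_rep_def by simp
    from choice[OF this] obtain t where t: "\<forall>n. D_rep \<omega> (fst (t n)) (fst (snd (snd (t n)))) \<and> L_rep \<omega> (fst (snd (t n))) (snd (snd (snd (t n))))
        \<and> fst (snd (snd (t n))) + snd (snd (snd (t n))) \<le> C n \<and> F n = (\<lambda>z. fst (t n) z + fst (snd (t n)) z)" ..
    show thesis
      by (rule that[of "\<lambda>n. fst (t n)" "\<lambda>n. fst (snd (snd (t n)))" "\<lambda>n. fst (snd (t n))" "\<lambda>n. snd (snd (snd (t n)))"])
         (simp_all add: t[rule_format])
  qed
  have c0: "0 \<le> c n" for n using D_rep_nonneg[OF w *(1)] .
  have d0: "0 \<le> d n" for n using L_rep_nonneg[OF w *(2)] .
  have cC: "c n \<le> C n" "d n \<le> C n" for n using *(3)[of n] c0[of n] d0[of n] by auto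
  have cs: "summable c" by (rule summable_comparison_test'[OF C, of 0]) (use c0 cC in auto)
  have ds: "summable d" by (rule summable_comparison_test'[OF C, of 0]) (use d0 cC in auto)
  have "(\<Sum>n. c n) + (\<Sum>n. d n) \<le> (\<Sum>n. C n)"
    unfolding suminf_add[OF cs ds] by (rule suminf_le[OF *(3) summable_add[OF cs ds] C])
  moreover have "(\<Sum>n. F n z) = (\<Sum>n. P n z) + (\<Sum>n. G n z)" for z
  proof -
    have "summable (\<lambda>n. P n z)" 
      by (rule summable_comparison_test'[OF cs, of 0]) (rule D_rep_bound[OF w *(1)])
    moreover have "summable (\<lambda>n. G n z)" 
      by (rule summable_comparison_test'[OF ds, of 0]) (rule L_rep_bound[OF w *(2)])
    ultimately show ?thesis by (simp add: *(4) suminf_add)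
  qed
  ultimately show ?thesis
    unfolding R_rep_def using D_rep_suminf[OF w *(1) cs] L_rep_suminf[OF w *(2) ds] by blast
qed

lemma suminf_two:
  fixes f :: "nat \<Rightarrow> 'a::{t2_space,comm_monoid_add,topological_space}"
  shows "(\<Sum>n. if n = 0 then x else if n = 1 then y else (0::'a)) = x + y"
    and "summable (\<lambda>n. if n = 0 then x else if n = 1 then y else (0::'a))"
proof -
  have "(\<lambda>n. if n = 0 then x else if n = 1 then y else (0::'a)) sums (\<Sum>n\<in>{0,1::nat}. if n = 0 then x else if n = 1 then y else 0)"
    by (rule sums_finite) auto
  then have "(\<lambda>n. if n = 0 then x else if n = 1 then y else (0::'a)) sums (x + y)" by simp
  then show "(\<Sum>n. if n = 0 then x else if n = 1 then y else (0::'a)) = x + y"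
     "summable (\<lambda>n. if n = 0 then x else if n = 1 then y else (0::'a))"
    by (auto simp: sums_iff)
qed

text \<open>A sum of two elements is a series with two nonzero terms, so one argument serves all
  three predicates.\<close>

lemma add_closed_if_suminf_closed:
  fixes X :: "(real \<Rightarrow> complex) \<Rightarrow> real \<Rightarrow> bool"
  assumes sum: "\<And>G E. (\<And>n. X (G n) (E n)) \<Longrightarrow> summable E \<Longrightarrow> X (\<lambda>z. \<Sum>n. G n z) (\<Sum>n. E n)"
    and zero: "X (\<lambda>z. 0) 0" and F: "X F C" and G: "X G D"
  shows "X (\<lambda>z. F z + G z) (C + D)"
proof -
  have "X (if n = 0 then F else if n = 1 then G else (\<lambda>z. 0)) (if n = 0 then C else if n = 1 then D else 0)" for n :: nat
    using zero F G by auto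
  from sum[OF this suminf_two(2)]
  have "X (\<lambda>z. \<Sum>n::nat. if n = 0 then F z else if n = 1 then G z else 0) (C + D)"
    by (simp only: suminf_two if_distribR)
  then show ?thesis by (simp only: suminf_two)
qed

lemma D_rep_add:
  "is_weight \<omega> \<Longrightarrow> D_rep \<omega> F C \<Longrightarrow> D_rep \<omega> G D \<Longrightarrow> D_rep \<omega> (\<lambda>z. F z + G z) (C + D)"
  by (rule add_closed_if_suminf_closed[of "D_rep \<omega>", OF D_rep_suminf D_rep_zero])

lemma L_rep_add:
  "is_weight \<omega> \<Longrightarrow> L_rep \<omega> F C \<Longrightarrow> L_rep \<omega> G D \<Longrightarrow> L_rep \<omega> (\<lambda>z. F z + G z) (C + D)"
  by (rule add_closed_if_suminf_closed[of "L_rep \<omega>", OF L_rep_suminf L_rep_zero])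

lemma R_rep_add:
  "is_weight \<omega> \<Longrightarrow> R_rep \<omega> F C \<Longrightarrow> R_rep \<omega> G D \<Longrightarrow> R_rep \<omega> (\<lambda>z. F z + G z) (C + D)"
  by (rule add_closed_if_suminf_closed[of "R_rep \<omega>", OF R_rep_suminf R_rep_D[OF D_rep_zero]])

text \<open>A character times a transform is the transform of the shifted measure, and
  submultiplicativity of the weight bounds the cost of a shift by \<open>s\<close> by the factor
  \<open>\<omega> s\<close>.\<close>

lemma D_rep_modulate:
  assumes w: "is_weight \<omega>" and "D_rep \<omega> P C"
  shows "D_rep \<omega> (\<lambda>z. c * iexp (z * s) * P z) (norm c * \<omega> s * C)"
proof -
  obtain a where a: "(\<lambda>y. \<omega> y * norm (a y)) summable_on UNIV"
     "(\<Sum>\<^sub>\<infinity>y. \<omega> y * norm (a y)) \<le> C" "P = trig_series UNIV a"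
    using assms(2) unfolding D_rep_def by blast
  define b where "b y = c * a (y - s)" for y
  have bij: "bij_betw (\<lambda>y. y - s) UNIV UNIV"
    by (rule bij_betw_byWitness[of _ "\<lambda>y. y + s"]) auto
  have le: "\<omega> y * norm (b y) \<le> norm c * \<omega> s * (\<omega> (y - s) * norm (a (y - s)))" for y
  proof -
    have "\<omega> y \<le> \<omega> s * \<omega> (y - s)" using weight_add[OF w, of s "y - s"] by simp
    then have "\<omega> y * norm (b y) \<le> \<omega> s * \<omega> (y - s) * norm (b y)" by (rule mult_right_mono) simp
    then show ?thesis by (simp add: b_def norm_mult mult_ac)
  qed
  have s1: "(\<lambda>y. norm c * \<omega> s * (\<omega> (y - s) * norm (a (y - s)))) summable_on UNIV"
    using summable_on_reindex_bij_betw[OF bij, of "\<lambda>y. \<omega> y * norm (a y)"] a(1)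
    by (intro summable_on_cmult_right) auto
  have s2: "(\<lambda>y. \<omega> y * norm (b y)) summable_on UNIV"
    by (rule summable_on_comparison_test[OF s1 le]) (auto intro!: mult_nonneg_nonneg weight_nonneg[OF w])
  have "(\<Sum>\<^sub>\<infinity>y. \<omega> y * norm (b y)) \<le> (\<Sum>\<^sub>\<infinity>y. norm c * \<omega> s * (\<omega> (y - s) * norm (a (y - s))))"
    by (rule infsum_mono[OF s2 s1 le])
  also have "\<dots> = norm c * \<omega> s * (\<Sum>\<^sub>\<infinity>y. \<omega> (y - s) * norm (a (y - s)))"
    by (rule infsum_cmult_right') 
  also have "\<dots> = norm c * \<omega> s * (\<Sum>\<^sub>\<infinity>y. \<omega> y * norm (a y))"
    using infsum_reindex_bij_betw[OF bij, of "\<lambda>y. \<omega> y * norm (a y)"] by simp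
  also have "\<dots> \<le> norm c * \<omega> s * C"
    by (intro mult_left_mono a mult_nonneg_nonneg weight_nonneg[OF w]) auto
  finally have s3: "(\<Sum>\<^sub>\<infinity>y. \<omega> y * norm (b y)) \<le> norm c * \<omega> s * C" .
  have "trig_series UNIV b z = c * iexp (z * s) * P z" for z
  proof -
    have "trig_series UNIV b z = (\<Sum>\<^sub>\<infinity>y. c * iexp (z * s) * (a (y - s) * iexp (z * (y - s))))"
      unfolding trig_series_def b_def
      by (intro infsum_cong) (simp add: right_diff_distrib exp_diff)
    also have "\<dots> = c * iexp (z * s) * (\<Sum>\<^sub>\<infinity>y. a (y - s) * iexp (z * (y - s)))"
      by (rule infsum_cmult_right')
    also have "\<dots> = c * iexp (z * s) * P z"
      using infsum_reindex_bij_betw[OF bij, of "\<lambda>y. a y * iexp (z * y)"] by (simp add: a(3) trig_series_def)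
    finally show ?thesis .
  qed
  then show ?thesis unfolding D_rep_def using s2 s3 by (intro exI[of _ b]) auto
qed

lemma L_rep_modulate:
  assumes w: "is_weight \<omega>" and "L_rep \<omega> G C"
  shows "L_rep \<omega> (\<lambda>z. c * iexp (z * s) * G z) (norm c * \<omega> s * C)"
proof -
  obtain g where g: "g \<in> L1_weighted \<omega>"
     "(LINT x|lborel. \<omega> x * norm (g x)) \<le> C" "G = fourier g"
    using assms(2) unfolding L_rep_def by blast
  have [measurable]: "g \<in> borel_measurable borel" "\<omega> \<in> borel_measurable borel"
    using g(1) weight_measurable[OF w] by (auto simp: L1_weighted_def)
  define h where "h x = c * g (x - s)" for x
  have gi: "integrable lborel (\<lambda>x. \<omega> x * norm (g x))"
    using g(1) by (auto simp: L1_weighted_def)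
  have gi': "integrable lborel (\<lambda>x. norm c * \<omega> s * (\<omega> (x - s) * norm (g (x - s))))"
    using lborel_integrable_real_affine[OF gi, of 1 "-s"] by (intro integrable_mult_right) simp
  have le: "\<omega> x * norm (h x) \<le> norm c * \<omega> s * (\<omega> (x - s) * norm (g (x - s)))" for x
  proof -
    have "\<omega> x \<le> \<omega> s * \<omega> (x - s)" using weight_add[OF w, of s "x - s"] by simp
    then have "\<omega> x * norm (h x) \<le> \<omega> s * \<omega> (x - s) * norm (h x)" by (rule mult_right_mono) simp
    then show ?thesis by (simp add: h_def norm_mult mult_ac)
  qed
  have hm[measurable]: "h \<in> borel_measurable borel" unfolding h_def by measurable
  have hi: "integrable lborel (\<lambda>x. \<omega> x * norm (h x))"
    by (rule Bochner_Integration.integrable_bound[OF gi'])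
       (use order_trans[OF le abs_ge_self] weight_nonneg[OF w] in \<open>auto simp: abs_mult\<close>)
  have "(LINT x|lborel. \<omega> x * norm (h x)) \<le> (LINT x|lborel. norm c * \<omega> s * (\<omega> (x - s) * norm (g (x - s))))"
    by (rule integral_mono[OF hi gi' le])
  also have "\<dots> = norm c * \<omega> s * (LINT x|lborel. \<omega> x * norm (g x))"
    using lborel_integral_real_affine[of 1 "\<lambda>x. \<omega> x * norm (g x)" "-s"] by simp
  also have "\<dots> \<le> norm c * \<omega> s * C"
    by (intro mult_left_mono g mult_nonneg_nonneg weight_nonneg[OF w]) auto
  finally have "(LINT x|lborel. \<omega> x * norm (h x)) \<le> norm c * \<omega> s * C" .
  moreover have "(\<lambda>z. c * iexp (z * s) * G z) = fourier h"
  proof (rule ext)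
    fix z
    have "fourier h z = c * fourier (\<lambda>x. g (x - s)) z"
      unfolding h_def by (rule fourier_cmult)
    then show "c * iexp (z * s) * G z = fourier h z"
      unfolding fourier_shift g(3) by (simp only: mult.assoc)
  qed
  ultimately show ?thesis
    unfolding L_rep_def using hi by (intro exI[of _ h]) (auto simp: L1_weighted_def)
qed

lemma R_rep_modulate:
  assumes w: "is_weight \<omega>" and "R_rep \<omega> F C"
  shows "R_rep \<omega> (\<lambda>z. c * iexp (z * s) * F z) (norm c * \<omega> s * C)"
proof -
  obtain P G p q where *: "D_rep \<omega> P p" "L_rep \<omega> G q" "p + q \<le> C" "F = (\<lambda>z. P z + G z)"
    using assms(2) unfolding R_rep_def by metis
  have "norm c * \<omega> s * p + norm c * \<omega> s * q \<le> norm c * \<omega> s * C"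
    using mult_left_mono[OF *(3), of "norm c * \<omega> s"] weight_nonneg[OF w, of s] by (simp add: ring_distribs)
  then show ?thesis
    unfolding R_rep_def *(4) ring_distribs
    using D_rep_modulate[OF w *(1), of c s] L_rep_modulate[OF w *(2), of c s] by blast
qed

section \<open>Multiplication in the weighted algebra\<close>

lemma countable_infsum_as_suminf:
  fixes f :: "real \<Rightarrow> 'a::banach"
  assumes S: "countable S" and z: "\<And>y. y \<notin> S \<Longrightarrow> f y = 0" and s: "f summable_on UNIV"
  shows "(\<lambda>n. if n \<in> to_nat_on S ` S then f (from_nat_into S n) else 0) summable_on UNIV"
    and "(\<Sum>n. if n \<in> to_nat_on S ` S then f (from_nat_into S n) else 0) = infsum f UNIV"
proof -
  let ?T = "to_nat_on S ` S"
  \<comment> \<open>Off the image of \<open>to_nat_on S\<close>, which is a proper subset of the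
    naturals when \<open>S\<close> is finite, \<open>from_nat_into S\<close> returns an unspecified
    value; its contribution has to be suppressed.\<close>
  let ?h = "\<lambda>n. if n \<in> ?T then f (from_nat_into S n) else 0"
  have bij: "bij_betw (from_nat_into S) ?T S"
    by (rule bij_betw_byWitness[of _ "to_nat_on S"]) (use S in auto)
  have "f summable_on S" using s by (rule summable_on_subset_banach) simp
  then have sT: "(\<lambda>n. f (from_nat_into S n)) summable_on ?T"
    using summable_on_reindex_bij_betw[OF bij, of f] by simp
  show 1: "?h summable_on UNIV"
    by (rule summable_on_cong_neutral[THEN iffD1, OF _ _ _ sT]) auto
  have "suminf ?h = infsum ?h UNIV" using infsum_nat_eq_suminf[OF 1] by simp
  also have "\<dots> = infsum (\<lambda>n. f (from_nat_into S n)) ?T"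
    by (rule infsum_cong_neutral) auto
  also have "\<dots> = infsum f S" using infsum_reindex_bij_betw[OF bij, of f] by simp
  also have "\<dots> = infsum f UNIV" by (rule infsum_cong_neutral) (use z in auto)
  finally show "suminf ?h = infsum f UNIV" .
qed

text \<open>Only countably many coefficients are nonzero. Enumerating them turns the unordered sum
  into a series, the form to which closure under countable sums applies.\<close>

lemma D_rep_enum:
  assumes w: "is_weight \<omega>" and "D_rep \<omega> P C"
  obtains a :: "nat \<Rightarrow> complex" and y :: "nat \<Rightarrow> real" where
    "summable (\<lambda>n. \<omega> (y n) * norm (a n))" "(\<Sum>n. \<omega> (y n) * norm (a n)) \<le> C"
    "\<And>z. P z = (\<Sum>n. a n * iexp (z * y n))"
proof -
  obtain a where a: "(\<lambda>y. \<omega> y * norm (a y)) summable_on UNIV"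
     "(\<Sum>\<^sub>\<infinity>y. \<omega> y * norm (a y)) \<le> C" "P = trig_series UNIV a"
    using assms(2) unfolding D_rep_def by blast
  have sn: "(\<lambda>y. norm (a y)) summable_on UNIV" by (rule weighted_summable_norm[OF w a(1)])
  define S where "S = {y\<in>UNIV. a y \<noteq> 0}"
  have S: "countable S" unfolding S_def using sn by (rule abs_summable_countable)
  define y where "y = from_nat_into S"
  define b where "b n = (if n \<in> to_nat_on S ` S then a (y n) else 0)" for n
  have e1: "(\<lambda>n. if n \<in> to_nat_on S ` S then \<omega> (from_nat_into S n) * norm (a (from_nat_into S n)) else 0)
      = (\<lambda>n. \<omega> (y n) * norm (b n))" by (auto simp: b_def y_def)
  have 1: "(\<lambda>n. \<omega> (y n) * norm (b n)) summable_on UNIV" "(\<Sum>n. \<omega> (y n) * norm (b n)) \<le> C"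
    using countable_infsum_as_suminf[OF S _ a(1)] a(2) unfolding e1 by (auto simp: S_def)
  have "P z = (\<Sum>n. b n * iexp (z * y n))" for z
  proof -
    have e2: "(\<lambda>n. if n \<in> to_nat_on S ` S then a (from_nat_into S n) * iexp (z * from_nat_into S n) else 0)
      = (\<lambda>n. b n * iexp (z * y n))" by (auto simp: b_def y_def)
    show ?thesis
      using countable_infsum_as_suminf(2)[OF S _ trig_series_terms_summable[OF sn, of z]]
      unfolding e2 by (auto simp: S_def a(3) trig_series_def)
  qed
  with 1 show thesis by (intro that[of y b]) (auto intro: summable_on_UNIV_nonneg_real_iff[THEN iffD1] summable_on_imp_summable)
qed

text \<open>Multiplying by a discrete element is a series of modulations, so any class that is
  complete and closed under modulation is closed under it.\<close>

lemma D_rep_mult_closed: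
  fixes X :: "(real \<Rightarrow> complex) \<Rightarrow> real \<Rightarrow> bool"
  assumes w: "is_weight \<omega>" and P: "D_rep \<omega> P C" and D: "0 \<le> D"
    and sum: "\<And>G E. (\<And>n. X (G n) (E n)) \<Longrightarrow> summable E \<Longrightarrow> X (\<lambda>z. \<Sum>n. G n z) (\<Sum>n. E n)"
    and modulate: "\<And>c s. X (\<lambda>z. c * iexp (z * s) * F z) (norm c * \<omega> s * D)"
    and mono: "\<And>G E E'. X G E \<Longrightarrow> E \<le> E' \<Longrightarrow> X G E'"
  shows "X (\<lambda>z. P z * F z) (C * D)"
proof -
  obtain a y where ay: "summable (\<lambda>n. \<omega> (y n) * norm (a n))" "(\<Sum>n. \<omega> (y n) * norm (a n)) \<le> C"
    "\<And>z. P z = (\<Sum>n::nat. a n * iexp (z * y n))"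
    by (rule D_rep_enum[OF w P]) (rule that)
  have "X (\<lambda>z. \<Sum>n. a n * iexp (z * y n) * F z) (\<Sum>n. norm (a n) * \<omega> (y n) * D)"
    by (rule sum[OF modulate]) (use ay(1) in \<open>auto intro!: summable_mult2 simp: mult.commute\<close>)
  moreover have "(\<Sum>n. norm (a n) * \<omega> (y n) * D) \<le> C * D"
    using ay suminf_mult2[OF ay(1), of D] mult_right_mono[OF ay(2) D]
    by (simp add: mult.commute)
  moreover have "(\<Sum>n. a n * iexp (z * y n) * F z) = P z * F z" for z
  proof -
    have "summable (\<lambda>n. a n * iexp (z * y n))"
      by (rule summable_comparison_test'[OF ay(1), of 0])
         (use mult_right_mono[OF weight_ge1[OF w]] in \<open>auto simp: norm_mult\<close>)
    then show ?thesis unfolding ay(3) by (rule suminf_mult2[symmetric])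
  qed
  ultimately show ?thesis using mono by simp
qed

lemma D_mult_R_rep:
  assumes w: "is_weight \<omega>" and P: "D_rep \<omega> P C" and F: "R_rep \<omega> F D"
  shows "R_rep \<omega> (\<lambda>z. P z * F z) (C * D)"
  by (rule D_rep_mult_closed[of \<omega> P C D "R_rep \<omega>",
      OF w P R_rep_nonneg[OF w F] R_rep_suminf[OF w] R_rep_modulate[OF w F] R_rep_mono])

lemma D_mult_L_rep:
  assumes w: "is_weight \<omega>" and P: "D_rep \<omega> P C" and F: "L_rep \<omega> F D"
  shows "L_rep \<omega> (\<lambda>z. P z * F z) (C * D)"
  by (rule D_rep_mult_closed[of \<omega> P C D "L_rep \<omega>",
      OF w P L_rep_nonneg[OF w F] L_rep_suminf[OF w] L_rep_modulate[OF w F] L_rep_mono])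

lemma D_mult_D_rep:
  assumes w: "is_weight \<omega>" and P: "D_rep \<omega> P C" and F: "D_rep \<omega> F D"
  shows "D_rep \<omega> (\<lambda>z. P z * F z) (C * D)"
  by (rule D_rep_mult_closed[of \<omega> P C D "D_rep \<omega>",
      OF w P D_rep_nonneg[OF w F] D_rep_suminf[OF w] D_rep_modulate[OF w F] D_rep_mono])

lemma nn_integral_lborel_shift:
  fixes u :: "real \<Rightarrow> ennreal"
  assumes "u \<in> borel_measurable borel"
  shows "(\<integral>\<^sup>+x. u (x - t) \<partial>lborel) = (\<integral>\<^sup>+x. u x \<partial>lborel)"
  using nn_integral_real_affine[of u 1 "-t"] assms by simp

text \<open>The product is the transform of the convolution \<open>h\<close>; submultiplicativity
  distributes the weight over the two factors, and Tonelli does the rest.\<close>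

lemma L_mult_L_rep:
  assumes w: "is_weight \<omega>" and "L_rep \<omega> F C" "L_rep \<omega> G D"
  shows "L_rep \<omega> (\<lambda>z. F z * G z) (C * D)"
proof -
  obtain f where f: "f \<in> L1_weighted \<omega>" "(LINT x|lborel. \<omega> x * norm (f x)) \<le> C" "F = fourier f"
    using assms(2) unfolding L_rep_def by blast
  obtain g where g: "g \<in> L1_weighted \<omega>" "(LINT x|lborel. \<omega> x * norm (g x)) \<le> D" "G = fourier g"
    using assms(3) unfolding L_rep_def by blast
  have [measurable]: "f \<in> borel_measurable borel" "g \<in> borel_measurable borel" "\<omega> \<in> borel_measurable borel"
    using f(1) g(1) weight_measurable[OF w] by (auto simp: L1_weighted_def)
  have w0: "0 \<le> \<omega> x" for x by (rule weight_nonneg[OF w])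
  have fi: "integrable lborel (\<lambda>x. \<omega> x * norm (f x))" and gi: "integrable lborel (\<lambda>x. \<omega> x * norm (g x))"
    using f(1) g(1) by (auto simp: L1_weighted_def)
  define Nf where "Nf = (LINT x|lborel. \<omega> x * norm (f x))"
  define Ng where "Ng = (LINT x|lborel. \<omega> x * norm (g x))"
  have N0: "0 \<le> Nf" "0 \<le> Ng" unfolding Nf_def Ng_def using w0 by auto
  have nnf: "(\<integral>\<^sup>+x. ennreal (\<omega> x * norm (f x)) \<partial>lborel) = ennreal Nf"
    unfolding Nf_def by (rule nn_integral_eq_integral[OF fi]) (simp add: w0)
  have nng: "(\<integral>\<^sup>+x. ennreal (\<omega> x * norm (g x)) \<partial>lborel) = ennreal Ng"
    unfolding Ng_def by (rule nn_integral_eq_integral[OF gi]) (simp add: w0)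
  define h where "h x = (LINT t|lborel. f (x - t) * g t)" for x
  have [measurable]: "h \<in> borel_measurable borel" unfolding h_def by measurable
  have dbl: "(\<integral>\<^sup>+x. \<integral>\<^sup>+t. ennreal (\<omega> (x - t) * norm (f (x - t))) * ennreal (\<omega> t * norm (g t)) \<partial>lborel \<partial>lborel) = ennreal (Nf * Ng)"
  proof -
    have "(\<integral>\<^sup>+x. \<integral>\<^sup>+t. ennreal (\<omega> (x - t) * norm (f (x - t))) * ennreal (\<omega> t * norm (g t)) \<partial>lborel \<partial>lborel)
       = (\<integral>\<^sup>+t. \<integral>\<^sup>+x. ennreal (\<omega> (x - t) * norm (f (x - t))) * ennreal (\<omega> t * norm (g t)) \<partial>lborel \<partial>lborel)"
      by (rule lborel_pair.Fubini'[symmetric]) measurable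
    also have "\<dots> = (\<integral>\<^sup>+t. ennreal Nf * ennreal (\<omega> t * norm (g t)) \<partial>lborel)"
    proof (rule nn_integral_cong)
      fix t
      have "(\<integral>\<^sup>+x. ennreal (\<omega> (x - t) * norm (f (x - t))) * ennreal (\<omega> t * norm (g t)) \<partial>lborel)
          = (\<integral>\<^sup>+x. ennreal (\<omega> (x - t) * norm (f (x - t))) \<partial>lborel) * ennreal (\<omega> t * norm (g t))"
        by (rule nn_integral_multc) measurable
      also have "(\<integral>\<^sup>+x. ennreal (\<omega> (x - t) * norm (f (x - t))) \<partial>lborel) = ennreal Nf"
        by (subst nn_integral_lborel_shift[of "\<lambda>x. ennreal (\<omega> x * norm (f x))"]) (auto simp: nnf)
      finally show "(\<integral>\<^sup>+x. ennreal (\<omega> (x - t) * norm (f (x - t))) * ennreal (\<omega> t * norm (g t)) \<partial>lborel) = ennreal Nf * ennreal (\<omega> t * norm (g t))" .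
    qed
    also have "\<dots> = ennreal Nf * ennreal Ng"
      by (subst nn_integral_cmult) (auto simp: nng)
    finally show ?thesis using N0 by (simp add: ennreal_mult')
  qed
  have pw: "ennreal (\<omega> x * norm (f (x - t) * g t)) \<le> ennreal (\<omega> (x - t) * norm (f (x - t))) * ennreal (\<omega> t * norm (g t))" for x t
  proof -
    have "\<omega> x \<le> \<omega> (x - t) * \<omega> t" using weight_add[OF w, of "x - t" t] by simp
    then have "\<omega> x * norm (f (x - t) * g t) \<le> \<omega> (x - t) * \<omega> t * norm (f (x - t) * g t)" by (rule mult_right_mono) simp
    also have "\<dots> = (\<omega> (x - t) * norm (f (x - t))) * (\<omega> t * norm (g t))" by (simp add: norm_mult mult_ac)
    finally show ?thesis using w0 by (simp add: ennreal_mult'[symmetric] ennreal_leI)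
  qed
  have hle: "(\<integral>\<^sup>+x. ennreal (\<omega> x * norm (h x)) \<partial>lborel) \<le> ennreal (Nf * Ng)"
    unfolding dbl[symmetric]
  proof (rule nn_integral_mono)
    fix x
    \<comment> \<open>Where the convolution integral does not converge, its value is 0 by convention
      and the bound is trivial.\<close>
    have "ennreal (norm (h x)) \<le> (\<integral>\<^sup>+t. ennreal (norm (f (x - t) * g t)) \<partial>lborel)"
      unfolding h_def using integral_norm_bound_ennreal[of lborel "\<lambda>t. f (x - t) * g t"]
      by (cases "integrable lborel (\<lambda>t. f (x - t) * g t)") (auto simp: not_integrable_integral_eq)
    then have "ennreal (\<omega> x) * ennreal (norm (h x)) \<le> ennreal (\<omega> x) * (\<integral>\<^sup>+t. ennreal (norm (f (x - t) * g t)) \<partial>lborel)"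
      by (rule mult_left_mono) simp
    also have "\<dots> = (\<integral>\<^sup>+t. ennreal (\<omega> x * norm (f (x - t) * g t)) \<partial>lborel)"
      using w0 by (subst nn_integral_cmult[symmetric]) (auto simp: ennreal_mult')
    also have "\<dots> \<le> (\<integral>\<^sup>+t. ennreal (\<omega> (x - t) * norm (f (x - t))) * ennreal (\<omega> t * norm (g t)) \<partial>lborel)"
      by (rule nn_integral_mono) (rule pw)
    finally show "ennreal (\<omega> x * norm (h x)) \<le> \<dots>" using w0 by (simp add: ennreal_mult')
  qed
  have hi: "integrable lborel (\<lambda>x. \<omega> x * norm (h x))"
    by (rule integrableI_bounded) (use hle w0 in \<open>auto simp: abs_mult le_less_trans\<close>)
  have "(LINT x|lborel. \<omega> x * norm (h x)) \<le> Nf * Ng"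
    by (rule integral_real_bounded) (use hle N0 in auto)
  also have "\<dots> \<le> C * D" using f(2) g(2) N0 unfolding Nf_def[symmetric] Ng_def[symmetric]
    by (intro mult_mono) auto
  finally have hC: "(LINT x|lborel. \<omega> x * norm (h x)) \<le> C * D" .
  have "fourier h z = F z * G z" for z
  proof -
    have pint: "integrable (lborel \<Otimes>\<^sub>M lborel) (\<lambda>(x, t). f (x - t) * g t * iexp (z * x))"
    proof (rule integrableI_bounded)
      show "(\<lambda>(x, t). f (x - t) * g t * iexp (z * x)) \<in> borel_measurable (lborel \<Otimes>\<^sub>M lborel)" by measurable
      have "(\<integral>\<^sup>+p. ennreal (norm (case p of (x, t) \<Rightarrow> f (x - t) * g t * iexp (z * x))) \<partial>(lborel \<Otimes>\<^sub>M lborel))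
          = (\<integral>\<^sup>+x. \<integral>\<^sup>+t. ennreal (norm (f (x - t) * g t * iexp (z * x))) \<partial>lborel \<partial>lborel)"
        by (subst lborel.nn_integral_fst[symmetric]) auto
      also have "\<dots> \<le> ennreal (Nf * Ng)"
        unfolding dbl[symmetric]
      proof (intro nn_integral_mono)
        fix x t
        have "norm (f (x - t) * g t * iexp (z * x)) \<le> \<omega> x * norm (f (x - t) * g t)"
          using mult_right_mono[OF weight_ge1[OF w, of x], of "norm (f (x - t) * g t)"] by (simp add: norm_mult)
        then show "ennreal (norm (f (x - t) * g t * iexp (z * x))) \<le> ennreal (\<omega> (x - t) * norm (f (x - t))) * ennreal (\<omega> t * norm (g t))"
          using pw[of x t] by (meson ennreal_leI order_trans)
      qed
      also have "\<dots> < \<infinity>" by simp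
      finally show "(\<integral>\<^sup>+p. ennreal (norm (case p of (x, t) \<Rightarrow> f (x - t) * g t * iexp (z * x))) \<partial>(lborel \<Otimes>\<^sub>M lborel)) < \<infinity>" .
    qed
    have "fourier h z = (LINT x|lborel. LINT t|lborel. f (x - t) * g t * iexp (z * x))"
      unfolding fourier_def h_def by (simp only: integral_mult_left_zero)
    also have "\<dots> = (LINT t|lborel. LINT x|lborel. f (x - t) * g t * iexp (z * x))"
      by (rule lborel_pair.Fubini_integral[symmetric]) (rule pint)
    also have "\<dots> = (LINT t|lborel. F z * (g t * iexp (z * t)))"
    proof (rule Bochner_Integration.integral_cong[OF refl])
      fix t
      have "(LINT x|lborel. f (x - t) * g t * iexp (z * x)) = (LINT x|lborel. g t * (f (x - t) * iexp (z * x)))"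
        by (simp only: mult_ac)
      also have "\<dots> = g t * fourier (\<lambda>x. f (x - t)) z" unfolding fourier_def by (rule integral_mult_right_zero)
      finally show "(LINT x|lborel. f (x - t) * g t * iexp (z * x)) = F z * (g t * iexp (z * t))"
        unfolding fourier_shift f(3) by (simp only: mult_ac)
    qed
    also have "\<dots> = F z * G z" unfolding g(3) fourier_def[of g] by (rule integral_mult_right_zero)
    finally show ?thesis .
  qed
  then have "(\<lambda>z. F z * G z) = fourier h" by auto
  then show ?thesis
    unfolding L_rep_def using hi hC by (intro exI[of _ h]) (auto simp: L1_weighted_def)
qed

text \<open>Absolutely continuous measures form an ideal. That the product is again
  \<open>L_rep\<close>, and so comes with a density and vanishes at infinity, is used in
  \<open>spectral_radius_compact\<close> and \<open>R_rep_logarithm\<close>.\<close>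

lemma L_mult_R_rep:
  assumes w: "is_weight \<omega>" and F: "L_rep \<omega> F C" and "R_rep \<omega> G D"
  shows "L_rep \<omega> (\<lambda>z. F z * G z) (C * D)"
proof -
  obtain P Q p q where *: "D_rep \<omega> P p" "L_rep \<omega> Q q" "p + q \<le> D" "G = (\<lambda>z. P z + Q z)"
    using assms(3) unfolding R_rep_def by metis
  have "L_rep \<omega> (\<lambda>z. P z * F z + F z * Q z) (p * C + C * q)"
    by (intro L_rep_add[OF w] D_mult_L_rep[OF w] L_mult_L_rep[OF w] * F)
  moreover have "p * C + C * q \<le> C * D"
    using mult_left_mono[OF *(3) L_rep_nonneg[OF w F]] by (simp add: ring_distribs mult.commute)
  ultimately show ?thesis
    unfolding *(4) by (simp add: ring_distribs mult.commute L_rep_mono)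
qed

lemma R_rep_mult:
  assumes w: "is_weight \<omega>" and "R_rep \<omega> F C" and G: "R_rep \<omega> G D"
  shows "R_rep \<omega> (\<lambda>z. F z * G z) (C * D)"
proof -
  obtain P Q p q where *: "D_rep \<omega> P p" "L_rep \<omega> Q q" "p + q \<le> C" "F = (\<lambda>z. P z + Q z)"
    using assms(2) unfolding R_rep_def by metis
  have "R_rep \<omega> (\<lambda>z. P z * G z + Q z * G z) (p * D + q * D)"
    by (intro R_rep_add[OF w] D_mult_R_rep[OF w] R_rep_L L_mult_R_rep[OF w] * G)
  moreover have "p * D + q * D \<le> C * D"
    using mult_right_mono[OF *(3) R_rep_nonneg[OF w G]] by (simp add: ring_distribs)
  ultimately show ?thesis
    unfolding *(4) by (simp add: ring_distribs R_rep_mono)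
qed

text \<open>The constant 1 is the transform of the unit mass at 0, whose weighted norm is
  \<open>\<omega> 0\<close> and may exceed 1; this is the origin of the factors
  \<open>\<omega> 0\<close> in the bounds below.\<close>

lemma R_rep_const: "R_rep \<omega> (\<lambda>z. c) (\<omega> 0 * norm c)"
  using R_rep_D[OF D_rep_atom[of \<omega> c 0]] by simp

lemma R_rep_cmult:
  assumes w: "is_weight \<omega>" and "R_rep \<omega> F C"
  shows "R_rep \<omega> (\<lambda>z. c * F z) (\<omega> 0 * norm c * C)"
  by (rule R_rep_mult[OF w R_rep_const assms(2)])

section \<open>Fourier inversion and the Riemann-Lebesgue lemma\<close>

text \<open>Fubini. The formula is used to move a transform onto a Gaussian, whose own transform is
  explicit.\<close>

lemma fourier_multiplication_formula:
  assumes f: "integrable lborel f" and k: "integrable lborel k"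
  shows "(LINT x|lborel. f x * fourier k x) = (LINT u|lborel. fourier f u * k u)"
proof -
  have [measurable]: "f \<in> borel_measurable borel" "k \<in> borel_measurable borel"
    using f k by auto
  have pint: "integrable (lborel \<Otimes>\<^sub>M lborel) (\<lambda>(x, u). f x * (k u * iexp (x * u)))"
  proof (rule integrableI_bounded)
    show "(\<lambda>(x, u). f x * (k u * iexp (x * u))) \<in> borel_measurable (lborel \<Otimes>\<^sub>M lborel)" by measurable
    have "(\<integral>\<^sup>+p. ennreal (norm (case p of (x, u) \<Rightarrow> f x * (k u * iexp (x * u)))) \<partial>(lborel \<Otimes>\<^sub>M lborel))
        = (\<integral>\<^sup>+x. \<integral>\<^sup>+u. ennreal (norm (f x)) * ennreal (norm (k u)) \<partial>lborel \<partial>lborel)"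
      by (subst lborel.nn_integral_fst[symmetric]) (auto simp: norm_mult ennreal_mult)
    also have "\<dots> = (\<integral>\<^sup>+x. ennreal (norm (f x)) \<partial>lborel) * (\<integral>\<^sup>+u. ennreal (norm (k u)) \<partial>lborel)"
      by (simp add: nn_integral_cmult nn_integral_multc)
    also have "\<dots> < \<infinity>"
      using f k by (simp add: integrable_iff_bounded ennreal_mult_less_top)
    finally show "(\<integral>\<^sup>+p. ennreal (norm (case p of (x, u) \<Rightarrow> f x * (k u * iexp (x * u)))) \<partial>(lborel \<Otimes>\<^sub>M lborel)) < \<infinity>" .
  qed
  have "(LINT x|lborel. f x * fourier k x) = (LINT x|lborel. LINT u|lborel. f x * (k u * iexp (x * u)))"
    unfolding fourier_def by (simp only: integral_mult_right_zero)
  also have "\<dots> = (LINT u|lborel. LINT x|lborel. f x * (k u * iexp (x * u)))"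
    by (rule lborel_pair.Fubini_integral[symmetric]) (rule pint)
  also have "\<dots> = (LINT u|lborel. LINT x|lborel. f x * iexp (u * x) * k u)"
    by (simp only: mult_ac)
  also have "\<dots> = (LINT u|lborel. fourier f u * k u)"
    unfolding fourier_def by (simp only: integral_mult_left_zero)
  finally show ?thesis .
qed

lemma normal_density_conv_exp:
  "\<sigma> > 0 \<Longrightarrow> normal_density 0 \<sigma> x = 1 / (\<sigma> * sqrt (2 * pi)) * exp (- (x / \<sigma>)\<^sup>2 / 2)"
  by (simp add: normal_density_def real_sqrt_mult power_divide mult.commute mult.left_commute)

lemma fourier_normal_density:
  assumes s: "\<sigma> > 0"
  shows "fourier (\<lambda>x. of_real (normal_density 0 \<sigma> x)) z = of_real (exp (- (\<sigma> * z)\<^sup>2 / 2))"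
proof -
  have "fourier (\<lambda>x. of_real (normal_density 0 \<sigma> x)) z
    = \<bar>\<sigma>\<bar> *\<^sub>R (LINT x|lborel. of_real (normal_density 0 \<sigma> (0 + \<sigma> * x)) * iexp (z * (0 + \<sigma> * x)))"
    unfolding fourier_def by (rule lborel_integral_real_affine) (use s in simp)
  also have "\<dots> = (LINT x|lborel. std_normal_density x *\<^sub>R iexp (\<sigma> * z * x))"
    using s by (subst integral_scaleR_right[symmetric], intro Bochner_Integration.integral_cong)
      (auto simp: normal_density_def scaleR_conv_of_real real_sqrt_mult power_mult_distrib mult_ac)
  also have "\<dots> = char std_normal_distribution (\<sigma> * z)"
    unfolding char_def by (subst integral_density) auto
  also have "\<dots> = of_real (exp (- (\<sigma> * z)\<^sup>2 / 2))"
    by (simp add: char_std_normal_distribution)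
  finally show ?thesis .
qed

lemma integrable_normal_density_complex:
  "\<sigma> > 0 \<Longrightarrow> integrable lborel (\<lambda>x. complex_of_real (normal_density 0 \<sigma> x))"
  by (intro integrable_of_real integrable_normal_density)

lemma cnj_fourier: "cnj (fourier f z) = (LINT x|lborel. cnj (f x) * iexp (- (z * x)))"
proof -
  have "cnj (fourier f z) = (LINT x|lborel. cnj (f x * iexp (z * x)))"
    unfolding fourier_def by (rule Bochner_Integration.integral_cnj[symmetric])
  also have "\<dots> = (LINT x|lborel. cnj (f x) * iexp (- (z * x)))"
    by (intro Bochner_Integration.integral_cong) (auto simp: exp_cnj)
  finally show ?thesis .
qed

lemma borel_measurable_cnj [measurable (raw)]:
  "f \<in> borel_measurable M \<Longrightarrow> (\<lambda>x. cnj (f x)) \<in> borel_measurable M"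
  by (rule borel_measurable_continuous_on[OF _ , where f=cnj]) (intro continuous_intros)

lemma measurable_fourier [measurable]:
  "integrable lborel f \<Longrightarrow> fourier f \<in> borel_measurable borel"
  by (intro borel_measurable_continuous_onI continuous_on_fourier)

text \<open>Half of Plancherel. Damping by a normal density of deviation \<open>s\<close> makes all
  integrals converge; the multiplication formula then bounds the damped integral by the product of
  the integral of \<open>norm (f x)\<close>, the bound \<open>M\<close> and
  \<open>sqrt (2 * pi) / s\<close>. After rescaling the density to height 1 this bound no longer
  depends on \<open>s\<close>, and \<open>s\<close> may tend to infinity.\<close>

lemma fourier_square_integrable:
  assumes f: "integrable lborel f" and M: "\<And>x. norm (f x) \<le> M"
  shows "integrable lborel (\<lambda>z. (norm (fourier f z))\<^sup>2)"
proof -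
  have [measurable]: "f \<in> borel_measurable borel" "fourier f \<in> borel_measurable borel"
    using f measurable_fourier[OF f] by auto
  have M0: "0 \<le> M" using M[of 0] norm_ge_zero[of "f 0"] by linarith
  define N where "N = (LINT x|lborel. norm (f x))"
  have fb: "norm (fourier f z) \<le> N" for z unfolding N_def by (rule norm_fourier_le)
  have N0: "0 \<le> N" unfolding N_def by simp
  have bound: "(LINT z|lborel. normal_density 0 s z * (norm (fourier f z))\<^sup>2) \<le> N * (M * (sqrt (2 * pi) / s))"
    and intg: "integrable lborel (\<lambda>z. normal_density 0 s z * (norm (fourier f z))\<^sup>2)" if s: "s > 0" for s
  proof -
    show "integrable lborel (\<lambda>z. normal_density 0 s z * (norm (fourier f z))\<^sup>2)"
    proof (rule Bochner_Integration.integrable_bound)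
      show "integrable lborel (\<lambda>z. normal_density 0 s z * N\<^sup>2)"
        using s by (intro integrable_mult_left integrable_normal_density)
      show "AE z in lborel. norm (normal_density 0 s z * (norm (fourier f z))\<^sup>2) \<le> norm (normal_density 0 s z * N\<^sup>2)"
        using s by (auto simp: abs_mult intro!: mult_left_mono power_mono fb)
    qed measurable
    define k where "k z = of_real (normal_density 0 s z) * cnj (fourier f z)" for z
    have [measurable]: "k \<in> borel_measurable borel" unfolding k_def by measurable
    have ki: "integrable lborel k"
    proof (rule Bochner_Integration.integrable_bound)
      show "integrable lborel (\<lambda>z. normal_density 0 s z * N)"
        using s by (intro integrable_mult_left integrable_normal_density)
      show "AE z in lborel. norm (k z) \<le> norm (normal_density 0 s z * N)"
        using s N0 by (auto simp: k_def norm_mult intro!: mult_left_mono fb)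
    qed measurable
    have kb: "norm (fourier k x) \<le> M * (sqrt (2 * pi) / s)" for x
    proof -
      \<comment> \<open>Reflecting and conjugating \<open>f\<close> around \<open>x\<close> makes
        the modulated conjugate transform a transform again, so that the multiplication formula
        applies a second time.\<close>
      define \<phi> where "\<phi> y = cnj (f (x - y))" for y
      have \<phi>i: "integrable lborel \<phi>"
        unfolding \<phi>_def using lborel_integrable_real_affine[OF f, of "-1" x] by simp
      have "cnj (fourier f z) * iexp (x * z) = fourier \<phi> z" for z
      proof -
        have "cnj (fourier f z) * iexp (x * z) = (LINT y|lborel. cnj (f y) * iexp (- (z * y)) * iexp (x * z))"
          unfolding cnj_fourier by (simp only: integral_mult_left_zero)
        also have "\<dots> = (LINT y|lborel. cnj (f (x + -1 * y)) * iexp (- (z * (x + -1 * y))) * iexp (x * z))"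
          by (subst lborel_integral_real_affine[where c="-1" and t=x]) auto
        also have "\<dots> = fourier \<phi> z"
          unfolding fourier_def \<phi>_def
          by (intro Bochner_Integration.integral_cong) (auto simp: algebra_simps exp_add[symmetric])
        finally show ?thesis .
      qed
      then have "fourier k x = (LINT z|lborel. of_real (normal_density 0 s z) * fourier \<phi> z)"
        unfolding fourier_def[of k] k_def by (simp only: mult.assoc)
      also have "\<dots> = (LINT y|lborel. of_real (exp (- (s * y)\<^sup>2 / 2)) * \<phi> y)"
        by (subst fourier_multiplication_formula[OF integrable_normal_density_complex[OF s] \<phi>i])
           (simp only: fourier_normal_density[OF s])
      finally have "norm (fourier k x) = norm (LINT y|lborel. of_real (exp (- (s * y)\<^sup>2 / 2)) * \<phi> y)" by simp
      also have "\<dots> \<le> (LINT y|lborel. M * (sqrt (2 * pi) / s) * normal_density 0 (1/s) y)"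
      proof (rule Bochner_Integration.integral_norm_bound_integral)
        have eq: "sqrt (2 * pi) / s * normal_density 0 (1/s) y = exp (- (s * y)\<^sup>2 / 2)" for y
          using s by (simp add: normal_density_conv_exp mult.commute)
        show *: "integrable lborel (\<lambda>y. M * (sqrt (2 * pi) / s) * normal_density 0 (1/s) y)"
          using s by (intro integrable_mult_right integrable_normal_density) simp
        have **: "norm (of_real (exp (- (s * y)\<^sup>2 / 2)) * \<phi> y) \<le> M * (sqrt (2 * pi) / s) * normal_density 0 (1/s) y" for y
          unfolding mult.assoc eq using M[of "x - y"] by (simp add: norm_mult \<phi>_def mult.commute)
        then show "norm (of_real (exp (- (s * y)\<^sup>2 / 2)) * \<phi> y) \<le> M * (sqrt (2 * pi) / s) * normal_density 0 (1/s) y" for y .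
        have [measurable]: "\<phi> \<in> borel_measurable borel" using \<phi>i by auto
        show "integrable lborel (\<lambda>y. of_real (exp (- (s * y)\<^sup>2 / 2)) * \<phi> y)"
          by (rule Bochner_Integration.integrable_bound[OF *], measurable)
             (rule AE_I2, unfold real_norm_def, rule order_trans[OF ** abs_ge_self])
      qed
      also have "\<dots> = M * (sqrt (2 * pi) / s)" using s by simp
      finally show ?thesis .
    qed
    have "of_real (LINT z|lborel. normal_density 0 s z * (norm (fourier f z))\<^sup>2)
        = (LINT z|lborel. complex_of_real (normal_density 0 s z * (norm (fourier f z))\<^sup>2))"
      by (rule integral_complex_of_real[symmetric])
    also have "\<dots> = (LINT z|lborel. fourier f z * k z)"
      unfolding k_def by (intro Bochner_Integration.integral_cong) (simp_all add: complex_norm_square del: of_real_power)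
    also have "\<dots> = (LINT x|lborel. f x * fourier k x)"
      by (rule fourier_multiplication_formula[OF f ki, symmetric])
    finally have "\<bar>LINT z|lborel. normal_density 0 s z * (norm (fourier f z))\<^sup>2\<bar> = norm (LINT x|lborel. f x * fourier k x)"
      by (metis norm_of_real)
    also have "\<dots> \<le> (LINT x|lborel. norm (f x) * (M * (sqrt (2 * pi) / s)))"
    proof (rule Bochner_Integration.integral_norm_bound_integral)
      have [measurable]: "fourier k \<in> borel_measurable borel" by (rule measurable_fourier[OF ki])
      show *: "integrable lborel (\<lambda>x. norm (f x) * (M * (sqrt (2 * pi) / s)))"
        using f by (intro integrable_mult_left integrable_norm)
      have **: "norm (f x * fourier k x) \<le> norm (f x) * (M * (sqrt (2 * pi) / s))" for x
        unfolding norm_mult by (rule mult_left_mono[OF kb]) simp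
      then show "norm (f x * fourier k x) \<le> norm (f x) * (M * (sqrt (2 * pi) / s))" for x .
      show "integrable lborel (\<lambda>x. f x * fourier k x)"
        by (rule Bochner_Integration.integrable_bound[OF *], measurable)
           (rule AE_I2, unfold real_norm_def, rule order_trans[OF ** abs_ge_self])
    qed
    also have "\<dots> = N * (M * (sqrt (2 * pi) / s))" unfolding N_def by (rule integral_mult_left_zero)
    finally show "(LINT z|lborel. normal_density 0 s z * (norm (fourier f z))\<^sup>2) \<le> N * (M * (sqrt (2 * pi) / s))" by simp
  qed
  \<comment> \<open>The normal density of deviation \<open>real (Suc n)\<close> scaled to height 1;
    it increases to 1 with \<open>n\<close>, which allows monotone convergence.\<close>
  define E where "E n z = exp (- (z / real (Suc n))\<^sup>2 / 2) * (norm (fourier f z))\<^sup>2" for n z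
  have E0: "0 \<le> E n z" for n z by (simp add: E_def)
  have eqE: "E n z = sqrt (2 * pi) * real (Suc n) * (normal_density 0 (real (Suc n)) z * (norm (fourier f z))\<^sup>2)" for n z
    unfolding E_def normal_density_conv_exp[OF of_nat_0_less_iff[THEN iffD2, OF zero_less_Suc]] by simp
  have Ei: "integrable lborel (E n)" for n
    unfolding eqE by (intro integrable_mult_right intg) simp
  have "(LINT z|lborel. E n z) \<le> 2 * pi * N * M" for n
  proof -
    have "(LINT z|lborel. E n z) \<le> sqrt (2 * pi) * real (Suc n) * (N * (M * (sqrt (2 * pi) / real (Suc n))))"
      unfolding eqE by (subst integral_mult_right_zero, intro mult_left_mono bound) auto
    also have "\<dots> = sqrt (2 * pi) * sqrt (2 * pi) * N * M" by (simp add: field_simps del: real_sqrt_mult_self)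
    finally show ?thesis by simp
  qed
  then have nnE: "(\<integral>\<^sup>+z. ennreal (E n z) \<partial>lborel) \<le> ennreal (2 * pi * N * M)" for n
    by (subst nn_integral_eq_integral[OF Ei]) (auto simp: E0 intro: ennreal_leI)
  have lim: "(\<lambda>n. \<integral>\<^sup>+z. ennreal (E n z) \<partial>lborel) \<longlonglongrightarrow> (\<integral>\<^sup>+z. ennreal ((norm (fourier f z))\<^sup>2) \<partial>lborel)"
  proof (rule nn_integral_LIMSEQ)
    show "incseq (\<lambda>n z. ennreal (E n z))"
      unfolding incseq_def le_fun_def E_def
      by (intro allI impI ennreal_leI mult_right_mono)
         (auto intro!: divide_left_mono mult_pos_pos power_mono simp: power_divide)
    show "(\<lambda>z. ennreal (E n z)) \<in> borel_measurable lborel" for n unfolding E_def by measurable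
    show "(\<lambda>n. ennreal (E n z)) \<longlonglongrightarrow> ennreal ((norm (fourier f z))\<^sup>2)" for z
    proof (rule tendsto_ennrealI)
      have "(\<lambda>n. z / real (Suc n)) \<longlonglongrightarrow> 0"
        using filterlim_compose[OF tendsto_divide_0[OF tendsto_const filterlim_at_top_imp_at_infinity[OF filterlim_real_sequentially]] filterlim_Suc]
        by simp
      then have "(\<lambda>n. exp (- (z / real (Suc n))\<^sup>2 / 2) * (norm (fourier f z))\<^sup>2) \<longlonglongrightarrow> exp (- 0\<^sup>2 / 2) * (norm (fourier f z))\<^sup>2"
        by (intro tendsto_intros) auto
      then show "(\<lambda>n. E n z) \<longlonglongrightarrow> (norm (fourier f z))\<^sup>2" by (simp add: E_def)
    qed
  qed
  have "(\<integral>\<^sup>+z. ennreal ((norm (fourier f z))\<^sup>2) \<partial>lborel) \<le> ennreal (2 * pi * N * M)"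
    by (rule LIMSEQ_le_const2[OF lim]) (use nnE in auto)
  then show ?thesis
    by (intro integrableI_bounded) (auto simp: le_less_trans)
qed

text \<open>Cutting in position and in height at once produces a bounded function of compact
  support, for which the square estimate above and all weights are available.\<close>

lemma L1_weighted_truncate:
  assumes w: "is_weight \<omega>" and f: "f \<in> L1_weighted \<omega>" and e: "e > 0"
  obtains n :: nat where
    "(LINT x|lborel. \<omega> x * norm (f x - (if \<bar>x\<bar> \<le> n \<and> norm (f x) \<le> n then f x else 0))) \<le> e"
proof -
  have [measurable]: "f \<in> borel_measurable borel" "\<omega> \<in> borel_measurable borel"
    using f weight_measurable[OF w] by (auto simp: L1_weighted_def)
  have fi: "integrable lborel (\<lambda>x. \<omega> x * norm (f x))" using f by (simp add: L1_weighted_def)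
  have "(\<lambda>n. LINT x|lborel. \<omega> x * norm (f x - (if \<bar>x\<bar> \<le> real n \<and> norm (f x) \<le> real n then f x else 0)))
      \<longlonglongrightarrow> integral\<^sup>L lborel (\<lambda>x::real. 0::real)"
  proof (rule integral_dominated_convergence[where w="\<lambda>x. \<omega> x * norm (f x)"])
    show "AE x in lborel. (\<lambda>n. \<omega> x * norm (f x - (if \<bar>x\<bar> \<le> real n \<and> norm (f x) \<le> real n then f x else 0))) \<longlonglongrightarrow> 0"
    proof (rule AE_I2)
      fix x
      obtain N where "max \<bar>x\<bar> (norm (f x)) \<le> real N" using real_arch_simple by blast
      then have "\<forall>\<^sub>F n in sequentially. \<bar>x\<bar> \<le> real n \<and> norm (f x) \<le> real n"
        by (intro eventually_sequentiallyI[of N]) auto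
      then have "\<forall>\<^sub>F n in sequentially. \<omega> x * norm (f x - (if \<bar>x\<bar> \<le> real n \<and> norm (f x) \<le> real n then f x else 0)) = 0"
        by eventually_elim simp
      then show "(\<lambda>n. \<omega> x * norm (f x - (if \<bar>x\<bar> \<le> real n \<and> norm (f x) \<le> real n then f x else 0))) \<longlonglongrightarrow> 0"
        by (rule tendsto_eventually)
    qed
  qed (use weight_nonneg[OF w] fi in \<open>auto simp: abs_mult\<close>)
  then have "\<forall>\<^sub>F n in sequentially. (LINT x|lborel. \<omega> x * norm (f x - (if \<bar>x\<bar> \<le> real n \<and> norm (f x) \<le> real n then f x else 0))) < e"
    using e by (intro order_tendstoD(2)) auto
  then show thesis using that by (auto simp: eventually_sequentially intro: less_imp_le)
qed

lemma integrable_L1_weighted_one: "f \<in> L1_weighted (\<lambda>_. 1) \<longleftrightarrow> integrable lborel f"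
  by (auto simp: L1_weighted_def integrable_norm_iff)

lemma norm_iexp_diff: "norm (iexp x - iexp y) \<le> \<bar>x - y\<bar>"
proof -
  have "iexp x - iexp y = iexp y * (iexp (x - y) - 1)"
    by (simp add: right_diff_distrib exp_diff)
  then have "norm (iexp x - iexp y) = norm (iexp (x - y) - 1)" by (simp add: norm_mult del: of_real_diff)
  also have "\<dots> \<le> \<bar>x - y\<bar>" using iexp_approx1[of "x - y" 0] by simp
  finally show ?thesis .
qed

text \<open>A square integrable Lipschitz function tends to 0: a value of at least \<open>e\<close>
  persists as \<open>e / 2\<close> on an interval of fixed length, and the tail integral of the
  square cannot afford such an interval far out. Compact support of \<open>f\<close> gives the
  Lipschitz property.\<close>

lemma fourier_tendsto_0_bounded:
  assumes f: "integrable lborel f" and M: "\<And>x. norm (f x) \<le> M" and R: "\<And>x. R < \<bar>x\<bar> \<Longrightarrow> f x = 0"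
  shows "(fourier f \<longlongrightarrow> 0) at_infinity"
proof -
  have [measurable]: "f \<in> borel_measurable borel" "fourier f \<in> borel_measurable borel"
    using f measurable_fourier[OF f] by auto
  define p where "p z = norm (fourier f z)" for z
  have [measurable]: "p \<in> borel_measurable borel" unfolding p_def by measurable
  have p2: "integrable lborel (\<lambda>z. (p z)\<^sup>2)"
    unfolding p_def by (rule fourier_square_integrable[OF f M])
  \<comment> \<open>The summand 1 keeps the Lipschitz constant positive, since it is divided by
    below.\<close>
  define L where "L = \<bar>R\<bar> * (LINT x|lborel. norm (f x)) + 1"
  have L: "L > 0" unfolding L_def by (simp add: add_nonneg_pos)
  have lip: "\<bar>p z - p w\<bar> \<le> L * \<bar>z - w\<bar>" for z w
  proof -
    have "\<bar>p z - p w\<bar> \<le> norm (fourier f z - fourier f w)" unfolding p_def by (rule norm_triangle_ineq3)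
    also have "fourier f z - fourier f w = (LINT x|lborel. f x * iexp (z * x) - f x * iexp (w * x))"
      unfolding fourier_def by (intro Bochner_Integration.integral_diff[symmetric] integrable_mult_iexp f)
    also have "norm \<dots> \<le> (LINT x|lborel. \<bar>R\<bar> * \<bar>z - w\<bar> * norm (f x))"
    proof (rule Bochner_Integration.integral_norm_bound_integral)
      show "integrable lborel (\<lambda>x. f x * iexp (z * x) - f x * iexp (w * x))"
        by (intro Bochner_Integration.integrable_diff integrable_mult_iexp f)
      show "integrable lborel (\<lambda>x. \<bar>R\<bar> * \<bar>z - w\<bar> * norm (f x))"
        using f by (intro integrable_mult_right integrable_norm)
      show "norm (f x * iexp (z * x) - f x * iexp (w * x)) \<le> \<bar>R\<bar> * \<bar>z - w\<bar> * norm (f x)" for x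
      proof (cases "R < \<bar>x\<bar>")
        case False
        have "norm (iexp (z * x) - iexp (w * x)) \<le> \<bar>z * x - w * x\<bar>" by (rule norm_iexp_diff)
        also have "\<dots> = \<bar>(z - w) * x\<bar>" by (simp add: left_diff_distrib)
        also have "\<dots> \<le> \<bar>R\<bar> * \<bar>z - w\<bar>" using False by (simp add: abs_mult mult.commute mult_right_mono)
        finally have "norm (iexp (z * x) - iexp (w * x)) \<le> \<bar>R\<bar> * \<bar>z - w\<bar>" .
        then have "norm (f x) * norm (iexp (z * x) - iexp (w * x)) \<le> norm (f x) * (\<bar>R\<bar> * \<bar>z - w\<bar>)" by (rule mult_left_mono) simp
        then show ?thesis by (simp add: norm_mult[symmetric] right_diff_distrib mult.commute)
      qed (simp add: R)
    qed
    also have "\<dots> = \<bar>R\<bar> * \<bar>z - w\<bar> * (LINT x|lborel. norm (f x))" by (rule integral_mult_right_zero)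
    also have "\<dots> = (L - 1) * \<bar>z - w\<bar>" by (simp add: L_def)
    also have "\<dots> \<le> L * \<bar>z - w\<bar>" by (intro mult_right_mono) auto
    finally show ?thesis .
  qed
  show ?thesis
  proof (rule tendsto_norm_zero_cancel, rule tendstoI)
    fix e :: real assume e: "e > 0"
    \<comment> \<open>Within distance \<open>h\<close> the function varies by at most
      \<open>e / 2\<close>, so a large value contributes \<open>2 * h * (e / 2)\<^sup>2\<close> to
      the integral, which is the threshold \<open>h * e\<^sup>2 / 2\<close>.\<close>
    define h where "h = e / (2 * L)"
    have h: "h > 0" using e L by (simp add: h_def)
    have "(\<lambda>n. LINT t|lborel. indicator {t. real n \<le> \<bar>t\<bar>} t * (p t)\<^sup>2) \<longlonglongrightarrow> integral\<^sup>L lborel (\<lambda>x::real. 0::real)"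
    proof (rule integral_dominated_convergence[where w="\<lambda>x. (p x)\<^sup>2"])
      show "AE x in lborel. (\<lambda>n. indicator {t. real n \<le> \<bar>t\<bar>} x * (p x)\<^sup>2) \<longlonglongrightarrow> 0"
      proof (rule AE_I2)
        fix x :: real
        have "\<forall>\<^sub>F n in sequentially. indicator {t. real n \<le> \<bar>t\<bar>} x * (p x)\<^sup>2 = 0"
          using eventually_gt_at_top[of "nat \<lceil>\<bar>x\<bar>\<rceil>"]
          by eventually_elim (auto simp: indicator_def, linarith)
        then show "(\<lambda>n. indicator {t. real n \<le> \<bar>t\<bar>} x * (p x)\<^sup>2) \<longlonglongrightarrow> 0"
          by (rule tendsto_eventually)
      qed
    qed (use p2 in \<open>auto simp: abs_mult indicator_def\<close>)
    moreover have "0 < h * e\<^sup>2 / 2" using h e by simp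
    ultimately have "\<forall>\<^sub>F n in sequentially. (LINT t|lborel. indicator {t. real n \<le> \<bar>t\<bar>} t * (p t)\<^sup>2) < h * e\<^sup>2 / 2"
      by (intro order_tendstoD(2)) auto
    then obtain n where n: "(LINT t|lborel. indicator {t. real n \<le> \<bar>t\<bar>} t * (p t)\<^sup>2) < h * e\<^sup>2 / 2"
      by (auto simp: eventually_sequentially)
    have small: "p z < e" if z: "\<bar>z\<bar> \<ge> real n + h" for z
    proof (rule ccontr)
      assume "\<not> p z < e"
      then have pe: "p z \<ge> e" by simp
      have pt: "e / 2 \<le> p t" if "t \<in> {z-h..z+h}" for t
      proof -
        have "\<bar>z - t\<bar> \<le> h" using that by auto
        then have "L * \<bar>z - t\<bar> \<le> L * h" using L by (intro mult_left_mono) auto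
        also have "\<dots> = e / 2" using L by (simp add: h_def)
        finally show ?thesis using lip[of z t] pe by linarith
      qed
      have "(LINT t|lborel. indicator {z-h..z+h} t * (e/2)\<^sup>2) \<le> (LINT t|lborel. indicator {t. real n \<le> \<bar>t\<bar>} t * (p t)\<^sup>2)"
      proof (rule integral_mono)
        show "integrable lborel (\<lambda>t. indicator {z-h..z+h} t * (e/2)\<^sup>2)"
          by (intro integrable_mult_left integrable_real_indicator) (auto simp: emeasure_lborel_Icc_eq)
        show "integrable lborel (\<lambda>t. indicator {t. real n \<le> \<bar>t\<bar>} t * (p t)\<^sup>2)"
          by (rule Bochner_Integration.integrable_bound[OF p2]) (auto simp: indicator_def)
        show "indicator {z-h..z+h} t * (e/2)\<^sup>2 \<le> indicator {t. real n \<le> \<bar>t\<bar>} t * (p t)\<^sup>2" for t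
        proof (cases "t \<in> {z-h..z+h}")
          case True
          then have "real n \<le> \<bar>t\<bar>" using z h by auto
          then show ?thesis using True pt[OF True] e by (auto intro!: power_mono)
        qed (auto simp: indicator_def)
      qed
      moreover have "(LINT t|lborel. indicator {z-h..z+h} t * (e/2)\<^sup>2) = h * e\<^sup>2 / 2"
        using h by (simp add: power_divide)
      ultimately show False using n by simp
    qed
    show "\<forall>\<^sub>F z in at_infinity. dist (norm (fourier f z)) 0 < e"
      unfolding eventually_at_infinity using small by (intro exI[of _ "real n + h"]) (auto simp: p_def)
  qed
qed

lemma Riemann_Lebesgue:
  assumes f: "integrable lborel f"
  shows "(fourier f \<longlongrightarrow> 0) at_infinity"
proof (rule tendstoI)
  fix e :: real assume e: "e > 0"
  have [measurable]: "f \<in> borel_measurable borel" using f by auto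
  obtain n :: nat where n: "(LINT x|lborel. 1 * norm (f x - (if \<bar>x\<bar> \<le> n \<and> norm (f x) \<le> n then f x else 0))) \<le> e / 2"
    by (rule L1_weighted_truncate[OF weight_one _ half_gt_zero[OF e], of f]) (use f in \<open>auto simp: integrable_L1_weighted_one\<close>)
  define g :: "real \<Rightarrow> complex" where "g x = (if \<bar>x\<bar> \<le> n \<and> norm (f x) \<le> n then f x else 0)" for x
  have [measurable]: "g \<in> borel_measurable borel" unfolding g_def by measurable
  have gi: "integrable lborel g"
    by (rule Bochner_Integration.integrable_bound[OF f]) (auto simp: g_def)
  have "(fourier g \<longlongrightarrow> 0) at_infinity"
    by (rule fourier_tendsto_0_bounded[OF gi, of "real n" "real n"]) (auto simp: g_def)
  then have "\<forall>\<^sub>F z in at_infinity. dist (fourier g z) 0 < e / 2" by (rule tendstoD) (use e in simp)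
  then show "\<forall>\<^sub>F z in at_infinity. dist (fourier f z) 0 < e"
  proof eventually_elim
    case (elim z)
    have "norm (fourier f z - fourier g z) \<le> (LINT x|lborel. norm (f x - g x))"
      unfolding fourier_diff[OF f gi, symmetric] by (rule norm_fourier_le)
    also have "\<dots> \<le> e / 2" using n by (simp add: g_def)
    finally show ?case using elim norm_triangle_ineq2[of "fourier f z" "fourier g z"] by simp
  qed
qed

text \<open>Since \<open>ennreal\<close> cuts negative values to 0, the two densities below are the
  positive and the negative part of \<open>w\<close>. Their measures agree on closed intervals, a
  generator stable under intersection, hence everywhere, and so the two parts agree almost
  everywhere.\<close>

lemma AE_eq_0_if_interval_integrals_0:
  fixes w :: "real \<Rightarrow> real"
  assumes [measurable]: "w \<in> borel_measurable borel"
    and int: "\<And>a b. set_integrable lborel {a..b} w"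
    and zero: "\<And>a b. (LINT x:{a..b}|lborel. w x) = 0"
  shows "AE x in lborel. w x = 0"
proof -
  have eq: "emeasure (density lborel (\<lambda>x. ennreal (w x))) {a..b} = emeasure (density lborel (\<lambda>x. ennreal (- w x))) {a..b}"
    and fin: "emeasure (density lborel (\<lambda>x. ennreal (w x))) {a..b} \<noteq> \<infinity>" for a b
  proof -
    let ?f = "\<lambda>x. indicator {a..b} x *\<^sub>R w x"
    have fi: "integrable lborel ?f" using int[of a b] by (simp add: set_integrable_def)
    have f1: "(\<integral>\<^sup>+x. ennreal (?f x) \<partial>lborel) < \<infinity>" "(\<integral>\<^sup>+x. ennreal (- ?f x) \<partial>lborel) < \<infinity>"
      using fi by (auto simp: real_integrable_def top.not_eq_extremum)
    have "enn2real (\<integral>\<^sup>+x. ennreal (?f x) \<partial>lborel) = enn2real (\<integral>\<^sup>+x. ennreal (- ?f x) \<partial>lborel)"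
      using real_lebesgue_integral_def[OF fi] zero[of a b] by (simp add: set_lebesgue_integral_def)
    with f1 have f2: "(\<integral>\<^sup>+x. ennreal (?f x) \<partial>lborel) = (\<integral>\<^sup>+x. ennreal (- ?f x) \<partial>lborel)"
      by (metis ennreal_enn2real infinity_ennreal_def)
    have e1: "emeasure (density lborel (\<lambda>x. ennreal (w x))) {a..b} = (\<integral>\<^sup>+x. ennreal (?f x) \<partial>lborel)"
      by (subst emeasure_density) (auto intro!: nn_integral_cong simp: indicator_def)
    have e2: "emeasure (density lborel (\<lambda>x. ennreal (- w x))) {a..b} = (\<integral>\<^sup>+x. ennreal (- ?f x) \<partial>lborel)"
      by (subst emeasure_density) (auto intro!: nn_integral_cong simp: indicator_def)
    show "emeasure (density lborel (\<lambda>x. ennreal (w x))) {a..b} = emeasure (density lborel (\<lambda>x. ennreal (- w x))) {a..b}"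
      "emeasure (density lborel (\<lambda>x. ennreal (w x))) {a..b} \<noteq> \<infinity>"
      using e1 e2 f1 f2 by auto
  qed
  have sets: "sigma_sets UNIV (range (\<lambda>(a, b). {a..b::real})) = sets borel"
    by (subst borel_eq_atLeastAtMost) simp
  have "density lborel (\<lambda>x. ennreal (w x)) = density lborel (\<lambda>x. ennreal (- w x))"
  proof (rule measure_eqI_generator_eq[where E="range (\<lambda>(a, b). {a..b::real})" and \<Omega>=UNIV and A="\<lambda>n. {- real n..real n}"])
    show "Int_stable (range (\<lambda>(a, b). {a..b::real}))"
      by (auto simp: Int_stable_def)
    show "(\<Union>n. {- real n..real n}) = UNIV"
    proof (intro set_eqI iffI UNIV_I)
      fix x :: real
      obtain n where "\<bar>x\<bar> \<le> real n" using real_arch_simple by blast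
      then show "x \<in> (\<Union>n. {- real n..real n})" by (auto intro!: exI[of _ n])
    qed
    show "emeasure (density lborel (\<lambda>x. ennreal (w x))) X = emeasure (density lborel (\<lambda>x. ennreal (- w x))) X"
      if "X \<in> range (\<lambda>(a, b). {a..b})" for X
      using that eq by auto
  qed (use fin sets in auto)
  then have "AE x in lborel. ennreal (w x) = ennreal (- w x)"
    by (intro sigma_finite_measure.density_unique[OF lborel.sigma_finite_measure_axioms]) auto
  then show ?thesis
  proof eventually_elim
    case (elim x)
    then show ?case
      by (cases "w x" "0::real" rule: linorder_cases) (auto simp: ennreal_neg)
  qed
qed

lemma std_normal_density_eq_exp: "sqrt (2 * pi) * std_normal_density x = exp (- x\<^sup>2 / 2)"
  by (simp add: std_normal_density_def)

text \<open>Gaussian averages of \<open>u\<close> have two limits as their width shrinks: pointwise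
  they tend to the inversion integral \<open>v\<close>, because the multiplication formula turns
  them into a damped version of it, while their integrals over intervals tend to those of
  \<open>u\<close>, because translation is continuous there. So \<open>u\<close> and
  \<open>v\<close> have the same interval integrals.\<close>

theorem fourier_inversion_AE:
  assumes u: "integrable lborel u" and uh: "integrable lborel (fourier u)"
  shows "AE x in lborel. u x = 1 / (2 * pi) * fourier (fourier u) (- x)"
proof -
  have [measurable]: "u \<in> borel_measurable borel" "fourier u \<in> borel_measurable borel"
    using u measurable_fourier[OF u] by auto
  define v where "v x = 1 / (2 * pi) * fourier (fourier u) (- x)" for x
  have vc: "continuous_on UNIV v"
    unfolding v_def
    by (intro continuous_intros continuous_on_compose2[OF continuous_on_fourier[OF uh]]) auto
  then have [measurable]: "v \<in> borel_measurable borel" by (rule borel_measurable_continuous_onI)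
  define \<phi> where "\<phi> s = complex_of_real (std_normal_density s)" for s
  have \<phi>i: "integrable lborel \<phi>" unfolding \<phi>_def by (intro integrable_normal_density_complex) simp
  have [measurable]: "\<phi> \<in> borel_measurable borel" using \<phi>i by auto
  have f\<phi>: "fourier \<phi> s = of_real (sqrt (2 * pi)) * \<phi> s" for s
    using fourier_normal_density[of 1 s] std_normal_density_eq_exp[of s]
    by (simp add: \<phi>_def[abs_def] flip: of_real_mult)
  \<comment> \<open>The average of \<open>u\<close> around \<open>x\<close> with respect to a normal
    density of deviation \<open>\<sigma>\<close>.\<close>
  define S where "S \<sigma> x = (LINT s|lborel. u (x + \<sigma> * s) * \<phi> s)" for \<sigma> x
  have Smeas[measurable]: "S \<sigma> \<in> borel_measurable borel" for \<sigma> unfolding S_def by measurable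
  have Sform: "S \<sigma> x = 1 / sqrt (2 * pi) * (LINT t|lborel. iexp (- (t * x)) * fourier u t * \<phi> (\<sigma> * t))"
    if s: "\<sigma> > 0" for \<sigma> x
  proof -
    have ui: "integrable lborel (\<lambda>s. u (x + \<sigma> * s))"
      by (rule lborel_integrable_real_affine[OF u]) (use s in simp)
    have fu: "fourier (\<lambda>s. u (x + \<sigma> * s)) z = 1 / \<sigma> * (iexp (- (z / \<sigma> * x)) * fourier u (z / \<sigma>))" for z
    proof -
      have "fourier u (z / \<sigma>) = \<bar>\<sigma>\<bar> *\<^sub>R (LINT s|lborel. u (x + \<sigma> * s) * iexp (z / \<sigma> * (x + \<sigma> * s)))"
        unfolding fourier_def by (rule lborel_integral_real_affine) (use s in simp)
      also have "(LINT s|lborel. u (x + \<sigma> * s) * iexp (z / \<sigma> * (x + \<sigma> * s))) 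
          = (LINT s|lborel. u (x + \<sigma> * s) * iexp (z * s) * iexp (z / \<sigma> * x))"
      proof (intro Bochner_Integration.integral_cong refl)
          fix t
          have "z / \<sigma> * (x + \<sigma> * t) = z * t + z / \<sigma> * x" using s by (simp add: field_simps)
          then show "u (x + \<sigma> * t) * iexp (z / \<sigma> * (x + \<sigma> * t)) = u (x + \<sigma> * t) * iexp (z * t) * iexp (z / \<sigma> * x)"
            by (simp only: of_real_add ring_distribs exp_add mult.assoc)
        qed
      also have "\<dots> = fourier (\<lambda>s. u (x + \<sigma> * s)) z * iexp (z / \<sigma> * x)"
        unfolding fourier_def by (rule integral_mult_left_zero)
      finally have "fourier u (z / \<sigma>) = \<sigma> * (fourier (\<lambda>s. u (x + \<sigma> * s)) z * iexp (z / \<sigma> * x))"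
        using s by (simp add: scaleR_conv_of_real)
      then show ?thesis using s by (simp add: exp_minus)
    qed
    have "of_real (sqrt (2 * pi)) * S \<sigma> x = (LINT s|lborel. u (x + \<sigma> * s) * fourier \<phi> s)"
      unfolding S_def f\<phi> by (subst integral_mult_right_zero[symmetric]) (simp add: mult_ac)
    also have "\<dots> = (LINT z|lborel. fourier (\<lambda>s. u (x + \<sigma> * s)) z * \<phi> z)"
      by (rule fourier_multiplication_formula[OF ui \<phi>i])
    also have "\<dots> = \<bar>\<sigma>\<bar> *\<^sub>R (LINT t|lborel. fourier (\<lambda>s. u (x + \<sigma> * s)) (0 + \<sigma> * t) * \<phi> (0 + \<sigma> * t))"
      by (rule lborel_integral_real_affine) (use s in simp)
    also have "\<dots> = (LINT t|lborel. iexp (- (t * x)) * fourier u t * \<phi> (\<sigma> * t))"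
      unfolding integral_scaleR_right[symmetric] fu
      using s by (intro Bochner_Integration.integral_cong) (auto simp: scaleR_conv_of_real)
    finally show ?thesis by (simp add: field_simps del: of_real_mult)
  qed
  define K where "K = (LINT t|lborel. norm (fourier u t))"
  have \<phi>b: "norm (\<phi> s) \<le> 1 / sqrt (2 * pi)" for s
  proof -
    have "norm (\<phi> s) = std_normal_density s" by (simp add: \<phi>_def)
    also have "\<dots> \<le> 1 / sqrt (2 * pi)" by (simp add: std_normal_density_def divide_right_mono)
    finally show ?thesis .
  qed
  have Sb: "norm (S \<sigma> x) \<le> K" if s: "\<sigma> > 0" for \<sigma> x
  proof -
    have "norm (LINT t|lborel. iexp (- (t * x)) * fourier u t * \<phi> (\<sigma> * t)) \<le> (LINT t|lborel. norm (fourier u t) * (1 / sqrt (2 * pi)))"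
    proof (rule Bochner_Integration.integral_norm_bound_integral)
      show *: "integrable lborel (\<lambda>t. norm (fourier u t) * (1 / sqrt (2 * pi)))"
        using uh by (intro integrable_mult_left integrable_norm)
      have **: "norm (iexp (- (t * x)) * fourier u t * \<phi> (\<sigma> * t)) \<le> norm (fourier u t) * (1 / sqrt (2 * pi))" for t
        using mult_left_mono[OF \<phi>b[of "\<sigma> * t"], of "norm (fourier u t)"] by (simp add: norm_mult)
      then show "norm (iexp (- (t * x)) * fourier u t * \<phi> (\<sigma> * t)) \<le> norm (fourier u t) * (1 / sqrt (2 * pi))" for t .
      show "integrable lborel (\<lambda>t. iexp (- (t * x)) * fourier u t * \<phi> (\<sigma> * t))"
        by (rule Bochner_Integration.integrable_bound[OF *], measurable)
           (rule AE_I2, unfold real_norm_def, rule order_trans[OF ** abs_ge_self])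
    qed
    also have "\<dots> = K * (1 / sqrt (2 * pi))" unfolding K_def by (rule integral_mult_left_zero)
    finally have "norm (S \<sigma> x) \<le> 1 / sqrt (2 * pi) * (K * (1 / sqrt (2 * pi)))"
      unfolding Sform[OF s] norm_mult by (intro mult_mono) (auto simp: norm_divide)
    also have "\<dots> = K / (2 * pi)" by simp
    also have "\<dots> \<le> K / 1"
      unfolding K_def by (rule divide_left_mono) (use pi_gt3 in auto)
    finally show ?thesis by simp
  qed
  define \<sigma> where "\<sigma> n = 1 / real (Suc n)" for n
  have \<sigma>p: "\<sigma> n > 0" for n by (simp add: \<sigma>_def)
  have \<sigma>0: "\<sigma> \<longlonglongrightarrow> 0" unfolding \<sigma>_def using LIMSEQ_inverse_real_of_nat by (simp add: inverse_eq_divide)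
  have Slim: "(\<lambda>n. S (\<sigma> n) x) \<longlonglongrightarrow> v x" for x
  proof -
    have "(\<lambda>n. LINT t|lborel. iexp (- (t * x)) * fourier u t * \<phi> (\<sigma> n * t)) \<longlonglongrightarrow> (LINT t|lborel. iexp (- (t * x)) * fourier u t * \<phi> 0)"
    proof (rule integral_dominated_convergence[where w="\<lambda>t. norm (fourier u t) * (1 / sqrt (2 * pi))"])
      show "integrable lborel (\<lambda>t. norm (fourier u t) * (1 / sqrt (2 * pi)))"
        using uh by (intro integrable_mult_left integrable_norm)
      show "AE t in lborel. norm (iexp (- (t * x)) * fourier u t * \<phi> (\<sigma> n * t)) \<le> norm (fourier u t) * (1 / sqrt (2 * pi))" for n
        using mult_left_mono[OF \<phi>b[of "\<sigma> n * _"], of "norm (fourier u _)"] by (intro AE_I2) (simp add: norm_mult)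
      show "AE t in lborel. (\<lambda>n. iexp (- (t * x)) * fourier u t * \<phi> (\<sigma> n * t)) \<longlonglongrightarrow> iexp (- (t * x)) * fourier u t * \<phi> 0"
      proof (intro AE_I2 tendsto_mult tendsto_const)
        fix t
        have "(\<lambda>n. 1 / sqrt (2 * pi) * exp (- (\<sigma> n * t)\<^sup>2 / 2)) \<longlonglongrightarrow> 1 / sqrt (2 * pi) * exp (- (0 * t)\<^sup>2 / 2)"
          by (intro tendsto_intros \<sigma>0) auto
        then show "(\<lambda>n. \<phi> (\<sigma> n * t)) \<longlonglongrightarrow> \<phi> 0"
          unfolding \<phi>_def std_normal_density_def by (intro tendsto_of_real) simp
      qed
    qed measurable
    then have "(\<lambda>n. S (\<sigma> n) x) \<longlonglongrightarrow> 1 / sqrt (2 * pi) * (LINT t|lborel. iexp (- (t * x)) * fourier u t * \<phi> 0)"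
      unfolding Sform[OF \<sigma>p] by (intro tendsto_mult tendsto_const)
    also have "(LINT t|lborel. iexp (- (t * x)) * fourier u t * \<phi> 0) = fourier (fourier u) (- x) * \<phi> 0"
      unfolding fourier_def[of "fourier u"] by (subst integral_mult_left_zero[symmetric]) (simp add: mult_ac)
    also have "1 / sqrt (2 * pi) * (fourier (fourier u) (- x) * \<phi> 0) = v x"
      by (simp add: v_def \<phi>_def std_normal_density_def field_simps flip: of_real_mult)
    finally show ?thesis .
  qed
  have Sint: "(LINT x:{a..b}|lborel. S \<sigma> x) = (LINT s|lborel. (LINT x:{a..b}|lborel. u (x + \<sigma> * s)) * \<phi> s)" for a b \<sigma>
  proof -
    have pint: "integrable (lborel \<Otimes>\<^sub>M lborel) (\<lambda>(x, s). indicator {a..b} x *\<^sub>R (u (x + \<sigma> * s) * \<phi> s))"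
    proof (rule integrableI_bounded)
      show "(\<lambda>(x, s). indicator {a..b} x *\<^sub>R (u (x + \<sigma> * s) * \<phi> s)) \<in> borel_measurable (lborel \<Otimes>\<^sub>M lborel)" by measurable
      have "(\<integral>\<^sup>+p. ennreal (norm (case p of (x, s) \<Rightarrow> indicator {a..b} x *\<^sub>R (u (x + \<sigma> * s) * \<phi> s))) \<partial>(lborel \<Otimes>\<^sub>M lborel))
        = (\<integral>\<^sup>+s. \<integral>\<^sup>+x. ennreal (norm (indicator {a..b} x *\<^sub>R (u (x + \<sigma> * s) * \<phi> s))) \<partial>lborel \<partial>lborel)"
        by (subst lborel_pair.nn_integral_snd[symmetric]) auto
      also have "\<dots> \<le> (\<integral>\<^sup>+s. \<integral>\<^sup>+x. ennreal (norm (u (x + \<sigma> * s))) * ennreal (norm (\<phi> s)) \<partial>lborel \<partial>lborel)"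
        by (intro nn_integral_mono) (auto simp: norm_mult ennreal_mult'[symmetric] indicator_def)
      also have "\<dots> = (\<integral>\<^sup>+s. (\<integral>\<^sup>+x. ennreal (norm (u x)) \<partial>lborel) * ennreal (norm (\<phi> s)) \<partial>lborel)"
      proof (rule nn_integral_cong)
        fix s
        have "(\<integral>\<^sup>+x. ennreal (norm (u (x + \<sigma> * s))) * ennreal (norm (\<phi> s)) \<partial>lborel) = (\<integral>\<^sup>+x. ennreal (norm (u (x + \<sigma> * s))) \<partial>lborel) * ennreal (norm (\<phi> s))"
          by (rule nn_integral_multc) measurable
        also have "(\<integral>\<^sup>+x. ennreal (norm (u (x + \<sigma> * s))) \<partial>lborel) = (\<integral>\<^sup>+x. ennreal (norm (u x)) \<partial>lborel)"
          using nn_integral_lborel_shift[of "\<lambda>x. ennreal (norm (u x))" "- \<sigma> * s"] by simp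
        finally show "(\<integral>\<^sup>+x. ennreal (norm (u (x + \<sigma> * s))) * ennreal (norm (\<phi> s)) \<partial>lborel) = (\<integral>\<^sup>+x. ennreal (norm (u x)) \<partial>lborel) * ennreal (norm (\<phi> s))" .
      qed
      also have "\<dots> = (\<integral>\<^sup>+x. ennreal (norm (u x)) \<partial>lborel) * (\<integral>\<^sup>+s. ennreal (norm (\<phi> s)) \<partial>lborel)"
        by (rule nn_integral_cmult) measurable
      also have "\<dots> < \<infinity>"
        using u \<phi>i by (simp add: integrable_iff_bounded ennreal_mult_less_top)
      finally show "(\<integral>\<^sup>+p. ennreal (norm (case p of (x, s) \<Rightarrow> indicator {a..b} x *\<^sub>R (u (x + \<sigma> * s) * \<phi> s))) \<partial>(lborel \<Otimes>\<^sub>M lborel)) < \<infinity>" .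
    qed
    have "(LINT x:{a..b}|lborel. S \<sigma> x) = (LINT x|lborel. LINT s|lborel. indicator {a..b} x *\<^sub>R (u (x + \<sigma> * s) * \<phi> s))"
      unfolding set_lebesgue_integral_def S_def by (simp only: integral_scaleR_right)
    also have "\<dots> = (LINT s|lborel. LINT x|lborel. indicator {a..b} x *\<^sub>R (u (x + \<sigma> * s) * \<phi> s))"
      by (rule lborel_pair.Fubini_integral[symmetric]) (rule pint)
    also have "\<dots> = (LINT s|lborel. LINT x|lborel. (indicator {a..b} x *\<^sub>R u (x + \<sigma> * s)) * \<phi> s)"
      by (simp only: mult_scaleR_left)
    also have "\<dots> = (LINT s|lborel. (LINT x:{a..b}|lborel. u (x + \<sigma> * s)) * \<phi> s)"
      unfolding set_lebesgue_integral_def by (simp only: integral_mult_left_zero)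
    finally show ?thesis .
  qed
  have v_int: "set_integrable lborel {a..b} v" for a b
    by (rule borel_integrable_atLeastAtMost') (rule continuous_on_subset[OF vc], simp)
  have u_int: "set_integrable lborel {a..b} u" for a b
    using u unfolding set_integrable_def by (intro integrable_mult_indicator) auto
  have eq: "(LINT x:{a..b}|lborel. u x) = (LINT x:{a..b}|lborel. v x)" for a b
  proof (rule LIMSEQ_unique)
    show "(\<lambda>n. LINT x:{a..b}|lborel. S (\<sigma> n) x) \<longlonglongrightarrow> (LINT x:{a..b}|lborel. v x)"
      unfolding set_lebesgue_integral_def
    proof (rule integral_dominated_convergence[where w="\<lambda>x. indicator {a..b} x * K"])
      show "integrable lborel (\<lambda>x. indicator {a..b} x * K)"
        by (intro integrable_mult_left integrable_real_indicator) (auto simp: emeasure_lborel_Icc_eq)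
      show "AE x in lborel. (\<lambda>n. indicat_real {a..b} x *\<^sub>R S (\<sigma> n) x) \<longlonglongrightarrow> indicat_real {a..b} x *\<^sub>R v x"
        by (intro AE_I2 tendsto_intros Slim)
      show "AE x in lborel. norm (indicat_real {a..b} x *\<^sub>R S (\<sigma> n) x) \<le> indicat_real {a..b} x * K" for n
        using Sb[OF \<sigma>p] by (intro AE_I2) (auto simp: indicator_def)
    qed measurable
    \<comment> \<open>After exchanging integrals only the interval integral of a translate of
      \<open>u\<close> depends on the width, and its continuity at 0 is all that is
      required.\<close>
    define W where "W y = (LINT x:{a..b}|lborel. u (x + y))" for y
    define N where "N = (LINT x|lborel. norm (u x))"
    have Weq: "W y = (LINT t|lborel. indicator {a..b} (t - y) *\<^sub>R u t)" for y
      unfolding W_def set_lebesgue_integral_def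
      by (subst lborel_integral_real_affine[where c=1 and t=y and f="\<lambda>t. indicator {a..b} (t - y) *\<^sub>R u t"]) (auto simp: add.commute)
    have Wb: "norm (W y) \<le> N" for y
      unfolding Weq N_def
    proof (rule Bochner_Integration.integral_norm_bound_integral)
      show "integrable lborel (\<lambda>t. indicator {a..b} (t - y) *\<^sub>R u t)"
        by (rule Bochner_Integration.integrable_bound[OF u]) (auto simp: indicator_def)
    qed (use u in \<open>auto simp: indicator_def\<close>)
    have Wlim: "(\<lambda>n. W (y n)) \<longlonglongrightarrow> W 0" if y: "y \<longlonglongrightarrow> 0" for y
      unfolding Weq
    proof (rule integral_dominated_convergence[where w="\<lambda>t. norm (u t)"])
      \<comment> \<open>Under a small shift the indicator of the interval changes in the limit only
        at the two endpoints.\<close>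
      have "AE t in lborel. t \<noteq> a" "AE t in lborel. t \<noteq> b" by (rule AE_lborel_singleton)+
      then show "AE t in lborel. (\<lambda>n. indicat_real {a..b} (t - y n) *\<^sub>R u t) \<longlonglongrightarrow> indicat_real {a..b} (t - 0) *\<^sub>R u t"
      proof eventually_elim
        case (elim t)
        have ty: "(\<lambda>n. t - y n) \<longlonglongrightarrow> t" using tendsto_diff[OF tendsto_const y, of t] by simp
        have "\<forall>\<^sub>F n in sequentially. indicat_real {a..b} (t - y n) = indicat_real {a..b} t"
        proof (cases "t < a \<or> t > b")
          case True
          then show ?thesis
            using order_tendstoD(2)[OF ty, of a] order_tendstoD(1)[OF ty, of b]
            by (auto elim!: eventually_mono simp: indicator_def)
        next
          case False
          with elim have "a < t" "t < b" by auto
          then show ?thesis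
            using eventually_conj[OF order_tendstoD(1)[OF ty, of a] order_tendstoD(2)[OF ty, of b]]
            by (auto elim!: eventually_mono simp: indicator_def)
        qed
        then have "\<forall>\<^sub>F n in sequentially. indicat_real {a..b} (t - y n) *\<^sub>R u t = indicat_real {a..b} (t - 0) *\<^sub>R u t"
          by eventually_elim simp
        then show ?case by (rule tendsto_eventually)
      qed
    qed (use u in \<open>auto simp: indicator_def\<close>)
    have [measurable]: "W \<in> borel_measurable borel"
      unfolding W_def set_lebesgue_integral_def by measurable
    have "(\<lambda>n. LINT s|lborel. W (\<sigma> n * s) * \<phi> s) \<longlonglongrightarrow> (LINT s|lborel. W 0 * \<phi> s)"
    proof (rule integral_dominated_convergence[where w="\<lambda>s. N * norm (\<phi> s)"])
      show "AE s in lborel. (\<lambda>n. W (\<sigma> n * s) * \<phi> s) \<longlonglongrightarrow> W 0 * \<phi> s"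
        using tendsto_mult[OF \<sigma>0 tendsto_const] by (intro AE_I2 tendsto_mult tendsto_const Wlim) simp
      show "AE s in lborel. norm (W (\<sigma> n * s) * \<phi> s) \<le> N * norm (\<phi> s)" for n
        using Wb by (auto simp: norm_mult intro!: mult_right_mono)
    qed (use \<phi>i in auto)
    moreover have "(LINT s|lborel. W 0 * \<phi> s) = (LINT x:{a..b}|lborel. u x)"
    proof -
      have "(LINT s|lborel. \<phi> s) = 1"
        unfolding \<phi>_def integral_complex_of_real by simp
      then show ?thesis by (simp add: W_def)
    qed
    ultimately show "(\<lambda>n. LINT x:{a..b}|lborel. S (\<sigma> n) x) \<longlonglongrightarrow> (LINT x:{a..b}|lborel. u x)"
      unfolding Sint by (simp only: W_def)
  qed
  have "set_integrable lborel {a..b} (\<lambda>x. u x - v x)" "(LINT x:{a..b}|lborel. u x - v x) = 0" for a b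
    using u_int v_int eq by (auto intro: set_integral_diff)
  then have i: "integrable lborel (\<lambda>x. indicat_real {a..b} x *\<^sub>R (u x - v x))"
      "(LINT x|lborel. indicat_real {a..b} x *\<^sub>R (u x - v x)) = 0" for a b
    by (auto simp: set_integrable_def set_lebesgue_integral_def)
  have "AE x in lborel. Re (u x - v x) = 0"
  proof (rule AE_eq_0_if_interval_integrals_0)
    show "set_integrable lborel {a..b} (\<lambda>x. Re (u x - v x))" for a b
      using integrable_Re[OF i(1)] unfolding set_integrable_def by simp
    show "(LINT x:{a..b}|lborel. Re (u x - v x)) = 0" for a b
      using integral_Re[OF i(1), of a b] i(2)[of a b] unfolding set_lebesgue_integral_def by simp
  qed measurable
  moreover have "AE x in lborel. Im (u x - v x) = 0"
  proof (rule AE_eq_0_if_interval_integrals_0)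
    show "set_integrable lborel {a..b} (\<lambda>x. Im (u x - v x))" for a b
      using integrable_Im[OF i(1)] unfolding set_integrable_def by simp
    show "(LINT x:{a..b}|lborel. Im (u x - v x)) = 0" for a b
      using integral_Im[OF i(1), of a b] i(2)[of a b] unfolding set_lebesgue_integral_def by simp
  qed measurable
  ultimately show ?thesis
    by eventually_elim (auto simp: v_def complex_eq_iff)
qed

corollary fourier_eq_0_imp_AE:
  assumes "integrable lborel g" "\<And>z. fourier g z = 0"
  shows "AE x in lborel. g x = 0"
proof -
  have "fourier g = (\<lambda>z. 0)" using assms(2) by auto
  with fourier_inversion_AE[OF assms(1)] show ?thesis
    by (simp add: fourier_def[of "\<lambda>z. 0"])
qed

text \<open>The factor \<open>1 / (2 * pi)\<close> is simply dropped. For densities this plays the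
  part that \<open>trig_series_coeff_bound\<close> plays for atoms.\<close>

corollary fourier_inversion_bound:
  assumes "integrable lborel u" "integrable lborel (fourier u)"
  shows "AE x in lborel. norm (u x) \<le> (LINT t|lborel. norm (fourier u t))"
  using fourier_inversion_AE[OF assms]
proof eventually_elim
  case (elim x)
  have "norm (u x) = 1 / (2 * pi) * norm (fourier (fourier u) (- x))"
    by (simp add: elim norm_mult norm_divide)
  also have "\<dots> \<le> 1 * norm (fourier (fourier u) (- x))"
    using pi_gt3 by (intro mult_right_mono) (auto simp: field_simps)
  also have "\<dots> \<le> (LINT t|lborel. norm (fourier u t))" using norm_fourier_le[of "fourier u" "-x"] by simp
  finally show ?case .
qed

section \<open>Almost periodicity\<close>

lemma trig_series_finite_support:
  assumes "finite S"
  shows "trig_series UNIV (\<lambda>y. if y \<in> S then a y else 0) z = (\<Sum>y\<in>S. a y * iexp (z * y))"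
  unfolding trig_series_restrict trig_series_def using assms by simp

text \<open>The set \<open>S0\<close> forces distinguished frequencies into the truncation: the
  frequency whose coefficient is sought in \<open>trig_series_mean\<close>, and 0 in
  \<open>Bohr_argument\<close>.\<close>

lemma D_rep_truncate:
  assumes w: "is_weight \<omega>" and a: "(\<lambda>y. \<omega> y * norm (a y)) summable_on UNIV" and e: "e > 0"
    and S0: "finite S0"
  obtains S where "finite S" "S0 \<subseteq> S" "D_rep \<omega> (\<lambda>z. trig_series UNIV a z - (\<Sum>y\<in>S. a y * iexp (z * y))) e"
proof -
  let ?f = "\<lambda>y. \<omega> y * norm (a y)"
  have "(sum ?f \<longlongrightarrow> infsum ?f UNIV) (finite_subsets_at_top UNIV)"
    using has_sum_infsum[OF a] by (simp add: has_sum_def)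
  then have "\<forall>\<^sub>F S in finite_subsets_at_top UNIV. infsum ?f UNIV - e < sum ?f S"
    by (rule order_tendstoD) (use e in simp)
  then obtain S1 where S1: "finite S1" "\<And>Y. finite Y \<Longrightarrow> S1 \<subseteq> Y \<Longrightarrow> infsum ?f UNIV - e < sum ?f Y"
    by (auto simp: eventually_finite_subsets_at_top)
  define S where "S = S0 \<union> S1"
  have S: "finite S" "S0 \<subseteq> S" "infsum ?f UNIV - e < sum ?f S"
    using S0 S1 by (auto simp: S_def)
  define b where "b y = (if y \<in> - S then a y else 0)" for y
  have "?f summable_on - S" by (rule summable_on_subset_banach[OF a]) simp
  then have bs: "(\<lambda>y. \<omega> y * norm (b y)) summable_on UNIV"
    by (rule summable_on_cong_neutral[THEN iffD1, rotated 3]) (auto simp: b_def)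
  have "(\<Sum>\<^sub>\<infinity>y. \<omega> y * norm (b y)) = infsum ?f (- S)"
    by (rule infsum_cong_neutral) (auto simp: b_def)
  also have "\<dots> = infsum ?f UNIV - infsum ?f S"
    using infsum_Diff[OF a, of S] S(1) by (simp add: Compl_eq_Diff_UNIV)
  also have "\<dots> \<le> e" using S by simp
  finally have be: "(\<Sum>\<^sub>\<infinity>y. \<omega> y * norm (b y)) \<le> e" .
  have an: "(\<lambda>y. norm (a y)) summable_on UNIV" by (rule weighted_summable_norm[OF w a])
  have bn: "(\<lambda>y. norm (b y)) summable_on UNIV" by (rule weighted_summable_norm[OF w bs])
  have "trig_series UNIV a z - (\<Sum>y\<in>S. a y * iexp (z * y)) = trig_series UNIV b z" for z
  proof -
    have "a = (\<lambda>y. b y + (if y \<in> S then a y else 0))" by (auto simp: b_def)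
    moreover have "(\<lambda>y. norm (if y \<in> S then a y else 0)) summable_on UNIV"
      by (rule summable_on_cong_neutral[THEN iffD1, rotated 3, OF summable_on_finite[OF S(1), of "\<lambda>y. norm (a y)"]]) auto
    ultimately have "trig_series UNIV a z = trig_series UNIV b z + trig_series UNIV (\<lambda>y. if y \<in> S then a y else 0) z"
      using trig_series_add[OF bn] by metis
    then show ?thesis by (simp add: trig_series_finite_support[OF S(1)])
  qed
  then have "D_rep \<omega> (\<lambda>z. trig_series UNIV a z - (\<Sum>y\<in>S. a y * iexp (z * y))) e"
    unfolding D_rep_def using bs be by (intro exI[of _ b]) auto
  then show thesis using S that by blast
qed

text \<open>Pigeonhole: two reals whose characters at all frequencies in \<open>S\<close> fall into the same small
  squares are indistinguishable up to \<open>e\<close>.\<close>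

lemma characters_finite_net:
  fixes S :: "real set"
  assumes S: "finite S" and e: "e > 0"
  obtains Z where "finite Z" "\<And>z. \<exists>w\<in>Z. \<forall>y\<in>S. norm (iexp (z * y) - iexp (w * y)) \<le> e"
proof -
  \<comment> \<open>Equal integer parts put the cosines, and likewise the sines, within
    \<open>1 / real N\<close>, so the characters differ by at most
    \<open>2 / real N\<close>.\<close>
  obtain N :: nat where N: "2 / e < real N" using reals_Archimedean2 by blast
  have N0: "real N > 0" using N e by (smt (verit) divide_pos_pos)
  define key where "key z = (\<lambda>y\<in>S. (\<lfloor>real N * cos (z * y)\<rfloor>, \<lfloor>real N * sin (z * y)\<rfloor>))" for z
  have rng: "\<lfloor>real N * c\<rfloor> \<in> {- int N..int N}" if "\<bar>c\<bar> \<le> 1" for c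
  proof -
    have "\<bar>real N * c\<bar> \<le> real N" using that mult_left_mono[of "\<bar>c\<bar>" 1 "real N"] by (simp add: abs_mult)
    then have "- real N \<le> real N * c" "real N * c \<le> real N" by auto
    then show ?thesis by (auto simp: le_floor_iff floor_le_iff)
  qed
  have "range key \<subseteq> S \<rightarrow>\<^sub>E ({- int N..int N} \<times> {- int N..int N})"
    unfolding key_def using rng by (auto simp: PiE_def extensional_def)
  moreover have "finite (S \<rightarrow>\<^sub>E ({- int N..int N} \<times> {- int N..int N}))"
    by (intro finite_PiE S) auto
  ultimately have fin: "finite (range key)" by (rule finite_subset)
  define Z where "Z = inv key ` range key"
  show thesis
  proof (rule that[of Z])
    show "finite Z" unfolding Z_def using fin by (rule finite_imageI)
    fix z
    define w where "w = inv key (key z)"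
    have kw: "key w = key z" unfolding w_def by (rule f_inv_into_f) simp
    have "norm (iexp (z * y) - iexp (w * y)) \<le> e" if y: "y \<in> S" for y
    proof -
      have k: "\<lfloor>real N * cos (w * y)\<rfloor> = \<lfloor>real N * cos (z * y)\<rfloor>" "\<lfloor>real N * sin (w * y)\<rfloor> = \<lfloor>real N * sin (z * y)\<rfloor>"
        using fun_cong[OF kw, of y] y by (auto simp: key_def)
      have close: "\<bar>c - d\<bar> \<le> 1 / real N" if "\<lfloor>real N * d\<rfloor> = \<lfloor>real N * c\<rfloor>" for c d
      proof -
        have "\<bar>real N * c - real N * d\<bar> < 1" using that by linarith
        then have "real N * \<bar>c - d\<bar> < 1" using N0 by (simp add: abs_mult flip: right_diff_distrib)
        then show ?thesis using N0 by (simp add: field_simps)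
      qed
      have "norm (iexp (z * y) - iexp (w * y)) \<le> \<bar>Re (iexp (z * y) - iexp (w * y))\<bar> + \<bar>Im (iexp (z * y) - iexp (w * y))\<bar>"
        by (rule cmod_le)
      also have "\<dots> \<le> 1 / real N + 1 / real N"
        using close[OF k(1)] close[OF k(2)] by (intro add_mono) (auto simp: Re_exp Im_exp)
      also have "\<dots> \<le> e" using N N0 e by (simp add: field_simps)
      finally show ?thesis .
    qed
    then show "\<exists>w\<in>Z. \<forall>y\<in>S. norm (iexp (z * y) - iexp (w * y)) \<le> e"
      unfolding Z_def w_def by blast
  qed
qed

text \<open>A trigonometric polynomial close to \<open>P\<close> sees a translation only through
  finitely many characters, to which \<open>characters_finite_net\<close> applies. This is Bochner's
  compactness of the set of translates.\<close>

lemma almost_periodic_net: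
  assumes w: "is_weight \<omega>" and P: "D_rep \<omega> P C" and e: "e > 0"
  obtains Z where "finite Z" "\<And>z. \<exists>w\<in>Z. \<forall>t. norm (P (t + z) - P (t + w)) \<le> e"
proof -
  obtain a where a: "(\<lambda>y. \<omega> y * norm (a y)) summable_on UNIV" "P = trig_series UNIV a"
    using P unfolding D_rep_def by blast
  obtain S where S: "finite S" "D_rep \<omega> (\<lambda>z. P z - (\<Sum>y\<in>S. a y * iexp (z * y))) (e / 3)"
    using D_rep_truncate[OF w a(1), of "e/3" "{}"] e a(2) by auto
  define B where "B = (\<Sum>y\<in>S. norm (a y)) + 1"
  have B: "B > 0" unfolding B_def by (simp add: add_nonneg_pos sum_nonneg)
  obtain Z where Z: "finite Z" "\<And>z. \<exists>w\<in>Z. \<forall>y\<in>S. norm (iexp (z * y) - iexp (w * y)) \<le> e / 3 / B"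
    using characters_finite_net[OF S(1), of "e/3/B"] e B by auto
  show thesis
  proof (rule that[OF Z(1)])
    fix z
    obtain w where w': "w \<in> Z" "\<And>y. y \<in> S \<Longrightarrow> norm (iexp (z * y) - iexp (w * y)) \<le> e / 3 / B" using Z(2) by blast
    let ?Q = "\<lambda>z. \<Sum>y\<in>S. a y * iexp (z * y)"
    have "norm (P (t + z) - P (t + w)) \<le> e" for t
    proof -
      have "?Q (t + z) - ?Q (t + w) = (\<Sum>y\<in>S. a y * iexp (t * y) * (iexp (z * y) - iexp (w * y)))"
        unfolding sum_subtractf[symmetric] by (intro sum.cong) (auto simp: algebra_simps exp_add)
      also have "norm \<dots> \<le> (\<Sum>y\<in>S. norm (a y) * (e / 3 / B))"
      proof (rule sum_norm_le)
        fix y assume y: "y \<in> S"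
        have "norm (a y * iexp (t * y) * (iexp (z * y) - iexp (w * y))) = norm (a y) * norm (iexp (z * y) - iexp (w * y))"
          by (simp add: norm_mult)
        also have "\<dots> \<le> norm (a y) * (e / 3 / B)" by (intro mult_left_mono w'(2) y) simp
        finally show "norm (a y * iexp (t * y) * (iexp (z * y) - iexp (w * y))) \<le> norm (a y) * (e / 3 / B)" .
      qed
      also have "\<dots> = (B - 1) * (e / 3 / B)" unfolding sum_distrib_right[symmetric] by (simp add: B_def)
      also have "\<dots> \<le> B * (e / 3 / B)" using e B by (intro mult_right_mono) auto
      also have "\<dots> = e / 3" using B by simp
      finally have "norm (?Q (t + z) - ?Q (t + w)) \<le> e / 3" .
      moreover have "norm (P (t + z) - ?Q (t + z)) \<le> e / 3" "norm (P (t + w) - ?Q (t + w)) \<le> e / 3"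
        using D_rep_bound[OF w S(2)] by blast+
      ultimately show ?thesis by norm
    qed
    then show "\<exists>w\<in>Z. \<forall>t. norm (P (t + z) - P (t + w)) \<le> e" using w'(1) by blast
  qed
qed

text \<open>Pigeonhole over the multiples of \<open>L\<close>: two of them share a point of the
  finite net, and their difference is an almost period of size at least \<open>L\<close>.\<close>

lemma almost_period_exists:
  assumes w: "is_weight \<omega>" and P: "D_rep \<omega> P C" and e: "e > 0" and L: "L > 0"
  obtains \<tau> where "\<tau> \<ge> L" "\<And>t. norm (P (t + \<tau>) - P t) \<le> e"
proof -
  obtain Z where Z: "finite Z" "\<And>z. \<exists>w\<in>Z. \<forall>t. norm (P (t + z) - P (t + w)) \<le> e / 2"
    using almost_periodic_net[OF w P, of "e/2"] e by auto
  define r where "r n = (SOME w. w \<in> Z \<and> (\<forall>t. norm (P (t + real n * L) - P (t + w)) \<le> e / 2))" for n :: nat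
  have r: "r n \<in> Z" "\<And>t. norm (P (t + real n * L) - P (t + r n)) \<le> e / 2" for n
    using someI_ex[of "\<lambda>w. w \<in> Z \<and> (\<forall>t. norm (P (t + real n * L) - P (t + w)) \<le> e / 2)"] Z(2)[of "real n * L"]
    unfolding r_def by blast+
  have "\<not> inj r"
  proof
    assume "inj r"
    moreover have "finite (range r)" using r(1) Z(1) by (auto intro: finite_subset)
    ultimately show False using finite_imageD infinite_UNIV_nat by blast
  qed
  then obtain m n where mn: "r m = r n" "n < m" unfolding inj_def by (metis linorder_neqE_nat)
  show thesis
  proof (rule that)
    have "1 * L \<le> (real m - real n) * L" using mn L by (intro mult_right_mono) auto
    then show "L \<le> (real m - real n) * L" by simp
    fix t
    have e: "t - real n * L + real m * L = t + (real m - real n) * L" by (simp add: algebra_simps)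
    have "norm (P (t + (real m - real n) * L) - P (t - real n * L + r n)) \<le> e / 2"
      using r(2)[of "t - real n * L" m] unfolding mn(1) e .
    moreover have "norm (P t - P (t - real n * L + r n)) \<le> e / 2"
      using r(2)[of "t - real n * L" n] by simp
    ultimately show "norm (P (t + (real m - real n) * L) - P t) \<le> e"
      by norm
  qed
qed

text \<open>Large almost periods bring back every value of \<open>P\<close> at places where
  \<open>G\<close> is already negligible. Hence bounds on \<open>P + G\<close>, from above or from
  below, pass to \<open>P\<close>.\<close>

lemma D_rep_recurrence:
  assumes w: "is_weight \<omega>" and P: "D_rep \<omega> P C" and e: "e > 0" and G: "(G \<longlongrightarrow> 0) at_infinity"
  obtains z' where "norm (P z' - P z) \<le> e" "norm (G z' :: complex) \<le> e"
proof -
  have "\<forall>\<^sub>F z in at_infinity. dist (G z) 0 < e" using G e by (rule tendstoD)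
  then obtain B where B: "\<And>x. B \<le> norm x \<Longrightarrow> norm (G x) < e" by (auto simp: eventually_at_infinity)
  have "\<bar>B\<bar> + \<bar>z\<bar> + 1 > 0" by simp
  from almost_period_exists[OF w P e this]
  obtain \<tau> where "\<tau> \<ge> \<bar>B\<bar> + \<bar>z\<bar> + 1" "\<And>t. norm (P (t + \<tau>) - P t) \<le> e"
    by blast
  then show thesis using B[of "z + \<tau>"] by (intro that[of "z + \<tau>"]) (auto intro: less_imp_le)
qed

lemma D_rep_upper_bound:
  assumes w: "is_weight \<omega>" and P: "D_rep \<omega> P C" and G: "(G \<longlongrightarrow> 0) at_infinity"
    and S: "\<And>z. norm (P z + G z :: complex) \<le> S"
  shows "norm (P z) \<le> S"
proof (rule field_le_epsilon)
  fix e :: real assume "e > 0"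
  then obtain z' where "norm (P z' - P z) \<le> e/2" "norm (G z') \<le> e/2"
    using D_rep_recurrence[OF w P _ G, of "e/2" z] by auto
  then show "norm (P z) \<le> S + e" using S[of z'] by norm
qed

lemma D_rep_lower_bound:
  assumes w: "is_weight \<omega>" and P: "D_rep \<omega> P C" and G: "(G \<longlongrightarrow> 0) at_infinity"
    and S: "\<And>z. norm (P z + G z :: complex) \<ge> S"
  shows "norm (P z) \<ge> S"
proof (rule field_le_epsilon)
  fix e :: real assume "e > 0"
  then obtain z' where "norm (P z' - P z) \<le> e/2" "norm (G z') \<le> e/2"
    using D_rep_recurrence[OF w P _ G, of "e/2" z] by auto
  then show "S \<le> norm (P z) + e" using S[of z'] by norm
qed

lemma L_rep_tendsto_0:
  assumes w: "is_weight \<omega>" and G: "L_rep \<omega> G C"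
  shows "(G \<longlongrightarrow> 0) at_infinity"
  using G Riemann_Lebesgue[OF L1_weighted_integrable[OF w]] unfolding L_rep_def by blast

text \<open>Averages against a character along a progression isolate one coefficient, since the
  other frequencies of a truncation contribute bounded geometric sums. Step and length do not depend
  on the starting point \<open>s\<close>, as \<open>levy_khintchine_lower_bound\<close>
  requires.\<close>

lemma trig_series_mean:
  assumes a: "(\<lambda>y. norm (a y)) summable_on UNIV" and e: "e > 0"
  obtains h :: real and n :: nat where "h > 0" "n > 0"
    "\<And>s. norm ((\<Sum>k<n. trig_series UNIV a (s + real k * h) * iexp (- ((s + real k * h) * y0))) / n - a y0) \<le> e"
proof -
  obtain S where S: "finite S" "y0 \<in> S" "D_rep (\<lambda>_. 1) (\<lambda>z. trig_series UNIV a z - (\<Sum>y\<in>S. a y * iexp (z * y))) (e / 2)"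
    using D_rep_truncate[OF weight_one, of a "e/2" "{y0}"] a e by auto
  \<comment> \<open>So small that \<open>h * (y - y0)\<close> is less than 1 in modulus, hence below
    \<open>2 * pi\<close>, for all frequencies kept: no two of them are aliased and every ratio
    \<open>q y\<close> with \<open>y \<noteq> y0\<close> differs from 1.\<close>
  define h where "h = 1 / (1 + (\<Sum>y\<in>S. \<bar>y - y0\<bar>))"
  have den: "1 + (\<Sum>y\<in>S. \<bar>y - y0\<bar>) > 0" by (simp add: add_pos_nonneg sum_nonneg)
  have h: "h > 0" unfolding h_def using den by simp
  define q where "q y = iexp (h * (y - y0))" for y
  have q: "q y \<noteq> 1" if y: "y \<in> S" "y \<noteq> y0" for y
  proof
    assume "q y = 1"
    then obtain n :: int where n: "h * (y - y0) = of_int (2 * n) * pi"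
      unfolding q_def exp_eq_1 by auto
    have "\<bar>y - y0\<bar> \<le> (\<Sum>y\<in>S. \<bar>y - y0\<bar>)" by (rule member_le_sum) (use y S in auto)
    then have "\<bar>h * (y - y0)\<bar> < 1" using den by (simp add: h_def abs_mult)
    then have lt: "\<bar>of_int n\<bar> * (2 * pi) < 1" unfolding n by (simp add: abs_mult mult_ac)
    have "n = 0"
    proof (rule ccontr)
      assume "n \<noteq> 0"
      then have "1 \<le> \<bar>of_int n :: real\<bar>" by linarith
      then have "1 * (2 * pi) \<le> \<bar>of_int n\<bar> * (2 * pi)" by (intro mult_right_mono) auto
      then show False using lt pi_gt3 by linarith
    qed
    then show False using n h y by auto
  qed
  have nq: "norm (q y) = 1" for y by (simp add: q_def)
  \<comment> \<open>Bounds all the geometric sums together, uniformly in their length; division by a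
    large \<open>n\<close> makes it small.\<close>
  define B where "B = (\<Sum>y\<in>S - {y0}. norm (a y) * (2 / norm (1 - q y)))"
  obtain n :: nat where n: "2 * B / e < real n" using reals_Archimedean2 by blast
  have B0: "B \<ge> 0" unfolding B_def by (intro sum_nonneg) auto
  have n0: "n > 0" using n B0 e by (metis divide_nonneg_pos mult_nonneg_nonneg not_gr_zero of_nat_0 not_less zero_le_numeral)
  have gs: "norm (\<Sum>k<n. q y ^ k) \<le> 2 / norm (1 - q y)" if "y \<in> S - {y0}" for y
  proof -
    have "(\<Sum>k<n. q y ^ k) = (1 - q y ^ n) / (1 - q y)"
      using q[of y] that by (simp add: sum_gp_strict)
    moreover have "norm (1 - q y ^ n) \<le> 2"
      using norm_triangle_ineq4[of 1 "q y ^ n"] by (simp add: norm_power nq)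
    ultimately show ?thesis by (simp add: norm_divide divide_right_mono)
  qed
  show thesis
  proof (rule that[OF h n0])
    fix s
    let ?c = "\<lambda>k. s + real k * h"
    define Q where "Q z = (\<Sum>y\<in>S. a y * iexp (z * y))" for z
    have "(\<Sum>k<n. Q (?c k) * iexp (- (?c k * y0))) = (\<Sum>y\<in>S. a y * iexp (s * (y - y0)) * (\<Sum>k<n. q y ^ k))"
    proof -
      have "Q (?c k) * iexp (- (?c k * y0)) = (\<Sum>y\<in>S. a y * iexp (s * (y - y0)) * q y ^ k)" for k
      proof -
        have "iexp (?c k * y) * iexp (- (?c k * y0)) = iexp (s * (y - y0)) * q y ^ k" for y
        proof -
          have "q y ^ k = iexp (real k * (h * (y - y0)))"
            unfolding q_def by (simp add: exp_of_nat_mult[symmetric] mult_ac)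
          moreover have "iexp (?c k * y) * iexp (- (?c k * y0)) = iexp (?c k * y + (- (?c k * y0)))"
            by (simp add: exp_add[symmetric] algebra_simps)
          moreover have "?c k * y + (- (?c k * y0)) = s * (y - y0) + real k * (h * (y - y0))" by (simp add: algebra_simps)
          moreover have "iexp (s * (y - y0) + real k * (h * (y - y0))) = iexp (s * (y - y0)) * iexp (real k * (h * (y - y0)))"
            by (simp only: of_real_add ring_distribs exp_add)
          ultimately show ?thesis by metis
        qed
        then show ?thesis unfolding Q_def sum_distrib_right by (simp add: mult.assoc)
      qed
      then have "(\<Sum>k<n. Q (?c k) * iexp (- (?c k * y0))) = (\<Sum>k<n. \<Sum>y\<in>S. a y * iexp (s * (y - y0)) * q y ^ k)" by simp
      also have "\<dots> = (\<Sum>y\<in>S. \<Sum>k<n. a y * iexp (s * (y - y0)) * q y ^ k)" by (rule sum.swap)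
      finally show ?thesis by (simp only: sum_distrib_left)
    qed
    also have "\<dots> = a y0 * n + (\<Sum>y\<in>S - {y0}. a y * iexp (s * (y - y0)) * (\<Sum>k<n. q y ^ k))"
      using S by (subst sum.remove[OF S(1,2)]) (simp add: q_def)
    finally have e1: "(\<Sum>k<n. Q (?c k) * iexp (- (?c k * y0))) / n - a y0 = (\<Sum>y\<in>S - {y0}. a y * iexp (s * (y - y0)) * (\<Sum>k<n. q y ^ k)) / n"
      using n0 by (simp add: field_simps)
    have "norm (\<Sum>y\<in>S - {y0}. a y * iexp (s * (y - y0)) * (\<Sum>k<n. q y ^ k)) \<le> B"
      unfolding B_def
    proof (rule sum_norm_le)
      fix y assume y: "y \<in> S - {y0}"
      have "norm (a y * iexp (s * (y - y0)) * (\<Sum>k<n. q y ^ k)) = norm (a y) * norm (\<Sum>k<n. q y ^ k)" by (simp add: norm_mult)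
      also have "\<dots> \<le> norm (a y) * (2 / norm (1 - q y))" by (intro mult_left_mono gs y) auto
      finally show "norm (a y * iexp (s * (y - y0)) * (\<Sum>k<n. q y ^ k)) \<le> norm (a y) * (2 / norm (1 - q y))" .
    qed
    then have "norm ((\<Sum>y\<in>S - {y0}. a y * iexp (s * (y - y0)) * (\<Sum>k<n. q y ^ k)) / n) \<le> B / n"
      by (simp add: norm_divide divide_right_mono)
    also have "\<dots> \<le> e / 2" using n n0 e by (simp add: field_simps)
    finally have 1: "norm ((\<Sum>k<n. Q (?c k) * iexp (- (?c k * y0))) / n - a y0) \<le> e / 2" unfolding e1 .
    have "norm ((\<Sum>k<n. trig_series UNIV a (?c k) * iexp (- (?c k * y0))) - (\<Sum>k<n. Q (?c k) * iexp (- (?c k * y0)))) \<le> (\<Sum>k<n. e / 2)"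
      unfolding sum_subtractf[symmetric]
    proof (rule sum_norm_le)
      fix k assume "k \<in> {..<n}"
      have "norm (trig_series UNIV a (?c k) - Q (?c k)) \<le> e / 2"
        unfolding Q_def using D_rep_bound[OF weight_one S(3)] .
      then show "norm (trig_series UNIV a (?c k) * iexp (- (?c k * y0)) - Q (?c k) * iexp (- (?c k * y0))) \<le> e / 2"
        by (simp add: norm_mult flip: left_diff_distrib)
    qed
    then have "norm (((\<Sum>k<n. trig_series UNIV a (?c k) * iexp (- (?c k * y0))) - (\<Sum>k<n. Q (?c k) * iexp (- (?c k * y0)))) / n) \<le> e / 2"
      using n0 by (simp add: norm_divide field_simps)
    then have "norm ((\<Sum>k<n. trig_series UNIV a (?c k) * iexp (- (?c k * y0))) / n - (\<Sum>k<n. Q (?c k) * iexp (- (?c k * y0))) / n) \<le> e / 2"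
      by (simp add: diff_divide_distrib)
    from norm_diff_triangle_le[OF this 1]
    show "norm ((\<Sum>k<n. trig_series UNIV a (?c k) * iexp (- (?c k * y0))) / n - a y0) \<le> e" by simp
  qed
qed

text \<open>A mean of the function against a character cannot exceed its supremum.\<close>

lemma trig_series_coeff_bound:
  assumes a: "(\<lambda>y. norm (a y)) summable_on UNIV" and S: "\<And>z. norm (trig_series UNIV a z) \<le> S"
  shows "norm (a y) \<le> S"
proof (rule field_le_epsilon)
  fix e :: real assume "e > 0"
  obtain h :: real and n :: nat where hn: "h > 0" "n > 0"
    "\<And>s. norm ((\<Sum>k<n. trig_series UNIV a (s + real k * h) * iexp (- ((s + real k * h) * y))) / n - a y) \<le> e"
    by (rule trig_series_mean[OF a \<open>e > 0\<close>, of y]) (rule that)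
  let ?M = "(\<Sum>k<n. trig_series UNIV a (0 + real k * h) * iexp (- ((0 + real k * h) * y)))"
  have "norm ?M \<le> (\<Sum>k<n. S)"
    by (rule sum_norm_le) (use S in \<open>simp add: norm_mult\<close>)
  then have "norm (?M / n) \<le> S" using hn(2) by (simp add: norm_divide field_simps)
  then show "norm (a y) \<le> S + e" using hn(3)[of 0] by norm
qed

text \<open>Recurrence separates the parts: the almost periodic part is bounded by the supremum of
  the sum, which is 0. Then means read off its coefficients and inversion determines the
  density.\<close>

theorem fourier_representation_unique:
  assumes a: "(\<lambda>y. norm (a y)) summable_on UNIV" and g: "integrable lborel g"
    and 0: "\<And>z. trig_series UNIV a z + fourier g z = 0"
  shows "a y = 0" and "AE x in lborel. g x = 0"
proof -
  have D: "D_rep (\<lambda>_. 1) (trig_series UNIV a) (\<Sum>\<^sub>\<infinity>y. norm (a y))"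
    unfolding D_rep_def using a by auto
  have P0: "norm (trig_series UNIV a z) \<le> 0" for z
    by (rule D_rep_upper_bound[OF weight_one D Riemann_Lebesgue[OF g]]) (simp add: 0)
  show "a y = 0" using trig_series_coeff_bound[OF a P0, of y] by simp
  have "fourier g z = 0" for z using 0[of z] P0[of z] by simp
  then show "AE x in lborel. g x = 0" by (rule fourier_eq_0_imp_AE[OF g])
qed

section \<open>The spectral radius and Wiener's theorem\<close>

text \<open>Far out the GRS condition gives the pure exponential; the constant \<open>C\<close> pays
  for the remaining compact interval, where the weight is bounded.\<close>

lemma GRS_exp_bound:
  assumes w: "is_weight \<omega>" and G: "GRS \<omega>" and k: "\<kappa> > 0"
  obtains C where "C \<ge> 1" "\<And>t. \<omega> t \<le> C * exp (\<kappa> * \<bar>t\<bar>)"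
proof -
  have "\<forall>\<^sub>F x in at_infinity. dist (ln (\<omega> x) / x) 0 < \<kappa>"
    using G k unfolding GRS_def by (rule tendstoD)
  then obtain B where B: "\<And>x. B \<le> \<bar>x\<bar> \<Longrightarrow> \<bar>ln (\<omega> x) / x\<bar> < \<kappa>" by (auto simp: eventually_at_infinity)
  define B' where "B' = \<bar>B\<bar> + 1"
  have large: "\<omega> x \<le> exp (\<kappa> * \<bar>x\<bar>)" if "B' \<le> \<bar>x\<bar>" for x
  proof -
    have x: "\<bar>x\<bar> > 0" "B \<le> \<bar>x\<bar>" using that by (auto simp: B'_def)
    have "\<bar>ln (\<omega> x)\<bar> / \<bar>x\<bar> < \<kappa>" using B[OF x(2)] by simp
    then have "ln (\<omega> x) < \<kappa> * \<bar>x\<bar>" using x(1) by (simp add: field_simps)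
    then have "exp (ln (\<omega> x)) \<le> exp (\<kappa> * \<bar>x\<bar>)" by simp
    then show ?thesis using weight_pos[OF w, of x] by simp
  qed
  have "bounded (\<omega> ` {-B'..B'})" using w unfolding is_weight_def by auto
  then obtain M where "\<forall>y\<in>\<omega> ` {-B'..B'}. norm y \<le> M" unfolding bounded_iff by blast
  then have M: "\<bar>\<omega> x\<bar> \<le> M" if "x \<in> {-B'..B'}" for x using that by auto
  show thesis
  proof (rule that[of "max 1 M"])
    fix t
    show "\<omega> t \<le> max 1 M * exp (\<kappa> * \<bar>t\<bar>)"
    proof (cases "B' \<le> \<bar>t\<bar>")
      case True
      have "1 * exp (\<kappa> * \<bar>t\<bar>) \<le> max 1 M * exp (\<kappa> * \<bar>t\<bar>)" by (rule mult_right_mono) auto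
      then show ?thesis using large[OF True] by linarith
    next
      case False
      then have "\<bar>\<omega> t\<bar> \<le> M" by (intro M) auto
      then have "\<omega> t \<le> max 1 M * 1" by simp
      also have "\<dots> \<le> max 1 M * exp (\<kappa> * \<bar>t\<bar>)" using k by (intro mult_left_mono) auto
      finally show ?thesis .
    qed
  qed simp
qed

lemma weight_exp: "\<kappa> \<ge> 0 \<Longrightarrow> is_weight (\<lambda>t. exp (\<kappa> * \<bar>t\<bar>))"
  unfolding is_weight_def
proof (intro conjI allI impI)
  assume k: "\<kappa> \<ge> 0"
  show "(\<lambda>t. exp (\<kappa> * \<bar>t\<bar>)) \<in> borel_measurable borel" by measurable
  show "bounded ((\<lambda>t. exp (\<kappa> * \<bar>t\<bar>)) ` K)" if "compact K" for K
    by (intro compact_imp_bounded compact_continuous_image that continuous_intros)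
  show "1 \<le> exp (\<kappa> * \<bar>x\<bar>)" for x using k by simp
  show "exp (\<kappa> * \<bar>x + y\<bar>) \<le> exp (\<kappa> * \<bar>x\<bar>) * exp (\<kappa> * \<bar>y\<bar>)" for x y
    unfolding exp_add[symmetric] using mult_left_mono[OF abs_triangle_ineq k, of x y] by (simp add: ring_distribs)
qed

section \<open>Truncation to finitely many atoms and a bounded density of compact support\<close>

lemma L1_weighted_bounded_support:
  assumes w: "is_weight \<omega>" and [measurable]: "f \<in> borel_measurable borel"
    and b: "\<And>x. norm (f x) \<le> N" and s: "\<And>x. N < \<bar>x\<bar> \<Longrightarrow> f x = 0"
  shows "f \<in> L1_weighted \<omega>"
proof -
  have "bounded (\<omega> ` {-N..N})" using w unfolding is_weight_def by auto
  then obtain M where "\<forall>y\<in>\<omega> ` {-N..N}. norm y \<le> M" unfolding bounded_iff by blast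
  then have M: "\<bar>\<omega> x\<bar> \<le> M" if "x \<in> {-N..N}" for x using that by auto
  have [measurable]: "\<omega> \<in> borel_measurable borel" by (rule weight_measurable[OF w])
  have "integrable lborel (\<lambda>x. indicator {-N..N} x * (M * N))"
    by (intro integrable_mult_left integrable_real_indicator) (auto simp: emeasure_lborel_Icc_eq)
  then have "integrable lborel (\<lambda>x. \<omega> x * norm (f x))"
  proof (rule Bochner_Integration.integrable_bound, measurable, intro AE_I2)
    fix x
    show "norm (\<omega> x * norm (f x)) \<le> norm (indicator {-N..N} x * (M * N))"
    proof (cases "x \<in> {-N..N}")
      case True
      have "\<bar>\<omega> x\<bar> * norm (f x) \<le> M * N" using M[OF True] b[of x] by (intro mult_mono) auto
      then have "\<bar>\<omega> x\<bar> * norm (f x) \<le> \<bar>M * N\<bar>" by linarith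
      then show ?thesis using True by (simp add: abs_mult)
    next
      case False
      then have "f x = 0" by (intro s) auto
      then show ?thesis by simp
    qed
  qed
  then show ?thesis by (simp add: L1_weighted_def)
qed

lemma L_rep_of_L1_weighted:
  "f \<in> L1_weighted \<omega> \<Longrightarrow> L_rep \<omega> (fourier f) (LINT x|lborel. \<omega> x * norm (f x))"
  unfolding L_rep_def by auto

lemma L_rep_truncate:
  assumes w: "is_weight \<omega>" and G: "L_rep \<omega> G C" and e: "e > 0"
  obtains f N where "f \<in> borel_measurable borel" "\<And>x. norm (f x) \<le> N" "\<And>x. N < \<bar>x\<bar> \<Longrightarrow> f x = 0"
    "L_rep \<omega> (\<lambda>z. G z - fourier f z) e"
proof -
  obtain g where g: "g \<in> L1_weighted \<omega>" "G = fourier g"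
    using G unfolding L_rep_def by blast
  have [measurable]: "g \<in> borel_measurable borel" using g(1) by (simp add: L1_weighted_def)
  obtain n :: nat where n: "(LINT x|lborel. \<omega> x * norm (g x - (if \<bar>x\<bar> \<le> n \<and> norm (g x) \<le> n then g x else 0))) \<le> e"
    by (rule L1_weighted_truncate[OF w g(1) e])
  define f :: "real \<Rightarrow> complex" where "f x = (if \<bar>x\<bar> \<le> n \<and> norm (g x) \<le> n then g x else 0)" for x
  have fm[measurable]: "f \<in> borel_measurable borel" unfolding f_def by measurable
  have fb: "norm (f x) \<le> real n" "real n < \<bar>x\<bar> \<Longrightarrow> f x = 0" for x by (auto simp: f_def)
  have fL: "f \<in> L1_weighted \<omega>" by (rule L1_weighted_bounded_support[OF w fm fb])
  have gi: "integrable lborel g" "integrable lborel f"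
    by (rule L1_weighted_integrable[OF w g(1)], rule L1_weighted_integrable[OF w fL])
  have [measurable]: "\<omega> \<in> borel_measurable borel" by (rule weight_measurable[OF w])
  have "integrable lborel (\<lambda>x. \<omega> x * norm (g x))" using g(1) by (simp add: L1_weighted_def)
  then have "integrable lborel (\<lambda>x. \<omega> x * norm (g x - f x))"
    by (rule Bochner_Integration.integrable_bound)
       (use weight_nonneg[OF w] in \<open>auto simp: f_def\<close>)
  then have "(\<lambda>x. g x - f x) \<in> L1_weighted \<omega>" by (simp add: L1_weighted_def)
  from L_rep_of_L1_weighted[OF this] n
  have "L_rep \<omega> (fourier (\<lambda>x. g x - f x)) e" unfolding f_def by (rule L_rep_mono)
  moreover have "fourier (\<lambda>x. g x - f x) = (\<lambda>z. G z - fourier f z)"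
    unfolding g(2) using fourier_diff[OF gi] by auto
  ultimately have "L_rep \<omega> (\<lambda>z. G z - fourier f z) e" by simp
  with fm fb show thesis by (rule that[of f "real n"])
qed

lemma D_rep_finite:
  assumes w: "is_weight \<omega>" and S: "finite S"
  shows "D_rep \<omega> (\<lambda>z. \<Sum>y\<in>S. a y * iexp (z * y)) (\<Sum>y\<in>S. \<omega> y * norm (a y))"
  using S
proof (induction S rule: finite_induct)
  case empty
  then show ?case by (simp add: D_rep_zero)
next
  case (insert x F)
  then show ?case using D_rep_add[OF w D_rep_atom insert.IH] by simp
qed

lemma R_rep_truncate:
  assumes w: "is_weight \<omega>" and F: "R_rep \<omega> F C" and e: "e > 0"
  obtains S a f N where "finite S" "f \<in> borel_measurable borel" "\<And>x. norm (f x) \<le> N" "\<And>x. N < \<bar>x\<bar> \<Longrightarrow> f x = 0"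
    "R_rep \<omega> (\<lambda>z. F z - ((\<Sum>y\<in>S. a y * iexp (z * y)) + fourier f z)) e"
proof -
  obtain P G p q where *: "D_rep \<omega> P p" "L_rep \<omega> G q" "F = (\<lambda>z. P z + G z)"
    using F unfolding R_rep_def by metis
  obtain f N where f: "f \<in> borel_measurable borel" "\<And>x. norm (f x) \<le> N" "\<And>x. N < \<bar>x\<bar> \<Longrightarrow> f x = 0"
    "L_rep \<omega> (\<lambda>z. G z - fourier f z) (e/2)"
    using L_rep_truncate[OF w *(2), of "e/2"] e half_gt_zero[OF e] by metis
  obtain a where a: "(\<lambda>y. \<omega> y * norm (a y)) summable_on UNIV" "P = trig_series UNIV a"
    using *(1) unfolding D_rep_def by blast
  obtain S where S: "finite S" "D_rep \<omega> (\<lambda>z. P z - (\<Sum>y\<in>S. a y * iexp (z * y))) (e / 2)"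
    using D_rep_truncate[OF w a(1), of "e/2" "{}"] e a(2) by auto
  have "R_rep \<omega> (\<lambda>z. (P z - (\<Sum>y\<in>S. a y * iexp (z * y))) + (G z - fourier f z)) (e/2 + e/2)"
    by (rule R_rep_add[OF w R_rep_D[OF S(2)] R_rep_L[OF f(4)]])
  then have "R_rep \<omega> (\<lambda>z. F z - ((\<Sum>y\<in>S. a y * iexp (z * y)) + fourier f z)) e"
    by (simp add: *(3) algebra_simps)
  with S(1) f(1-3) show thesis by (rule that)
qed

section \<open>Growth of powers\<close>

lemma R_rep_power:
  assumes w: "is_weight \<omega>" and F: "R_rep \<omega> F C"
  shows "R_rep \<omega> (\<lambda>z. F z ^ n) (\<omega> 0 * C ^ n)"
proof (induction n)
  case 0
  then show ?case using R_rep_const[of \<omega> 1] by simp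
next
  case (Suc n)
  then show ?case using R_rep_mult[OF w F Suc.IH] by (simp add: mult_ac)
qed

lemma R_rep_sum:
  assumes w: "is_weight \<omega>" and "finite I" "\<And>i. i \<in> I \<Longrightarrow> R_rep \<omega> (F i) (C i)"
  shows "R_rep \<omega> (\<lambda>z. \<Sum>i\<in>I. F i z) (\<Sum>i\<in>I. C i)"
  using assms(2,3)
proof (induction I rule: finite_induct)
  case empty
  then show ?case by (simp add: R_rep_D[OF D_rep_zero])
next
  case (insert x I)
  then show ?case using R_rep_add[OF w insert.prems(1)[of x] insert.IH] by simp
qed

lemma poly_le_exp:
  fixes q :: real
  assumes q: "q > 1"
  obtains K where "K \<ge> 0" "\<And>n. (real n + 1) ^ k \<le> K * q ^ n"
proof -
  \<comment> \<open>Bernoulli's inequality bounds \<open>real n + 1\<close> by a multiple of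
    \<open>r ^ n\<close>; the power \<open>k\<close> of this is at most a multiple of
    \<open>q ^ n\<close>. The root of order \<open>Suc k\<close> also covers
    \<open>k = 0\<close>.\<close>
  define r where "r = root (Suc k) q"
  have r: "r > 1" using q unfolding r_def by simp
  have rq: "r ^ Suc k = q" unfolding r_def using q by (intro real_root_pow_pos2) auto
  define K where "K = max 1 (1 / (r - 1))"
  have K: "K \<ge> 1" by (simp add: K_def)
  have b: "real n + 1 \<le> K * r ^ n" for n
  proof -
    have B: "1 + real n * (r - 1) \<le> r ^ n"
      using Bernoulli_inequality[of "r - 1" n] r by simp
    have "1 \<le> K * (r - 1)"
      using r mult_right_mono[of "1 / (r - 1)" K "r - 1"] by (simp add: K_def)
    then have "real n * 1 \<le> real n * (K * (r - 1))" by (intro mult_left_mono) auto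
    then have "real n + 1 \<le> K * (1 + real n * (r - 1))"
      using K by (simp add: algebra_simps)
    also have "\<dots> \<le> K * r ^ n" using B K by (intro mult_left_mono) auto
    finally show ?thesis .
  qed
  have "(real n + 1) ^ k \<le> K ^ k * q ^ n" for n
  proof -
    have "(real n + 1) ^ k \<le> (K * r ^ n) ^ k" by (intro power_mono b) simp
    also have "\<dots> = K ^ k * (r ^ k) ^ n" by (simp add: power_mult_distrib power_mult[symmetric] mult.commute)
    also have "\<dots> \<le> K ^ k * (r ^ Suc k) ^ n"
      using r K by (intro mult_left_mono power_mono power_increasing) auto
    finally show ?thesis by (simp add: rq del: power_Suc)
  qed
  then show thesis using K by (intro that[of "K ^ k"]) auto
qed

lemma poly_times_exp_le:
  fixes a b :: real
  assumes a: "0 < a" "a < b"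
  obtains K where "K \<ge> 0" "\<And>n. (real n + 1) ^ k * a ^ n \<le> K * b ^ n"
proof -
  obtain K where K: "K \<ge> 0" "\<And>n. (real n + 1) ^ k \<le> K * (b / a) ^ n"
    using poly_le_exp[of "b/a" k] a by auto
  show thesis
  proof (rule that[OF K(1)])
    fix n
    have "(real n + 1) ^ k * a ^ n \<le> K * (b / a) ^ n * a ^ n" using a by (intro mult_right_mono K) auto
    then show "(real n + 1) ^ k * a ^ n \<le> K * b ^ n" using a by (simp add: power_divide)
  qed
qed

lemma trig_polynomial_power_support:
  fixes S :: "real set"
  assumes S: "finite S"
  shows "\<exists>T c. finite T \<and> card T \<le> (n + 1) ^ card S \<and> (\<forall>t\<in>T. \<bar>t\<bar> \<le> real n * (\<Sum>y\<in>S. \<bar>y\<bar>)) \<and>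
    (\<forall>z. (\<Sum>y\<in>S. a y * iexp (z * y)) ^ n = (\<Sum>t\<in>T. c t * iexp (z * t)))"
proof -
  \<comment> \<open>Exponents range over the whole box \<open>{0..n}\<close> for each frequency, not
    only over those with sum \<open>n\<close>: the count remains polynomial in \<open>n\<close>, and
    multiplication by one more character stays inside the next box.\<close>
  define T where "T n = (\<lambda>m. \<Sum>y\<in>S. real (m y) * y) ` (S \<rightarrow>\<^sub>E {0..n})" for n :: nat
  have T: "finite (T n)" for n unfolding T_def by (intro finite_imageI finite_PiE S) auto
  have cT: "card (T n) \<le> (n + 1) ^ card S" for n
  proof -
    have "card (T n) \<le> card (S \<rightarrow>\<^sub>E {0..n})" unfolding T_def by (intro card_image_le finite_PiE S) auto
    also have "\<dots> = (n + 1) ^ card S" using S by (simp add: card_PiE)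
    finally show ?thesis .
  qed
  have bT: "\<bar>t\<bar> \<le> real n * (\<Sum>y\<in>S. \<bar>y\<bar>)" if "t \<in> T n" for t n
  proof -
    obtain m where m: "m \<in> S \<rightarrow>\<^sub>E {0..n}" "t = (\<Sum>y\<in>S. real (m y) * y)" using \<open>t \<in> T n\<close> unfolding T_def by auto
    have "\<bar>t\<bar> \<le> (\<Sum>y\<in>S. \<bar>real (m y) * y\<bar>)" unfolding m(2) by (rule sum_abs)
    also have "\<dots> \<le> (\<Sum>y\<in>S. real n * \<bar>y\<bar>)"
      using m(1) by (intro sum_mono) (auto simp: abs_mult PiE_def intro!: mult_right_mono)
    finally show ?thesis by (simp add: sum_distrib_left)
  qed
  have addT: "t + y \<in> T (Suc n)" if "t \<in> T n" "y \<in> S" for t y n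
  proof -
    obtain m where m: "m \<in> S \<rightarrow>\<^sub>E {0..n}" "t = (\<Sum>y\<in>S. real (m y) * y)" using \<open>t \<in> T n\<close> unfolding T_def by auto
    let ?m = "m(y := Suc (m y))"
    have "?m \<in> S \<rightarrow>\<^sub>E {0..Suc n}"
      using m(1) \<open>y \<in> S\<close> by (auto simp: PiE_def Pi_def extensional_def le_Suc_eq)
    moreover have "(\<Sum>x\<in>S. real (?m x) * x) = t + y"
    proof -
      have "(\<Sum>x\<in>S. real (?m x) * x) = (\<Sum>x\<in>S. real (m x) * x + (if x = y then y else 0))"
        by (intro sum.cong) (auto simp: algebra_simps)
      then show ?thesis using S \<open>y \<in> S\<close> by (simp add: sum.distrib m(2))
    qed
    ultimately show ?thesis unfolding T_def by (intro image_eqI[of _ _ ?m]) simp_all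
  qed
  have "\<exists>c. \<forall>z. (\<Sum>y\<in>S. a y * iexp (z * y)) ^ n = (\<Sum>t\<in>T n. c t * iexp (z * t))"
  proof (induction n)
    case 0
    have "T 0 = {0}"
    proof -
      have "(S \<rightarrow>\<^sub>E {0..0::nat}) = {\<lambda>y\<in>S. 0}" by (auto simp: PiE_eq_singleton)
      then show ?thesis unfolding T_def by simp
    qed
    then show ?case by (intro exI[of _ "\<lambda>_. 1"]) simp
  next
    case (Suc n)
    then obtain c where c: "\<And>z. (\<Sum>y\<in>S. a y * iexp (z * y)) ^ n = (\<Sum>t\<in>T n. c t * iexp (z * t))" by blast
    define g where "g p = snd p + fst p" for p :: "real \<times> real"
    \<comment> \<open>Different pairs of old frequencies may have the same sum, so their
      coefficients are collected over the fibres of \<open>g\<close>.\<close>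
    define c' where "c' u = (\<Sum>p\<in>{p \<in> S \<times> T n. g p = u}. a (fst p) * c (snd p))" for u
    have "(\<Sum>y\<in>S. a y * iexp (z * y)) ^ Suc n = (\<Sum>t\<in>T (Suc n). c' t * iexp (z * t))" for z
    proof -
      have "(\<Sum>y\<in>S. a y * iexp (z * y)) ^ Suc n = (\<Sum>y\<in>S. a y * iexp (z * y)) * (\<Sum>t\<in>T n. c t * iexp (z * t))"
        by (simp only: power_Suc c)
      also have "\<dots> = (\<Sum>y\<in>S. \<Sum>t\<in>T n. a y * iexp (z * y) * (c t * iexp (z * t)))" by (rule sum_product)
      also have "\<dots> = (\<Sum>p\<in>S \<times> T n. a (fst p) * c (snd p) * iexp (z * g p))"
        unfolding sum.cartesian_product
        by (intro sum.cong) (auto simp: g_def ring_distribs exp_add mult_ac)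
      also have "\<dots> = (\<Sum>u\<in>T (Suc n). \<Sum>p\<in>{p \<in> S \<times> T n. g p = u}. a (fst p) * c (snd p) * iexp (z * g p))"
        by (rule sum.group[symmetric]) (use S T addT in \<open>auto simp: g_def\<close>)
      also have "\<dots> = (\<Sum>u\<in>T (Suc n). c' u * iexp (z * u))"
        unfolding c'_def sum_distrib_right by (intro sum.cong) auto
      finally show ?thesis .
    qed
    then show ?case by blast
  qed
  then obtain c where "\<And>z. (\<Sum>y\<in>S. a y * iexp (z * y)) ^ n = (\<Sum>t\<in>T n. c t * iexp (z * t))" by blast
  then show ?thesis using T[of n] cT[of n] bT[of _ n] by blast
qed

text \<open>Every coefficient of the power is at most \<open>M ^ n\<close>, being bounded by the
  supremum; there are polynomially many, at frequencies of size proportional to \<open>n\<close>,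
  where the weight grows as slowly as desired.\<close>

lemma trig_polynomial_power_bound:
  assumes w: "is_weight \<omega>" and G: "GRS \<omega>" and S: "finite S"
    and d: "\<And>z. norm (\<Sum>y\<in>S. a y * iexp (z * y)) \<le> M" and M: "0 < M" "M < s"
  obtains K where "K \<ge> 0" "\<And>n. D_rep \<omega> (\<lambda>z. (\<Sum>y\<in>S. a y * iexp (z * y)) ^ n) (K * s ^ n)"
proof -
  define \<rho> where "\<rho> = (\<Sum>y\<in>S. \<bar>y\<bar>) + 1"
  have \<rho>: "\<rho> > 0" unfolding \<rho>_def by (simp add: add_nonneg_pos sum_nonneg)
  define s1 where "s1 = (M + s) / 2"
  have s1: "M < s1" "s1 < s" "0 < s1" using M by (auto simp: s1_def)
  \<comment> \<open>Chosen so that over frequencies up to \<open>\<rho> * n\<close> the weight costs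
    at most a multiple of \<open>(s1 / M) ^ n\<close>. The gap between \<open>s1\<close> and
    \<open>s\<close> is kept for the polynomial number of frequencies.\<close>
  define \<kappa> where "\<kappa> = ln (s1 / M) / \<rho>"
  have \<kappa>: "\<kappa> > 0" using s1 M \<rho> by (simp add: \<kappa>_def)
  have \<kappa>\<rho>: "exp (\<kappa> * \<rho>) = s1 / M" using \<rho> s1 M by (simp add: \<kappa>_def)
  obtain C where C: "C \<ge> 1" "\<And>t. \<omega> t \<le> C * exp (\<kappa> * \<bar>t\<bar>)" using GRS_exp_bound[OF w G \<kappa>] by blast
  obtain K where K: "K \<ge> 0" "\<And>n. (real n + 1) ^ card S * s1 ^ n \<le> K * s ^ n"
    by (rule poly_times_exp_le[OF s1(3,2), of "card S"]) (rule that)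
  show thesis
  proof (rule that[of "C * K"])
    show "0 \<le> C * K" using C K by simp
    fix n
    obtain T c where T: "finite T" "card T \<le> (n + 1) ^ card S" "\<And>t. t\<in>T \<Longrightarrow> \<bar>t\<bar> \<le> real n * (\<Sum>y\<in>S. \<bar>y\<bar>)"
      and eq: "\<And>z. (\<Sum>y\<in>S. a y * iexp (z * y)) ^ n = (\<Sum>t\<in>T. c t * iexp (z * t))"
      using trig_polynomial_power_support[OF S, of n a] by blast
    have cb: "norm (c t) \<le> M ^ n" if "t \<in> T" for t
    proof -
      have "norm (if t \<in> T then c t else 0) \<le> M ^ n"
      proof (rule trig_series_coeff_bound)
        show "(\<lambda>y. norm (if y \<in> T then c y else 0)) summable_on UNIV"
          by (rule summable_on_cong_neutral[THEN iffD1, rotated 3, OF summable_on_finite[OF T(1), of "\<lambda>y. norm (c y)"]]) auto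
        show "norm (trig_series UNIV (\<lambda>y. if y \<in> T then c y else 0) z) \<le> M ^ n" for z
          unfolding trig_series_finite_support[OF T(1)] eq[symmetric] norm_power by (intro power_mono d) simp
      qed
      then show ?thesis using that by simp
    qed
    have "(\<Sum>t\<in>T. \<omega> t * norm (c t)) \<le> (\<Sum>t\<in>T. C * (s1 / M) ^ n * M ^ n)"
    proof (intro sum_mono mult_mono cb)
      fix t assume t: "t \<in> T"
      have "\<bar>t\<bar> \<le> real n * \<rho>" using T(3)[OF t] mult_left_mono[of "\<Sum>y\<in>S. \<bar>y\<bar>" \<rho> "real n"] by (simp add: \<rho>_def)
      then have "\<kappa> * \<bar>t\<bar> \<le> real n * (\<kappa> * \<rho>)" using \<kappa> mult_left_mono[of "\<bar>t\<bar>" "real n * \<rho>" \<kappa>] by (simp add: mult_ac)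
      then have "exp (\<kappa> * \<bar>t\<bar>) \<le> (s1 / M) ^ n" using \<kappa>\<rho> by (simp add: exp_of_nat_mult[symmetric] flip: \<kappa>\<rho>)
      then have "C * exp (\<kappa> * \<bar>t\<bar>) \<le> C * (s1 / M) ^ n" using C(1) by (intro mult_left_mono) auto
      then show "\<omega> t \<le> C * (s1 / M) ^ n" using C(2)[of t] by linarith
    qed (use C s1 M in auto)
    also have "\<dots> = C * (real (card T) * s1 ^ n)" using M by (simp add: power_divide)
    also have "\<dots> \<le> C * ((real n + 1) ^ card S * s1 ^ n)"
    proof (intro mult_left_mono mult_right_mono)
      have "real (card T) \<le> real ((n + 1) ^ card S)" using T(2) of_nat_le_iff by blast
      then show "real (card T) \<le> (real n + 1) ^ card S" by (simp add: add.commute)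
    qed (use C s1 in auto)
    also have "\<dots> \<le> C * (K * s ^ n)" using C by (intro mult_left_mono K) auto
    finally have "(\<Sum>t\<in>T. \<omega> t * norm (c t)) \<le> C * K * s ^ n" by simp
    with D_rep_finite[OF w T(1)] show "D_rep \<omega> (\<lambda>z. (\<Sum>y\<in>S. a y * iexp (z * y)) ^ n) (C * K * s ^ n)"
      unfolding eq by (rule D_rep_mono)
  qed
qed

text \<open>The spectral radius is computed on measures with finite discrete and bounded, compactly
  supported continuous part. In the expansion
  \<open>(d + \<phi>)\<^sup>n = d\<^sup>n + n d\<^sup>n\<^sup>-\<^sup>1 \<phi> + \<phi>\<^sup>2 W\<^sub>n\<close> the powers of \<open>d\<close> have polynomially many
  coefficients, each at most the supremum norm, and the last term is the transform of a density which
  is bounded by Fourier inversion (\<open>\<phi>\<^sup>2\<close> is integrable) and small outside \<open>[-\<rho>n, \<rho>n]\<close>.\<close>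

lemma spectral_radius_compact:
  assumes w: "is_weight \<omega>" and G: "GRS \<omega>" and S: "finite S"
    and fm[measurable]: "f \<in> borel_measurable borel" and fb: "\<And>x. norm (f x) \<le> N" and fs: "\<And>x. N < \<bar>x\<bar> \<Longrightarrow> f x = 0"
    and xM: "\<And>z. norm ((\<Sum>y\<in>S. a y * iexp (z * y)) + fourier f z) \<le> M" and M: "0 < M" "M < s"
  obtains K where "K \<ge> 0" "\<And>n. R_rep \<omega> (\<lambda>z. ((\<Sum>y\<in>S. a y * iexp (z * y)) + fourier f z) ^ n) (K * s ^ n)"
proof -
  define d where "d z = (\<Sum>y\<in>S. a y * iexp (z * y))" for z
  define \<phi> where "\<phi> = fourier f"
  define x where "x z = d z + \<phi> z" for z
  have xM': "norm (x z) \<le> M" for z using xM by (simp add: x_def d_def \<phi>_def)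
  have fL: "f \<in> L1_weighted \<omega>'" if "is_weight \<omega>'" for \<omega>' by (rule L1_weighted_bounded_support[OF that fm fb fs])
  have fi: "integrable lborel f" by (rule L1_weighted_integrable[OF w fL[OF w]])
  have \<phi>m[measurable]: "\<phi> \<in> borel_measurable borel" unfolding \<phi>_def by (rule measurable_fourier[OF fi])
  have \<phi>2: "integrable lborel (\<lambda>z. (norm (\<phi> z))\<^sup>2)" unfolding \<phi>_def by (rule fourier_square_integrable[OF fi fb])
  define I where "I = (LINT z|lborel. (norm (\<phi> z))\<^sup>2)"
  have I0: "I \<ge> 0" unfolding I_def by simp
  define c\<phi> where "c\<phi> = (LINT x|lborel. \<omega> x * norm (f x))"
  have \<phi>L: "L_rep \<omega> \<phi> c\<phi>" unfolding \<phi>_def c\<phi>_def by (rule L_rep_of_L1_weighted[OF fL[OF w]])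
  have c\<phi>: "c\<phi> \<ge> 0" by (rule L_rep_nonneg[OF w \<phi>L])
  have dM: "norm (d z) \<le> M" for z
  proof (rule D_rep_upper_bound[OF w _ Riemann_Lebesgue[OF fi]])
    show "D_rep \<omega> d (\<Sum>y\<in>S. \<omega> y * norm (a y))" unfolding d_def[abs_def] by (rule D_rep_finite[OF w S])
    show "norm (d z + fourier f z) \<le> M" for z using xM' by (simp add: x_def \<phi>_def)
  qed
  define s1 where "s1 = (M + s) / 2"
  have s1: "M < s1" "s1 < s" "0 < s1" using M by (auto simp: s1_def)
  obtain K1 where K1: "K1 \<ge> 0" "\<And>n. D_rep \<omega> (\<lambda>z. d z ^ n) (K1 * s1 ^ n)"
    unfolding d_def by (rule trig_polynomial_power_bound[OF w G S, of a M s1]) (use dM M s1 in \<open>auto simp: d_def\<close>)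
  obtain q1 where q1: "q1 \<ge> 0" "\<And>n. (real n + 1) ^ 1 * s1 ^ n \<le> q1 * s ^ n"
    by (rule poly_times_exp_le[OF s1(3,2), of 1]) (rule that)
  obtain q3 where q3: "q3 \<ge> 0" "\<And>n. (real n + 1) ^ 3 * s1 ^ n \<le> q3 * s ^ n"
    by (rule poly_times_exp_le[OF s1(3,2), of 3]) (rule that)
  have w0: "\<omega> 0 \<ge> 0" by (rule weight_nonneg[OF w])

  have T2: "R_rep \<omega> (\<lambda>z. of_nat n * (d z ^ (n - 1) * \<phi> z)) (\<omega> 0 * K1 * c\<phi> / s1 * q1 * s ^ n)" for n
  proof -
    have "R_rep \<omega> (\<lambda>z. of_nat n * (d z ^ (n - 1) * \<phi> z)) (\<omega> 0 * norm (of_nat n :: complex) * (K1 * s1 ^ (n - 1) * c\<phi>))"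
      by (rule R_rep_cmult[OF w R_rep_L[OF D_mult_L_rep[OF w K1(2) \<phi>L]]])
    moreover have "\<omega> 0 * norm (of_nat n :: complex) * (K1 * s1 ^ (n - 1) * c\<phi>) \<le> \<omega> 0 * K1 * c\<phi> / s1 * (q1 * s ^ n)"
    proof -
      have "real n * s1 ^ (n - 1) \<le> (real n + 1) ^ 1 * s1 ^ n / s1"
        using s1 by (cases n) (auto simp: field_simps)
      also have "\<dots> \<le> q1 * s ^ n / s1" using s1 by (intro divide_right_mono q1) auto
      finally have "(\<omega> 0 * K1 * c\<phi>) * (real n * s1 ^ (n - 1)) \<le> (\<omega> 0 * K1 * c\<phi>) * (q1 * s ^ n / s1)"
        using w0 K1 c\<phi> by (intro mult_left_mono) auto
      then show ?thesis by (simp add: mult_ac)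
    qed
    ultimately show ?thesis by (simp add: R_rep_mono mult.assoc)
  qed

  \<comment> \<open>The recursion arises from multiplying the expansion by
    \<open>x = d + \<phi>\<close> and collecting everything that contains \<open>\<phi>\<close>
    twice. For \<open>n = 0\<close> the factor \<open>of_nat n\<close> hides the truncated
    exponent.\<close>
  define W where "W = rec_nat (\<lambda>z. 0) (\<lambda>n w z. x z * w z + of_nat n * d z ^ (n - 1))"
  have W0: "W 0 = (\<lambda>z. 0)" and WS: "W (Suc n) = (\<lambda>z. x z * W n z + of_nat n * d z ^ (n - 1))" for n
    by (simp_all add: W_def)
  have expand: "x z ^ n = d z ^ n + of_nat n * (d z ^ (n - 1) * \<phi> z) + (\<phi> z)\<^sup>2 * W n z" for n z
  proof (induction n)
    case (Suc n)
    have dd: "of_nat n * (d z * d z ^ (n - 1)) = of_nat n * d z ^ n" by (cases n) auto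
    have "x z ^ Suc n = x z * (d z ^ n + of_nat n * (d z ^ (n - 1) * \<phi> z) + (\<phi> z)\<^sup>2 * W n z)"
      by (simp only: power_Suc Suc)
    also have "\<dots> = (d z + \<phi> z) * d z ^ n + \<phi> z * (of_nat n * (d z * d z ^ (n - 1))) + (\<phi> z)\<^sup>2 * of_nat n * d z ^ (n - 1) + (\<phi> z)\<^sup>2 * (x z * W n z)"
      by (simp add: x_def algebra_simps power2_eq_square)
    finally show ?case unfolding dd by (simp add: WS algebra_simps power2_eq_square)
  qed (simp add: W0)
  \<comment> \<open>Dividing by \<open>M\<^sup>2\<close> avoids the exponent \<open>n - 2\<close>,
    which would be truncated for small \<open>n\<close>.\<close>
  have Wb: "norm (W n z) \<le> (real n)\<^sup>2 * M ^ n / M\<^sup>2" for n z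
  proof (induction n)
    case (Suc n)
    have 1: "norm (x z * W n z) \<le> M * ((real n)\<^sup>2 * M ^ n / M\<^sup>2)"
      unfolding norm_mult using M by (intro mult_mono xM' Suc) auto
    have "norm (of_nat n * d z ^ (n - 1)) \<le> real n * M ^ (n - 1)"
      unfolding norm_mult norm_power norm_of_nat by (intro mult_left_mono power_mono dM) auto
    also have "\<dots> = real n * M ^ Suc n / M\<^sup>2" using M by (cases n) (auto simp: power2_eq_square)
    finally have "norm (W (Suc n) z) \<le> M * ((real n)\<^sup>2 * M ^ n / M\<^sup>2) + real n * M ^ Suc n / M\<^sup>2"
      unfolding WS using 1 norm_triangle_ineq[of "x z * W n z" "of_nat n * d z ^ (n - 1)"] by linarith
    also have "\<dots> = ((real n)\<^sup>2 + real n) * M ^ Suc n / M\<^sup>2" using M by (simp add: field_simps)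
    also have "\<dots> \<le> (real (Suc n))\<^sup>2 * M ^ Suc n / M\<^sup>2"
      using M by (intro divide_right_mono mult_right_mono) (auto simp: power2_eq_square algebra_simps)
    finally show ?case .
  qed (simp add: W0)

  \<comment> \<open>A second, stronger weight, harmless for a compactly supported \<open>f\<close>.
    Since \<open>\<omega>\<close> grows at most like \<open>exp \<bar>t\<bar>\<close>, a bound in
    the norm of \<open>v\<close> leaves a factor \<open>exp (- \<bar>t\<bar>)\<close> for the part
    of a density outside a window.\<close>
  define v where "v = (\<lambda>t::real. exp (2 * \<bar>t\<bar>))"
  have v: "is_weight v" unfolding v_def by (rule weight_exp) simp
  have v0: "v 0 = 1" by (simp add: v_def)
  define c\<phi>' where "c\<phi>' = (LINT x|lborel. v x * norm (f x))"
  have \<phi>L': "L_rep v \<phi> c\<phi>'" unfolding \<phi>_def c\<phi>'_def by (rule L_rep_of_L1_weighted[OF fL[OF v]])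
  have c\<phi>': "c\<phi>' \<ge> 0" by (rule L_rep_nonneg[OF v \<phi>L'])
  \<comment> \<open>The summand 1 ensures \<open>1 \<le> D\<close>, so that its powers increase with
    the exponent.\<close>
  define D where "D = (\<Sum>y\<in>S. v y * norm (a y)) + c\<phi>' + 1"
  have dD: "D_rep v d (\<Sum>y\<in>S. v y * norm (a y))" unfolding d_def[abs_def] by (rule D_rep_finite[OF v S])
  have Sv: "(\<Sum>y\<in>S. v y * norm (a y)) \<ge> 0" by (rule D_rep_nonneg[OF v dD])
  have D1: "D \<ge> 1" using Sv c\<phi>' by (simp add: D_def)
  have Rd: "R_rep v d D" by (rule R_rep_mono[OF R_rep_D[OF dD]]) (use c\<phi>' in \<open>simp add: D_def\<close>)
  have Rx: "R_rep v x D" unfolding x_def[abs_def]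
    by (rule R_rep_mono[OF R_rep_add[OF v R_rep_D[OF dD] R_rep_L[OF \<phi>L']]]) (simp add: D_def)
  have RW: "R_rep v (W n) ((real n)\<^sup>2 * D ^ n)" for n
  proof (induction n)
    case 0
    then show ?case by (simp add: W0 R_rep_D[OF D_rep_zero])
  next
    case (Suc n)
    have "R_rep v (W (Suc n)) (D * ((real n)\<^sup>2 * D ^ n) + v 0 * norm (of_nat n :: complex) * (v 0 * D ^ (n - 1)))"
      unfolding WS by (intro R_rep_add[OF v] R_rep_mult[OF v Rx Suc] R_rep_cmult[OF v] R_rep_power[OF v Rd])
    moreover have "D * ((real n)\<^sup>2 * D ^ n) + v 0 * norm (of_nat n :: complex) * (v 0 * D ^ (n - 1)) \<le> (real (Suc n))\<^sup>2 * D ^ Suc n"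
    proof -
      have "real n * D ^ (n - 1) \<le> real n * D ^ Suc n" using D1 by (intro mult_left_mono power_increasing) auto
      then have "D * ((real n)\<^sup>2 * D ^ n) + real n * D ^ (n - 1) \<le> ((real n)\<^sup>2 + real n) * D ^ Suc n" by (simp add: algebra_simps)
      also have "\<dots> \<le> (real (Suc n))\<^sup>2 * D ^ Suc n"
        using D1 by (intro mult_right_mono) (auto simp: power2_eq_square algebra_simps)
      finally show ?thesis by (simp add: v0)
    qed
    ultimately show ?case by (rule R_rep_mono)
  qed

  \<comment> \<open>Outside the window of radius \<open>\<rho> * n\<close> the norm for
    \<open>v\<close> grows like \<open>D ^ n\<close>; this \<open>\<rho>\<close> is large enough for
    \<open>exp (- (\<rho> * n))\<close> to bring that down to \<open>M ^ n\<close>.\<close>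
  define \<rho> where "\<rho> = max 1 (ln (D / M))"
  have \<rho>: "\<rho> \<ge> 1" by (simp add: \<rho>_def)
  have D\<rho>: "exp (- \<rho>) * D \<le> M"
  proof -
    have "D / M = exp (ln (D / M))" using D1 M by simp
    also have "\<dots> \<le> exp \<rho>" by (simp add: \<rho>_def)
    finally have "D \<le> M * exp \<rho>" using M by (simp add: field_simps)
    then show ?thesis by (simp add: exp_minus field_simps)
  qed
  define \<kappa> where "\<kappa> = ln (s1 / M) / \<rho>"
  have \<kappa>: "\<kappa> > 0" using s1 M \<rho> by (simp add: \<kappa>_def)
  have \<kappa>\<rho>: "exp (\<kappa> * \<rho>) = s1 / M" using \<rho> s1 M by (simp add: \<kappa>_def)
  obtain C where C: "C \<ge> 1" "\<And>t. \<omega> t \<le> C * exp (\<kappa> * \<bar>t\<bar>)" using GRS_exp_bound[OF w G \<kappa>] by blast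
  obtain C1 where C1: "C1 \<ge> 1" "\<And>t. \<omega> t \<le> C1 * exp (1 * \<bar>t\<bar>)" using GRS_exp_bound[OF w G zero_less_one] by blast
  define K3 where "K3 = 2 * \<rho> * C * I / M\<^sup>2 + C1 * c\<phi>'\<^sup>2"
  have K3: "K3 \<ge> 0" unfolding K3_def using \<rho> C C1 I0 M by auto
  have T3: "L_rep \<omega> (\<lambda>z. (\<phi> z)\<^sup>2 * W n z) (K3 * q3 * s ^ n)" for n
  proof -
    define H where "H z = (\<phi> z)\<^sup>2 * W n z" for z
    have "L_rep v (\<lambda>z. \<phi> z * (\<phi> z * W n z)) (c\<phi>' * (c\<phi>' * ((real n)\<^sup>2 * D ^ n)))"
      by (intro L_mult_R_rep[OF v] \<phi>L' R_rep_L[OF L_mult_R_rep[OF v]] RW)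
    then have "L_rep v H (c\<phi>'\<^sup>2 * ((real n)\<^sup>2 * D ^ n))"
      by (simp add: H_def[abs_def] power2_eq_square mult.assoc)
    then obtain g where g: "g \<in> L1_weighted v" "(LINT x|lborel. v x * norm (g x)) \<le> c\<phi>'\<^sup>2 * ((real n)\<^sup>2 * D ^ n)" "H = fourier g"
      unfolding L_rep_def by blast
    have gm[measurable]: "g \<in> borel_measurable borel" and gv: "integrable lborel (\<lambda>x. v x * norm (g x))"
      using g(1) by (auto simp: L1_weighted_def)
    have gi: "integrable lborel g" by (rule L1_weighted_integrable[OF v g(1)])
    have Hm[measurable]: "H \<in> borel_measurable borel" unfolding g(3) by (rule measurable_fourier[OF gi])
    have Hb: "norm (H z) \<le> (norm (\<phi> z))\<^sup>2 * ((real n)\<^sup>2 * M ^ n / M\<^sup>2)" for z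
      unfolding H_def norm_mult norm_power by (intro mult_left_mono Wb) auto
    have Hi0: "integrable lborel (\<lambda>z. (norm (\<phi> z))\<^sup>2 * ((real n)\<^sup>2 * M ^ n / M\<^sup>2))" by (intro integrable_mult_left \<phi>2)
    have Hi: "integrable lborel H"
      by (rule Bochner_Integration.integrable_bound[OF Hi0], measurable)
         (rule AE_I2, unfold real_norm_def, rule order_trans[OF Hb abs_ge_self])
    define B where "B = I * ((real n)\<^sup>2 * M ^ n / M\<^sup>2)"
    have B0: "B \<ge> 0" unfolding B_def using I0 M by simp
    have "(LINT z|lborel. norm (H z)) \<le> (LINT z|lborel. (norm (\<phi> z))\<^sup>2 * ((real n)\<^sup>2 * M ^ n / M\<^sup>2))"
      by (rule integral_mono[OF _ Hi0 Hb]) (use Hi in simp)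
    also have "\<dots> = B" unfolding B_def I_def by (rule integral_mult_left_zero)
    finally have HB: "(LINT z|lborel. norm (H z)) \<le> B" .
    have "AE t in lborel. norm (g t) \<le> (LINT z|lborel. norm (fourier g z))"
      by (rule fourier_inversion_bound[OF gi]) (use Hi g(3) in simp)
    then have gB: "AE t in lborel. norm (g t) \<le> B"
      using HB unfolding g(3) by (auto elim: eventually_mono)
    have [measurable]: "\<omega> \<in> borel_measurable borel" by (rule weight_measurable[OF w])
    \<comment> \<open>An integrable majorant: inside the window the pointwise bound \<open>B\<close>
      from Fourier inversion times the growth of the weight, outside it the surplus decay of
      \<open>v\<close>.\<close>
    define U where "U t = indicator {- (\<rho> * n)..\<rho> * n} t * (C * (s1 / M) ^ n * B) + C1 * exp (- (\<rho> * n)) * (v t * norm (g t))" for t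
    have Ui: "integrable lborel U" unfolding U_def
      by (intro Bochner_Integration.integrable_add integrable_mult_left integrable_mult_right gv integrable_real_indicator)
         (auto simp: emeasure_lborel_Icc_eq)
    have \<omega>U: "AE t in lborel. \<omega> t * norm (g t) \<le> U t"
      using gB
    proof eventually_elim
      case (elim t)
      show ?case
      proof (cases "t \<in> {- (\<rho> * n)..\<rho> * n}")
        case True
        then have "\<bar>t\<bar> \<le> \<rho> * n" by auto
        then have "\<kappa> * \<bar>t\<bar> \<le> \<kappa> * (\<rho> * n)" using \<kappa> by (intro mult_left_mono) auto
        then have "exp (\<kappa> * \<bar>t\<bar>) \<le> exp (real n * (\<kappa> * \<rho>))" by (simp add: mult_ac)
        also have "\<dots> = (s1 / M) ^ n" unfolding exp_of_nat_mult \<kappa>\<rho> ..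
        finally have "C * exp (\<kappa> * \<bar>t\<bar>) \<le> C * (s1 / M) ^ n" using C(1) by (intro mult_left_mono) auto
        then have "\<omega> t \<le> C * (s1 / M) ^ n" using C(2)[of t] by linarith
        then have "\<omega> t * norm (g t) \<le> C * (s1 / M) ^ n * B"
          using elim B0 weight_nonneg[OF w, of t] by (intro mult_mono) auto
        moreover have "0 \<le> C1 * exp (- (\<rho> * n)) * (v t * norm (g t))" using C1 by (simp add: v_def)
        ultimately show ?thesis using True by (simp add: U_def)
      next
        case False
        then have t: "\<bar>t\<bar> \<ge> \<rho> * n" by auto
        have "exp (1 * \<bar>t\<bar>) = exp (- \<bar>t\<bar>) * v t" by (simp add: v_def flip: exp_add)
        also have "\<dots> \<le> exp (- (\<rho> * n)) * v t" using t by (intro mult_right_mono) (auto simp: v_def)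
        finally have "C1 * exp (1 * \<bar>t\<bar>) \<le> C1 * (exp (- (\<rho> * n)) * v t)" using C1 by (intro mult_left_mono) auto
        then have "\<omega> t \<le> C1 * (exp (- (\<rho> * n)) * v t)" using C1(2)[of t] by linarith
        then have "\<omega> t * norm (g t) \<le> C1 * (exp (- (\<rho> * n)) * v t) * norm (g t)" by (rule mult_right_mono) simp
        then show ?thesis using False by (simp add: U_def mult_ac)
      qed
    qed
    have g\<omega>: "integrable lborel (\<lambda>t. \<omega> t * norm (g t))"
      by (rule Bochner_Integration.integrable_bound[OF Ui], measurable)
         (use \<omega>U in eventually_elim, use weight_nonneg[OF w] in \<open>auto simp: abs_mult\<close>)
    have "(LINT t|lborel. \<omega> t * norm (g t)) \<le> (LINT t|lborel. U t)"
      by (rule integral_mono_AE[OF g\<omega> Ui \<omega>U])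
    also have "(LINT t|lborel. U t) = 2 * \<rho> * n * (C * (s1 / M) ^ n * B) + C1 * exp (- (\<rho> * n)) * (LINT t|lborel. v t * norm (g t))"
    proof -
      have "(LINT t|lborel. U t) = (LINT t|lborel. indicator {- (\<rho> * n)..\<rho> * n} t * (C * (s1 / M) ^ n * B)) + (LINT t|lborel. C1 * exp (- (\<rho> * n)) * (v t * norm (g t)))"
        unfolding U_def
        by (intro Bochner_Integration.integral_add integrable_mult_left integrable_mult_right gv integrable_real_indicator)
           (auto simp: emeasure_lborel_Icc_eq)
      then show ?thesis using \<rho> by simp
    qed
    also have "\<dots> \<le> 2 * \<rho> * n * (C * (s1 / M) ^ n * B) + C1 * exp (- (\<rho> * n)) * (c\<phi>'\<^sup>2 * ((real n)\<^sup>2 * D ^ n))"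
      using C1 by (intro add_left_mono mult_left_mono g) auto
    also have "\<dots> \<le> K3 * ((real n + 1) ^ 3 * s1 ^ n)"
    proof -
      have n3: "real n * (real n)\<^sup>2 \<le> (real n + 1) ^ 3" "(real n)\<^sup>2 \<le> (real n + 1) ^ 3"
      proof -
        have "(real n) ^ 3 \<le> (real n + 1) ^ 3" by (intro power_mono) auto
        then show "real n * (real n)\<^sup>2 \<le> (real n + 1) ^ 3" by (simp add: power2_eq_square power3_eq_cube)
        have "(real n)\<^sup>2 \<le> (real n + 1)\<^sup>2" by (intro power_mono) auto
        also have "\<dots> \<le> (real n + 1) ^ 3" by (intro power_increasing) auto
        finally show "(real n)\<^sup>2 \<le> (real n + 1) ^ 3" .
      qed
      have "2 * \<rho> * n * (C * (s1 / M) ^ n * B) = 2 * \<rho> * C * I / M\<^sup>2 * ((real n * (real n)\<^sup>2) * s1 ^ n)"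
        using M unfolding B_def by (simp add: power_divide field_simps)
      also have "\<dots> \<le> 2 * \<rho> * C * I / M\<^sup>2 * ((real n + 1) ^ 3 * s1 ^ n)"
        using \<rho> C I0 s1 n3 by (intro mult_left_mono mult_right_mono) auto
      finally have 1: "2 * \<rho> * n * (C * (s1 / M) ^ n * B) \<le> 2 * \<rho> * C * I / M\<^sup>2 * ((real n + 1) ^ 3 * s1 ^ n)" .
      have "exp (- (\<rho> * n)) * D ^ n = (exp (- \<rho>) * D) ^ n"
        by (simp add: power_mult_distrib exp_of_nat_mult[symmetric] mult.commute)
      also have "\<dots> \<le> s1 ^ n" using D\<rho> s1 D1 by (intro power_mono) auto
      finally have "(real n)\<^sup>2 * (exp (- (\<rho> * n)) * D ^ n) \<le> (real n + 1) ^ 3 * s1 ^ n"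
        using n3 D1 by (intro mult_mono) auto
      then have "C1 * c\<phi>'\<^sup>2 * ((real n)\<^sup>2 * (exp (- (\<rho> * n)) * D ^ n)) \<le> C1 * c\<phi>'\<^sup>2 * ((real n + 1) ^ 3 * s1 ^ n)"
        using C1 by (intro mult_left_mono) auto
      then show ?thesis using 1 unfolding K3_def by (simp add: algebra_simps)
    qed
    also have "\<dots> \<le> K3 * (q3 * s ^ n)" using K3 by (intro mult_left_mono q3) auto
    finally have "(LINT t|lborel. \<omega> t * norm (g t)) \<le> K3 * q3 * s ^ n" by simp
    moreover have "g \<in> L1_weighted \<omega>" using g\<omega> by (simp add: L1_weighted_def)
    ultimately have "L_rep \<omega> H (K3 * q3 * s ^ n)" unfolding L_rep_def using g(3) by blast
    then show ?thesis by (simp add: H_def[abs_def])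
  qed
  have K1s: "K1 * s1 ^ n \<le> K1 * s ^ n" for n using K1 s1 by (intro mult_left_mono power_mono) auto
  have "R_rep \<omega> (\<lambda>z. x z ^ n) ((K1 + \<omega> 0 * K1 * c\<phi> / s1 * q1 + K3 * q3) * s ^ n)" for n
  proof -
    have "R_rep \<omega> (\<lambda>z. d z ^ n + of_nat n * (d z ^ (n - 1) * \<phi> z) + (\<phi> z)\<^sup>2 * W n z) (K1 * s ^ n + \<omega> 0 * K1 * c\<phi> / s1 * q1 * s ^ n + K3 * q3 * s ^ n)"
      by (intro R_rep_add[OF w] R_rep_L[OF T3] T2 R_rep_D[OF D_rep_mono[OF K1(2) K1s]])
    then show ?thesis by (simp add: expand ring_distribs)
  qed
  moreover have "K1 + \<omega> 0 * K1 * c\<phi> / s1 * q1 + K3 * q3 \<ge> 0"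
    using K1 w0 c\<phi> s1 q1 K3 q3 by (intro add_nonneg_nonneg mult_nonneg_nonneg divide_nonneg_nonneg) auto
  ultimately show thesis by (intro that) (auto simp: x_def d_def \<phi>_def)
qed

text \<open>The binomial theorem separates a truncation, covered by the preceding lemma, from a
  remainder of norm \<open>e = (s - M) / 4\<close>. The truncation has supremum at most
  \<open>M + e\<close> and powers of rate \<open>M + 2 * e\<close>; the remainder raises this to
  \<open>M + 3 * e\<close>, still below \<open>s\<close>.\<close>

theorem spectral_radius:
  assumes w: "is_weight \<omega>" and G: "GRS \<omega>" and F: "R_rep \<omega> F C"
    and S: "\<And>z. norm (F z) \<le> M" and M: "M < s"
  obtains K where "K \<ge> 0" "\<And>n. R_rep \<omega> (\<lambda>z. F z ^ n) (K * s ^ n)"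
proof -
  have M0: "0 \<le> M" using S[of 0] norm_ge_zero[of "F 0"] by linarith
  define e where "e = (s - M) / 4"
  have e: "e > 0" using M by (simp add: e_def)
  obtain S a f N where t: "finite S" "f \<in> borel_measurable borel" "\<And>x. norm (f x) \<le> N" "\<And>x. N < \<bar>x\<bar> \<Longrightarrow> f x = 0"
    "R_rep \<omega> (\<lambda>z. F z - ((\<Sum>y\<in>S. a y * iexp (z * y)) + fourier f z)) e"
    by (rule R_rep_truncate[OF w F e]) (rule that)
  define F0 where "F0 z = (\<Sum>y\<in>S. a y * iexp (z * y)) + fourier f z" for z
  define F1 where "F1 z = F z - F0 z" for z
  have F1: "R_rep \<omega> F1 e" using t(5) by (simp add: F1_def[abs_def] F0_def)
  have F0b: "norm (F0 z) \<le> M + e" for z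
    using norm_triangle_ineq4[of "F z" "F1 z"] S[of z] R_rep_bound[OF w F1, of z] by (simp add: F1_def)
  obtain K where K: "K \<ge> 0" "\<And>n. R_rep \<omega> (\<lambda>z. F0 z ^ n) (K * (M + 2 * e) ^ n)"
    unfolding F0_def
    by (rule spectral_radius_compact[OF w G t(1,2,3,4), of a "M + e" "M + 2 * e"])
       (use F0b e M0 in \<open>auto simp: F0_def\<close>)
  have w0: "\<omega> 0 \<ge> 0" by (rule weight_nonneg[OF w])
  define K' where "K' = \<omega> 0 * \<omega> 0 * K"
  have K': "K' \<ge> 0" using K w0 by (simp add: K'_def)
  have "R_rep \<omega> (\<lambda>z. F z ^ n) (K' * s ^ n)" for n
  proof -
    have "R_rep \<omega> (\<lambda>z. \<Sum>j\<le>n. of_nat (n choose j) * (F0 z ^ j * F1 z ^ (n - j)))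
       (\<Sum>j\<le>n. \<omega> 0 * norm (of_nat (n choose j) :: complex) * (K * (M + 2 * e) ^ j * (\<omega> 0 * e ^ (n - j))))"
      by (intro R_rep_sum[OF w] R_rep_cmult[OF w] R_rep_mult[OF w K(2) R_rep_power[OF w F1]]) auto
    moreover have "(\<Sum>j\<le>n. of_nat (n choose j) * (F0 z ^ j * F1 z ^ (n - j))) = F z ^ n" for z
      using binomial_ring[of "F0 z" "F1 z" n] by (simp add: F1_def mult.assoc)
    moreover have "(\<Sum>j\<le>n. \<omega> 0 * norm (of_nat (n choose j) :: complex) * (K * (M + 2 * e) ^ j * (\<omega> 0 * e ^ (n - j)))) = K' * (M + 2 * e + e) ^ n"
      unfolding binomial_ring[of "M + 2 * e" e n] K'_def sum_distrib_left by (intro sum.cong) (auto simp: mult_ac)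
    moreover have "K' * (M + 2 * e + e) ^ n \<le> K' * s ^ n"
      using M0 e K' by (intro mult_left_mono power_mono) (auto simp: e_def field_simps)
    ultimately show ?thesis by (auto intro: R_rep_mono)
  qed
  with K' show thesis by (rule that)
qed

section \<open>Inverses and logarithms by power series\<close>

lemma R_rep_uminus_one_plus:
  assumes w: "is_weight \<omega>" and "R_rep \<omega> F C"
  shows "R_rep \<omega> (\<lambda>z. 1 - F z) (\<omega> 0 + \<omega> 0 * C)"
  using R_rep_add[OF w R_rep_const[of \<omega> 1] R_rep_cmult[OF w assms(2), of "-1"]] by simp

lemma R_rep_inverse_near_1:
  assumes w: "is_weight \<omega>" and G: "GRS \<omega>" and F: "R_rep \<omega> F C"
    and q: "q < 1" "\<And>z. norm (1 - F z) \<le> q"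
  shows "\<exists>K. R_rep \<omega> (\<lambda>z. 1 / F z) K" and "\<exists>H K. R_rep \<omega> H K \<and> (\<forall>z. F z = exp (H z))"
proof -
  define s where "s = (1 + q) / 2"
  have q0: "0 \<le> q" using q(2)[of 0] norm_ge_zero[of "1 - F 0"] by linarith
  have s: "q < s" "s < 1" "0 < s" using q(1) q0 by (auto simp: s_def)
  obtain K where K: "K \<ge> 0" "\<And>n. R_rep \<omega> (\<lambda>z. (1 - F z) ^ n) (K * s ^ n)"
    by (rule spectral_radius[OF w G R_rep_uminus_one_plus[OF w F] q(2) s(1)]) (rule that)
  have sm: "summable (\<lambda>n. K * s ^ n)" using s by (intro summable_mult summable_geometric) auto
  have lt: "norm (1 - F z) < 1" for z using q(2)[of z] q(1) by linarith
  have "R_rep \<omega> (\<lambda>z. \<Sum>n. (1 - F z) ^ n) (\<Sum>n. K * s ^ n)" by (rule R_rep_suminf[OF w K(2) sm])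
  moreover have "(\<Sum>n. (1 - F z) ^ n) = 1 / F z" for z using suminf_geometric[OF lt[of z]] by simp
  ultimately show "\<exists>K. R_rep \<omega> (\<lambda>z. 1 / F z) K" by auto
  have w0: "\<omega> 0 \<ge> 0" by (rule weight_nonneg[OF w])
  \<comment> \<open>For \<open>n = 0\<close> the coefficient is \<open>-1 / 0\<close>, which is 0,
    so the series has no constant term, as the logarithm series should.\<close>
  have "R_rep \<omega> (\<lambda>z. (-1 / of_nat n) * (1 - F z) ^ n) (\<omega> 0 * (K * s ^ n))" for n
  proof (rule R_rep_mono[OF R_rep_cmult[OF w K(2)]])
    have "norm (-1 / of_nat n :: complex) \<le> 1" by (cases n) (simp_all add: norm_divide del: of_nat_Suc)
    then have "norm (-1 / of_nat n :: complex) * (K * s ^ n) \<le> 1 * (K * s ^ n)" using K s by (intro mult_right_mono) auto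
    then have "\<omega> 0 * (norm (-1 / of_nat n :: complex) * (K * s ^ n)) \<le> \<omega> 0 * (1 * (K * s ^ n))" using w0 by (rule mult_left_mono)
    then show "\<omega> 0 * norm (-1 / of_nat n :: complex) * (K * s ^ n) \<le> \<omega> 0 * (K * s ^ n)" by (simp add: mult.assoc)
  qed
  from R_rep_suminf[OF w this summable_mult[OF sm]]
  have "R_rep \<omega> (\<lambda>z. \<Sum>n. (-1 / of_nat n) * (1 - F z) ^ n) (\<Sum>n. \<omega> 0 * (K * s ^ n))" .
  moreover have "F z = exp (\<Sum>n. (-1 / of_nat n) * (1 - F z) ^ n)" for z
  proof -
    have "norm (- (1 - F z)) < 1" using lt by (simp add: norm_minus_commute)
    from Ln_series'[OF this] have "(\<lambda>n. (-1 / of_nat n) * (1 - F z) ^ n) sums ln (1 + - (1 - F z))"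
      by simp
    then have "(\<Sum>n. (-1 / of_nat n) * (1 - F z) ^ n) = ln (F z)" by (simp add: sums_iff)
    moreover have "F z \<noteq> 0" using lt[of z] by auto
    ultimately show ?thesis by simp
  qed
  ultimately show "\<exists>H K. R_rep \<omega> H K \<and> (\<forall>z. F z = exp (H z))" by blast
qed

lemma R_rep_exp:
  assumes w: "is_weight \<omega>" and H: "R_rep \<omega> H C"
  shows "\<exists>K. R_rep \<omega> (\<lambda>z. exp (H z)) K"
proof -
  have "R_rep \<omega> (\<lambda>z. (1 / fact n) * H z ^ n) (\<omega> 0 * norm (1 / fact n :: complex) * (\<omega> 0 * C ^ n))" for n
    by (rule R_rep_cmult[OF w R_rep_power[OF w H]])
  moreover have "summable (\<lambda>n. \<omega> 0 * norm (1 / fact n :: complex) * (\<omega> 0 * C ^ n))"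
  proof -
    have "summable (\<lambda>n. \<omega> 0 * \<omega> 0 * (inverse (fact n) * C ^ n))"
      by (intro summable_mult summable_exp)
    then show ?thesis by (simp add: norm_divide field_simps)
  qed
  ultimately have "R_rep \<omega> (\<lambda>z. \<Sum>n. (1 / fact n) * H z ^ n) (\<Sum>n. \<omega> 0 * norm (1 / fact n :: complex) * (\<omega> 0 * C ^ n))"
    by (rule R_rep_suminf[OF w])
  moreover have "(\<Sum>n. (1 / fact n) * H z ^ n) = exp (H z)" for z
    by (simp add: exp_def scaleR_conv_of_real divide_inverse)
  ultimately show ?thesis by auto
qed

text \<open>Conjugation reflects the measure, and the weight at \<open>-y\<close> is not related to
  that at \<open>y\<close>; finite support and boundedness make the reflected measure admissible for
  any weight.\<close>

lemma R_rep_cnj_compact: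
  assumes w: "is_weight \<omega>" and S: "finite S"
    and fm[measurable]: "f \<in> borel_measurable borel" and fb: "\<And>x. norm (f x) \<le> N" and fs: "\<And>x. N < \<bar>x\<bar> \<Longrightarrow> f x = 0"
  shows "\<exists>K. R_rep \<omega> (\<lambda>z. cnj ((\<Sum>y\<in>S. a y * iexp (z * y)) + fourier f z)) K"
proof -
  define g where "g x = cnj (f (- x))" for x
  have [measurable]: "g \<in> borel_measurable borel" unfolding g_def by measurable
  have "g \<in> L1_weighted \<omega>"
    by (rule L1_weighted_bounded_support[OF w, of g N]) (use fb fs in \<open>auto simp: g_def\<close>)
  from L_rep_of_L1_weighted[OF this] have 1: "R_rep \<omega> (fourier g) (LINT x|lborel. \<omega> x * norm (g x))" by (rule R_rep_L)
  have fg: "cnj (fourier f z) = fourier g z" for z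
  proof -
    have "cnj (fourier f z) = (LINT x|lborel. cnj (f (0 + -1 * x)) * iexp (- (z * (0 + -1 * x))))"
      unfolding cnj_fourier by (subst lborel_integral_real_affine[where c="-1" and t=0]) auto
    then show ?thesis by (simp add: fourier_def g_def)
  qed
  have "D_rep \<omega> (\<lambda>z. \<Sum>y\<in>uminus ` S. cnj (a (- y)) * iexp (z * y)) (\<Sum>y\<in>uminus ` S. \<omega> y * norm (cnj (a (- y))))"
    using S by (intro D_rep_finite[OF w]) auto
  from R_rep_add[OF w R_rep_D[OF this] 1]
  have "R_rep \<omega> (\<lambda>z. (\<Sum>y\<in>uminus ` S. cnj (a (- y)) * iexp (z * y)) + fourier g z)
     ((\<Sum>y\<in>uminus ` S. \<omega> y * norm (cnj (a (- y)))) + (LINT x|lborel. \<omega> x * norm (g x)))" .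
  moreover have "(\<Sum>y\<in>uminus ` S. cnj (a (- y)) * iexp (z * y)) = cnj (\<Sum>y\<in>S. a y * iexp (z * y))" for z
    by (subst sum.reindex) (auto simp: exp_cnj)
  ultimately show ?thesis unfolding fg[symmetric] by auto
qed

text \<open>Up to a small error the product of \<open>F\<close> and the conjugate of a truncation is
  the squared modulus of \<open>F\<close>, which divided by \<open>M\<^sup>2\<close> lies between
  \<open>\<delta>\<^sup>2 / M\<^sup>2\<close> and 1. The tolerance \<open>e\<close> makes the error
  at most half of that lower bound, so the product is invertible by
  \<open>R_rep_inverse_near_1\<close>.\<close>

theorem Wiener_R_rep:
  assumes w: "is_weight \<omega>" and G: "GRS \<omega>" and F: "R_rep \<omega> F C"
    and \<delta>: "\<delta> > 0" "\<And>z. norm (F z) \<ge> \<delta>"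
  shows "\<exists>K. R_rep \<omega> (\<lambda>z. 1 / F z) K"
proof -
  define M where "M = max C 1"
  have M: "M \<ge> 1" "norm (F z) \<le> M" for z using R_rep_bound[OF w F, of z] by (auto simp: M_def)
  have \<delta>M: "\<delta> \<le> M" using \<delta>(2)[of 0] M(2)[of 0] by linarith
  define e where "e = \<delta>\<^sup>2 / (2 * M)"
  have e: "e > 0" using \<delta> M(1) by (simp add: e_def)
  obtain S a f N where t: "finite S" "f \<in> borel_measurable borel" "\<And>x. norm (f x) \<le> N" "\<And>x. N < \<bar>x\<bar> \<Longrightarrow> f x = 0"
    "R_rep \<omega> (\<lambda>z. F z - ((\<Sum>y\<in>S. a y * iexp (z * y)) + fourier f z)) e"
    by (rule R_rep_truncate[OF w F e]) (rule that)
  define F0 where "F0 z = (\<Sum>y\<in>S. a y * iexp (z * y)) + fourier f z" for z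
  obtain K0 where K0: "R_rep \<omega> (\<lambda>z. cnj (F0 z)) K0"
    using R_rep_cnj_compact[OF w t(1-4)] unfolding F0_def by blast
  have F1: "norm (F z - F0 z) \<le> e" for z
    using R_rep_bound[OF w t(5), of z] by (simp add: F0_def)
  define E where "E z = 1 / M\<^sup>2 * (F z * cnj (F0 z))" for z
  have RE: "R_rep \<omega> E (\<omega> 0 * norm (1 / M\<^sup>2 :: complex) * (C * K0))"
    unfolding E_def[abs_def] by (rule R_rep_cmult[OF w R_rep_mult[OF w F K0]])
  have "norm (1 - E z) \<le> 1 - \<delta>\<^sup>2 / (2 * M\<^sup>2)" for z
  proof -
    have M2: "M\<^sup>2 > 0" using M(1) by simp
    have "1 - E z = of_real (1 - (norm (F z))\<^sup>2 / M\<^sup>2) + F z * cnj (F z - F0 z) / M\<^sup>2"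
      unfolding E_def of_real_diff of_real_divide complex_norm_square using M2 by (simp add: field_simps)
    also have "norm \<dots> \<le> norm (of_real (1 - (norm (F z))\<^sup>2 / M\<^sup>2) :: complex) + norm (F z * cnj (F z - F0 z) / M\<^sup>2)"
      by (rule norm_triangle_ineq)
    also have "norm (of_real (1 - (norm (F z))\<^sup>2 / M\<^sup>2) :: complex) \<le> 1 - \<delta>\<^sup>2 / M\<^sup>2"
    proof -
      have "(norm (F z))\<^sup>2 \<le> M\<^sup>2" by (intro power_mono M) auto
      then have "0 \<le> 1 - (norm (F z))\<^sup>2 / M\<^sup>2" using M2 by simp
      moreover have "\<delta>\<^sup>2 \<le> (norm (F z))\<^sup>2" using \<delta> by (intro power_mono) auto
      then have "\<delta>\<^sup>2 / M\<^sup>2 \<le> (norm (F z))\<^sup>2 / M\<^sup>2" by (rule divide_right_mono) simp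
      ultimately show ?thesis unfolding norm_of_real by linarith
    qed
    also have "norm (F z * cnj (F z - F0 z) / M\<^sup>2) \<le> M * e / M\<^sup>2"
    proof -
      have "norm (F z) * norm (F z - F0 z) \<le> M * e" using M F1 by (intro mult_mono) (auto intro: order_trans[OF zero_le_one])
      then have "norm (F z) * norm (F z - F0 z) / M\<^sup>2 \<le> M * e / M\<^sup>2" by (rule divide_right_mono) simp
      then show ?thesis by (simp add: norm_divide norm_mult norm_power flip: complex_cnj_diff)
    qed
    also have "M * e / M\<^sup>2 = \<delta>\<^sup>2 / (2 * M\<^sup>2)" using M(1) by (simp add: e_def)
    finally show ?thesis using M2 by (simp add: field_simps)
  qed
  moreover have "1 - \<delta>\<^sup>2 / (2 * M\<^sup>2) < 1" using \<delta> M(1) by simp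
  ultimately obtain K1 where K1: "R_rep \<omega> (\<lambda>z. 1 / E z) K1"
    using R_rep_inverse_near_1(1)[OF w G RE] by blast
  have "R_rep \<omega> (\<lambda>z. 1 / M\<^sup>2 * (cnj (F0 z) * (1 / E z))) (\<omega> 0 * norm (1 / M\<^sup>2 :: complex) * (K0 * K1))"
    by (rule R_rep_cmult[OF w R_rep_mult[OF w K0 K1]])
  moreover have "1 / M\<^sup>2 * (cnj (F0 z) * (1 / E z)) = 1 / F z" for z
  proof -
    \<comment> \<open>A zero would force \<open>\<delta> \<le> e\<close>, but
      \<open>\<delta> \<le> M\<close> gives \<open>e \<le> \<delta> / 2\<close>.\<close>
    have "F0 z \<noteq> 0"
    proof
      assume "F0 z = 0"
      then have "\<delta> \<le> e" using F1[of z] \<delta>(2)[of z] by simp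
      moreover have "e \<le> \<delta> * M / (2 * M)" unfolding e_def power2_eq_square
        using \<delta> M(1) \<delta>M by (intro divide_right_mono mult_left_mono) auto
      ultimately show False using \<delta> M(1) by simp
    qed
    then show ?thesis using \<delta> \<delta>(2)[of z] M(1) by (auto simp: E_def field_simps)
  qed
  ultimately show ?thesis by auto
qed

lemma D_rep_diff:
  assumes w: "is_weight \<omega>" and "D_rep \<omega> F C" "D_rep \<omega> G D"
  shows "D_rep \<omega> (\<lambda>z. F z - G z) (C + \<omega> 0 * D)"
  using D_rep_add[OF w assms(2) D_rep_modulate[OF w assms(3), of "-1" 0]] by simp

text \<open>The absolutely continuous part of the inverse vanishes because a function that is almost
  periodic and tends to \<open>0\<close> is \<open>0\<close>.\<close>

theorem Wiener_D_rep:
  assumes w: "is_weight \<omega>" and G: "GRS \<omega>" and Q: "D_rep \<omega> Q C"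
    and \<delta>: "\<delta> > 0" "\<And>z. norm (Q z) \<ge> \<delta>"
  shows "\<exists>K. D_rep \<omega> (\<lambda>z. 1 / Q z) K"
proof -
  obtain K where "R_rep \<omega> (\<lambda>z. 1 / Q z) K" using Wiener_R_rep[OF w G R_rep_D[OF Q] \<delta>] by blast
  then obtain P H p h where *: "D_rep \<omega> P p" "L_rep \<omega> H h" "(\<lambda>z. 1 / Q z) = (\<lambda>z. P z + H z)"
    unfolding R_rep_def by metis
  have Q0: "Q z \<noteq> 0" for z using \<delta>(1) \<delta>(2)[of z] by auto
  have 1: "D_rep \<omega> (\<lambda>z. 1 - Q z * P z) (\<omega> 0 * norm (1::complex) + \<omega> 0 * (C * p))"
    using D_rep_diff[OF w D_rep_atom[of \<omega> 1 0] D_mult_D_rep[OF w Q *(1)]] by simp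
  \<comment> \<open>The sign is written as a modulation at frequency 0, so that
    \<open>L_rep_modulate\<close> supplies the negative.\<close>
  have 2: "((\<lambda>z. - 1 * iexp (z * 0) * (Q z * H z)) \<longlongrightarrow> 0) at_infinity"
    by (rule L_rep_tendsto_0[OF w L_rep_modulate[OF w D_mult_L_rep[OF w Q *(2)]]])
  have "norm (1 - Q z * P z) \<le> 0" for z
  proof (rule D_rep_upper_bound[OF w 1 2])
    fix z
    have "Q z * (P z + H z) = 1" using fun_cong[OF *(3), of z] Q0[of z] by (simp add: field_simps)
    then have "1 - Q z * P z = Q z * H z" by (metis add_diff_cancel_left' ring_distribs(1))
    then show "norm (1 - Q z * P z + - 1 * iexp (z * 0) * (Q z * H z)) \<le> 0" by simp
  qed
  then have "P = (\<lambda>z. 1 / Q z)" using Q0 by (auto simp: field_simps)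
  with *(1) show ?thesis by auto
qed

section \<open>Logarithms\<close>

lemma GRS_one: "GRS (\<lambda>_. 1)"
  by (simp add: GRS_def)

lemma norm_exp_minus_1_le:
  fixes w :: complex
  assumes "norm w \<le> 1/2"
  shows "norm (exp w - 1) \<le> 2 * norm w"
proof -
  have "norm (exp w - exp 0) \<le> 2 * norm (w - 0)"
  proof (rule field_differentiable_bound[of "cball 0 (1/2)" exp exp])
    show "(exp has_field_derivative exp z) (at z within cball 0 (1/2))" for z :: complex
      by (rule DERIV_subset[OF DERIV_exp]) simp
    show "norm (exp z) \<le> 2" if "z \<in> cball 0 (1/2)" for z :: complex
    proof -
      have "Re z \<le> 1/2" using that complex_Re_le_cmod[of z] by simp
      then have "exp (Re z) \<le> exp (1/2)" by simp
      also have "\<dots> \<le> 2" by (rule exp_half_le2)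
      finally show ?thesis by simp
    qed
  qed (use assms in auto)
  then show ?thesis by simp
qed

lemma lipschitz_of_vector_derivative:
  fixes f :: "real \<Rightarrow> complex"
  assumes d: "\<And>x. (f has_vector_derivative f' x) (at x)" and b: "\<And>x. norm (f' x) \<le> B"
  shows "norm (f z - f w) \<le> B * \<bar>z - w\<bar>"
proof -
  have "norm (f z - f w) \<le> B * norm (z - w)"
  proof (rule differentiable_bound[of UNIV f "\<lambda>x h. h *\<^sub>R f' x"])
    show "(f has_derivative (\<lambda>h. h *\<^sub>R f' x)) (at x within UNIV)" for x
      using d[of x] by (simp add: has_vector_derivative_def)
    show "onorm (\<lambda>h. h *\<^sub>R f' x) \<le> B" for x
    proof (rule onorm_bound)
      show "0 \<le> B" using b[of x] norm_ge_zero[of "f' x"] by linarith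
      show "norm (h *\<^sub>R f' x) \<le> B * norm h" for h
        using mult_right_mono[OF b, of "norm h" x] by (simp add: mult.commute)
    qed
  qed auto
  then show ?thesis by simp
qed

text \<open>The values lie in the discrete set of multiples of 2 pi i. This compares any two
  continuous logarithms of the same function.\<close>

lemma exp_eq_1_imp_constant:
  fixes f :: "real \<Rightarrow> complex"
  assumes c: "continuous_on S f" and S: "connected S" and e: "\<And>x. x \<in> S \<Longrightarrow> exp (f x) = 1"
    and xy: "x \<in> S" "y \<in> S"
  shows "f x = f y"
proof -
  have "f constant_on S"
  proof (rule continuous_discrete_range_constant[OF S c])
    fix x assume x: "x \<in> S"
    show "\<exists>e>0. \<forall>y. y \<in> S \<and> f y \<noteq> f x \<longrightarrow> e \<le> norm (f y - f x)"
    proof (intro exI[of _ 1] conjI allI impI)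
      fix y assume y: "y \<in> S \<and> f y \<noteq> f x"
      have "exp (f y - f x) = 1" using e x y by (simp add: exp_diff)
      then obtain n :: int where n: "Re (f y - f x) = 0" "Im (f y - f x) = of_int (2 * n) * pi"
        unfolding exp_eq_1 by blast
      have "n \<noteq> 0"
      proof
        assume "n = 0"
        then have "f y - f x = 0" using n by (simp add: complex_eq_iff)
        then show False using y by simp
      qed
      then have "1 \<le> \<bar>real_of_int n\<bar>" by linarith
      then have "1 * (2 * pi) \<le> \<bar>real_of_int n\<bar> * (2 * pi)" by (intro mult_right_mono) auto
      moreover have "\<bar>Im (f y - f x)\<bar> = \<bar>real_of_int n\<bar> * (2 * pi)" unfolding n(2) by (simp add: abs_mult)
      ultimately have "1 \<le> \<bar>Im (f y - f x)\<bar>" using pi_gt3 by linarith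
      also have "\<dots> \<le> norm (f y - f x)" by (rule abs_Im_le_cmod)
      finally show "1 \<le> norm (f y - f x)" .
    qed simp
  qed
  then show ?thesis using xy unfolding constant_on_def by metis
qed

lemma trig_polynomial_has_derivative:
  fixes a :: "real \<Rightarrow> complex"
  shows "((\<lambda>z. \<Sum>y\<in>S. a y * iexp (z * y)) has_vector_derivative (\<Sum>y\<in>S. (\<i> * of_real y * a y) * iexp (z * y))) (at z)"
proof (rule has_vector_derivative_sum)
  fix y
  have "((\<lambda>w. a y * exp (\<i> * of_real y * w)) has_field_derivative (a y * (exp (\<i> * of_real y * of_real z) * (\<i> * of_real y)))) (at (of_real z))"
    by (auto intro!: derivative_eq_intros)
  from has_vector_derivative_real_field[OF this]
  show "((\<lambda>z. a y * iexp (z * y)) has_vector_derivative (\<i> * of_real y * a y) * iexp (z * y)) (at z)"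
    by (simp add: mult_ac)
qed

text \<open>The derivative is recorded because Wiener's theorem reaches the logarithm only through
  \<open>Q' / Q\<close>.\<close>

lemma continuous_log_derivative:
  fixes Q Q' :: "real \<Rightarrow> complex"
  assumes Q: "\<And>z. (Q has_vector_derivative Q' z) (at z)" and Q': "continuous_on UNIV Q'" and Q0: "\<And>z. Q z \<noteq> 0"
  obtains l where "\<And>z. (l has_vector_derivative Q' z / Q z) (at z)" "\<And>z. Q z = exp (l z)"
proof -
  have Qc: "continuous (at z) Q" for z using Q by (rule has_vector_derivative_continuous)
  have Q'c: "isCont Q' z" for z using Q' by (simp add: continuous_on_eq_continuous_at)
  have "\<exists>F. \<forall>x::real. - \<infinity> < ereal x \<longrightarrow> ereal x < \<infinity> \<longrightarrow> (F has_vector_derivative Q' x / Q x) (at x)"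
    by (rule einterval_antiderivative) (use Qc Q'c Q0 in \<open>auto intro!: continuous_intros\<close>)
  then obtain F where F: "\<And>x. (F has_vector_derivative Q' x / Q x) (at x)" by auto
  have expF: "((\<lambda>z. exp (- F z)) has_vector_derivative (- (Q' x / Q x) * exp (- F x))) (at x)" for x
    using field_vector_diff_chain_at[of "\<lambda>z. - F z" "- (Q' x / Q x)" x exp "exp (- F x)"]
      has_vector_derivative_minus[OF F[of x]] DERIV_exp[of "- F x"]
    by (simp add: o_def)
  have "((\<lambda>z. Q z * exp (- F z)) has_vector_derivative 0) (at x within UNIV)" for x
    using has_vector_derivative_mult[OF Q[of x] expF[of x]] Q0[of x] by simp
  then obtain k where k: "\<And>z. Q z * exp (- F z) = k"
    using has_vector_derivative_zero_constant[of UNIV "\<lambda>z. Q z * exp (- F z)"] by auto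
  have k0: "k \<noteq> 0" using k[of 0] Q0[of 0] by auto
  show thesis
  proof (rule that[of "\<lambda>z. F z + Ln k"])
    show "((\<lambda>z. F z + Ln k) has_vector_derivative Q' z / Q z) (at z)" for z
      using has_vector_derivative_add[OF F[of z] has_vector_derivative_const[of "Ln k"]] by simp
    show "Q z = exp (F z + Ln k)" for z
      using k[of z] k0 by (simp add: exp_add exp_minus field_simps)
  qed
qed

text \<open>Bohr's theorem on the argument of an almost periodic function. If \<open>l\<close> is a logarithm of \<open>Q\<close>
  then \<open>l' = Q' / Q\<close> has an absolutely convergent trigonometric series by Wiener's theorem. With
  \<open>c\<^sub>0\<close> its mean, \<open>\<theta>(z) = l(z) - c\<^sub>0 z\<close> is bounded and has the almost periods of \<open>Q\<close>. Its means
  over long arithmetic progressions are nearly constant, and they differ from \<open>\<theta>\<close> by increments of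
  \<open>\<theta>\<close>, which trigonometric polynomials approximate without small denominators.\<close>

lemma Bohr_argument:
  fixes a :: "real \<Rightarrow> complex"
  assumes S: "finite S" and \<delta>: "\<delta> > 0" "\<And>z. norm (\<Sum>y\<in>S. a y * iexp (z * y)) \<ge> \<delta>"
  obtains \<gamma> :: real and S' b where "finite S'"
    "\<And>z. norm (1 - (\<Sum>y\<in>S. a y * iexp (z * y)) * exp (- (\<i> * \<gamma> * z)) * exp (- (\<Sum>y\<in>S'. b y * iexp (z * y)))) \<le> 1/2"
proof -
  define Q where "Q z = (\<Sum>y\<in>S. a y * iexp (z * y))" for z
  define Q' where "Q' z = (\<Sum>y\<in>S. (\<i> * of_real y * a y) * iexp (z * y))" for z
  have Qd: "\<And>z. (Q has_vector_derivative Q' z) (at z)"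
    unfolding Q_def[abs_def] Q'_def by (rule trig_polynomial_has_derivative)
  have Q'c: "continuous_on UNIV Q'" unfolding Q'_def by (intro continuous_intros)
  have Q\<delta>: "norm (Q z) \<ge> \<delta>" for z using \<delta>(2) by (simp add: Q_def)
  have Q0: "Q z \<noteq> 0" for z using Q\<delta>[of z] \<delta>(1) by auto
  \<comment> \<open>The trivial weight is enough for the analysis: the result is a finite
    trigonometric polynomial, which lies in the algebra of every weight.\<close>
  obtain CQ where QD: "D_rep (\<lambda>_. 1) Q CQ" unfolding Q_def[abs_def] using D_rep_finite[OF weight_one S] by blast
  obtain CQ' where Q'D: "D_rep (\<lambda>_. 1) Q' CQ'" unfolding Q'_def[abs_def] using D_rep_finite[OF weight_one S, of "\<lambda>y. \<i> * of_real y * a y"] by blast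
  obtain K where "D_rep (\<lambda>_. 1) (\<lambda>z. 1 / Q z) K" using Wiener_D_rep[OF weight_one GRS_one QD \<delta>(1) Q\<delta>] by blast
  from D_mult_D_rep[OF weight_one Q'D this]
  have "D_rep (\<lambda>_. 1) (\<lambda>z. Q' z / Q z) (CQ' * K)" by simp
  then obtain c where c: "(\<lambda>y. 1 * norm (c y)) summable_on UNIV" "(\<lambda>z. Q' z / Q z) = trig_series UNIV c"
    unfolding D_rep_def by blast
  obtain l where l: "\<And>z. (l has_vector_derivative Q' z / Q z) (at z)" "\<And>z. Q z = exp (l z)"
    by (rule continuous_log_derivative[OF Qd Q'c Q0]) (rule that)
  define c0 where "c0 = c 0"
  define \<theta> where "\<theta> z = l z - c0 * of_real z" for z
  have \<theta>d: "(\<theta> has_vector_derivative (Q' z / Q z - c0)) (at z)" for z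
    unfolding \<theta>_def by (auto intro!: derivative_eq_intros l simp: has_vector_derivative_of_real)
  have lc: "continuous_on UNIV l"
    using l(1) has_vector_derivative_continuous by (metis continuous_at_imp_continuous_on)
  have Qc: "continuous_on UNIV Q" unfolding l(2) by (intro continuous_intros lc)

  \<comment> \<open>With the mean removed, a truncation of the series for the derivative of
    \<open>\<theta>\<close> has no frequency 0 and is integrated term by term, dividing by
    \<open>\<i> * of_real y\<close>. What is left has derivative at most
    \<open>\<eta>\<close>.\<close>
  have approx: "\<exists>T b. finite T \<and> (\<forall>z w. norm ((\<theta> z - (\<Sum>y\<in>T. b y * iexp (z * y))) - (\<theta> w - (\<Sum>y\<in>T. b y * iexp (w * y)))) \<le> \<eta> * \<bar>z - w\<bar>)"
    if \<eta>: "\<eta> > 0" for \<eta>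
  proof -
    obtain T where T: "finite T" "{0} \<subseteq> T" "D_rep (\<lambda>_. 1) (\<lambda>z. trig_series UNIV c z - (\<Sum>y\<in>T. c y * iexp (z * y))) \<eta>"
      by (rule D_rep_truncate[OF weight_one c(1) \<eta>, of "{0}"]) auto
    define b where "b y = c y / (\<i> * of_real y)" for y
    have "norm ((\<theta> z - (\<Sum>y\<in>T - {0}. b y * iexp (z * y))) - (\<theta> w - (\<Sum>y\<in>T - {0}. b y * iexp (w * y)))) \<le> \<eta> * \<bar>z - w\<bar>" for z w
    proof (rule lipschitz_of_vector_derivative)
      show "((\<lambda>x. \<theta> x - (\<Sum>y\<in>T - {0}. b y * iexp (x * y))) has_vector_derivative (Q' x / Q x - c0 - (\<Sum>y\<in>T - {0}. (\<i> * of_real y * b y) * iexp (x * y)))) (at x)" for x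
        by (intro has_vector_derivative_diff \<theta>d trig_polynomial_has_derivative)
      fix x
      have "(\<Sum>y\<in>T - {0}. (\<i> * of_real y * b y) * iexp (x * y)) = (\<Sum>y\<in>T - {0}. c y * iexp (x * y))"
        by (intro sum.cong) (auto simp: b_def)
      then have "c0 + (\<Sum>y\<in>T - {0}. (\<i> * of_real y * b y) * iexp (x * y)) = (\<Sum>y\<in>T. c y * iexp (x * y))"
        using T(1,2) sum.remove[of T 0 "\<lambda>y. c y * iexp (x * y)"] by (simp add: c0_def)
      then have "Q' x / Q x - c0 - (\<Sum>y\<in>T - {0}. (\<i> * of_real y * b y) * iexp (x * y)) = trig_series UNIV c x - (\<Sum>y\<in>T. c y * iexp (x * y))"
        unfolding fun_cong[OF c(2), symmetric] by (simp add: algebra_simps)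
      then show "norm (Q' x / Q x - c0 - (\<Sum>y\<in>T - {0}. (\<i> * of_real y * b y) * iexp (x * y))) \<le> \<eta>"
        using D_rep_bound[OF weight_one T(3), of x] by simp
    qed
    then show ?thesis using T(1) by (intro exI[of _ "T - {0}"] exI[of _ b]) auto
  qed

  define B where "B = (\<Sum>\<^sub>\<infinity>y. norm (c y)) + norm c0 + 1"
  have Bpos: "B > 0" unfolding B_def by (intro add_nonneg_pos add_nonneg_nonneg infsum_nonneg) auto
  have lip: "norm (\<theta> z - \<theta> w) \<le> B * \<bar>z - w\<bar>" for z w
  proof (rule lipschitz_of_vector_derivative[OF \<theta>d])
    fix x
    have "norm (Q' x / Q x) \<le> (\<Sum>\<^sub>\<infinity>y. norm (c y))"
      using norm_trig_series_le[of c UNIV x] c fun_cong[OF c(2), of x] by simp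
    then show "norm (Q' x / Q x - c0) \<le> B"
      using norm_triangle_ineq4[of "Q' x / Q x" c0] by (simp add: B_def)
  qed

  \<comment> \<open>The budget: the means stay within \<open>6 * e\<close> of \<open>A 0\<close>,
    and they differ from \<open>\<theta>\<close> by a trigonometric polynomial up to
    \<open>e\<close>. Altogether 7/40 is below the 1/4 that \<open>norm_exp_minus_1_le\<close> turns
    into 1/2.\<close>
  define e :: real where "e = 1 / 40"
  have e: "e > 0" by (simp add: e_def)
  have period: "norm (\<theta> (t + \<tau>) - \<theta> t) \<le> 4 * e" if \<tau>: "\<And>t. norm (Q (t + \<tau>) - Q t) \<le> e * \<delta>" for \<tau> t
  proof -
    define r where "r t = Q (t + \<tau>) / Q t" for t
    have r1: "norm (r t - 1) \<le> e" for t
    proof -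
      have "r t - 1 = (Q (t + \<tau>) - Q t) / Q t" using Q0[of t] by (simp add: r_def field_simps)
      then have "norm (r t - 1) = norm (Q (t + \<tau>) - Q t) / norm (Q t)" by (simp add: norm_divide)
      also have "\<dots> \<le> e * \<delta> / \<delta>" using \<tau>[of t] Q\<delta>[of t] \<delta>(1) e by (intro frac_le) auto
      finally show ?thesis using \<delta>(1) by simp
    qed
    have Lr: "norm (Ln (r t)) \<le> 2 * e" for t
    proof -
      have "norm (Ln (1 + (r t - 1))) \<le> 2 * norm (r t - 1)"
        by (rule norm_Ln_le) (use r1[of t] in \<open>simp add: e_def\<close>)
      then show ?thesis using r1[of t] by simp
    qed
    have r0: "r t \<notin> \<real>\<^sub>\<le>\<^sub>0" for t
    proof
      assume "r t \<in> \<real>\<^sub>\<le>\<^sub>0"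
      then have "Re (r t) \<le> 0" by (auto simp: complex_nonpos_Reals_iff)
      then have "1 \<le> \<bar>Re (r t - 1)\<bar>" by simp
      also have "\<dots> \<le> norm (r t - 1)" by (rule abs_Re_le_cmod)
      finally show False using r1[of t] by (simp add: e_def)
    qed
    \<comment> \<open>Both \<open>l (t + \<tau>) - l t\<close> and \<open>Ln (r t)\<close> are
      continuous logarithms of \<open>r t\<close>, the latter because \<open>r t\<close> stays close
      to 1, so their difference is constant.\<close>
    define N where "N t = l (t + \<tau>) - l t - Ln (r t)" for t
    have "continuous_on UNIV N"
      unfolding N_def r_def
      by (intro continuous_intros continuous_on_compose2[OF lc] continuous_on_compose2[OF Qc])
         (use Q0 r0 in \<open>auto simp: r_def\<close>)
    moreover have "exp (N t) = 1" for t
    proof -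
      have "r t \<noteq> 0" using Q0 by (simp add: r_def)
      then show ?thesis by (simp add: N_def exp_diff r_def l(2)[symmetric])
    qed
    ultimately have Nc: "N t = N 0" for t by (intro exp_eq_1_imp_constant[of UNIV N]) auto
    define D where "D = N 0 - c0 * of_real \<tau>"
    have step: "\<theta> (t + \<tau>) - \<theta> t = D + Ln (r t)" for t
      using Nc[of t] by (simp add: D_def N_def \<theta>_def algebra_simps)
    have multi: "norm (\<theta> (real k * \<tau>) - \<theta> 0 - of_nat k * D) \<le> real k * (2 * e)" for k
    proof (induction k)
      case (Suc k)
      have "\<theta> (real (Suc k) * \<tau>) - \<theta> 0 - of_nat (Suc k) * D = (\<theta> (real k * \<tau>) - \<theta> 0 - of_nat k * D) + Ln (r (real k * \<tau>))"
        using step[of "real k * \<tau>"] by (simp add: algebra_simps)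
      then have "norm (\<theta> (real (Suc k) * \<tau>) - \<theta> 0 - of_nat (Suc k) * D) \<le> real k * (2 * e) + 2 * e"
        using norm_triangle_mono[OF Suc Lr[of "real k * \<tau>"]] by (simp only:)
      then show ?case by (simp add: algebra_simps)
    qed simp
    \<comment> \<open>Otherwise \<open>\<theta>\<close> would grow linearly along the multiples of
      \<open>\<tau>\<close>. But up to a Lipschitz error with arbitrarily small constant it is a
      bounded trigonometric polynomial, so its growth is sublinear.\<close>
    have "norm D \<le> 2 * e"
    proof (rule ccontr)
      assume "\<not> norm D \<le> 2 * e"
      define \<eta> where "\<eta> = (norm D - 2 * e) / (2 * (\<bar>\<tau>\<bar> + 1))"
      have \<eta>: "\<eta> > 0" using \<open>\<not> norm D \<le> 2 * e\<close> by (simp add: \<eta>_def)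
      obtain T b where T: "finite T" "\<And>z w. norm ((\<theta> z - (\<Sum>y\<in>T. b y * iexp (z * y))) - (\<theta> w - (\<Sum>y\<in>T. b y * iexp (w * y)))) \<le> \<eta> * \<bar>z - w\<bar>"
        using approx[OF \<eta>] by blast
      define M where "M = (\<Sum>y\<in>T. norm (b y))"
      have TM: "norm (\<Sum>y\<in>T. b y * iexp (z * y)) \<le> M" for z
        unfolding M_def by (rule sum_norm_le) (simp add: norm_mult)
      have "real k * (norm D - 2 * e) \<le> 4 * M" for k
      proof -
        have 1: "norm (of_nat k * D) \<le> norm (\<theta> (real k * \<tau>) - \<theta> 0) + real k * (2 * e)"
          using multi[of k] norm_triangle_ineq4[of "\<theta> (real k * \<tau>) - \<theta> 0" "\<theta> (real k * \<tau>) - \<theta> 0 - of_nat k * D"] by simp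
        let ?U = "\<Sum>y\<in>T. b y * iexp (real k * \<tau> * y)" and ?V = "\<Sum>y\<in>T. b y * iexp (0 * y)"
        have "norm (((\<theta> (real k * \<tau>) - ?U) - (\<theta> 0 - ?V)) + (?U - ?V)) \<le> norm ((\<theta> (real k * \<tau>) - ?U) - (\<theta> 0 - ?V)) + norm (?U - ?V)"
          by (rule norm_triangle_ineq)
        also have "((\<theta> (real k * \<tau>) - ?U) - (\<theta> 0 - ?V)) + (?U - ?V) = \<theta> (real k * \<tau>) - \<theta> 0" by simp
        finally have "norm (\<theta> (real k * \<tau>) - \<theta> 0) \<le> norm ((\<theta> (real k * \<tau>) - ?U) - (\<theta> 0 - ?V)) + norm (?U - ?V)" .
        also have "\<dots> \<le> \<eta> * \<bar>real k * \<tau> - 0\<bar> + (M + M)"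
          by (intro add_mono T(2) order_trans[OF norm_triangle_ineq4] TM)
        also have "\<eta> * \<bar>real k * \<tau> - 0\<bar> \<le> real k * (\<eta> * (\<bar>\<tau>\<bar> + 1))"
          using \<eta> by (simp add: abs_mult algebra_simps)
        also have "\<eta> * (\<bar>\<tau>\<bar> + 1) = (norm D - 2 * e) / 2" unfolding \<eta>_def by (simp add: field_simps)
        finally have "norm (\<theta> (real k * \<tau>) - \<theta> 0) \<le> real k * ((norm D - 2 * e) / 2) + (M + M)" by simp
        moreover have "real k * ((norm D - 2 * e) / 2) = (real k * (norm D - 2 * e)) / 2" by (rule times_divide_eq_right)
        moreover have "real k * (norm D - 2 * e) = real k * norm D - real k * (2 * e)" by (rule right_diff_distrib)
        moreover have "norm (of_nat k * D) = real k * norm D" by (simp add: norm_mult)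
        ultimately show ?thesis using 1 by linarith
      qed
      moreover obtain k :: nat where "4 * M < real k * (norm D - 2 * e)"
        using reals_Archimedean3[of "norm D - 2 * e"] \<open>\<not> norm D \<le> 2 * e\<close> by auto
      ultimately show False by (meson not_less)
    qed
    then show ?thesis using step[of t] Lr[of t] norm_triangle_ineq[of D "Ln (r t)"] by simp
  qed

  have "e * \<delta> > 0" using e \<delta>(1) by simp
  from almost_periodic_net[OF weight_one QD this]
  obtain Z where Z: "finite Z" "\<And>z. \<exists>w\<in>Z. \<forall>t. norm (Q (t + z) - Q (t + w)) \<le> e * \<delta>" by blast
  \<comment> \<open>If \<open>z\<close> and \<open>w\<close> are indistinguishable for
    \<open>Q\<close>, then \<open>z - w\<close> is an almost period of \<open>Q\<close> and hence,
    with a worse constant, of \<open>\<theta>\<close>.\<close>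
  have net: "\<exists>w\<in>Z. \<forall>t. norm (\<theta> (t + z) - \<theta> (t + w)) \<le> 4 * e" for z
  proof -
    obtain w where w: "w \<in> Z" "\<And>t. norm (Q (t + z) - Q (t + w)) \<le> e * \<delta>" using Z(2) by blast
    have "norm (Q (t + (z - w)) - Q t) \<le> e * \<delta>" for t using w(2)[of "t - w"] by (simp add: algebra_simps)
    from period[OF this] have p: "norm (\<theta> (t + (z - w)) - \<theta> t) \<le> 4 * e" for t by blast
    have "norm (\<theta> (t + z) - \<theta> (t + w)) \<le> 4 * e" for t using p[of "t + w"] by (simp add: algebra_simps)
    then show ?thesis using w(1) by blast
  qed
  define M where "M = (\<Sum>w\<in>Z. norm (\<theta> w)) + 4 * e"
  have \<theta>M: "norm (\<theta> z) \<le> M" for z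
  proof -
    obtain w where w: "w \<in> Z" "norm (\<theta> (0 + z) - \<theta> (0 + w)) \<le> 4 * e" using net by blast
    have "norm (\<theta> w) \<le> (\<Sum>w\<in>Z. norm (\<theta> w))" by (rule member_le_sum) (use w Z in auto)
    then show ?thesis using w(2) norm_triangle_ineq2[of "\<theta> z" "\<theta> w"] by (simp add: M_def)
  qed
  have M0: "M \<ge> 0" using \<theta>M[of 0] norm_ge_zero order_trans by blast
  define rad where "rad = (\<Sum>w\<in>Z. \<bar>w\<bar>)"
  have rad: "\<bar>w\<bar> \<le> rad" if "w \<in> Z" for w unfolding rad_def by (rule member_le_sum) (use that Z in auto)
  \<comment> \<open>By its Lipschitz constant \<open>B\<close>, \<open>\<theta>\<close> changes by
    at most \<open>e\<close> over one step of the progression.\<close>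
  define h where "h = e / B"
  have h: "h > 0" using e Bpos by (simp add: h_def)
  have Bh: "B * h = e" using Bpos by (simp add: h_def)
  \<comment> \<open>Moving the start by one step changes a mean by at most \<open>2 * M / n\<close>.
    This \<open>n\<close> keeps the total below \<open>e\<close> for the \<open>rad / h + 1\<close>
    steps that reach any point of the net.\<close>
  obtain n :: nat where n: "2 * M * (rad / h + 1) / e < real n" using reals_Archimedean2 by blast
  have l0: "rad \<ge> 0" unfolding rad_def by (intro sum_nonneg) auto
  have n0: "n > 0"
  proof -
    have "0 \<le> 2 * M * (rad / h + 1) / e" using M0 l0 h e by auto
    then show ?thesis using n by (metis gr0I not_le of_nat_0)
  qed
  define A where "A z = (\<Sum>k<n. \<theta> (z + real k * h)) / n" for z
  have shift: "norm (A (x + real j * h) - A x) \<le> real j * (2 * M / n)" for x j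
  proof (induction j)
    case (Suc j)
    have "A (y + h) - A y = (\<theta> (y + real n * h) - \<theta> y) / n" for y
    proof -
      have "(\<Sum>k<n. \<theta> (y + h + real k * h)) - (\<Sum>k<n. \<theta> (y + real k * h)) = (\<Sum>k<n. \<theta> (y + real (Suc k) * h) - \<theta> (y + real k * h))"
        unfolding sum_subtractf[symmetric] by (intro sum.cong) (auto simp: algebra_simps)
      also have "\<dots> = \<theta> (y + real n * h) - \<theta> (y + real 0 * h)" by (rule sum_lessThan_telescope)
      finally show ?thesis by (simp add: A_def flip: diff_divide_distrib)
    qed
    then have "norm (A (x + real j * h + h) - A (x + real j * h)) = norm (\<theta> (x + real j * h + real n * h) - \<theta> (x + real j * h)) / n"
      by (simp add: norm_divide)
    also have "\<dots> \<le> (M + M) / n"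
      by (intro divide_right_mono order_trans[OF norm_triangle_ineq4] add_mono \<theta>M) auto
    finally have "norm (A (x + real j * h + h) - A (x + real j * h)) \<le> 2 * M / n" by simp
    then have "norm (A (x + real j * h + h) - A x) \<le> 2 * M / n + real j * (2 * M / n)"
      using norm_diff_triangle_le[OF _ Suc.IH] by blast
    then show ?case by (simp add: algebra_simps add_divide_distrib)
  qed simp
  have near: "norm (A x - A y) \<le> s" if "\<And>k. norm (\<theta> (x + real k * h) - \<theta> (y + real k * h)) \<le> s" for x y s
  proof -
    have "norm ((\<Sum>k<n. \<theta> (x + real k * h)) - (\<Sum>k<n. \<theta> (y + real k * h))) \<le> (\<Sum>k<n. s)"
      unfolding sum_subtractf[symmetric] by (rule sum_norm_le) (rule that)
    then have "norm (((\<Sum>k<n. \<theta> (x + real k * h)) - (\<Sum>k<n. \<theta> (y + real k * h))) / n) \<le> s"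
      using n0 by (simp add: norm_divide field_simps)
    then show ?thesis by (simp add: A_def diff_divide_distrib)
  qed
  have Anear: "norm (A x - A y) \<le> e" if "\<bar>x - y\<bar> \<le> h" for x y
  proof (rule near)
    fix k
    have "norm (\<theta> (x + real k * h) - \<theta> (y + real k * h)) \<le> B * \<bar>x - y\<bar>" using lip[of "x + real k * h" "y + real k * h"] by simp
    also have "\<dots> \<le> B * h" using that Bpos by (intro mult_left_mono) auto
    finally show "norm (\<theta> (x + real k * h) - \<theta> (y + real k * h)) \<le> e" by (simp add: Bh)
  qed
  have jb: "real j * (2 * M / n) \<le> e" if "real j \<le> rad / h + 1" for j
  proof -
    have "real j * (2 * M) \<le> (rad / h + 1) * (2 * M)" using that M0 by (intro mult_right_mono) auto
    also have "\<dots> \<le> e * n" using n e by (simp add: field_simps)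
    finally show ?thesis using n0 by (simp add: field_simps)
  qed
  \<comment> \<open>A whole number of steps leads from \<open>w\<close> to within \<open>h\<close>
    of 0; the steps together cost at most \<open>e\<close>, the remaining gap another
    \<open>e\<close>.\<close>
  have Aw: "norm (A w - A 0) \<le> 2 * e" if w: "w \<in> Z" for w
  proof -
    define j where "j = nat \<lfloor>\<bar>w\<bar> / h\<rfloor>"
    have fl: "real j \<le> \<bar>w\<bar> / h" "\<bar>w\<bar> / h < real j + 1"
      using h unfolding j_def by (simp_all add: of_nat_nat)
    then have r: "real j * h \<le> \<bar>w\<bar>" "\<bar>w\<bar> < (real j + 1) * h" using h by (simp_all add: field_simps)
    have "\<bar>w\<bar> / h \<le> rad / h" using rad[OF w] h by (intro divide_right_mono) auto
    then have J: "real j * (2 * M / n) \<le> e" using fl by (intro jb) linarith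
    show ?thesis
    proof (cases "w \<ge> 0")
      case True
      have "norm (A w - A (w - real j * h)) \<le> e" using shift[of "w - real j * h" j] J by simp
      moreover have "norm (A (w - real j * h) - A 0) \<le> e" by (rule Anear) (use True r in \<open>auto simp: algebra_simps\<close>)
      ultimately show ?thesis using norm_diff_triangle_le[of "A w" "A (w - real j * h)" e "A 0" e] by simp
    next
      case False
      have "norm (A w - A (w + real j * h)) \<le> e" using shift[of w j] J by (simp add: norm_minus_commute)
      moreover have "norm (A (w + real j * h) - A 0) \<le> e" by (rule Anear) (use False r in \<open>auto simp: algebra_simps\<close>)
      ultimately show ?thesis using norm_diff_triangle_le[of "A w" "A (w + real j * h)" e "A 0" e] by simp
    qed
  qed
  have A0: "norm (A z - A 0) \<le> 6 * e" for z
  proof -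
    obtain w where w: "w \<in> Z" "\<And>t. norm (\<theta> (t + z) - \<theta> (t + w)) \<le> 4 * e" using net by blast
    have "norm (\<theta> (z + t) - \<theta> (w + t)) \<le> 4 * e" for t using w(2)[of t] by (simp only: add.commute)
    then have "norm (A z - A w) \<le> 4 * e" by (rule near)
    then show ?thesis using norm_diff_triangle_le[OF _ Aw[OF w(1)]] by fastforce
  qed

  \<comment> \<open>The progression has length less than \<open>n * h\<close>, so the Lipschitz
    error accumulates to at most \<open>e\<close>.\<close>
  define \<eta> where "\<eta> = e / (n * h)"
  have \<eta>: "\<eta> > 0" using e n0 h by (simp add: \<eta>_def)
  obtain T b where T: "finite T" "\<And>z w. norm ((\<theta> z - (\<Sum>y\<in>T. b y * iexp (z * y))) - (\<theta> w - (\<Sum>y\<in>T. b y * iexp (w * y)))) \<le> \<eta> * \<bar>z - w\<bar>"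
    using approx[OF \<eta>] by blast
  define P where "P z = (\<Sum>y\<in>T. b y * iexp (z * y))" for z
  define b1 where "b1 y = (\<Sum>k<n. b y * (iexp (real k * h * y) - 1)) / n" for y
  have P1: "(\<Sum>k<n. P (z + real k * h) - P z) / n = (\<Sum>y\<in>T. b1 y * iexp (z * y))" for z
  proof -
    have "(\<Sum>k<n. P (z + real k * h) - P z) = (\<Sum>k<n. \<Sum>y\<in>T. b y * (iexp (real k * h * y) - 1) * iexp (z * y))"
      unfolding P_def sum_subtractf[symmetric]
      by (intro sum.cong refl) (simp add: ring_distribs exp_add mult_ac)
    also have "\<dots> = (\<Sum>y\<in>T. (\<Sum>k<n. b y * (iexp (real k * h * y) - 1)) * iexp (z * y))"
      unfolding sum_distrib_right by (rule sum.swap)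
    finally have eq: "(\<Sum>k<n. P (z + real k * h) - P z) = (\<Sum>y\<in>T. (\<Sum>k<n. b y * (iexp (real k * h * y) - 1)) * iexp (z * y))" .
    show ?thesis unfolding eq by (subst sum_divide_distrib) (simp add: b1_def)
  qed
  have A\<theta>: "norm (A z - \<theta> z - (\<Sum>y\<in>T. b1 y * iexp (z * y))) \<le> e" for z
  proof -
    have "norm (\<Sum>k<n. (\<theta> (z + real k * h) - P (z + real k * h)) - (\<theta> z - P z)) \<le> (\<Sum>k<n. e)"
    proof (rule sum_norm_le)
      fix k assume k: "k \<in> {..<n}"
      have "norm ((\<theta> (z + real k * h) - P (z + real k * h)) - (\<theta> z - P z)) \<le> \<eta> * \<bar>z + real k * h - z\<bar>"
        unfolding P_def by (rule T(2))
      also have "\<dots> \<le> \<eta> * (real n * h)" using \<eta> h k by (intro mult_left_mono) (auto simp: abs_mult)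
      also have "\<dots> = e" using n0 h by (simp add: \<eta>_def)
      finally show "norm ((\<theta> (z + real k * h) - P (z + real k * h)) - (\<theta> z - P z)) \<le> e" .
    qed
    then have 1: "norm ((\<Sum>k<n. (\<theta> (z + real k * h) - P (z + real k * h)) - (\<theta> z - P z)) / n) \<le> e"
      using n0 by (simp add: norm_divide field_simps)
    have "(\<Sum>k<n. (\<theta> (z + real k * h) - P (z + real k * h)) - (\<theta> z - P z)) = (\<Sum>k<n. \<theta> (z + real k * h)) - of_nat n * \<theta> z - (\<Sum>k<n. P (z + real k * h) - P z)"
      by (simp only: sum_subtractf sum_constant card_lessThan) (simp add: algebra_simps)
    then have "(\<Sum>k<n. (\<theta> (z + real k * h) - P (z + real k * h)) - (\<theta> z - P z)) / n = A z - \<theta> z - (\<Sum>k<n. P (z + real k * h) - P z) / n"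
      using n0 by (simp add: A_def diff_divide_distrib)
    with 1 show ?thesis unfolding P1 by simp
  qed
  \<comment> \<open>Frequency 0 carries the constant \<open>A 0\<close> around which the means
    stay.\<close>
  define S' where "S' = insert 0 T"
  define b' where "b' y = (if y = 0 then A 0 else 0) - (if y \<in> T then b1 y else 0)" for y
  have S': "finite S'" using T by (simp add: S'_def)
  have E: "(\<Sum>y\<in>S'. b' y * iexp (z * y)) = A 0 - (\<Sum>y\<in>T. b1 y * iexp (z * y))" for z
  proof -
    have "(\<Sum>y\<in>S'. b' y * iexp (z * y)) = (\<Sum>y\<in>S'. (if y = 0 then A 0 else 0) * iexp (z * y)) - (\<Sum>y\<in>S'. (if y \<in> T then b1 y else 0) * iexp (z * y))"
      unfolding sum_subtractf[symmetric] b'_def by (simp only: left_diff_distrib)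
    also have "(\<Sum>y\<in>S'. (if y = 0 then A 0 else 0) * iexp (z * y)) = (\<Sum>y\<in>{0}. A 0 * iexp (z * y))"
      by (rule sum.mono_neutral_cong_right) (use S' in \<open>auto simp: S'_def\<close>)
    also have "(\<Sum>y\<in>S'. (if y \<in> T then b1 y else 0) * iexp (z * y)) = (\<Sum>y\<in>T. b1 y * iexp (z * y))"
      by (rule sum.mono_neutral_cong_right) (use S' in \<open>auto simp: S'_def\<close>)
    finally show ?thesis by simp
  qed
  define W where "W z = \<theta> z - (\<Sum>y\<in>S'. b' y * iexp (z * y))" for z
  have Wb: "norm (W z) \<le> 1/4" for z
  proof -
    have "W z = (A z - A 0) - (A z - \<theta> z - (\<Sum>y\<in>T. b1 y * iexp (z * y)))" unfolding W_def E by simp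
    then have "norm (W z) \<le> norm (A z - A 0) + norm (A z - \<theta> z - (\<Sum>y\<in>T. b1 y * iexp (z * y)))"
      by (simp only: norm_triangle_ineq4)
    then show ?thesis using A0[of z] A\<theta>[of z] by (simp add: e_def)
  qed
  have form: "Q z * exp (- (c0 * of_real z)) * exp (- (\<Sum>y\<in>S'. b' y * iexp (z * y))) = exp (W z)" for z
    by (simp only: l(2) W_def \<theta>_def exp_add[symmetric] diff_conv_add_uminus)

  \<comment> \<open>The modulus of \<open>Q\<close> lies between positive constants and
    \<open>\<theta>\<close> is bounded, so the real part of \<open>c0 * z\<close> is bounded in
    \<open>z\<close>. This makes the frequency \<open>\<gamma>\<close> real.\<close>
  have Re0: "Re c0 = 0"
  proof (rule ccontr)
    assume ne: "Re c0 \<noteq> 0"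
    define K where "K = max (ln (CQ + 1)) (- ln \<delta>) + M"
    have "\<bar>Re c0 * z\<bar> \<le> K" for z
    proof -
      have "norm (Q z) = exp (Re (l z))" by (simp add: l(2))
      then have 1: "Re (l z) = ln (norm (Q z))" by simp
      have pos: "norm (Q z) > 0" using Q0 by simp
      have CQ: "norm (Q z) \<le> CQ + 1" using D_rep_bound[OF weight_one QD, of z] by simp
      have "ln (norm (Q z)) \<le> ln (CQ + 1)" by (rule ln_mono[OF CQ pos])
      moreover have "ln \<delta> \<le> ln (norm (Q z))" by (rule ln_mono[OF Q\<delta> \<delta>(1)])
      moreover have "\<bar>Re (\<theta> z)\<bar> \<le> M" using abs_Re_le_cmod[of "\<theta> z"] \<theta>M[of z] by linarith
      moreover have "Re (l z) = Re (\<theta> z) + Re c0 * z" by (simp add: \<theta>_def)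
      moreover have "ln (CQ + 1) \<le> K - M" "- ln \<delta> \<le> K - M" by (simp_all add: K_def)
      ultimately show ?thesis using 1 by linarith
    qed
    from this[of "(K + 1) / Re c0"] ne show False by (simp add: abs_if split: if_splits)
  qed
  have c0: "c0 = \<i> * of_real (Im c0)" using Re0 by (simp add: complex_eq_iff)
  show thesis
  proof (rule that[OF S', of "Im c0" b'])
    fix z
    have "(\<Sum>y\<in>S. a y * iexp (z * y)) * exp (- (\<i> * Im c0 * z)) * exp (- (\<Sum>y\<in>S'. b' y * iexp (z * y))) = exp (W z)"
      using form[of z] unfolding Q_def by (subst (asm) c0) simp
    moreover have "norm (exp (W z) - 1) \<le> 2 * norm (W z)" by (rule norm_exp_minus_1_le) (use Wb[of z] in simp)
    ultimately show "norm (1 - (\<Sum>y\<in>S. a y * iexp (z * y)) * exp (- (\<i> * Im c0 * z)) * exp (- (\<Sum>y\<in>S'. b' y * iexp (z * y)))) \<le> 1/2"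
      using Wb[of z] by (simp add: norm_minus_commute)
  qed
qed

text \<open>For a truncation \<open>Q\<close> the Bohr representation leaves a factor close to 1,
  and \<open>P / Q\<close> is close to 1 as well: the tolerance \<open>\<delta> / 4\<close> gives
  distance at most 1/3. Both factors have logarithms in the weighted algebra.\<close>

theorem D_rep_logarithm:
  assumes w: "is_weight \<omega>" and G: "GRS \<omega>" and P: "D_rep \<omega> P C"
    and \<delta>: "\<delta> > 0" "\<And>z. norm (P z) \<ge> \<delta>"
  shows "\<exists>(\<gamma>::real) H K. R_rep \<omega> H K \<and> (\<forall>z. P z = exp (\<i> * \<gamma> * of_real z + H z))"
proof -
  obtain a where a: "(\<lambda>y. \<omega> y * norm (a y)) summable_on UNIV" "P = trig_series UNIV a"
    using P unfolding D_rep_def by blast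
  have e: "\<delta> / 4 > 0" using \<delta>(1) by simp
  obtain S where S: "finite S" "D_rep \<omega> (\<lambda>z. P z - (\<Sum>y\<in>S. a y * iexp (z * y))) (\<delta> / 4)"
    using D_rep_truncate[OF w a(1) e, of "{}"] a(2) by auto
  define Q where "Q z = (\<Sum>y\<in>S. a y * iexp (z * y))" for z
  have PQ: "norm (P z - Q z) \<le> \<delta> / 4" for z
    using D_rep_bound[OF w S(2), of z] by (simp add: Q_def)
  have Q\<delta>: "norm (Q z) \<ge> 3 * \<delta> / 4" for z
    using PQ[of z] \<delta>(2)[of z] norm_triangle_ineq2[of "P z" "Q z"] by simp
  obtain CQ where QD: "D_rep \<omega> Q CQ" unfolding Q_def[abs_def] using D_rep_finite[OF w S(1)] by blast
  have Q0: "Q z \<noteq> 0" for z using Q\<delta>[of z] \<delta>(1) by auto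
  have \<delta>3: "3 * \<delta> / 4 > 0" using \<delta>(1) by simp
  obtain \<gamma> :: real and S' b where b: "finite S'"
    "\<And>z. norm (1 - (\<Sum>y\<in>S. a y * iexp (z * y)) * exp (- (\<i> * \<gamma> * z)) * exp (- (\<Sum>y\<in>S'. b y * iexp (z * y)))) \<le> 1/2"
    by (rule Bohr_argument[OF S(1) \<delta>3, of a]) (use Q\<delta> that in \<open>auto simp: Q_def\<close>)
  define E where "E z = (\<Sum>y\<in>S'. b y * iexp (z * y))" for z
  obtain CE where ED: "R_rep \<omega> E CE" unfolding E_def[abs_def] using R_rep_D[OF D_rep_finite[OF w b(1)]] by blast
  obtain CE' where ED': "R_rep \<omega> (\<lambda>z. exp (-1 * E z)) CE'" using R_rep_exp[OF w R_rep_cmult[OF w ED]] by blast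
  have R1: "R_rep \<omega> (\<lambda>z. 1 * iexp (z * (- \<gamma>)) * Q z) (norm (1::complex) * \<omega> (- \<gamma>) * CQ)"
    by (rule R_rep_modulate[OF w R_rep_D[OF QD]])
  have half: "(1/2::real) < 1" by simp
  have RE: "R_rep \<omega> (\<lambda>z. 1 * iexp (z * (- \<gamma>)) * Q z * exp (-1 * E z)) (norm (1::complex) * \<omega> (- \<gamma>) * CQ * CE')"
    by (rule R_rep_mult[OF w R1 ED'])
  have nE: "norm (1 - 1 * iexp (z * (- \<gamma>)) * Q z * exp (-1 * E z)) \<le> 1/2" for z
    using b(2)[of z] by (simp add: Q_def E_def mult_ac)
  obtain H1 K1 where H1: "R_rep \<omega> H1 K1" "\<And>z. 1 * iexp (z * (- \<gamma>)) * Q z * exp (-1 * E z) = exp (H1 z)"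
    using R_rep_inverse_near_1(2)[OF w G RE half nE] by blast
  obtain K where "D_rep \<omega> (\<lambda>z. 1 / Q z) K" using Wiener_D_rep[OF w G QD \<delta>3 Q\<delta>] by blast
  from R_rep_D[OF D_mult_D_rep[OF w P this]] have RP: "R_rep \<omega> (\<lambda>z. P z / Q z) (C * K)" by simp
  have nP: "norm (1 - P z / Q z) \<le> 1/2" for z
  proof -
    have "1 - P z / Q z = - ((P z - Q z) / Q z)" using Q0[of z] by (simp add: field_simps)
    then have "norm (1 - P z / Q z) = norm (P z - Q z) / norm (Q z)" by (simp only: norm_minus_cancel norm_divide)
    also have "\<dots> \<le> (\<delta> / 4) / (3 * \<delta> / 4)" using PQ[of z] Q\<delta>[of z] \<delta>(1) by (intro frac_le) auto
    also have "\<dots> \<le> 1/2" using \<delta>(1) by simp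
    finally show ?thesis .
  qed
  obtain H2 K2 where H2: "R_rep \<omega> H2 K2" "\<And>z. P z / Q z = exp (H2 z)"
    using R_rep_inverse_near_1(2)[OF w G RP half nP] by blast
  have "R_rep \<omega> (\<lambda>z. H1 z + H2 z + E z) (K1 + K2 + CE)"
    by (intro R_rep_add[OF w] H1 H2 ED)
  moreover have "P z = exp (\<i> * \<gamma> * of_real z + (H1 z + H2 z + E z))" for z
  proof -
    have "exp (\<i> * \<gamma> * of_real z + (H1 z + H2 z + E z)) = iexp (z * \<gamma>) * exp (E z) * exp (H1 z) * exp (H2 z)"
      by (simp add: exp_add mult_ac)
    also have "\<dots> = iexp (z * \<gamma>) * exp (E z) * (iexp (z * (- \<gamma>)) * Q z * exp (-1 * E z)) * (P z / Q z)"
      by (simp add: H1(2)[symmetric] H2(2)[symmetric])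
    also have "\<dots> = P z" using Q0[of z] by (simp add: exp_minus field_simps)
    finally show ?thesis by simp
  qed
  ultimately show ?thesis by blast
qed

section \<open>One-sided exponentials, the winding exponent and the Cayley transform\<close>

lemma integrable_exp_minus_atLeast:
  assumes c: "(c::real) > 0"
  shows "integrable lborel (\<lambda>x. indicator {0..} x * exp (- c * x))"
proof (rule integrableI_bounded)
  have "(\<integral>\<^sup>+x. ennreal (exp (- c * x)) * indicator {0..} x \<partial>lborel) = 0 - (- exp (- c * 0) / c)"
  proof (rule nn_integral_FTC_atLeast)
    show "((\<lambda>x. - exp (- c * x) / c) has_real_derivative exp (- c * x)) (at x)" for x
      using c by (auto intro!: derivative_eq_intros)
    have "((\<lambda>x. exp (- (c * x))) \<longlongrightarrow> 0) at_top"
      by (rule filterlim_compose[OF exp_at_bot], rule filterlim_uminus_at_bot_at_top[THEN filterlim_compose])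
         (rule filterlim_tendsto_pos_mult_at_top[OF tendsto_const c filterlim_ident])
    then have "((\<lambda>x. - exp (- (c * x)) / c) \<longlongrightarrow> - 0 / c) at_top"
      by (intro tendsto_intros) (use c in auto)
    then show "((\<lambda>x. - exp (- c * x) / c) \<longlongrightarrow> 0) at_top" by simp
  qed auto
  moreover have "ennreal (norm (indicator {0..} x * exp (- c * x))) = ennreal (exp (- c * x)) * indicator {0..} x" for x
    by (auto simp: indicator_def)
  ultimately show "(\<integral>\<^sup>+x. ennreal (norm (indicator {0..} x * exp (- c * x))) \<partial>lborel) < \<infinity>"
    by simp
qed measurable

lemma integrable_exp_minus_abs:
  assumes c: "(c::real) > 0"
  shows "integrable lborel (\<lambda>x. exp (- c * \<bar>x\<bar>))"
proof (rule Bochner_Integration.integrable_bound)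
  have "integrable lborel (\<lambda>x. indicator {0..} (- x) * exp (- c * (- x)))"
    using lborel_integrable_real_affine[OF integrable_exp_minus_atLeast[OF c], of "-1" 0] by simp
  then show "integrable lborel (\<lambda>x. indicator {0..} x * exp (- c * x) + indicator {0..} (- x) * exp (- c * (- x)))"
    by (intro Bochner_Integration.integrable_add integrable_exp_minus_atLeast c)
  show "AE x in lborel. norm (exp (- c * \<bar>x\<bar>)) \<le> norm (indicator {0..} x * exp (- c * x) + indicator {0..} (- x) * exp (- c * (- x)))"
    by (rule AE_I2) (auto simp: indicator_def abs_if)
qed measurable

text \<open>Its transform is \<open>1 / (1 - \<i> * z)\<close>. The Cayley transform and its inverse
  are \<open>-1\<close> plus twice the transform of this function and of its reflection,
  respectively.\<close>

definition half_exp :: "real \<Rightarrow> complex" where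
  "half_exp x = of_real (indicator {0..} x * exp (- x))"

lemma half_exp_integrable: "integrable lborel half_exp"
  unfolding half_exp_def[abs_def] using integrable_exp_minus_atLeast[of 1] by (intro integrable_of_real) simp

lemma half_exp_measurable [measurable]: "half_exp \<in> borel_measurable borel"
  unfolding half_exp_def by measurable

lemma one_minus_iz_nonzero: "1 - \<i> * complex_of_real z \<noteq> 0" "1 + \<i> * complex_of_real z \<noteq> 0"
  by (auto simp: complex_eq_iff)

lemma fourier_half_exp: "fourier half_exp z = 1 / (1 - \<i> * z)"
proof -
  define c where "c = \<i> * complex_of_real z - 1"
  have c0: "c \<noteq> 0" by (auto simp: c_def complex_eq_iff)
  define f where "f x = exp (c * complex_of_real x)" for x
  have fn: "norm (f x) = exp (- x)" for x by (simp add: f_def c_def)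
  have eq: "half_exp x * iexp (z * x) = indicator {0..} x *\<^sub>R f x" for x
    by (simp add: half_exp_def f_def c_def scaleR_conv_of_real exp_of_real[symmetric] ring_distribs exp_add[symmetric] exp_diff exp_minus field_simps)
  have si: "set_integrable lborel (einterval 0 \<infinity>) f"
  proof -
    have "integrable lborel (\<lambda>x. indicator {0..} x *\<^sub>R f x)"
      unfolding eq[symmetric] by (rule integrable_mult_iexp[OF half_exp_integrable])
    then have "set_integrable lborel {0..} f" by (simp add: set_integrable_def)
    then show ?thesis by (rule set_integrable_subset) (auto simp: einterval_def)
  qed
  have "(LBINT x=0..\<infinity>. f x) = 0 - 1 / c"
  proof (rule interval_integral_FTC_integrable[where F="\<lambda>x. f x / c"])
    show "((\<lambda>x. f x / c) has_vector_derivative f x) (at x)" for x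
    proof -
      have "((\<lambda>w. exp (c * w) / c) has_field_derivative exp (c * of_real x)) (at (of_real x))"
        using c0 by (auto intro!: derivative_eq_intros)
      from has_vector_derivative_real_field[OF this] show ?thesis by (simp add: f_def)
    qed
    show "isCont f x" for x unfolding f_def by (intro continuous_intros)
    show "set_integrable lborel (einterval 0 \<infinity>) f" by (rule si)
    have "((\<lambda>x. f x / c) \<longlongrightarrow> f 0 / c) (at_right 0)"
      unfolding f_def by (intro tendsto_intros) (rule c0)
    then show "(((\<lambda>x. f x / c) \<circ> real_of_ereal) \<longlongrightarrow> 1 / c) (at_right 0)"
      unfolding zero_ereal_def ereal_tendsto_simps by (simp add: f_def)
    have "((\<lambda>x. norm (f x / c)) \<longlongrightarrow> 0 / norm c) at_top"
      unfolding norm_divide fn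
      using tendsto_divide[OF filterlim_compose[OF exp_at_bot filterlim_uminus_at_bot_at_top] tendsto_const[of "norm c"]] c0 by simp
    then have "((\<lambda>x. f x / c) \<longlongrightarrow> 0) at_top" by (subst tendsto_norm_zero_iff[symmetric]) simp
    then show "(((\<lambda>x. f x / c) \<circ> real_of_ereal) \<longlongrightarrow> 0) (at_left \<infinity>)"
      unfolding ereal_tendsto_simps .
  qed simp
  moreover have "(LBINT x=0..\<infinity>. f x) = (LINT x|lborel. indicator {0<..} x *\<^sub>R f x)"
    by (simp add: interval_lebesgue_integral_def set_lebesgue_integral_def einterval_def greaterThan_def)
  moreover have "(LINT x|lborel. indicator {0<..} x *\<^sub>R f x) = (LINT x|lborel. indicator {0..} x *\<^sub>R f x)"
  proof (rule integral_cong_AE)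
    have [measurable]: "f \<in> borel_measurable borel" unfolding f_def by measurable
    show "(\<lambda>x. indicat_real {0<..} x *\<^sub>R f x) \<in> borel_measurable lborel"
      "(\<lambda>x. indicat_real {0..} x *\<^sub>R f x) \<in> borel_measurable lborel" by measurable
    show "AE x in lborel. indicat_real {0<..} x *\<^sub>R f x = indicat_real {0..} x *\<^sub>R f x"
      using AE_lborel_singleton[of 0] by eventually_elim (auto simp: indicator_def)
  qed
  ultimately have "fourier half_exp z = 0 - 1 / c" unfolding fourier_def eq by simp
  also have "\<dots> = 1 / (1 - \<i> * z)"
    using c0 one_minus_iz_nonzero(1)[of z] by (simp add: c_def field_simps)
  finally show ?thesis .
qed

lemma fourier_reflect: "fourier (\<lambda>x. f (- x)) z = fourier f (- z)"
proof -
  have "fourier f (- z) = (LINT x|lborel. f (0 + -1 * x) * iexp (- z * (0 + -1 * x)))"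
    unfolding fourier_def by (subst lborel_integral_real_affine[where c="-1" and t=0]) auto
  then show ?thesis by (simp add: fourier_def)
qed

text \<open>The GRS condition bounds the weight by a multiple of
  \<open>exp (\<bar>x\<bar> / 2)\<close>, which leaves half of the exponential decay.\<close>

lemma half_exp_L1_weighted:
  assumes w: "is_weight \<omega>" and G: "GRS \<omega>"
  shows "half_exp \<in> L1_weighted \<omega>" "(\<lambda>x. half_exp (- x)) \<in> L1_weighted \<omega>"
proof -
  obtain C where C: "C \<ge> 1" "\<And>t. \<omega> t \<le> C * exp (1/2 * \<bar>t\<bar>)"
    using GRS_exp_bound[OF w G, of "1/2"] by auto
  have [measurable]: "\<omega> \<in> borel_measurable borel" by (rule weight_measurable[OF w])
  have i: "integrable lborel (\<lambda>x. C * exp (- (1/2) * \<bar>x\<bar>))"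
    by (intro integrable_mult_right integrable_exp_minus_abs) simp
  have b: "\<omega> x * u \<le> C * exp (- (1/2) * \<bar>x\<bar>)" if "u \<le> exp (- \<bar>x\<bar>)" "0 \<le> u" for x u
  proof -
    have "\<omega> x * u \<le> (C * exp (1/2 * \<bar>x\<bar>)) * exp (- \<bar>x\<bar>)"
      using that C weight_nonneg[OF w, of x] by (intro mult_mono) auto
    also have "\<dots> = C * exp (1/2 * \<bar>x\<bar> + - \<bar>x\<bar>)" unfolding exp_add by simp
    finally show ?thesis by simp
  qed
  have "integrable lborel (\<lambda>x. \<omega> x * norm (half_exp x))"
    by (rule Bochner_Integration.integrable_bound[OF i])
       (use C weight_nonneg[OF w] b in \<open>auto simp: half_exp_def indicator_def abs_mult\<close>)
  then show "half_exp \<in> L1_weighted \<omega>" by (simp add: L1_weighted_def)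
  have "integrable lborel (\<lambda>x. \<omega> x * norm (half_exp (- x)))"
    by (rule Bochner_Integration.integrable_bound[OF i])
       (use C weight_nonneg[OF w] b in \<open>auto simp: half_exp_def indicator_def abs_mult\<close>)
  then show "(\<lambda>x. half_exp (- x)) \<in> L1_weighted \<omega>" by (simp add: L1_weighted_def)
qed

definition winding_exponent :: "real \<Rightarrow> complex" where
  "winding_exponent z = (LINT x|lborel. of_real (exp (- \<bar>x\<bar>) / \<bar>x\<bar> * sgn x) * (iexp (z * x) - 1))"

lemma winding_exponent_integrable:
  "integrable lborel (\<lambda>x. complex_of_real (exp (- \<bar>x\<bar>) / \<bar>x\<bar> * sgn x) * (iexp (z * x) - 1))"
proof (rule Bochner_Integration.integrable_bound)
  show "integrable lborel (\<lambda>x. \<bar>z\<bar> * exp (- 1 * \<bar>x\<bar>))"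
    by (intro integrable_mult_right integrable_exp_minus_abs) simp
  show "AE x in lborel. norm (complex_of_real (exp (- \<bar>x\<bar>) / \<bar>x\<bar> * sgn x) * (iexp (z * x) - 1)) \<le> norm (\<bar>z\<bar> * exp (- 1 * \<bar>x\<bar>))"
  proof (rule AE_I2)
    fix x :: real
    show "norm (complex_of_real (exp (- \<bar>x\<bar>) / \<bar>x\<bar> * sgn x) * (iexp (z * x) - 1)) \<le> norm (\<bar>z\<bar> * exp (- 1 * \<bar>x\<bar>))"
    proof (cases "x = 0")
      case False
      have "norm (complex_of_real (exp (- \<bar>x\<bar>) / \<bar>x\<bar> * sgn x) * (iexp (z * x) - 1)) = exp (- \<bar>x\<bar>) / \<bar>x\<bar> * norm (iexp (z * x) - 1)"
        using False unfolding norm_mult norm_of_real abs_mult by (simp add: abs_sgn_eq)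
      also have "\<dots> \<le> exp (- \<bar>x\<bar>) / \<bar>x\<bar> * \<bar>z * x\<bar>"
        using iexp_approx1[of "z * x" 0] by (intro mult_left_mono) auto
      also have "\<dots> = \<bar>z\<bar> * exp (- \<bar>x\<bar>)" using False by (simp add: abs_mult)
      finally show ?thesis by (simp add: abs_mult)
    qed simp
  qed
qed measurable

text \<open>The factor \<open>x\<close> produced by differentiation cancels the singularity of the
  kernel, leaving \<open>\<i>\<close> times the transform of \<open>exp (- \<bar>x\<bar>)\<close>.
  The Taylor remainder of second order, of size \<open>h\<^sup>2 * x\<^sup>2 / 2\<close>, justifies
  differentiating under the integral.\<close>

lemma winding_exponent_derivative:
  "(winding_exponent has_vector_derivative (\<i> * (2 / (1 + z\<^sup>2)))) (at z)"
proof -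
  define E where "E x = complex_of_real (exp (- \<bar>x\<bar>))" for x
  have Ei: "integrable lborel E" unfolding E_def[abs_def] using integrable_exp_minus_abs[of 1] by (intro integrable_of_real) simp
  have [measurable]: "E \<in> borel_measurable borel" using Ei by auto
  have FE: "fourier E z = 2 / (1 + z\<^sup>2)" for z
  proof -
    have "fourier E z = fourier (\<lambda>x. half_exp x + half_exp (- x)) z"
    proof (rule fourier_cong_AE)
      show "AE x in lborel. E x = half_exp x + half_exp (- x)"
        using AE_lborel_singleton[of 0] by eventually_elim (auto simp: E_def half_exp_def indicator_def)
    qed measurable
    also have "\<dots> = fourier half_exp z + fourier (\<lambda>x. half_exp (- x)) z"
      using lborel_integrable_real_affine[OF half_exp_integrable, of "-1" 0]
      by (intro fourier_add half_exp_integrable) simp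
    also have "\<dots> = 1 / (1 - \<i> * z) + 1 / (1 + \<i> * z)"
      by (simp add: fourier_reflect fourier_half_exp)
    also have "\<dots> = 2 / ((1 - \<i> * z) * (1 + \<i> * z))"
      using one_minus_iz_nonzero[of z] by (simp add: field_simps)
    also have "(1 - \<i> * z) * (1 + \<i> * z) = 1 + (of_real z)\<^sup>2" by (simp add: algebra_simps power2_eq_square)
    finally show ?thesis by simp
  qed
  define N :: real where "N = (LINT x|lborel. \<bar>x\<bar> * exp (- \<bar>x\<bar>))"
  have Ni: "integrable lborel (\<lambda>x::real. \<bar>x\<bar> * exp (- \<bar>x\<bar>))"
  proof (rule Bochner_Integration.integrable_bound)
    show "integrable lborel (\<lambda>x::real. 2 * exp (- (1/2) * \<bar>x\<bar>))"
      by (intro integrable_mult_right integrable_exp_minus_abs) simp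
    show "AE x in lborel. norm (\<bar>x\<bar> * exp (- \<bar>x\<bar>)) \<le> norm (2 * exp (- (1/2) * \<bar>x\<bar>) :: real)"
    proof (rule AE_I2)
      fix x :: real
      have "\<bar>x\<bar> \<le> 2 * exp (1/2 * \<bar>x\<bar>)" using exp_ge_add_one_self[of "1/2 * \<bar>x\<bar>"] by linarith
      then have "\<bar>x\<bar> * exp (- \<bar>x\<bar>) \<le> 2 * exp (1/2 * \<bar>x\<bar>) * exp (- \<bar>x\<bar>)" by (rule mult_right_mono) simp
      also have "\<dots> = 2 * exp (1/2 * \<bar>x\<bar> + - \<bar>x\<bar>)" unfolding exp_add by simp
      finally show "norm (\<bar>x\<bar> * exp (- \<bar>x\<bar>)) \<le> norm (2 * exp (- (1/2) * \<bar>x\<bar>) :: real)" by (simp add: abs_mult)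
    qed
  qed measurable
  let ?k = "\<lambda>x. complex_of_real (exp (- \<bar>x\<bar>) / \<bar>x\<bar> * sgn x)"
  have est: "norm (winding_exponent (z + h) - winding_exponent z - h *\<^sub>R (\<i> * fourier E z)) \<le> N / 2 * h\<^sup>2" for z h
  proof -
    have "winding_exponent (z + h) - winding_exponent z - h *\<^sub>R (\<i> * fourier E z)
       = (LINT x|lborel. ?k x * (iexp ((z + h) * x) - 1)) - (LINT x|lborel. ?k x * (iexp (z * x) - 1)) - (LINT x|lborel. (h * \<i>) * (E x * iexp (z * x)))"
      unfolding winding_exponent_def fourier_def integral_mult_right_zero scaleR_conv_of_real by (simp only: mult.assoc)
    also have "\<dots> = (LINT x|lborel. ?k x * (iexp ((z + h) * x) - 1) - ?k x * (iexp (z * x) - 1) - (h * \<i>) * (E x * iexp (z * x)))"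
      by (simp only: Bochner_Integration.integral_diff[OF winding_exponent_integrable winding_exponent_integrable]
          Bochner_Integration.integral_diff[OF Bochner_Integration.integrable_diff[OF winding_exponent_integrable winding_exponent_integrable] integrable_mult_right[OF integrable_mult_iexp[OF Ei]]])
    also have "\<dots> = (LINT x|lborel. ?k x * iexp (z * x) * (iexp (h * x) - 1 - \<i> * (h * x)))"
    proof (rule integral_cong_AE)
      show "AE x in lborel. ?k x * (iexp ((z + h) * x) - 1) - ?k x * (iexp (z * x) - 1) - (h * \<i>) * (E x * iexp (z * x))
          = ?k x * iexp (z * x) * (iexp (h * x) - 1 - \<i> * (h * x))"
        using AE_lborel_singleton[of 0]
      proof eventually_elim
        case (elim x)
        have kx: "E x = ?k x * x"
          using elim unfolding E_def of_real_mult[symmetric] by (simp add: sgn_if abs_if)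
        have e: "iexp ((z + h) * x) = iexp (z * x) * iexp (h * x)"
          by (simp only: ring_distribs of_real_add exp_add)
        define k where "k = ?k x"
        show ?case unfolding kx e k_def[symmetric] by (simp add: algebra_simps)
      qed
    qed measurable
    finally have eq: "winding_exponent (z + h) - winding_exponent z - h *\<^sub>R (\<i> * fourier E z)
       = (LINT x|lborel. ?k x * iexp (z * x) * (iexp (h * x) - 1 - \<i> * (h * x)))" .
    have "norm (LINT x|lborel. ?k x * iexp (z * x) * (iexp (h * x) - 1 - \<i> * (h * x))) \<le> (LINT x|lborel. h\<^sup>2 / 2 * (\<bar>x\<bar> * exp (- \<bar>x\<bar>)))"
    proof (rule Bochner_Integration.integral_norm_bound_integral)
      show *: "integrable lborel (\<lambda>x. h\<^sup>2 / 2 * (\<bar>x\<bar> * exp (- \<bar>x\<bar>)))" by (intro integrable_mult_right Ni)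
      have **: "norm (?k x * iexp (z * x) * (iexp (h * x) - 1 - \<i> * (h * x))) \<le> h\<^sup>2 / 2 * (\<bar>x\<bar> * exp (- \<bar>x\<bar>))" for x
      proof (cases "x = 0")
        case False
        have i: "norm (iexp (h * x) - 1 - \<i> * (h * x)) \<le> \<bar>h * x\<bar>\<^sup>2 / 2"
          using iexp_approx1[of "h * x" 1] by (simp add: numeral_2_eq_2 algebra_simps)
        have "norm (?k x * iexp (z * x) * (iexp (h * x) - 1 - \<i> * (h * x))) = exp (- \<bar>x\<bar>) / \<bar>x\<bar> * norm (iexp (h * x) - 1 - \<i> * (h * x))"
          using False unfolding norm_mult norm_of_real abs_mult by (simp add: abs_sgn_eq)
        also have "\<dots> \<le> exp (- \<bar>x\<bar>) / \<bar>x\<bar> * (\<bar>h * x\<bar>\<^sup>2 / 2)"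
          by (intro mult_left_mono i) auto
        also have "\<dots> = h\<^sup>2 / 2 * (\<bar>x\<bar> * exp (- \<bar>x\<bar>))" using False by (simp add: power2_eq_square field_simps abs_if)
        finally show ?thesis .
      qed simp
      then show "norm (?k x * iexp (z * x) * (iexp (h * x) - 1 - \<i> * (h * x))) \<le> h\<^sup>2 / 2 * (\<bar>x\<bar> * exp (- \<bar>x\<bar>))" for x .
      show "integrable lborel (\<lambda>x. ?k x * iexp (z * x) * (iexp (h * x) - 1 - \<i> * (h * x)))"
        by (rule Bochner_Integration.integrable_bound[OF *], measurable)
           (rule AE_I2, unfold real_norm_def, rule order_trans[OF ** abs_ge_self])
    qed
    also have "\<dots> = h\<^sup>2 / 2 * N" unfolding N_def by (rule integral_mult_right_zero)
    also have "\<dots> = N / 2 * h\<^sup>2" by simp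
    finally show ?thesis unfolding eq .
  qed
  have "((\<lambda>h. norm (winding_exponent (z + h) - winding_exponent z - h *\<^sub>R (\<i> * fourier E z)) / norm h) \<longlongrightarrow> 0) (at 0)"
  proof (rule Lim_null_comparison)
    have "((\<lambda>h. N / 2 * \<bar>h\<bar>) \<longlongrightarrow> N / 2 * \<bar>0\<bar>) (at 0)" by (intro tendsto_intros)
    then show "((\<lambda>h. N / 2 * \<bar>h\<bar>) \<longlongrightarrow> 0) (at (0::real))" by simp
    show "\<forall>\<^sub>F h in at 0. norm (norm (winding_exponent (z + h) - winding_exponent z - h *\<^sub>R (\<i> * fourier E z)) / norm h) \<le> N / 2 * \<bar>h\<bar>"
      unfolding eventually_at_filter
    proof (intro always_eventually allI impI)
      fix h :: real assume "h \<noteq> 0"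
      then show "norm (norm (winding_exponent (z + h) - winding_exponent z - h *\<^sub>R (\<i> * fourier E z)) / norm h) \<le> N / 2 * \<bar>h\<bar>"
        using est[of z h] by (simp add: divide_le_eq power2_eq_square abs_mult_self_eq mult.assoc)
    qed
  qed
  then have "(winding_exponent has_vector_derivative (\<i> * fourier E z)) (at z)"
    unfolding has_vector_derivative_def has_derivative_at by (intro conjI bounded_linear_scaleR_left)
  then show ?thesis by (simp add: FE)
qed

lemma winding_exponent_eq: "winding_exponent z = 2 * \<i> * of_real (arctan z)"
proof -
  have d: "((\<lambda>z. winding_exponent z - 2 * \<i> * of_real (arctan z)) has_vector_derivative 0) (at z within UNIV)" for z
  proof -
    have "((\<lambda>z. arctan z) has_vector_derivative inverse (1 + z\<^sup>2)) (at z)"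
      using DERIV_arctan[of z] by (simp add: has_real_derivative_iff_has_vector_derivative)
    then have "((\<lambda>z. of_real (arctan z)) has_vector_derivative complex_of_real (inverse (1 + z\<^sup>2))) (at z)"
      by (rule bounded_linear.has_vector_derivative[OF bounded_linear_of_real])
    from has_vector_derivative_diff[OF winding_exponent_derivative has_vector_derivative_mult_right[OF this, of "2 * \<i>"]]
    show ?thesis by (simp add: divide_inverse mult_ac)
  qed
  obtain c where c: "\<And>z. winding_exponent z - 2 * \<i> * of_real (arctan z) = c"
    using has_vector_derivative_zero_constant[OF convex_UNIV d] by auto
  have "c = 0" using c[of 0] by (simp add: winding_exponent_def)
  then show ?thesis using c[of z] by simp
qed

text \<open>The number \<open>1 + \<i> * z\<close> has argument \<open>arctan z\<close>, so its
  square divided by its squared modulus has twice that argument.\<close>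

lemma exp_winding_exponent: "exp (winding_exponent z) = (1 + \<i> * z) / (1 - \<i> * z)"
proof -
  have pos: "sqrt (1 + z\<^sup>2) > 0" by (simp add: add_pos_nonneg)
  have "exp (winding_exponent z) = (iexp (arctan z))\<^sup>2"
    by (simp add: winding_exponent_eq power2_eq_square exp_add[symmetric] mult.assoc)
  also have "iexp (arctan z) = (1 + \<i> * z) / of_real (sqrt (1 + z\<^sup>2))"
    using pos by (simp add: complex_eq_iff Re_exp Im_exp cos_arctan sin_arctan Re_divide_of_real Im_divide_of_real)
  also have "((1 + \<i> * z) / of_real (sqrt (1 + z\<^sup>2)))\<^sup>2 = (1 + \<i> * z)\<^sup>2 / ((1 + \<i> * z) * (1 - \<i> * z))"
  proof -
    have "(of_real (sqrt (1 + z\<^sup>2)))\<^sup>2 = complex_of_real (1 + z\<^sup>2)"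
      unfolding of_real_power[symmetric] by (simp add: add_nonneg_nonneg)
    also have "\<dots> = (1 + \<i> * z) * (1 - \<i> * z)" by (simp add: algebra_simps power2_eq_square)
    finally show ?thesis by (simp add: power_divide)
  qed
  also have "\<dots> = (1 + \<i> * z) / (1 - \<i> * z)"
    using one_minus_iz_nonzero[of z] by (simp add: power2_eq_square)
  finally show ?thesis .
qed

lemma exp_winding_exponent_R_rep:
  assumes w: "is_weight \<omega>" and G: "GRS \<omega>"
  shows "\<exists>K. R_rep \<omega> (\<lambda>z. exp (winding_exponent z)) K" "\<exists>K. R_rep \<omega> (\<lambda>z. exp (- winding_exponent z)) K"
proof -
  have 1: "exp (winding_exponent z) = -1 + 2 * fourier half_exp z" for z
    using one_minus_iz_nonzero[of z] by (simp add: exp_winding_exponent fourier_half_exp field_simps)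
  have 2: "exp (- winding_exponent z) = -1 + 2 * fourier (\<lambda>x. half_exp (- x)) z" for z
    using one_minus_iz_nonzero[of z] by (simp add: exp_minus exp_winding_exponent fourier_reflect fourier_half_exp field_simps)
  show "\<exists>K. R_rep \<omega> (\<lambda>z. exp (winding_exponent z)) K"
    unfolding 1 using R_rep_add[OF w R_rep_const R_rep_cmult[OF w R_rep_L[OF L_rep_of_L1_weighted[OF half_exp_L1_weighted(1)[OF w G]]]]] by blast
  show "\<exists>K. R_rep \<omega> (\<lambda>z. exp (- winding_exponent z)) K"
    unfolding 2 using R_rep_add[OF w R_rep_const R_rep_cmult[OF w R_rep_L[OF L_rep_of_L1_weighted[OF half_exp_L1_weighted(2)[OF w G]]]]] by blast
qed

lemma exp_int_winding_exponent_R_rep: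
  assumes w: "is_weight \<omega>" and G: "GRS \<omega>"
  shows "\<exists>K. R_rep \<omega> (\<lambda>z. exp (of_int m * winding_exponent z)) K"
proof (cases "m \<ge> 0")
  case True
  obtain K where "R_rep \<omega> (\<lambda>z. exp (winding_exponent z)) K" using exp_winding_exponent_R_rep(1)[OF w G] by blast
  from R_rep_power[OF w this, of "nat m"] True show ?thesis
    by (auto simp: exp_of_nat_mult[symmetric])
next
  case False
  obtain K where "R_rep \<omega> (\<lambda>z. exp (- winding_exponent z)) K" using exp_winding_exponent_R_rep(2)[OF w G] by blast
  from R_rep_power[OF w this, of "nat (- m)"] False show ?thesis
    by (auto simp: exp_of_nat_mult[symmetric])
qed

text \<open>On the circle the conjugate of \<open>u\<close> is its inverse, which lies in the
  algebra by the explicit formula. So real polynomials in the real and imaginary part of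
  \<open>u\<close> stay in the algebra even if the weight is not symmetric.\<close>

lemma polynomial_of_winding_R_rep:
  fixes g :: "complex \<Rightarrow> complex"
  assumes w: "is_weight \<omega>" and G: "GRS \<omega>" and g: "polynomial_function g"
  shows "\<exists>K. R_rep \<omega> (\<lambda>z. g (exp (winding_exponent z))) K"
proof -
  define u where "u z = exp (winding_exponent z)" for z
  obtain K1 where K1: "R_rep \<omega> u K1" using exp_winding_exponent_R_rep(1)[OF w G] unfolding u_def[abs_def] by blast
  obtain K2 where K2: "R_rep \<omega> (\<lambda>z. exp (- winding_exponent z)) K2" using exp_winding_exponent_R_rep(2)[OF w G] by blast
  have cu: "cnj (u z) = exp (- winding_exponent z)" for z
    by (simp add: u_def exp_cnj winding_exponent_eq)
  have K3: "R_rep \<omega> (\<lambda>z. cnj (u z)) K2" unfolding cu by (rule K2)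
  have real: "\<exists>K. R_rep \<omega> (\<lambda>z. of_real (p (u z))) K" if "real_polynomial_function p" for p :: "complex \<Rightarrow> real"
    using that
  proof (induction p rule: real_polynomial_function.induct)
    case (linear f)
    interpret bounded_linear f by fact
    \<comment> \<open>A real-linear functional of \<open>u\<close> is a complex combination of
      \<open>u\<close> and its conjugate.\<close>
    have "complex_of_real (f (u z)) = ((f 1 - \<i> * f \<i>) / 2) * u z + ((f 1 + \<i> * f \<i>) / 2) * cnj (u z)" for z
    proof -
      have "u z = Re (u z) *\<^sub>R 1 + Im (u z) *\<^sub>R \<i>" by (simp add: complex_eq_iff)
      then have "f (u z) = Re (u z) * f 1 + Im (u z) * f \<i>" by (metis add scaleR real_scaleR_def)
      then show ?thesis by (simp add: complex_eq_iff field_simps)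
    qed
    then have eq: "(\<lambda>z. complex_of_real (f (u z))) = (\<lambda>z. ((f 1 - \<i> * f \<i>) / 2) * u z + ((f 1 + \<i> * f \<i>) / 2) * cnj (u z))" by (rule ext)
    show ?case unfolding eq by (rule exI, rule R_rep_add[OF w R_rep_cmult[OF w K1] R_rep_cmult[OF w K3]])
  next
    case (const c)
    then show ?case using R_rep_const by blast
  next
    case (add f g)
    then obtain A B where "R_rep \<omega> (\<lambda>z. of_real (f (u z))) A" "R_rep \<omega> (\<lambda>z. of_real (g (u z))) B" by blast
    from R_rep_add[OF w this] show ?case by auto
  next
    case (mult f g)
    then obtain A B where "R_rep \<omega> (\<lambda>z. of_real (f (u z))) A" "R_rep \<omega> (\<lambda>z. of_real (g (u z))) B" by blast
    from R_rep_mult[OF w this] show ?case by auto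
  qed
  have "real_polynomial_function (Re \<circ> g)" "real_polynomial_function (Im \<circ> g)"
    using g bounded_linear_Re bounded_linear_Im unfolding polynomial_function_def by blast+
  from real[OF this(1)] real[OF this(2)] obtain A B where
    "R_rep \<omega> (\<lambda>z. of_real (Re (g (u z)))) A" "R_rep \<omega> (\<lambda>z. of_real (Im (g (u z)))) B" by auto
  from R_rep_add[OF w this(1) R_rep_cmult[OF w this(2), of \<i>]]
  have "R_rep \<omega> (\<lambda>z. of_real (Re (g (u z))) + \<i> * of_real (Im (g (u z)))) (A + \<omega> 0 * norm \<i> * B)" .
  then show ?thesis unfolding complex_eq[symmetric] u_def by blast
qed

text \<open>The Cayley transform \<open>exp (winding_exponent z)\<close> identifies the line with the unit circle
  minus \<open>-1\<close>, with inverse \<open>Im u / (1 + Re u)\<close>.\<close>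

lemma approx_by_polynomial_of_winding:
  fixes N :: "real \<Rightarrow> complex"
  assumes N: "continuous_on UNIV N" and lim: "(N \<longlongrightarrow> c) at_infinity" and e: "e > 0"
  obtains g :: "complex \<Rightarrow> complex" where "polynomial_function g"
    "\<And>z. norm (N z - g (exp (winding_exponent z))) < e"
proof -
  define t where "t u = Im u / (1 + Re u)" for u
  define f where "f u = (if u = -1 then c else N (t u))" for u
  have Re1: "1 + Re u > 0" if "u \<in> sphere 0 1" "u \<noteq> -1" for u
  proof -
    have n: "norm u = 1" using that by simp
    then have "\<bar>Re u\<bar> \<le> 1" using abs_Re_le_cmod[of u] by simp
    moreover have "Re u \<noteq> -1"
    proof
      assume R: "Re u = -1"
      have "(Re u)\<^sup>2 + (Im u)\<^sup>2 = 1" using n cmod_power2[of u] by simp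
      then have "Im u = 0" using R by simp
      then show False using R that by (simp add: complex_eq_iff)
    qed
    ultimately show ?thesis by linarith
  qed
  have "continuous_on (sphere 0 1) f"
    unfolding continuous_on_def
  proof
    fix u :: complex assume u: "u \<in> sphere 0 1"
    show "(f \<longlongrightarrow> f u) (at u within sphere 0 1)"
    proof (cases "u = -1")
      case False
      have Nc: "isCont N (t u)" using N by (simp add: continuous_on_eq_continuous_at)
      have "isCont t u"
        unfolding t_def using Re1[OF u False] by (intro continuous_intros) auto
      from isCont_o2[OF this Nc] have "isCont (\<lambda>u. N (t u)) u" .
      then have "((\<lambda>u. N (t u)) \<longlongrightarrow> N (t u)) (at u)" by (simp add: isCont_def)
      then have 1: "((\<lambda>u. N (t u)) \<longlongrightarrow> N (t u)) (at u within sphere 0 1)"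
        by (rule tendsto_within_subset) simp
      have "\<forall>\<^sub>F v in at u within sphere 0 1. v \<in> - {-1}"
        by (rule eventually_at_topological[THEN iffD2]) (use False in \<open>auto intro!: exI[of _ "- {-1}"]\<close>)
      then have "\<forall>\<^sub>F v in at u within sphere 0 1. f v = N (t v)"
        by eventually_elim (simp add: f_def)
      with 1 show ?thesis using False by (simp add: f_def tendsto_cong)
    next
      case True
      show ?thesis
      proof (rule tendstoI)
        fix r :: real assume r: "r > 0"
        have "\<forall>\<^sub>F z in at_infinity. dist (N z) c < r" using lim r by (rule tendstoD)
        then obtain B where B: "\<And>z. B \<le> \<bar>z\<bar> \<Longrightarrow> dist (N z) c < r" by (auto simp: eventually_at_infinity)
        \<comment> \<open>As \<open>d \<le> 1\<close>, a point of the circle this close to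
          \<open>-1\<close> has negative real part, so the square of its preimage is at least
          \<open>1 / (1 + Re v)\<close>, which exceeds \<open>1 / d = B\<^sup>2 + 1\<close>.\<close>
        define d where "d = 1 / (B\<^sup>2 + 1)"
        have d: "d > 0" "d \<le> 1" by (auto simp: d_def add_nonneg_pos)
        have "dist (f v) c < r" if v: "v \<in> sphere 0 1" "v \<noteq> -1" "dist v (-1) < d" for v
        proof -
          have x0: "1 + Re v > 0" by (rule Re1[OF v(1,2)])
          have "\<bar>Re (v + 1)\<bar> \<le> norm (v + 1)" by (rule abs_Re_le_cmod)
          then have xd: "1 + Re v < d" using v(3) by (simp add: dist_norm add.commute)
          have "(Re v)\<^sup>2 + (Im v)\<^sup>2 = 1" using v(1) cmod_power2[of v] by simp
          then have im: "(Im v)\<^sup>2 = (1 - Re v) * (1 + Re v)" by (simp add: algebra_simps power2_eq_square)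
          have "(t v)\<^sup>2 = (1 - Re v) / (1 + Re v)"
            using x0 unfolding t_def power_divide im by (simp add: power2_eq_square)
          moreover have "1 / (1 + Re v) \<le> (1 - Re v) / (1 + Re v)" using x0 xd d by (intro divide_right_mono) auto
          moreover have "1 / d \<le> 1 / (1 + Re v)" using x0 xd d by (intro divide_left_mono) auto
          moreover have "1 / d = B\<^sup>2 + 1" by (simp add: d_def)
          ultimately have "B\<^sup>2 \<le> (t v)\<^sup>2" by linarith
          then have "\<bar>B\<bar> \<le> \<bar>t v\<bar>" by (simp add: abs_le_square_iff)
          then have "B \<le> \<bar>t v\<bar>" by linarith
          then show ?thesis using B v(2) by (simp add: f_def)
        qed
        then show "\<forall>\<^sub>F v in at u within sphere 0 1. dist (f v) (f u) < r"
          unfolding True eventually_at using d by (intro exI[of _ d]) (auto simp: f_def)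
      qed
    qed
  qed
  from Stone_Weierstrass_polynomial_function[OF compact_sphere this e]
  obtain g :: "complex \<Rightarrow> complex" where g: "polynomial_function g" "\<And>u. u \<in> sphere 0 1 \<Longrightarrow> norm (f u - g u) < e"
    by blast
  show thesis
  proof (rule that[OF g(1)])
    fix z
    let ?u = "exp (winding_exponent z)"
    have nz: "1 + z\<^sup>2 > 0" by (simp add: add_pos_nonneg)
    have "?u = (1 + \<i> * z)\<^sup>2 / ((1 - \<i> * z) * (1 + \<i> * z))"
      using one_minus_iz_nonzero[of z] by (simp add: exp_winding_exponent power2_eq_square)
    also have "(1 - \<i> * z) * (1 + \<i> * z) = of_real (1 + z\<^sup>2)" by (simp add: algebra_simps power2_eq_square)
    also have "(1 + \<i> * z)\<^sup>2 = Complex (1 - z\<^sup>2) (2 * z)" by (simp add: complex_eq_iff power2_eq_square)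
    finally have Reu: "Re ?u = (1 - z\<^sup>2) / (1 + z\<^sup>2)" and Imu: "Im ?u = 2 * z / (1 + z\<^sup>2)"
      by (simp_all add: Re_divide_of_real Im_divide_of_real del: of_real_add)
    have one: "1 + Re ?u = 2 / (1 + z\<^sup>2)" unfolding Reu using nz by (simp add: field_simps)
    have "t ?u = z" unfolding t_def one Imu using nz by simp
    moreover have "?u \<noteq> -1"
    proof
      assume "?u = -1"
      then have "1 + Re ?u = 0" by simp
      then show False using one nz by simp
    qed
    moreover have "?u \<in> sphere 0 1" by (simp add: winding_exponent_eq)
    ultimately show "norm (N z - g ?u) < e" using g(2)[of ?u] by (simp add: f_def)
  qed
qed

text \<open>Far out \<open>M\<close> is close to 1 and \<open>Ln (M z)\<close> is continuous, so on
  each half-line \<open>\<mu>\<close> differs from it by a constant multiple of 2 pi i. The two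
  constants may differ.\<close>

lemma log_limit_at_infinity:
  fixes M \<mu> :: "real \<Rightarrow> complex"
  assumes M: "(M \<longlongrightarrow> 1) at_infinity" and mu: "continuous_on UNIV \<mu>" "\<And>z. M z = exp (\<mu> z)"
  obtains p q :: int where "(\<mu> \<longlongrightarrow> 2 * pi * \<i> * p) at_top" "(\<mu> \<longlongrightarrow> 2 * pi * \<i> * q) at_bot"
proof -
  have "\<forall>\<^sub>F z in at_infinity. dist (M z) 1 < 1" using M by (rule tendstoD) simp
  then obtain B where B: "\<And>z. B \<le> \<bar>z\<bar> \<Longrightarrow> norm (M z - 1) < 1" by (auto simp: eventually_at_infinity dist_norm)
  have M0: "M z \<noteq> 0" for z unfolding mu(2) by simp
  have np: "M z \<notin> \<real>\<^sub>\<le>\<^sub>0" if "B \<le> \<bar>z\<bar>" for z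
  proof
    assume "M z \<in> \<real>\<^sub>\<le>\<^sub>0"
    then have "Re (M z) \<le> 0" by (auto simp: complex_nonpos_Reals_iff)
    then have "1 \<le> \<bar>Re (M z - 1)\<bar>" by simp
    also have "\<dots> \<le> norm (M z - 1)" by (rule abs_Re_le_cmod)
    finally show False using B[OF that] by simp
  qed
  have Mc: "continuous_on UNIV M" unfolding mu(2) by (intro continuous_intros mu(1))
  define N where "N z = \<mu> z - Ln (M z)" for z
  have eN: "exp (N z) = 1" for z using M0[of z] by (simp add: N_def exp_diff flip: mu(2))
  have lim: "\<exists>p::int. (\<mu> \<longlongrightarrow> 2 * pi * \<i> * p) Fl" if S: "connected S" "\<And>z. z \<in> S \<Longrightarrow> B \<le> \<bar>z\<bar>" "z0 \<in> S"
      and F: "\<forall>\<^sub>F z in Fl. z \<in> S" "Fl \<le> at_infinity" for S z0 Fl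
  proof -
    have "continuous_on S N" unfolding N_def
      by (intro continuous_intros continuous_on_subset[OF mu(1)] continuous_on_subset[OF Mc]) (use np S in auto)
    then have c: "N z = N z0" if "z \<in> S" for z using exp_eq_1_imp_constant[of S N z z0] S(1,3) eN that by blast
    obtain p :: int where p: "Re (N z0) = 0" "Im (N z0) = of_int (2 * p) * pi" using eN[of z0] unfolding exp_eq_1 by blast
    have Np: "N z0 = 2 * pi * \<i> * p" using p by (simp add: complex_eq_iff)
    have "(M \<longlongrightarrow> 1) Fl" using M F(2) by (rule tendsto_mono[rotated])
    then have "((\<lambda>z. N z0 + Ln (M z)) \<longlongrightarrow> N z0 + Ln 1) Fl" by (intro tendsto_intros) auto
    moreover have "\<forall>\<^sub>F z in Fl. \<mu> z = N z0 + Ln (M z)"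
      using F(1) by eventually_elim (use c in \<open>auto simp: N_def algebra_simps\<close>)
    ultimately have "(\<mu> \<longlongrightarrow> 2 * pi * \<i> * p) Fl" by (simp add: Np tendsto_cong)
    then show ?thesis by blast
  qed
  have "\<exists>p::int. (\<mu> \<longlongrightarrow> 2 * pi * \<i> * p) at_top"
    by (rule lim[of "{\<bar>B\<bar>..}" "\<bar>B\<bar>"]) (auto simp: at_top_le_at_infinity eventually_ge_at_top)
  moreover have "\<exists>q::int. (\<mu> \<longlongrightarrow> 2 * pi * \<i> * q) at_bot"
    by (rule lim[of "{..- \<bar>B\<bar>}" "- \<bar>B\<bar>"]) (auto simp: at_bot_le_at_infinity eventually_le_at_bot)
  ultimately show thesis using that by blast
qed

text \<open>The limits of a continuous logarithm differ by 2 pi i times the winding number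
  \<open>m\<close> of \<open>1 + k\<close> around 0. Each winding exponent gains 2 pi i along the
  line, so subtracting \<open>m\<close> of them makes the limits equal and allows approximation by
  polynomials in the Cayley transform.\<close>

theorem one_plus_L_rep_logarithm:
  assumes w: "is_weight \<omega>" and G: "GRS \<omega>" and k: "L_rep \<omega> k C" and M0: "\<And>z. 1 + k z \<noteq> 0"
  shows "\<exists>(m::int) H K. R_rep \<omega> H K \<and> (\<forall>z. 1 + k z = exp (H z + m * winding_exponent z))"
proof -
  define M where "M z = 1 + k z" for z
  have kc: "continuous_on UNIV k"
    using k continuous_on_fourier L1_weighted_integrable[OF w] unfolding L_rep_def by blast
  have Mc: "continuous_on UNIV M" unfolding M_def by (intro continuous_intros kc)
  have Mlim: "(M \<longlongrightarrow> 1) at_infinity"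
    unfolding M_def using tendsto_add[OF tendsto_const L_rep_tendsto_0[OF w k], of 1] by simp
  obtain \<mu> where mu: "continuous_on UNIV \<mu>" "\<And>z. M z = exp (\<mu> z)"
    using continuous_logarithm_on_contractible[OF Mc] M0 by (auto simp: M_def)
  obtain p q :: int where pq: "(\<mu> \<longlongrightarrow> 2 * pi * \<i> * p) at_top" "(\<mu> \<longlongrightarrow> 2 * pi * \<i> * q) at_bot"
    by (rule log_limit_at_infinity[OF Mlim mu]) (rule that)
  define m where "m = p - q"
  define N where "N z = \<mu> z - m * winding_exponent z" for z
  define c where "c = pi * \<i> * (p + q)"
  have Nc: "continuous_on UNIV N" unfolding N_def winding_exponent_eq by (intro continuous_intros mu(1))
  have "(N \<longlongrightarrow> 2 * pi * \<i> * p - m * (2 * \<i> * complex_of_real (pi / 2))) at_top"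
    unfolding N_def winding_exponent_eq by (intro tendsto_intros pq tendsto_arctan_at_top)
  then have 1: "(N \<longlongrightarrow> c) at_top" by (simp add: c_def m_def algebra_simps)
  have "(N \<longlongrightarrow> 2 * pi * \<i> * q - m * (2 * \<i> * complex_of_real (- (pi / 2)))) at_bot"
    unfolding N_def winding_exponent_eq by (intro tendsto_intros pq tendsto_arctan_at_bot)
  then have 2: "(N \<longlongrightarrow> c) at_bot" by (simp add: c_def m_def algebra_simps)
  have Nlim: "(N \<longlongrightarrow> c) at_infinity"
    unfolding at_infinity_eq_at_top_bot by (rule filterlim_sup[OF 1 2])
  \<comment> \<open>An error below 1/4 in the exponent keeps the remaining factor within 1/2 of the
    constant 1.\<close>
  obtain g :: "complex \<Rightarrow> complex" where g: "polynomial_function g" "\<And>z. norm (N z - g (exp (winding_exponent z))) < 1/4"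
    by (rule approx_by_polynomial_of_winding[OF Nc Nlim, of "1/4"]) (use that in auto)
  obtain Kg where Kg: "R_rep \<omega> (\<lambda>z. g (exp (winding_exponent z))) Kg" using polynomial_of_winding_R_rep[OF w G g(1)] by blast
  obtain Ke where Ke: "R_rep \<omega> (\<lambda>z. exp (-1 * g (exp (winding_exponent z)))) Ke" using R_rep_exp[OF w R_rep_cmult[OF w Kg]] by blast
  obtain Km where Km: "R_rep \<omega> (\<lambda>z. exp (of_int (- m) * winding_exponent z)) Km" using exp_int_winding_exponent_R_rep[OF w G] by blast
  define E where "E z = M z * exp (of_int (- m) * winding_exponent z) * exp (-1 * g (exp (winding_exponent z)))" for z
  have RE: "R_rep \<omega> E ((\<omega> 0 * norm (1::complex) + C) * Km * Ke)"
    unfolding E_def[abs_def] M_def by (intro R_rep_mult[OF w] R_rep_add[OF w] R_rep_const R_rep_L k Km Ke)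
  have eE: "E z = exp (N z - g (exp (winding_exponent z)))" for z
  proof -
    have "E z = exp (\<mu> z + of_int (- m) * winding_exponent z + -1 * g (exp (winding_exponent z)))"
      unfolding E_def mu(2) exp_add ..
    also have "\<mu> z + of_int (- m) * winding_exponent z + -1 * g (exp (winding_exponent z)) = N z - g (exp (winding_exponent z))"
      by (simp add: N_def)
    finally show ?thesis .
  qed
  have "norm (1 - E z) \<le> 1/2" for z
    using norm_exp_minus_1_le[of "N z - g (exp (winding_exponent z))"] g(2)[of z] unfolding eE by (simp add: norm_minus_commute)
  from R_rep_inverse_near_1(2)[OF w G RE _ this]
  obtain H K where H: "R_rep \<omega> H K" "\<And>z. E z = exp (H z)" by auto
  have "R_rep \<omega> (\<lambda>z. H z + g (exp (winding_exponent z))) (K + Kg)" by (rule R_rep_add[OF w H(1) Kg])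
  moreover have "1 + k z = exp (H z + g (exp (winding_exponent z)) + m * winding_exponent z)" for z
  proof -
    have "exp (H z + g (exp (winding_exponent z)) + m * winding_exponent z) = E z * exp (g (exp (winding_exponent z))) * exp (m * winding_exponent z)"
      by (simp only: exp_add H(2))
    also have "\<dots> = M z * (exp (of_int (- m) * winding_exponent z) * exp (m * winding_exponent z)) * (exp (-1 * g (exp (winding_exponent z))) * exp (g (exp (winding_exponent z))))"
      unfolding E_def by (simp only: mult_ac)
    also have "\<dots> = M z" unfolding exp_add[symmetric] by simp
    finally show ?thesis by (simp add: M_def)
  qed
  ultimately show ?thesis by blast
qed

text \<open>The almost periodic part \<open>P\<close> inherits the lower bound by recurrence, so it
  can be divided out; \<open>g / P\<close> lies in the ideal of absolutely continuous
  elements.\<close>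

theorem R_rep_logarithm:
  assumes w: "is_weight \<omega>" and G: "GRS \<omega>" and P: "D_rep \<omega> P C" and g: "L_rep \<omega> g D"
    and \<delta>: "\<delta> > 0" "\<And>z. norm (P z + g z) \<ge> \<delta>"
  shows "\<exists>(\<gamma>::real) (m::int) H K. R_rep \<omega> H K \<and>
    (\<forall>z. P z + g z = exp (\<i> * \<gamma> * of_real z + H z + m * winding_exponent z))"
proof -
  have P\<delta>: "norm (P z) \<ge> \<delta>" for z by (rule D_rep_lower_bound[OF w P L_rep_tendsto_0[OF w g] \<delta>(2)])
  have P0: "P z \<noteq> 0" for z using P\<delta>[of z] \<delta>(1) by auto
  obtain \<gamma> :: real and H1 K1 where 1: "R_rep \<omega> H1 K1" "\<And>z. P z = exp (\<i> * \<gamma> * of_real z + H1 z)"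
    using D_rep_logarithm[OF w G P \<delta>(1) P\<delta>] by blast
  obtain Ki where "R_rep \<omega> (\<lambda>z. 1 / P z) Ki" using Wiener_R_rep[OF w G R_rep_D[OF P] \<delta>(1) P\<delta>] by blast
  from L_mult_R_rep[OF w g this] have k: "L_rep \<omega> (\<lambda>z. g z * (1 / P z)) (D * Ki)" .
  have eq: "P z * (1 + g z * (1 / P z)) = P z + g z" for z using P0[of z] by (simp add: field_simps)
  have "1 + g z * (1 / P z) \<noteq> 0" for z using eq[of z] \<delta>(2)[of z] \<delta>(1) by auto
  from one_plus_L_rep_logarithm[OF w G k this] obtain m :: int and H2 K2 where
    2: "R_rep \<omega> H2 K2" "\<And>z. 1 + g z * (1 / P z) = exp (H2 z + m * winding_exponent z)" by blast
  have "R_rep \<omega> (\<lambda>z. H1 z + H2 z) (K1 + K2)" by (rule R_rep_add[OF w 1(1) 2(1)])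
  moreover have "P z + g z = exp (\<i> * \<gamma> * of_real z + (H1 z + H2 z) + m * winding_exponent z)" for z
    unfolding eq[symmetric] 2(2) by (subst 1(2)) (simp add: exp_add[symmetric] add_ac)
  ultimately show ?thesis by blast
qed

section \<open>Levy-Khintchine representations\<close>

text \<open>Serves to glue an absolutely continuous part and atoms into one Levy measure; the lemmas
  about it take both arguments to be measures on the Borel sets of the line.\<close>

definition add_measure :: "real measure \<Rightarrow> real measure \<Rightarrow> real measure" where
  "add_measure M N = measure_of UNIV (sets borel) (\<lambda>A. emeasure M A + emeasure N A)"

lemma sets_add_measure [simp, measurable_cong]: "sets (add_measure M N) = sets borel"
proof -
  have "sigma_sets UNIV (sets (borel :: real measure)) = sets borel"
    using sets.sigma_sets_eq[of "borel :: real measure"] by simp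
  then show ?thesis by (simp add: add_measure_def sets_measure_of_conv)
qed

lemma emeasure_add_measure:
  assumes M: "sets M = sets borel" and N: "sets N = sets borel" and A: "A \<in> sets borel"
  shows "emeasure (add_measure M N) A = emeasure M A + emeasure N A"
proof (rule emeasure_measure_of[OF add_measure_def])
  show "sets borel \<subseteq> Pow UNIV" by simp
  show "positive (sets (add_measure M N)) (\<lambda>A. emeasure M A + emeasure N A)"
    by (simp add: positive_def)
  show "countably_additive (sets (add_measure M N)) (\<lambda>A. emeasure M A + emeasure N A)"
  proof (rule countably_additiveI)
    fix A :: "nat \<Rightarrow> real set"
    assume A: "range A \<subseteq> sets (add_measure M N)" "disjoint_family A"
    then have "range A \<subseteq> sets M" "range A \<subseteq> sets N" using M N by auto
    then show "(\<Sum>i. emeasure M (A i) + emeasure N (A i)) = emeasure M (\<Union> (range A)) + emeasure N (\<Union> (range A))"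
      using A(2) by (simp add: suminf_add[symmetric] suminf_emeasure)
  qed
  show "A \<in> sets (add_measure M N)" using A by simp
qed

lemma nn_integral_add_measure:
  assumes M: "sets M = sets borel" and N: "sets N = sets borel" and f: "f \<in> borel_measurable borel"
  shows "(\<integral>\<^sup>+x. f x \<partial>add_measure M N) = (\<integral>\<^sup>+x. f x \<partial>M) + (\<integral>\<^sup>+x. f x \<partial>N)"
proof -
  have sp: "space M = UNIV" "space N = UNIV" "space (add_measure M N) = UNIV"
    using sets_eq_imp_space_eq[OF M] sets_eq_imp_space_eq[OF N] sets_eq_imp_space_eq[OF sets_add_measure] by auto
  note cong = measurable_cong_sets[OF M refl] measurable_cong_sets[OF N refl] measurable_cong_sets[OF sets_add_measure refl]
  show ?thesis using f
  proof (induction rule: borel_measurable_induct)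
    case (cong f g)
    then have "f = g" by auto
    then show ?case using cong by simp
  next
    case (set A)
    then show ?case using M N by (simp add: emeasure_add_measure)
  next
    case (mult u c)
    then show ?case by (simp add: nn_integral_cmult cong distrib_left)
  next
    case (add u v)
    then show ?case by (simp add: nn_integral_add cong add_ac)
  next
    case (seq U)
    have U: "U i \<in> borel_measurable L" if "sets L = sets borel" for i L
      using seq(1) measurable_cong_sets[OF that refl] by blast
    have conv: "(\<lambda>i. integral\<^sup>N L (U i)) \<longlonglongrightarrow> integral\<^sup>N L (SUP i. U i)" if "sets L = sets borel" for L
    proof (rule nn_integral_LIMSEQ[OF \<open>incseq U\<close> U[OF that]])
      show "(\<lambda>i. U i x) \<longlonglongrightarrow> (SUP i. U i) x" for x
        using LIMSEQ_SUP[of "\<lambda>i. U i x"] \<open>incseq U\<close> by (simp add: incseq_def le_fun_def image_image)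
    qed
    have "(\<lambda>i. integral\<^sup>N M (U i) + integral\<^sup>N N (U i)) \<longlonglongrightarrow> integral\<^sup>N M (SUP i. U i) + integral\<^sup>N N (SUP i. U i)"
      by (intro tendsto_add conv M N)
    moreover have "(\<lambda>i. integral\<^sup>N M (U i) + integral\<^sup>N N (U i)) = (\<lambda>i. integral\<^sup>N (add_measure M N) (U i))"
      using seq by auto
    ultimately show ?case using LIMSEQ_unique[OF conv[OF sets_add_measure]] by metis
  qed
qed

lemma enn2real_add: "x < \<infinity> \<Longrightarrow> y < \<infinity> \<Longrightarrow> enn2real (x + y) = enn2real x + enn2real y"
  by (cases x; cases y) (auto simp: ennreal_plus[symmetric] simp del: ennreal_plus)

lemma integral_add_measure_real:
  fixes f :: "real \<Rightarrow> real"
  assumes M: "sets M = sets borel" and N: "sets N = sets borel" and i: "integrable M f" "integrable N f"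
  shows "integrable (add_measure M N) f \<and> integral\<^sup>L (add_measure M N) f = integral\<^sup>L M f + integral\<^sup>L N f"
proof -
  have f[measurable]: "f \<in> borel_measurable borel"
    using borel_measurable_integrable[OF i(1)] measurable_cong_sets[OF M refl] by blast
  then have fm: "f \<in> borel_measurable (add_measure M N)" using measurable_cong_sets[OF sets_add_measure refl] by blast
  have 1: "(\<integral>\<^sup>+x. ennreal (f x) \<partial>add_measure M N) = (\<integral>\<^sup>+x. ennreal (f x) \<partial>M) + (\<integral>\<^sup>+x. ennreal (f x) \<partial>N)"
    by (rule nn_integral_add_measure[OF M N]) measurable
  have 2: "(\<integral>\<^sup>+x. ennreal (- f x) \<partial>add_measure M N) = (\<integral>\<^sup>+x. ennreal (- f x) \<partial>M) + (\<integral>\<^sup>+x. ennreal (- f x) \<partial>N)"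
    by (rule nn_integral_add_measure[OF M N]) measurable
  have fin: "(\<integral>\<^sup>+x. ennreal (f x) \<partial>M) < \<infinity>" "(\<integral>\<^sup>+x. ennreal (f x) \<partial>N) < \<infinity>"
    "(\<integral>\<^sup>+x. ennreal (- f x) \<partial>M) < \<infinity>" "(\<integral>\<^sup>+x. ennreal (- f x) \<partial>N) < \<infinity>"
    using i by (auto simp: real_integrable_def top.not_eq_extremum)
  have int: "integrable (add_measure M N) f"
    unfolding real_integrable_def 1 2 using fin fm by (auto simp: top.not_eq_extremum)
  show ?thesis
    using fin by (simp add: int real_lebesgue_integral_def[OF int] real_lebesgue_integral_def[OF i(1)] real_lebesgue_integral_def[OF i(2)] 1 2 enn2real_add)
qed

lemma integral_add_measure:
  fixes f :: "real \<Rightarrow> complex"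
  assumes M: "sets M = sets borel" and N: "sets N = sets borel" and i: "integrable M f" "integrable N f"
  shows "integral\<^sup>L (add_measure M N) f = integral\<^sup>L M f + integral\<^sup>L N f"
proof -
  note R = integral_add_measure_real[OF M N integrable_Re[OF i(1)] integrable_Re[OF i(2)]]
  note I = integral_add_measure_real[OF M N integrable_Im[OF i(1)] integrable_Im[OF i(2)]]
  have "integrable (add_measure M N) (\<lambda>x. of_real (Re (f x)) + \<i> * of_real (Im (f x)))"
    using R I by (intro Bochner_Integration.integrable_add integrable_mult_right integrable_of_real) auto
  then have int: "integrable (add_measure M N) f" by (simp only: complex_eq[symmetric])
  show ?thesis
    using R I by (simp add: complex_eq_iff integral_Re[OF int, symmetric] integral_Im[OF int, symmetric] integral_Re[OF i(1), symmetric] integral_Re[OF i(2), symmetric] integral_Im[OF i(1), symmetric] integral_Im[OF i(2), symmetric])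
qed

lemma min_square_le_min_abs: "min (x\<^sup>2) 1 \<le> min \<bar>x\<bar> (1::real)"
proof (cases "\<bar>x\<bar> \<le> 1")
  case True
  then have "x\<^sup>2 \<le> \<bar>x\<bar>" using mult_left_mono[of "\<bar>x\<bar>" 1 "\<bar>x\<bar>"] by (simp add: power2_eq_square)
  then show ?thesis by auto
qed auto

text \<open>The density has a first moment near 0, more than a Levy measure must have. Test
  functions of order \<open>\<bar>x\<bar>\<close> at 0 are therefore integrable without
  compensation, and their integral splits into a Lebesgue integral and a sum. Leaving 0 out of
  \<open>Y\<close> avoids an atom at 0.\<close>

lemma levy_measure_mixed:
  fixes p c :: "real \<Rightarrow> real"
  assumes [measurable]: "p \<in> borel_measurable borel" and p0: "\<And>x. 0 \<le> p x" and pi: "integrable lborel (\<lambda>x. min \<bar>x\<bar> 1 * p x)"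
    and c0: "\<And>y. 0 \<le> c y" and cs: "c summable_on Y" and Y: "0 \<notin> Y"
  obtains \<nu> where "levy_measure \<nu>"
    "\<And>\<phi> K. \<phi> \<in> borel_measurable borel \<Longrightarrow> (\<And>x. norm (\<phi> x :: complex) \<le> K * min \<bar>x\<bar> 1) \<Longrightarrow>
       (LINT x|\<nu>. \<phi> x) = (LINT x|lborel. p x *\<^sub>R \<phi> x) + (\<Sum>\<^sub>\<infinity>y\<in>Y. c y *\<^sub>R \<phi> y)"
proof -
  define M where "M = density lborel (\<lambda>x. ennreal (p x))"
  define N where "N = distr (density (count_space Y) (\<lambda>y. ennreal (c y))) borel (\<lambda>y. y)"
  have M: "sets M = sets borel" and N: "sets N = sets borel" by (auto simp: M_def N_def)
  have mY: "(\<lambda>y. y) \<in> density (count_space Y) (\<lambda>y. ennreal (c y)) \<rightarrow>\<^sub>M borel"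
    by (subst measurable_cong_sets[OF sets_density refl]) simp
  have ci: "integrable (count_space Y) c"
    using cs c0 abs_summable_equivalent[of c Y] by (simp add: abs_summable_on_def)
  have levy: "levy_measure (add_measure M N)"
    unfolding levy_measure_def
  proof (intro conjI)
    show "sets (add_measure M N) = sets borel" by simp
    have "emeasure M {0} = 0"
      unfolding M_def by (subst emeasure_density) (auto simp: nn_integral_0_iff_AE intro!: AE_mp[OF AE_lborel_singleton[of 0]])
    moreover have "emeasure N {0} = 0"
    proof -
      have "(\<lambda>y. y) -` {0} \<inter> space (density (count_space Y) (\<lambda>y. ennreal (c y))) = {}" using Y by auto
      then show ?thesis unfolding N_def by (subst emeasure_distr[OF mY]) simp_all
    qed
    ultimately show "emeasure (add_measure M N) {0} = 0" by (simp add: emeasure_add_measure[OF M N])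
    have "(\<integral>\<^sup>+x. ennreal (min (x\<^sup>2) 1) \<partial>M) = (\<integral>\<^sup>+x. ennreal (p x) * ennreal (min (x\<^sup>2) 1) \<partial>lborel)"
      unfolding M_def by (rule nn_integral_density) measurable
    also have "\<dots> \<le> (\<integral>\<^sup>+x. ennreal (norm (min \<bar>x\<bar> 1 * p x)) \<partial>lborel)"
      using p0 min_square_le_min_abs by (intro nn_integral_mono) (auto simp: ennreal_mult'[symmetric] abs_mult mult.commute intro!: ennreal_leI mult_left_mono)
    also have "\<dots> < \<infinity>" using pi by (simp add: integrable_iff_bounded)
    finally have 1: "(\<integral>\<^sup>+x. ennreal (min (x\<^sup>2) 1) \<partial>M) < \<infinity>" .
    have "(\<integral>\<^sup>+x. ennreal (min (x\<^sup>2) 1) \<partial>N) = (\<integral>\<^sup>+y. ennreal (min (y\<^sup>2) 1) \<partial>density (count_space Y) (\<lambda>y. ennreal (c y)))"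
      unfolding N_def by (rule nn_integral_distr[OF mY]) simp
    also have "\<dots> = (\<integral>\<^sup>+y. ennreal (c y) * ennreal (min (y\<^sup>2) 1) \<partial>count_space Y)"
      by (rule nn_integral_density) auto
    also have "\<dots> \<le> (\<integral>\<^sup>+y. ennreal (norm (c y)) \<partial>count_space Y)"
      using c0 by (intro nn_integral_mono) (auto simp: ennreal_mult'[symmetric] intro!: ennreal_leI mult_left_le)
    also have "\<dots> < \<infinity>" using ci by (simp add: integrable_iff_bounded)
    finally have 2: "(\<integral>\<^sup>+x. ennreal (min (x\<^sup>2) 1) \<partial>N) < \<infinity>" .
    have "(\<integral>\<^sup>+x. ennreal (min (x\<^sup>2) 1) \<partial>add_measure M N) = (\<integral>\<^sup>+x. ennreal (min (x\<^sup>2) 1) \<partial>M) + (\<integral>\<^sup>+x. ennreal (min (x\<^sup>2) 1) \<partial>N)"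
      by (rule nn_integral_add_measure[OF M N]) measurable
    then show "(\<integral>\<^sup>+x. ennreal (min (x\<^sup>2) 1) \<partial>add_measure M N) < \<infinity>" using 1 2 by simp
  qed
  show thesis
  proof (rule that[OF levy])
    fix \<phi> :: "real \<Rightarrow> complex" and K
    assume [measurable]: "\<phi> \<in> borel_measurable borel" and b: "\<And>x. norm (\<phi> x) \<le> K * min \<bar>x\<bar> 1"
    have "norm (\<phi> 1) \<le> K" using b[of 1] by simp
    then have K0: "K \<ge> 0" using norm_ge_zero[of "\<phi> 1"] by linarith
    have i1: "integrable lborel (\<lambda>x. p x *\<^sub>R \<phi> x)"
    proof (rule Bochner_Integration.integrable_bound)
      show "integrable lborel (\<lambda>x. K * (min \<bar>x\<bar> 1 * p x))" by (intro integrable_mult_right pi)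
      show "AE x in lborel. norm (p x *\<^sub>R \<phi> x) \<le> norm (K * (min \<bar>x\<bar> 1 * p x))"
      proof (rule AE_I2)
        fix x
        have "norm (p x *\<^sub>R \<phi> x) \<le> p x * (K * min \<bar>x\<bar> 1)" using p0[of x] b[of x] by (simp add: mult_left_mono)
        also have "\<dots> \<le> norm (K * (min \<bar>x\<bar> 1 * p x))" by (simp add: mult_ac)
        finally show "norm (p x *\<^sub>R \<phi> x) \<le> norm (K * (min \<bar>x\<bar> 1 * p x))" .
      qed
    qed measurable
    have i2: "integrable (count_space Y) (\<lambda>y. c y *\<^sub>R \<phi> y)"
    proof (rule Bochner_Integration.integrable_bound)
      show "integrable (count_space Y) (\<lambda>y. K * c y)" by (intro integrable_mult_right ci)
      show "AE y in count_space Y. norm (c y *\<^sub>R \<phi> y) \<le> norm (K * c y)"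
      proof (rule AE_I2)
        fix y
        have "norm (\<phi> y) \<le> K" using b[of y] K0 mult_left_mono[of "min \<bar>y\<bar> 1" 1 K] by simp
        then have "c y * norm (\<phi> y) \<le> c y * K" using c0 by (intro mult_left_mono) auto
        then show "norm (c y *\<^sub>R \<phi> y) \<le> norm (K * c y)" using c0[of y] K0 by (simp add: abs_mult mult.commute)
      qed
    qed auto
    have "integrable M \<phi>" unfolding M_def using i1 p0 by (subst integrable_density) auto
    moreover have "integrable N \<phi>"
      unfolding N_def by (subst integrable_distr_eq[OF mY], simp, subst integrable_density) (use i2 c0 in auto)
    ultimately have "(LINT x|add_measure M N. \<phi> x) = (LINT x|M. \<phi> x) + (LINT x|N. \<phi> x)"
      by (rule integral_add_measure[OF M N])
    also have "(LINT x|M. \<phi> x) = (LINT x|lborel. p x *\<^sub>R \<phi> x)"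
      unfolding M_def using p0 by (subst integral_density) auto
    also have "(LINT x|N. \<phi> x) = (LINT y|count_space Y. c y *\<^sub>R \<phi> y)"
      unfolding N_def by (subst integral_distr[OF mY], simp, subst integral_density) (use c0 in auto)
    also have "(LINT y|count_space Y. c y *\<^sub>R \<phi> y) = (\<Sum>\<^sub>\<infinity>y\<in>Y. c y *\<^sub>R \<phi> y)"
      using i2 infsetsum_infsum[of "\<lambda>y. c y *\<^sub>R \<phi> y" Y] by (simp add: infsetsum_def abs_summable_on_def)
    finally show "(LINT x|add_measure M N. \<phi> x) = (LINT x|lborel. p x *\<^sub>R \<phi> x) + (\<Sum>\<^sub>\<infinity>y\<in>Y. c y *\<^sub>R \<phi> y)" .
  qed
qed

text \<open>The positive and negative parts of the real and the imaginary part of density and atoms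
  supply the four Levy measures.\<close>

lemma complex_quasi_levy_mixed:
  fixes q c :: "real \<Rightarrow> complex"
  assumes [measurable]: "q \<in> borel_measurable borel" and qi: "integrable lborel (\<lambda>x. min \<bar>x\<bar> 1 * norm (q x))"
    and cs: "(\<lambda>y. norm (c y)) summable_on Y" and Y: "0 \<notin> Y"
  obtains \<nu> where "complex_quasi_levy \<nu>"
    "\<And>\<phi> K. \<phi> \<in> borel_measurable borel \<Longrightarrow> (\<And>x. norm (\<phi> x) \<le> K * min \<bar>x\<bar> 1) \<Longrightarrow>
       complex_quasi_levy_integral \<nu> \<phi> = (LINT x|lborel. q x * \<phi> x) + (\<Sum>\<^sub>\<infinity>y\<in>Y. c y * \<phi> y)"
proof -
  have part: "\<exists>\<nu>. levy_measure \<nu> \<and> (\<forall>\<phi> K. \<phi> \<in> borel_measurable borel \<longrightarrow> (\<forall>x. norm (\<phi> x :: complex) \<le> K * min \<bar>x\<bar> 1) \<longrightarrow>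
       (LINT x|\<nu>. \<phi> x) = (LINT x|lborel. r (q x) *\<^sub>R \<phi> x) + (\<Sum>\<^sub>\<infinity>y\<in>Y. r (c y) *\<^sub>R \<phi> y))"
    if [measurable]: "r \<in> borel_measurable borel" and r: "\<And>v. 0 \<le> r v" "\<And>v. r v \<le> norm v" for r :: "complex \<Rightarrow> real"
  proof -
    have "integrable lborel (\<lambda>x. min \<bar>x\<bar> 1 * r (q x))"
      by (rule Bochner_Integration.integrable_bound[OF qi]) (use r in \<open>auto simp: abs_mult intro!: mult_left_mono\<close>)
    moreover have "(\<lambda>y. r (c y)) summable_on Y"
      by (rule summable_on_comparison_test[OF cs]) (use r in auto)
    ultimately obtain \<nu> where "levy_measure \<nu>" "\<And>\<phi> K. \<phi> \<in> borel_measurable borel \<Longrightarrow> (\<And>x. norm (\<phi> x :: complex) \<le> K * min \<bar>x\<bar> 1) \<Longrightarrow>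
       (LINT x|\<nu>. \<phi> x) = (LINT x|lborel. r (q x) *\<^sub>R \<phi> x) + (\<Sum>\<^sub>\<infinity>y\<in>Y. r (c y) *\<^sub>R \<phi> y)"
      using levy_measure_mixed[of "\<lambda>x. r (q x)" "\<lambda>y. r (c y)" Y] r(1) Y by (auto simp: measurable_compose)
    then show ?thesis by blast
  qed
  define r1 where "r1 v = max 0 (Re v)" for v
  define r2 where "r2 v = max 0 (- Re v)" for v
  define r3 where "r3 v = max 0 (Im v)" for v
  define r4 where "r4 v = max 0 (- Im v)" for v
  have m[measurable]: "r1 \<in> borel_measurable borel" "r2 \<in> borel_measurable borel" "r3 \<in> borel_measurable borel" "r4 \<in> borel_measurable borel"
    unfolding r1_def r2_def r3_def r4_def by measurable
  have r0: "0 \<le> r1 v" "0 \<le> r2 v" "0 \<le> r3 v" "0 \<le> r4 v" for v by (auto simp: r1_def r2_def r3_def r4_def)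
  have rn: "r1 v \<le> norm v" "r2 v \<le> norm v" "r3 v \<le> norm v" "r4 v \<le> norm v" for v
    using abs_Re_le_cmod[of v] abs_Im_le_cmod[of v] norm_ge_zero[of v] unfolding r1_def r2_def r3_def r4_def by linarith+
  have split: "(of_real (r1 v) - of_real (r2 v)) + \<i> * (of_real (r3 v) - of_real (r4 v)) = v" for v
    by (auto simp: r1_def r2_def r3_def r4_def complex_eq_iff max_def)
  obtain \<nu>1 where n1: "levy_measure \<nu>1" "\<And>\<phi> K. \<phi> \<in> borel_measurable borel \<Longrightarrow> (\<And>x. norm (\<phi> x :: complex) \<le> K * min \<bar>x\<bar> 1) \<Longrightarrow>
       (LINT x|\<nu>1. \<phi> x) = (LINT x|lborel. r1 (q x) *\<^sub>R \<phi> x) + (\<Sum>\<^sub>\<infinity>y\<in>Y. r1 (c y) *\<^sub>R \<phi> y)"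
    using part[OF m(1) r0(1) rn(1)] by blast
  obtain \<nu>2 where n2: "levy_measure \<nu>2" "\<And>\<phi> K. \<phi> \<in> borel_measurable borel \<Longrightarrow> (\<And>x. norm (\<phi> x :: complex) \<le> K * min \<bar>x\<bar> 1) \<Longrightarrow>
       (LINT x|\<nu>2. \<phi> x) = (LINT x|lborel. r2 (q x) *\<^sub>R \<phi> x) + (\<Sum>\<^sub>\<infinity>y\<in>Y. r2 (c y) *\<^sub>R \<phi> y)"
    using part[OF m(2) r0(2) rn(2)] by blast
  obtain \<nu>3 where n3: "levy_measure \<nu>3" "\<And>\<phi> K. \<phi> \<in> borel_measurable borel \<Longrightarrow> (\<And>x. norm (\<phi> x :: complex) \<le> K * min \<bar>x\<bar> 1) \<Longrightarrow>
       (LINT x|\<nu>3. \<phi> x) = (LINT x|lborel. r3 (q x) *\<^sub>R \<phi> x) + (\<Sum>\<^sub>\<infinity>y\<in>Y. r3 (c y) *\<^sub>R \<phi> y)"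
    using part[OF m(3) r0(3) rn(3)] by blast
  obtain \<nu>4 where n4: "levy_measure \<nu>4" "\<And>\<phi> K. \<phi> \<in> borel_measurable borel \<Longrightarrow> (\<And>x. norm (\<phi> x :: complex) \<le> K * min \<bar>x\<bar> 1) \<Longrightarrow>
       (LINT x|\<nu>4. \<phi> x) = (LINT x|lborel. r4 (q x) *\<^sub>R \<phi> x) + (\<Sum>\<^sub>\<infinity>y\<in>Y. r4 (c y) *\<^sub>R \<phi> y)"
    using part[OF m(4) r0(4) rn(4)] by blast
  show thesis
  proof (rule that[of "((\<nu>1, \<nu>2), (\<nu>3, \<nu>4))"])
    show "complex_quasi_levy ((\<nu>1, \<nu>2), \<nu>3, \<nu>4)"
      using n1 n2 n3 n4 by (simp add: complex_quasi_levy_def quasi_levy_def)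
    fix \<phi> :: "real \<Rightarrow> complex" and K
    assume [measurable]: "\<phi> \<in> borel_measurable borel" and b: "\<And>x. norm (\<phi> x) \<le> K * min \<bar>x\<bar> 1"
    have "norm (\<phi> 1) \<le> K" using b[of 1] by simp
    then have K0: "K \<ge> 0" using norm_ge_zero[of "\<phi> 1"] by linarith
    have \<phi>K: "norm (\<phi> x) \<le> K" for x using b[of x] K0 mult_left_mono[of "min \<bar>x\<bar> 1" 1 K] by simp
    have i: "integrable lborel (\<lambda>x. complex_of_real (r (q x)) * \<phi> x)"
      if [measurable]: "r \<in> borel_measurable borel" and r: "\<And>v. 0 \<le> r v" "\<And>v. r v \<le> norm v" for r
    proof (rule Bochner_Integration.integrable_bound)
      show "integrable lborel (\<lambda>x. K * (min \<bar>x\<bar> 1 * norm (q x)))" by (intro integrable_mult_right qi)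
      show "AE x in lborel. norm (complex_of_real (r (q x)) * \<phi> x) \<le> norm (K * (min \<bar>x\<bar> 1 * norm (q x)))"
      proof (rule AE_I2)
        fix x
        have "norm (complex_of_real (r (q x)) * \<phi> x) \<le> norm (q x) * (K * min \<bar>x\<bar> 1)"
          unfolding norm_mult using r[of "q x"] b[of x] by (intro mult_mono) auto
        also have "\<dots> \<le> norm (K * (min \<bar>x\<bar> 1 * norm (q x)))" by (simp add: mult_ac)
        finally show "norm (complex_of_real (r (q x)) * \<phi> x) \<le> norm (K * (min \<bar>x\<bar> 1 * norm (q x)))" .
      qed
    qed measurable
    have s: "(\<lambda>y. complex_of_real (r (c y)) * \<phi> y) summable_on Y" if r: "\<And>v. 0 \<le> r v" "\<And>v. r v \<le> norm v" for r
    proof (rule abs_summable_summable, rule summable_on_comparison_test)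
      show "(\<lambda>y. K * norm (c y)) summable_on Y" by (intro summable_on_cmult_right cs)
      show "norm (complex_of_real (r (c y)) * \<phi> y) \<le> K * norm (c y)" for y
        unfolding norm_mult using r[of "c y"] mult_mono[of "\<bar>r (c y)\<bar>" "norm (c y)" "norm (\<phi> y)" K] \<phi>K[of y] by (simp add: mult.commute)
    qed auto
    have "(LINT x|lborel. q x * \<phi> x) = (LINT x|lborel. (of_real (r1 (q x)) * \<phi> x - of_real (r2 (q x)) * \<phi> x) + \<i> * (of_real (r3 (q x)) * \<phi> x - of_real (r4 (q x)) * \<phi> x))"
    proof (rule Bochner_Integration.integral_cong[OF refl])
      fix x
      show "q x * \<phi> x = (of_real (r1 (q x)) * \<phi> x - of_real (r2 (q x)) * \<phi> x) + \<i> * (of_real (r3 (q x)) * \<phi> x - of_real (r4 (q x)) * \<phi> x)"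
        by (subst split[of "q x", symmetric]) (simp add: algebra_simps)
    qed
    also have "\<dots> = ((LINT x|lborel. of_real (r1 (q x)) * \<phi> x) - (LINT x|lborel. of_real (r2 (q x)) * \<phi> x)) + \<i> * ((LINT x|lborel. of_real (r3 (q x)) * \<phi> x) - (LINT x|lborel. of_real (r4 (q x)) * \<phi> x))"
      using i[OF m(1) r0(1) rn(1)] i[OF m(2) r0(2) rn(2)] i[OF m(3) r0(3) rn(3)] i[OF m(4) r0(4) rn(4)] by simp
    finally have A: "(LINT x|lborel. q x * \<phi> x) = \<dots>" .
    have "(\<Sum>\<^sub>\<infinity>y\<in>Y. c y * \<phi> y) = (\<Sum>\<^sub>\<infinity>y\<in>Y. (of_real (r1 (c y)) * \<phi> y + - 1 * (of_real (r2 (c y)) * \<phi> y)) + \<i> * (of_real (r3 (c y)) * \<phi> y + - 1 * (of_real (r4 (c y)) * \<phi> y)))"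
    proof (rule infsum_cong)
      fix y
      show "c y * \<phi> y = (of_real (r1 (c y)) * \<phi> y + - 1 * (of_real (r2 (c y)) * \<phi> y)) + \<i> * (of_real (r3 (c y)) * \<phi> y + - 1 * (of_real (r4 (c y)) * \<phi> y))"
        by (subst split[of "c y", symmetric]) (simp add: algebra_simps)
    qed
    also have "\<dots> = ((\<Sum>\<^sub>\<infinity>y\<in>Y. of_real (r1 (c y)) * \<phi> y) + - 1 * (\<Sum>\<^sub>\<infinity>y\<in>Y. of_real (r2 (c y)) * \<phi> y)) + \<i> * ((\<Sum>\<^sub>\<infinity>y\<in>Y. of_real (r3 (c y)) * \<phi> y) + - 1 * (\<Sum>\<^sub>\<infinity>y\<in>Y. of_real (r4 (c y)) * \<phi> y))"
      by (simp only: infsum_add infsum_cmult_right' summable_on_add summable_on_cmult_right s[OF r0(1) rn(1)] s[OF r0(2) rn(2)] s[OF r0(3) rn(3)] s[OF r0(4) rn(4)])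
    finally have B: "(\<Sum>\<^sub>\<infinity>y\<in>Y. c y * \<phi> y) = \<dots>" .
    show "complex_quasi_levy_integral ((\<nu>1, \<nu>2), \<nu>3, \<nu>4) \<phi> = (LINT x|lborel. q x * \<phi> x) + (\<Sum>\<^sub>\<infinity>y\<in>Y. c y * \<phi> y)"
      unfolding A B complex_quasi_levy_integral_def quasi_levy_integral_def fst_conv snd_conv
        n1(2)[OF \<open>\<phi> \<in> borel_measurable borel\<close> b] n2(2)[OF \<open>\<phi> \<in> borel_measurable borel\<close> b]
        n3(2)[OF \<open>\<phi> \<in> borel_measurable borel\<close> b] n4(2)[OF \<open>\<phi> \<in> borel_measurable borel\<close> b]
      by (simp add: scaleR_conv_of_real algebra_simps)
  qed
qed

section \<open>The kernel of the Levy-Khintchine formula\<close>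

definition lk_kernel :: "real \<Rightarrow> real \<Rightarrow> complex" where
  "lk_kernel z x = exp (\<i> * of_real (z * x)) - 1 - \<i> * of_real (z * x * indicator {-1<..<1} x)"

lemma lk_kernel_measurable [measurable]: "lk_kernel z \<in> borel_measurable borel"
  unfolding lk_kernel_def by measurable

lemma norm_lk_kernel_le: "norm (lk_kernel z x) \<le> (z\<^sup>2 + 2) * min (x\<^sup>2) 1"
proof (cases "\<bar>x\<bar> < 1")
  case True
  then have x1: "x\<^sup>2 \<le> 1" by (simp add: abs_square_le_1)
  have "norm (iexp (z * x) - 1 - \<i> * (z * x)) \<le> \<bar>z * x\<bar>\<^sup>2 / 2"
    using iexp_approx1[of "z * x" 1] by (simp add: numeral_2_eq_2 algebra_simps)
  moreover have "lk_kernel z x = iexp (z * x) - 1 - \<i> * (z * x)"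
    using True by (auto simp: lk_kernel_def indicator_def)
  ultimately have "norm (lk_kernel z x) \<le> z\<^sup>2 * x\<^sup>2 / 2" by (simp add: power_mult_distrib)
  also have "\<dots> \<le> (z\<^sup>2 + 2) * x\<^sup>2" by (simp add: algebra_simps)
  finally show ?thesis using x1 by simp
next
  case False
  then have "1 \<le> \<bar>x\<bar>" by simp
  then have x1: "1 \<le> x\<^sup>2" using one_le_power[of "\<bar>x\<bar>" 2] by simp
  have "lk_kernel z x = iexp (z * x) - 1" using False by (auto simp: lk_kernel_def indicator_def)
  then have "norm (lk_kernel z x) \<le> 2" using norm_triangle_ineq4[of "iexp (z * x)" 1] by (simp del: of_real_mult)
  also have "\<dots> \<le> z\<^sup>2 + 2" by simp
  finally show ?thesis using x1 by simp
qed

lemma levy_integrable_lk_kernel: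
  assumes "levy_measure \<nu>"
  shows "integrable \<nu> (\<lambda>x. min (x\<^sup>2) 1)" "integrable \<nu> (lk_kernel z)"
proof -
  have s: "sets \<nu> = sets borel" and f: "(\<integral>\<^sup>+x. ennreal (min (x\<^sup>2) 1) \<partial>\<nu>) < \<infinity>"
    using assms by (auto simp: levy_measure_def)
  note cong = measurable_cong_sets[OF s refl]
  show 1: "integrable \<nu> (\<lambda>x. min (x\<^sup>2) 1)"
    by (rule integrableI_bounded) (use f in \<open>auto simp: cong\<close>)
  show "integrable \<nu> (lk_kernel z)"
    by (rule Bochner_Integration.integrable_bound[OF integrable_mult_right[OF 1, of "z\<^sup>2 + 2"]])
       (auto simp: cong intro!: AE_I2 order_trans[OF norm_lk_kernel_le])
qed

text \<open>In the second difference the linear compensators in \<open>z\<close> cancel, and what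
  remains is a unimodular factor times the sum of the kernels at \<open>h\<close> and
  \<open>- h\<close>. Hence the bound does not depend on \<open>z\<close>.\<close>

lemma complex_quasi_levy_second_difference:
  assumes \<nu>: "complex_quasi_levy \<nu>"
  obtains B where "\<And>z h. norm (complex_quasi_levy_integral \<nu> (lk_kernel (z + h)) + complex_quasi_levy_integral \<nu> (lk_kernel (z - h))
      - 2 * complex_quasi_levy_integral \<nu> (lk_kernel z)) \<le> (h\<^sup>2 + 2) * B"
proof -
  have one: "norm ((LINT x|\<mu>. lk_kernel (z + h) x) + (LINT x|\<mu>. lk_kernel (z - h) x) - 2 * (LINT x|\<mu>. lk_kernel z x)) \<le> (h\<^sup>2 + 2) * (2 * (LINT x|\<mu>. min (x\<^sup>2) 1))"
    if "levy_measure \<mu>" for \<mu> z h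
  proof -
    note i = levy_integrable_lk_kernel[OF that]
    have "(LINT x|\<mu>. lk_kernel (z + h) x) + (LINT x|\<mu>. lk_kernel (z - h) x) - 2 * (LINT x|\<mu>. lk_kernel z x)
      = (LINT x|\<mu>. lk_kernel (z + h) x + lk_kernel (z - h) x - 2 * lk_kernel z x)"
      using i(2) by simp
    moreover have "norm (LINT x|\<mu>. lk_kernel (z + h) x + lk_kernel (z - h) x - 2 * lk_kernel z x) \<le> (LINT x|\<mu>. (h\<^sup>2 + 2) * (2 * min (x\<^sup>2) 1))"
    proof (rule Bochner_Integration.integral_norm_bound_integral)
      show "integrable \<mu> (\<lambda>x. lk_kernel (z + h) x + lk_kernel (z - h) x - 2 * lk_kernel z x)"
        by (intro Bochner_Integration.integrable_add Bochner_Integration.integrable_diff integrable_mult_right i)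
      show "integrable \<mu> (\<lambda>x. (h\<^sup>2 + 2) * (2 * min (x\<^sup>2) 1))" by (intro integrable_mult_right i)
      fix x
      have e: "iexp ((z + h) * x) = iexp (z * x) * iexp (h * x)" "iexp ((z - h) * x) = iexp (z * x) * iexp (- h * x)"
        by (simp_all add: exp_add[symmetric] algebra_simps)
      have "lk_kernel (z + h) x + lk_kernel (z - h) x - 2 * lk_kernel z x = iexp (z * x) * (lk_kernel h x + lk_kernel (- h) x)"
        unfolding lk_kernel_def e by (simp add: algebra_simps)
      then have "norm (lk_kernel (z + h) x + lk_kernel (z - h) x - 2 * lk_kernel z x) = norm (lk_kernel h x + lk_kernel (- h) x)"
        by (simp add: norm_mult del: of_real_mult)
      also have "\<dots> \<le> norm (lk_kernel h x) + norm (lk_kernel (- h) x)" by (rule norm_triangle_ineq)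
      also have "\<dots> \<le> (h\<^sup>2 + 2) * (2 * min (x\<^sup>2) 1)"
        using norm_lk_kernel_le[of h x] norm_lk_kernel_le[of "- h" x] by simp
      finally show "norm (lk_kernel (z + h) x + lk_kernel (z - h) x - 2 * lk_kernel z x) \<le> (h\<^sup>2 + 2) * (2 * min (x\<^sup>2) 1)" .
    qed
    ultimately show ?thesis by (simp only: integral_mult_right_zero)
  qed
  obtain \<nu>1 \<nu>2 \<nu>3 \<nu>4 where n: "\<nu> = ((\<nu>1, \<nu>2), \<nu>3, \<nu>4)" by (metis prod.collapse)
  have l: "levy_measure \<nu>1" "levy_measure \<nu>2" "levy_measure \<nu>3" "levy_measure \<nu>4"
    using \<nu> by (auto simp: n complex_quasi_levy_def quasi_levy_def)
  define m where "m \<mu> = (LINT x|\<mu>. min (x\<^sup>2) 1)" for \<mu> :: "real measure"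
  show thesis
  proof (rule that)
    fix z h
    define D where "D \<mu> = (LINT x|\<mu>. lk_kernel (z + h) x) + (LINT x|\<mu>. lk_kernel (z - h) x) - 2 * (LINT x|\<mu>. lk_kernel z x)" for \<mu>
    have Db: "norm (D \<mu>) \<le> (h\<^sup>2 + 2) * (2 * m \<mu>)" if "levy_measure \<mu>" for \<mu>
      unfolding D_def m_def by (rule one[OF that])
    have "complex_quasi_levy_integral \<nu> (lk_kernel (z + h)) + complex_quasi_levy_integral \<nu> (lk_kernel (z - h)) - 2 * complex_quasi_levy_integral \<nu> (lk_kernel z)
       = (D \<nu>1 - D \<nu>2) + \<i> * (D \<nu>3 - D \<nu>4)"
      by (simp add: n complex_quasi_levy_integral_def quasi_levy_integral_def D_def algebra_simps)
    also have "norm \<dots> \<le> (norm (D \<nu>1) + norm (D \<nu>2)) + (norm (D \<nu>3) + norm (D \<nu>4))"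
      by (intro order_trans[OF norm_triangle_ineq] add_mono) (simp_all add: norm_mult norm_triangle_ineq4)
    also have "\<dots> \<le> ((h\<^sup>2 + 2) * (2 * m \<nu>1) + (h\<^sup>2 + 2) * (2 * m \<nu>2)) + ((h\<^sup>2 + 2) * (2 * m \<nu>3) + (h\<^sup>2 + 2) * (2 * m \<nu>4))"
      by (intro add_mono Db l)
    also have "\<dots> = (h\<^sup>2 + 2) * (2 * (m \<nu>1 + m \<nu>2 + m \<nu>3 + m \<nu>4))" by (simp add: algebra_simps)
    finally show "norm (complex_quasi_levy_integral \<nu> (lk_kernel (z + h)) + complex_quasi_levy_integral \<nu> (lk_kernel (z - h))
      - 2 * complex_quasi_levy_integral \<nu> (lk_kernel z)) \<le> (h\<^sup>2 + 2) * (2 * (m \<nu>1 + m \<nu>2 + m \<nu>3 + m \<nu>4))" .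
  qed
qed

section \<open>Uniqueness and the equivalences\<close>

lemma INF_norm_pos_iff:
  fixes F :: "real \<Rightarrow> complex"
  shows "(INF z. norm (F z)) > 0 \<longleftrightarrow> (\<exists>\<delta>>0. \<forall>z. norm (F z) \<ge> \<delta>)"
proof
  assume p: "(INF z. norm (F z)) > 0"
  have "(INF z. norm (F z)) \<le> norm (F z)" for z
    by (rule cINF_lower) (auto intro: bdd_belowI[of _ 0])
  with p show "\<exists>\<delta>>0. \<forall>z. norm (F z) \<ge> \<delta>" by blast
next
  assume "\<exists>\<delta>>0. \<forall>z. norm (F z) \<ge> \<delta>"
  then obtain \<delta> where \<delta>: "\<delta> > 0" "\<And>z. \<delta> \<le> norm (F z)" by blast
  have "\<delta> \<le> (INF z. norm (F z))" by (rule cINF_greatest) (use \<delta> in auto)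
  then show "(INF z. norm (F z)) > 0" using \<delta>(1) by linarith
qed

lemma lower_bound_from_infinity:
  fixes F :: "real \<Rightarrow> complex"
  assumes c: "continuous_on UNIV F" and nz: "\<And>z. F z \<noteq> 0" and d: "d > 0" "\<forall>\<^sub>F z in at_infinity. norm (F z) \<ge> d"
  shows "\<exists>\<delta>>0. \<forall>z. norm (F z) \<ge> \<delta>"
proof -
  obtain B where B: "\<And>z. B \<le> \<bar>z\<bar> \<Longrightarrow> norm (F z) \<ge> d" using d(2) by (auto simp: eventually_at_infinity)
  have "\<exists>x\<in>{- \<bar>B\<bar>..\<bar>B\<bar>}. \<forall>y\<in>{- \<bar>B\<bar>..\<bar>B\<bar>}. norm (F x) \<le> norm (F y)"
    by (rule continuous_attains_inf) (auto intro!: continuous_intros continuous_on_subset[OF c])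
  then obtain x where x: "\<And>y. y \<in> {- \<bar>B\<bar>..\<bar>B\<bar>} \<Longrightarrow> norm (F x) \<le> norm (F y)" by blast
  show ?thesis
  proof (intro exI[of _ "min d (norm (F x))"] conjI allI)
    show "0 < min d (norm (F x))" using d(1) nz by simp
    show "min d (norm (F x)) \<le> norm (F z)" for z
    proof (cases "B \<le> \<bar>z\<bar>")
      case True
      then show ?thesis using B[of z] by simp
    next
      case False
      then have "z \<in> {- \<bar>B\<bar>..\<bar>B\<bar>}" by auto
      then show ?thesis using x[of z] by simp
    qed
  qed
qed

lemma trig_series_D_rep:
  assumes "(\<lambda>y. \<omega> y * norm (a y)) summable_on UNIV"
  shows "D_rep \<omega> (trig_series UNIV a) (\<Sum>\<^sub>\<infinity>y. \<omega> y * norm (a y))"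
  unfolding D_rep_def using assms by blast

lemma trig_series_continuous:
  assumes a: "(\<lambda>y. norm (a y)) summable_on UNIV"
  shows "continuous_on UNIV (trig_series UNIV a)"
proof -
  have "\<exists>S. finite S \<and> D_rep (\<lambda>_. 1) (\<lambda>z. trig_series UNIV a z - (\<Sum>y\<in>S. a y * iexp (z * y))) (1 / real (Suc n))" for n
  proof -
    have "(\<lambda>y. 1 * norm (a y)) summable_on UNIV" using a by simp
    from D_rep_truncate[OF weight_one this, of "1 / real (Suc n)" "{}"] show ?thesis by auto
  qed
  from choice[OF allI[OF this]] obtain S where
    "\<forall>n. finite (S n) \<and> D_rep (\<lambda>_. 1) (\<lambda>z. trig_series UNIV a z - (\<Sum>y\<in>S n. a y * iexp (z * y))) (1 / real (Suc n))" ..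
  then have S: "D_rep (\<lambda>_. 1) (\<lambda>z. trig_series UNIV a z - (\<Sum>y\<in>S n. a y * iexp (z * y))) (1 / real (Suc n))" for n
    by blast
  have 1: "\<forall>\<^sub>F n in sequentially. continuous_on UNIV (\<lambda>z. \<Sum>y\<in>S n. a y * iexp (z * y))"
    by (intro always_eventually allI continuous_intros)
  have 2: "uniform_limit UNIV (\<lambda>n z. \<Sum>y\<in>S n. a y * iexp (z * y)) (trig_series UNIV a) sequentially"
  proof (rule uniform_limitI)
    fix e :: real assume "e > 0"
    then obtain N where N: "1 / real (Suc N) < e" using nat_approx_posE by blast
    have "norm (trig_series UNIV a z - (\<Sum>y\<in>S n. a y * iexp (z * y))) < e" if "n \<ge> N" for n z
    proof -
      have "norm (trig_series UNIV a z - (\<Sum>y\<in>S n. a y * iexp (z * y))) \<le> 1 / real (Suc n)"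
        using D_rep_bound[OF weight_one S] .
      also have "\<dots> \<le> 1 / real (Suc N)" using that by (intro divide_left_mono) auto
      finally show ?thesis using N by linarith
    qed
    then show "\<forall>\<^sub>F n in sequentially. \<forall>z\<in>UNIV. dist (\<Sum>y\<in>S n. a y * iexp (z * y)) (trig_series UNIV a z) < e"
      by (auto simp: eventually_sequentially dist_norm norm_minus_commute)
  qed
  show ?thesis by (rule uniform_limit_theorem[OF 1 2]) simp
qed

lemma trig_series_cmult: "trig_series A (\<lambda>y. k * a y) z = k * trig_series A a z"
  unfolding trig_series_def mult.assoc by (rule infsum_cmult_right')

section \<open>Supports of coefficients and transfer of weights\<close>

lemma R_rep_coefficients:
  assumes w: "is_weight \<omega>" and H: "R_rep \<omega> H K"
  obtains c h where "(\<lambda>y. \<omega> y * norm (c y)) summable_on UNIV" "h \<in> L1_weighted \<omega>"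
    "\<And>z. H z = trig_series UNIV c z + fourier h z"
proof -
  obtain P G p q where *: "D_rep \<omega> P p" "L_rep \<omega> G q" "H = (\<lambda>z. P z + G z)"
    using H unfolding R_rep_def by metis
  obtain c where c: "(\<lambda>y. \<omega> y * norm (c y)) summable_on UNIV" "P = trig_series UNIV c"
    using *(1) unfolding D_rep_def by blast
  obtain h where h: "h \<in> L1_weighted \<omega>" "G = fourier h"
    using *(2) unfolding L_rep_def by blast
  show thesis by (rule that[OF c(1) h(1)]) (simp add: * c h)
qed

lemma discrete_coeffs_support:
  assumes "(\<lambda>y. norm (c y)) summable_on UNIV"
  shows "discrete_coeffs {y. c y \<noteq> 0} c" "trig_series {y. c y \<noteq> 0} c = trig_series UNIV c"
proof -
  have "countable {y \<in> UNIV. c y \<noteq> 0}" by (rule abs_summable_countable) (rule assms)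
  then show "discrete_coeffs {y. c y \<noteq> 0} c"
    unfolding discrete_coeffs_def using summable_on_subset_banach[OF assms, of "{y. c y \<noteq> 0}"] by simp
  show "trig_series {y. c y \<noteq> 0} c = trig_series UNIV c"
    unfolding trig_series_def by (rule ext, rule infsum_cong_neutral) auto
qed

lemma discrete_coeffs_extend:
  assumes "discrete_coeffs A a"
  shows "(\<lambda>y. norm (if y \<in> A then a y else 0)) summable_on UNIV"
proof -
  have "(\<lambda>y. norm (a y)) summable_on A" using assms by (simp add: discrete_coeffs_def)
  then show ?thesis by (rule summable_on_cong_neutral[THEN iffD1, rotated 3]) auto
qed

lemma weighted_summable_extend_iff:
  "(\<lambda>y. \<omega> y * norm (a y)) summable_on A \<longleftrightarrow> (\<lambda>y. \<omega> y * norm (if y \<in> A then a y else 0)) summable_on UNIV"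
  by (rule summable_on_cong_neutral) auto

lemma L1_weighted_cong_AE:
  assumes g: "g \<in> L1_weighted \<omega>" and w: "is_weight \<omega>" and h: "integrable lborel h" and ae: "AE x in lborel. h x = g x"
  shows "h \<in> L1_weighted \<omega>"
proof -
  have [measurable]: "g \<in> borel_measurable borel" "\<omega> \<in> borel_measurable borel" "h \<in> borel_measurable borel"
    using g h weight_measurable[OF w] by (auto simp: L1_weighted_def)
  have "integrable lborel (\<lambda>x. \<omega> x * norm (g x))" using g by (simp add: L1_weighted_def)
  then have "integrable lborel (\<lambda>x. \<omega> x * norm (h x))"
    by (rule integrable_cong_AE_imp) (use ae in \<open>auto elim: eventually_mono\<close>)
  then show ?thesis by (simp add: L1_weighted_def)
qed

text \<open>By uniqueness a given representation agrees with one known to satisfy the weighted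
  bounds. The constant \<open>k\<close>, an atom at 0, is allowed because exponents are determined
  only up to a constant.\<close>

lemma representation_weights:
  assumes w: "is_weight \<omega>" and a: "(\<lambda>y. norm (a y)) summable_on UNIV" and g: "integrable lborel g"
    and b: "(\<lambda>y. \<omega> y * norm (b y)) summable_on UNIV" and h: "h \<in> L1_weighted \<omega>"
    and eq: "\<And>z. trig_series UNIV a z + fourier g z = trig_series UNIV b z + fourier h z + k"
  shows "(\<lambda>y. \<omega> y * norm (a y)) summable_on UNIV" "g \<in> L1_weighted \<omega>"
proof -
  define b' where "b' y = b y + (if y \<in> {0} then k else 0)" for y
  have hi: "integrable lborel h" by (rule L1_weighted_integrable[OF w h])
  have bn: "(\<lambda>y. norm (b y)) summable_on UNIV" by (rule weighted_summable_norm[OF w b])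
  have kn: "(\<lambda>y. norm (if y \<in> {0::real} then k else 0)) summable_on UNIV"
    by (rule summable_on_cong_neutral[THEN iffD1, rotated 3, OF summable_on_finite[of "{0}" "\<lambda>y. norm k"]]) auto
  have kw: "(\<lambda>y. \<omega> y * norm (if y \<in> {0::real} then k else 0)) summable_on UNIV"
    by (rule summable_on_cong_neutral[THEN iffD1, rotated 3, OF summable_on_finite[of "{0}" "\<lambda>y. \<omega> y * norm k"]]) auto
  have b'n: "(\<lambda>y. norm (b' y)) summable_on UNIV"
    unfolding b'_def by (rule summable_on_comparison_test[OF summable_on_add[OF bn kn]]) (auto intro: norm_triangle_ineq)
  have b'w: "(\<lambda>y. \<omega> y * norm (b' y)) summable_on UNIV"
  proof (rule summable_on_comparison_test[OF summable_on_add[OF b kw]])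
    fix y
    show "\<omega> y * norm (b' y) \<le> \<omega> y * norm (b y) + \<omega> y * norm (if y \<in> {0} then k else 0)"
      unfolding b'_def distrib_left[symmetric] by (intro mult_left_mono norm_triangle_ineq weight_nonneg[OF w])
    show "0 \<le> \<omega> y * norm (b' y)" using weight_nonneg[OF w] by simp
  qed
  have b'z: "trig_series UNIV b' z = trig_series UNIV b z + k" for z
    unfolding b'_def trig_series_add[OF bn kn] using trig_series_finite_support[of "{0}" "\<lambda>_. k" z] by simp
  have dn: "(\<lambda>y. norm (a y - b' y)) summable_on UNIV"
    by (rule summable_on_comparison_test[OF summable_on_add[OF a b'n]]) (auto intro: norm_triangle_ineq4)
  have di: "integrable lborel (\<lambda>x. g x - h x)" by (intro Bochner_Integration.integrable_diff g hi)
  have z: "trig_series UNIV (\<lambda>y. a y - b' y) z + fourier (\<lambda>x. g x - h x) z = 0" for z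
    unfolding trig_series_diff[OF a b'n] fourier_diff[OF g hi] b'z using eq[of z] by (simp add: algebra_simps)
  have "a y = b' y" for y using fourier_representation_unique(1)[OF dn di z, of y] by simp
  then have "a = b'" by auto
  then show "(\<lambda>y. \<omega> y * norm (a y)) summable_on UNIV" using b'w by simp
  have "AE x in lborel. g x - h x = 0" by (rule fourier_representation_unique(2)[OF dn di z])
  then have "AE x in lborel. g x = h x" by eventually_elim simp
  then show "g \<in> L1_weighted \<omega>" by (rule L1_weighted_cong_AE[OF h w g])
qed

text \<open>Arbitrarily large almost periods carry any point towards either end of the line with
  almost the same value.\<close>

lemma D_rep_eq_limit:
  assumes w: "is_weight \<omega>" and P: "D_rep \<omega> P C"
  shows "(P \<longlongrightarrow> l) at_top \<Longrightarrow> P z = l" "(P \<longlongrightarrow> l) at_bot \<Longrightarrow> P z = l"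
proof -
  assume lim: "(P \<longlongrightarrow> l) at_top"
  have "norm (P z - l) \<le> 0"
  proof (rule field_le_epsilon)
    fix e :: real assume e: "e > 0"
    then have "\<forall>\<^sub>F x in at_top. dist (P x) l < e / 2" by (intro tendstoD[OF lim]) simp
    then obtain B where B: "\<And>x. x \<ge> B \<Longrightarrow> dist (P x) l < e / 2" by (auto simp: eventually_at_top_linorder)
    have "e / 2 > 0" "\<bar>B\<bar> + \<bar>z\<bar> + 1 > 0" using e by auto
    from almost_period_exists[OF w P this] obtain \<tau> where \<tau>: "\<tau> \<ge> \<bar>B\<bar> + \<bar>z\<bar> + 1" "\<And>t. norm (P (t + \<tau>) - P t) \<le> e / 2" by blast
    have "dist (P (z + \<tau>)) l < e / 2" by (rule B) (use \<tau>(1) in linarith)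
    then show "norm (P z - l) \<le> 0 + e" using \<tau>(2)[of z] unfolding dist_norm by norm
  qed
  then show "P z = l" by simp
next
  assume lim: "(P \<longlongrightarrow> l) at_bot"
  have "norm (P z - l) \<le> 0"
  proof (rule field_le_epsilon)
    fix e :: real assume e: "e > 0"
    then have "\<forall>\<^sub>F x in at_bot. dist (P x) l < e / 2" by (intro tendstoD[OF lim]) simp
    then obtain B where B: "\<And>x. x \<le> B \<Longrightarrow> dist (P x) l < e / 2" by (auto simp: eventually_at_bot_linorder)
    have "e / 2 > 0" "\<bar>B\<bar> + \<bar>z\<bar> + 1 > 0" using e by auto
    from almost_period_exists[OF w P this] obtain \<tau> where \<tau>: "\<tau> \<ge> \<bar>B\<bar> + \<bar>z\<bar> + 1" "\<And>t. norm (P (t + \<tau>) - P t) \<le> e / 2" by blast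
    have 1: "dist (P (z - \<tau>)) l < e / 2" by (rule B) (use \<tau>(1) in linarith)
    have "norm (P z - P (z - \<tau>)) \<le> e / 2" using \<tau>(2)[of "z - \<tau>"] by simp
    then show "norm (P z - l) \<le> 0 + e" using 1 unfolding dist_norm by norm
  qed
  then show "P z = l" by simp
qed

text \<open>The exponent is determined up to a multiple of \<open>2\<pi>\<i>\<close>: the linear term by its growth, and
  \<open>m\<close> because the almost periodic part has the same limits at both ends of the line.\<close>

lemma exponent_unique:
  assumes c: "(\<lambda>y. norm (c y)) summable_on UNIV" and h: "integrable lborel h"
    and c': "(\<lambda>y. norm (c' y)) summable_on UNIV" and h': "integrable lborel h'"
    and eq: "\<And>z. exp (\<i> * \<gamma> * of_real z + trig_series UNIV c z + fourier h z + of_int m * winding_exponent z)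
      = exp (\<i> * \<gamma>' * of_real z + trig_series UNIV c' z + fourier h' z + of_int m' * winding_exponent z)"
  obtains k where "\<And>z. trig_series UNIV c z + fourier h z = trig_series UNIV c' z + fourier h' z + k"
proof -
  define d where "d y = c y - c' y" for y
  define g where "g x = h x - h' x" for x
  have dn: "(\<lambda>y. norm (d y)) summable_on UNIV"
    unfolding d_def by (rule summable_on_comparison_test[OF summable_on_add[OF c c']]) (auto intro: norm_triangle_ineq4)
  have gi: "integrable lborel g" unfolding g_def[abs_def] by (intro Bochner_Integration.integrable_diff h h')
  have tz: "trig_series UNIV d z = trig_series UNIV c z - trig_series UNIV c' z" for z
    unfolding d_def by (rule trig_series_diff[OF c c'])
  have gz: "fourier g z = fourier h z - fourier h' z" for z
    unfolding g_def by (rule fourier_diff[OF h h'])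
  have D: "D_rep (\<lambda>_. 1) (trig_series UNIV d) (\<Sum>\<^sub>\<infinity>y. 1 * norm (d y))" by (rule trig_series_D_rep) (use dn in simp)
  define N :: complex where "N = of_int (m - m')"
  define \<Delta> where "\<Delta> z = \<i> * (\<gamma> - \<gamma>') * of_real z + trig_series UNIV d z + fourier g z + N * winding_exponent z" for z
  have "continuous_on UNIV \<Delta>"
    unfolding \<Delta>_def winding_exponent_eq by (intro continuous_intros trig_series_continuous[OF dn] continuous_on_fourier[OF gi])
  moreover have "exp (\<Delta> z) = 1" for z
  proof -
    have "\<Delta> z = (\<i> * \<gamma> * of_real z + trig_series UNIV c z + fourier h z + of_int m * winding_exponent z)
      - (\<i> * \<gamma>' * of_real z + trig_series UNIV c' z + fourier h' z + of_int m' * winding_exponent z)"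
      unfolding \<Delta>_def tz gz N_def by (simp add: algebra_simps)
    then show ?thesis using eq[of z] by (simp only: exp_diff) simp
  qed
  ultimately have \<Delta>0: "\<Delta> z = \<Delta> 0" for z using exp_eq_1_imp_constant[of UNIV \<Delta> z 0] by simp
  have \<gamma>: "\<gamma> - \<gamma>' = 0"
  proof (rule ccontr)
    assume ne: "\<gamma> - \<gamma>' \<noteq> 0"
    define K where "K = norm (\<Delta> 0) + (\<Sum>\<^sub>\<infinity>y. 1 * norm (d y)) + (LINT x|lborel. norm (g x)) + norm N * pi"
    have "norm (\<gamma> - \<gamma>') * \<bar>z\<bar> \<le> K" for z
    proof -
      have "\<i> * (\<gamma> - \<gamma>') * of_real z = \<Delta> 0 - trig_series UNIV d z - fourier g z - N * winding_exponent z"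
        unfolding \<Delta>0[of z, symmetric] by (simp add: \<Delta>_def)
      then have "norm (\<i> * (\<gamma> - \<gamma>') * of_real z) \<le> norm (\<Delta> 0) + norm (trig_series UNIV d z) + norm (fourier g z) + norm (N * winding_exponent z)"
        by (simp only:) (intro order_trans[OF norm_triangle_ineq4] add_right_mono, simp)
      moreover have "norm (winding_exponent z) \<le> pi"
        using arctan_lbound[of z] arctan_ubound[of z] by (simp add: winding_exponent_eq norm_mult)
      then have "norm (N * winding_exponent z) \<le> norm N * pi" unfolding norm_mult by (rule mult_left_mono) simp
      moreover note D_rep_bound[OF weight_one D, of z] norm_fourier_le[of g z]
      ultimately show ?thesis by (simp add: K_def norm_mult)
    qed
    from this[of "(\<bar>K\<bar> + 1) / norm (\<gamma> - \<gamma>')"] ne show False by simp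
  qed
  have form: "trig_series UNIV d z = \<Delta> 0 - fourier g z - N * winding_exponent z" for z
    using \<Delta>0[of z] \<gamma> by (simp add: \<Delta>_def algebra_simps)
  have RL: "(fourier g \<longlongrightarrow> 0) at_top" "(fourier g \<longlongrightarrow> 0) at_bot"
    using Riemann_Lebesgue[OF gi] at_top_le_at_infinity at_bot_le_at_infinity by (auto intro: tendsto_mono)
  have "(trig_series UNIV d \<longlongrightarrow> \<Delta> 0 - 0 - N * (2 * \<i> * of_real (pi / 2))) at_top"
    unfolding form winding_exponent_eq by (intro tendsto_intros RL tendsto_arctan_at_top)
  from D_rep_eq_limit(1)[OF weight_one D this, of 0]
  have 1: "trig_series UNIV d 0 = \<Delta> 0 - N * (2 * \<i> * of_real (pi / 2))" by simp
  have "(trig_series UNIV d \<longlongrightarrow> \<Delta> 0 - 0 - N * (2 * \<i> * of_real (- (pi / 2)))) at_bot"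
    unfolding form winding_exponent_eq by (intro tendsto_intros RL tendsto_arctan_at_bot)
  from D_rep_eq_limit(2)[OF weight_one D this, of 0]
  have 2: "trig_series UNIV d 0 = \<Delta> 0 - N * (2 * \<i> * of_real (- (pi / 2)))" by simp
  have N0: "N = 0" using 1 2 by (simp add: complex_eq_iff)
  show thesis
  proof (rule that[of "\<Delta> 0"])
    show "trig_series UNIV c z + fourier h z = trig_series UNIV c' z + fourier h' z + \<Delta> 0" for z
      using form[of z] N0 unfolding tz gz by (simp add: algebra_simps)
  qed
qed

lemma levy_khintchine_rep_iff_kernel:
  "levy_khintchine_rep F \<longleftrightarrow> (\<exists>a \<gamma> \<nu>. complex_quasi_levy \<nu> \<and>
     (\<forall>z. F z = exp (\<i> * \<gamma> * of_real z - a * (of_real z)\<^sup>2 / 2 + complex_quasi_levy_integral \<nu> (lk_kernel z))))"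
  unfolding levy_khintchine_rep_def lk_kernel_def[abs_def] ..

text \<open>The second difference of the exponent is bounded, so
  \<open>\<bar>F(z)\<bar>\<^sup>2 \<le> K \<bar>F(z - h)\<bar>\<close>: if \<open>F\<close> is small at \<open>s\<close>, it is small on any given finite
  progression starting at \<open>s\<close>. Far out this contradicts the mean of \<open>F\<close> being a nonzero
  coefficient.\<close>

lemma levy_khintchine_lower_bound:
  assumes a: "(\<lambda>y. norm (a y)) summable_on UNIV" and y0: "a y0 \<noteq> 0" and f: "integrable lborel f"
    and F: "\<And>z. F z = trig_series UNIV a z + fourier f z" and L: "levy_khintchine_rep F"
  shows "\<exists>\<delta>>0. \<forall>z. norm (F z) \<ge> \<delta>"
proof -
  obtain A \<gamma> \<nu> where \<nu>: "complex_quasi_levy \<nu>"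
    and FE: "\<And>z. F z = exp (\<i> * \<gamma> * of_real z - A * (of_real z)\<^sup>2 / 2 + complex_quasi_levy_integral \<nu> (lk_kernel z))"
    using L unfolding levy_khintchine_rep_iff_kernel by blast
  define \<psi> where "\<psi> z = \<i> * \<gamma> * of_real z - A * (of_real z)\<^sup>2 / 2 + complex_quasi_levy_integral \<nu> (lk_kernel z)" for z
  have F\<psi>: "F z = exp (\<psi> z)" for z by (simp add: FE \<psi>_def)
  obtain B where B: "\<And>z h. norm (complex_quasi_levy_integral \<nu> (lk_kernel (z + h)) + complex_quasi_levy_integral \<nu> (lk_kernel (z - h))
      - 2 * complex_quasi_levy_integral \<nu> (lk_kernel z)) \<le> (h\<^sup>2 + 2) * B"
    by (rule complex_quasi_levy_second_difference[OF \<nu>]) (rule that)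
  define C where "C h = norm A * h\<^sup>2 + (h\<^sup>2 + 2) * B" for h
  have diff: "norm (\<psi> (z + h) + \<psi> (z - h) - 2 * \<psi> z) \<le> C h" for z h
  proof -
    define q where "q = complex_quasi_levy_integral \<nu> (lk_kernel (z + h)) + complex_quasi_levy_integral \<nu> (lk_kernel (z - h))
      - 2 * complex_quasi_levy_integral \<nu> (lk_kernel z)"
    have "\<psi> (z + h) + \<psi> (z - h) - 2 * \<psi> z = - A * (of_real h)\<^sup>2 + q"
      by (simp add: \<psi>_def q_def field_simps power2_eq_square)
    moreover have "norm (- A * (of_real h)\<^sup>2) = norm A * h\<^sup>2" by (simp add: norm_mult norm_power)
    moreover have "norm q \<le> (h\<^sup>2 + 2) * B" unfolding q_def by (rule B)
    ultimately show ?thesis using norm_triangle_ineq[of "- A * (of_real h)\<^sup>2" q] by (simp add: C_def)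
  qed
  define M where "M = (\<Sum>\<^sub>\<infinity>y. norm (a y)) + (LINT x|lborel. norm (f x))"
  have FM: "norm (F z) \<le> M" for z
    unfolding F M_def by (intro order_trans[OF norm_triangle_ineq] add_mono norm_trig_series_le[OF a] norm_fourier_le)
  have M0: "M \<ge> 0" using FM[of 0] norm_ge_zero order_trans by blast
  have F2: "(norm (F z))\<^sup>2 \<le> exp (C h) * M * norm (F (z - h))" for z h
  proof -
    define D where "D = \<psi> (z + h) + \<psi> (z - h) - 2 * \<psi> z"
    \<comment> \<open>Exponentiating the second difference turns its bound into a multiplicative
      one; the factor at \<open>z + h\<close> is then absorbed by the upper bound
      \<open>M\<close>.\<close>
    have "\<psi> z + \<psi> z = \<psi> (z + h) + \<psi> (z - h) + - D" by (simp add: D_def)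
    then have "F z * F z = F (z + h) * F (z - h) * exp (- D)" unfolding F\<psi> exp_add[symmetric] by simp
    then have "norm (F z) * norm (F z) = norm (F (z + h)) * norm (F (z - h)) * exp (- Re D)"
      by (metis norm_mult norm_exp_eq_Re uminus_complex.simps(1))
    also have "\<dots> \<le> M * norm (F (z - h)) * exp (C h)"
    proof (intro mult_mono FM)
      have "\<bar>Re D\<bar> \<le> C h" using abs_Re_le_cmod[of D] diff[of z h] unfolding D_def by linarith
      then show "exp (- Re D) \<le> exp (C h)" by simp
    qed (use M0 in auto)
    finally show ?thesis by (simp add: power2_eq_square mult_ac)
  qed
  \<comment> \<open>The mean keeps modulus at least \<open>3 * e\<close>, hence so does some term on
    every progression; the absolutely continuous part costs \<open>e\<close> far out and leaves
    \<open>2 * e\<close>.\<close>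
  define e where "e = norm (a y0) / 4"
  have e: "e > 0" using y0 by (simp add: e_def)
  obtain h :: real and n :: nat where hn: "h > 0" "n > 0"
    "\<And>s. norm ((\<Sum>k<n. trig_series UNIV a (s + real k * h) * iexp (- ((s + real k * h) * y0))) / n - a y0) \<le> e"
    by (rule trig_series_mean[OF a e, of y0]) (rule that)
  have mean: "norm ((\<Sum>k<n. trig_series UNIV a (s + real k * h) * iexp (- ((s + real k * h) * y0))) / n) \<ge> 3 * e" for s
    using hn(3)[of s] norm_triangle_ineq2[of "a y0" "(\<Sum>k<n. trig_series UNIV a (s + real k * h) * iexp (- ((s + real k * h) * y0))) / n"]
    by (simp add: e_def norm_minus_commute)
  have "\<exists>k<n. norm (trig_series UNIV a (s + real k * h)) \<ge> 3 * e" for s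
  proof (rule ccontr)
    assume "\<not> (\<exists>k<n. norm (trig_series UNIV a (s + real k * h)) \<ge> 3 * e)"
    then have lt: "norm (trig_series UNIV a (s + real k * h)) < 3 * e" if "k < n" for k using that by auto
    have "norm (\<Sum>k<n. trig_series UNIV a (s + real k * h) * iexp (- ((s + real k * h) * y0))) \<le> (\<Sum>k<n. norm (trig_series UNIV a (s + real k * h)))"
      by (rule sum_norm_le) (simp add: norm_mult)
    also have "\<dots> < (\<Sum>k<n. 3 * e)" by (rule sum_strict_mono) (use lt hn(2) in auto)
    finally have "norm ((\<Sum>k<n. trig_series UNIV a (s + real k * h) * iexp (- ((s + real k * h) * y0))) / n) < 3 * e"
      using hn(2) by (simp add: norm_divide field_simps)
    then show False using mean[of s] by linarith
  qed
  then obtain r where r: "\<And>s. r s < n" "\<And>s. norm (trig_series UNIV a (s + real (r s) * h)) \<ge> 3 * e" by metis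
  have "\<forall>\<^sub>F z in at_infinity. dist (fourier f z) 0 < e" using Riemann_Lebesgue[OF f] e by (rule tendstoD)
  then obtain R where R: "\<And>z. R \<le> \<bar>z\<bar> \<Longrightarrow> norm (fourier f z) < e" by (auto simp: eventually_at_infinity)
  \<comment> \<open>One constant for all shifts \<open>real k * h\<close> with \<open>k < n\<close>:
    the sum dominates each exponential, and the summand 1 keeps \<open>E\<close> positive.\<close>
  define E where "E = (\<Sum>k<n. exp (C (real k * h))) * M + 1"
  have E0: "E > 0" unfolding E_def using M0 by (intro add_nonneg_pos mult_nonneg_nonneg sum_nonneg) auto
  define d where "d = (2 * e)\<^sup>2 / E"
  have d0: "d > 0" using e E0 by (simp add: d_def)
  have large: "norm (F s) \<ge> d" if s: "\<bar>s\<bar> \<ge> \<bar>R\<bar> + real n * h" for s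
  proof -
    let ?z = "s + real (r s) * h"
    have "real (r s) * h \<le> real n * h" using r(1)[of s] hn(1) by (intro mult_right_mono) auto
    moreover have "0 \<le> real (r s) * h" using hn(1) by simp
    ultimately have "R \<le> \<bar>?z\<bar>" using s by linarith
    then have "norm (fourier f ?z) < e" by (rule R)
    then have "norm (F ?z) \<ge> 2 * e"
      using r(2)[of s] norm_triangle_ineq2[of "trig_series UNIV a ?z" "- fourier f ?z"] by (simp add: F)
    then have "(2 * e)\<^sup>2 \<le> (norm (F ?z))\<^sup>2" using e by (intro power_mono) auto
    also have "\<dots> \<le> exp (C (real (r s) * h)) * M * norm (F (?z - real (r s) * h))" by (rule F2)
    also have "\<dots> \<le> E * norm (F s)"
    proof -
      have "exp (C (real (r s) * h)) \<le> (\<Sum>k<n. exp (C (real k * h)))"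
        by (rule member_le_sum) (use r(1)[of s] in auto)
      then have "exp (C (real (r s) * h)) * M \<le> E" unfolding E_def using M0 by (meson add_increasing2 mult_right_mono zero_le_one)
      then show ?thesis by (simp add: mult_right_mono)
    qed
    finally show ?thesis using E0 by (simp add: d_def divide_le_eq mult.commute)
  qed
  show ?thesis
  proof (rule lower_bound_from_infinity[OF _ _ d0])
    have "F = (\<lambda>z. trig_series UNIV a z + fourier f z)" using F by auto
    then show "continuous_on UNIV F" using trig_series_continuous[OF a] continuous_on_fourier[OF f] by (simp add: continuous_on_add)
    show "F z \<noteq> 0" for z by (simp add: F\<psi>)
    show "\<forall>\<^sub>F z in at_infinity. norm (F z) \<ge> d"
      unfolding eventually_at_infinity using large by (intro exI[of _ "\<bar>R\<bar> + real n * h"]) auto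
  qed
qed

text \<open>The function \<open>h\<close> and \<open>m\<close> times the winding kernel form the
  density and the coefficients \<open>c\<close> away from 0 form the atoms of the quasi-Levy
  measure; the Gaussian coefficient is 0.\<close>

lemma levy_khintchine_of_exponent:
  assumes c: "(\<lambda>y. norm (c y)) summable_on UNIV" and h: "integrable lborel h"
    and F: "\<And>z. F z = exp (\<i> * \<gamma> * of_real z + (trig_series UNIV c z + fourier h z) + of_int m * winding_exponent z)"
    and F0: "F 0 = 1"
  shows "levy_khintchine_rep F"
proof -
  \<comment> \<open>A Levy measure has no atom at 0. Omitting the coefficient there is harmless: the
    kernel vanishes at 0, and the coefficient cancels between the values of the series at
    \<open>z\<close> and at 0.\<close>
  define Y where "Y = - {0::real}"
  define k where "k x = complex_of_real (exp (- \<bar>x\<bar>) / \<bar>x\<bar> * sgn x)" for x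
  define q where "q x = h x + of_int m * k x" for x
  have [measurable]: "h \<in> borel_measurable borel" using h by auto
  have [measurable]: "k \<in> borel_measurable borel" unfolding k_def by measurable
  have qm[measurable]: "q \<in> borel_measurable borel" unfolding q_def by measurable
  have kx: "\<bar>x\<bar> * norm (k x) \<le> exp (- 1 * \<bar>x\<bar>)" for x
    unfolding k_def norm_of_real abs_mult by (cases "x = 0") (auto simp: abs_sgn_eq)
  have nmin: "min \<bar>x\<bar> 1 * norm (q x) \<le> norm (h x) + norm (of_int m :: complex) * exp (- 1 * \<bar>x\<bar>)" for x :: real
  proof -
    have "min \<bar>x\<bar> 1 * norm (q x) \<le> min \<bar>x\<bar> 1 * (norm (h x) + norm (of_int m :: complex) * norm (k x))"
      unfolding q_def by (intro mult_left_mono order_trans[OF norm_triangle_ineq]) (auto simp: norm_mult)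
    also have "\<dots> = min \<bar>x\<bar> 1 * norm (h x) + norm (of_int m :: complex) * (min \<bar>x\<bar> 1 * norm (k x))" by (simp add: algebra_simps)
    also have "\<dots> \<le> 1 * norm (h x) + norm (of_int m :: complex) * (\<bar>x\<bar> * norm (k x))"
      by (intro add_mono mult_right_mono mult_left_mono) auto
    also have "\<dots> \<le> norm (h x) + norm (of_int m :: complex) * exp (- 1 * \<bar>x\<bar>)"
      using mult_left_mono[OF kx[of x], of "norm (of_int m :: complex)"] by simp
    finally show ?thesis .
  qed
  have di: "integrable lborel (\<lambda>x. norm (h x) + norm (of_int m :: complex) * exp (- 1 * \<bar>x\<bar>))"
    using h by (intro Bochner_Integration.integrable_add integrable_mult_right integrable_exp_minus_abs integrable_norm) auto
  have qi: "integrable lborel (\<lambda>x. min \<bar>x\<bar> 1 * norm (q x))"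
    by (rule Bochner_Integration.integrable_bound[OF di], measurable)
       (rule AE_I2, unfold real_norm_def, simp only: abs_mult abs_norm_cancel, rule order_trans[OF _ abs_ge_self], use nmin in simp)
  have cY: "(\<lambda>y. norm (c y)) summable_on Y" by (rule summable_on_subset_banach[OF c]) simp
  obtain \<nu> where \<nu>: "complex_quasi_levy \<nu>" "\<And>\<phi> K. \<phi> \<in> borel_measurable borel \<Longrightarrow> (\<And>x. norm (\<phi> x) \<le> K * min \<bar>x\<bar> 1) \<Longrightarrow>
       complex_quasi_levy_integral \<nu> \<phi> = (LINT x|lborel. q x * \<phi> x) + (\<Sum>\<^sub>\<infinity>y\<in>Y. c y * \<phi> y)"
    by (rule complex_quasi_levy_mixed[OF qm qi cY]) (use that in \<open>auto simp: Y_def\<close>)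
  define u where "u x = complex_of_real (x * indicator {-1<..<1} x)" for x :: real
  have [measurable]: "u \<in> borel_measurable borel" unfolding u_def by measurable
  have un: "norm (u x) \<le> min \<bar>x\<bar> 1" for x
    unfolding u_def norm_of_real by (auto simp: indicator_def)
  have qu: "integrable lborel (\<lambda>x. q x * u x)"
    by (rule Bochner_Integration.integrable_bound[OF qi])
       (use mult_left_mono[OF un norm_ge_zero[of "q _"]] in \<open>auto simp: norm_mult abs_mult mult.commute\<close>)
  have cu: "(\<lambda>y. c y * u y) summable_on Y"
  proof (rule abs_summable_summable, rule summable_on_comparison_test[OF cY])
    show "norm (c y * u y) \<le> norm (c y)" for y
      using mult_left_mono[of "norm (u y)" 1 "norm (c y)"] un[of y] by (simp add: norm_mult)
  qed auto
  \<comment> \<open>The compensating term is integrable by itself, so it can be split off; it only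
    shifts the drift by \<open>\<beta>\<close>.\<close>
  define \<beta> where "\<beta> = (LINT x|lborel. q x * u x) + (\<Sum>\<^sub>\<infinity>y\<in>Y. c y * u y)"
  have main: "complex_quasi_levy_integral \<nu> (lk_kernel z) = (trig_series UNIV c z + fourier h z) - (trig_series UNIV c 0 + fourier h 0)
      + of_int m * winding_exponent z - \<i> * z * \<beta>" for z
  proof -
    have ker: "lk_kernel z x = (iexp (z * x) - 1) - \<i> * z * u x" for x
      by (simp add: lk_kernel_def u_def mult.assoc)
    have "norm (lk_kernel z x) \<le> (z\<^sup>2 + 2) * min \<bar>x\<bar> 1" for x
      using norm_lk_kernel_le[of z x] mult_left_mono[OF min_square_le_min_abs[of x], of "z\<^sup>2 + 2"] by simp
    from \<nu>(2)[OF lk_kernel_measurable this]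
    have 1: "complex_quasi_levy_integral \<nu> (lk_kernel z) = (LINT x|lborel. q x * lk_kernel z x) + (\<Sum>\<^sub>\<infinity>y\<in>Y. c y * lk_kernel z y)" .
    have hi: "integrable lborel (\<lambda>x. h x * iexp (z * x))" by (rule integrable_mult_iexp[OF h])
    have ki: "integrable lborel (\<lambda>x. k x * (iexp (z * x) - 1))" unfolding k_def by (rule winding_exponent_integrable)
    have "(LINT x|lborel. q x * lk_kernel z x) = (LINT x|lborel. (h x * iexp (z * x) - h x + of_int m * (k x * (iexp (z * x) - 1))) - \<i> * z * (q x * u x))"
      by (intro Bochner_Integration.integral_cong) (auto simp: ker q_def algebra_simps)
    also have "\<dots> = (LINT x|lborel. h x * iexp (z * x)) - (LINT x|lborel. h x) + of_int m * (LINT x|lborel. k x * (iexp (z * x) - 1)) - \<i> * z * (LINT x|lborel. q x * u x)"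
      using hi ki h qu by (simp del: of_real_mult)
    finally have 2: "(LINT x|lborel. q x * lk_kernel z x) = fourier h z - fourier h 0 + of_int m * winding_exponent z - \<i> * z * (LINT x|lborel. q x * u x)"
      by (simp add: fourier_def winding_exponent_def k_def)
    have cs: "(\<lambda>y. c y * iexp (z * y)) summable_on UNIV" "c summable_on UNIV"
      using trig_series_terms_summable[OF c, of z] trig_series_terms_summable[OF c, of 0] by simp_all
    have cs': "(\<lambda>y. c y * iexp (z * y) + - 1 * c y) summable_on Y"
      by (intro summable_on_add summable_on_cmult_right summable_on_subset_banach[OF cs(1)] summable_on_subset_banach[OF cs(2)]) auto
    have "(\<Sum>\<^sub>\<infinity>y\<in>Y. c y * lk_kernel z y) = (\<Sum>\<^sub>\<infinity>y\<in>Y. (c y * iexp (z * y) + - 1 * c y) + (- \<i> * z) * (c y * u y))"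
      by (intro infsum_cong) (auto simp: ker algebra_simps)
    also have "\<dots> = (\<Sum>\<^sub>\<infinity>y\<in>Y. c y * iexp (z * y) + - 1 * c y) + (- \<i> * z) * (\<Sum>\<^sub>\<infinity>y\<in>Y. c y * u y)"
      by (subst infsum_add[OF cs' summable_on_cmult_right[OF cu]]) (simp only: infsum_cmult_right')
    also have "(\<Sum>\<^sub>\<infinity>y\<in>Y. c y * iexp (z * y) + - 1 * c y) = (\<Sum>\<^sub>\<infinity>y. c y * iexp (z * y) + - 1 * c y)"
      by (rule infsum_cong_neutral) (auto simp: Y_def)
    also have "\<dots> = trig_series UNIV c z + - 1 * trig_series UNIV c 0"
      unfolding trig_series_def by (subst infsum_add[OF cs(1) summable_on_cmult_right[OF cs(2)]]) (simp add: infsum_uminus)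
    finally have 3: "(\<Sum>\<^sub>\<infinity>y\<in>Y. c y * lk_kernel z y) = trig_series UNIV c z - trig_series UNIV c 0 - \<i> * z * (\<Sum>\<^sub>\<infinity>y\<in>Y. c y * u y)"
      by simp
    show ?thesis unfolding 1 2 3 \<beta>_def by (simp add: algebra_simps)
  qed
  have w0: "winding_exponent 0 = 0" by (simp add: winding_exponent_eq)
  \<comment> \<open>The exponents differ by this constant, and the normalisation
    \<open>F 0 = 1\<close> disposes of it.\<close>
  have e0: "exp (trig_series UNIV c 0 + fourier h 0) = 1" using F[of 0] F0 by (simp add: w0)
  have "F z = exp (\<i> * (\<gamma> + \<beta>) * of_real z - 0 * (of_real z)\<^sup>2 / 2 + complex_quasi_levy_integral \<nu> (lk_kernel z))" for z
  proof -
    have "\<i> * \<gamma> * of_real z + (trig_series UNIV c z + fourier h z) + of_int m * winding_exponent z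
      = (\<i> * (\<gamma> + \<beta>) * of_real z - 0 * (of_real z)\<^sup>2 / 2 + complex_quasi_levy_integral \<nu> (lk_kernel z)) + (trig_series UNIV c 0 + fourier h 0)"
      unfolding main by (simp add: algebra_simps)
    then have "F z = exp ((\<i> * (\<gamma> + \<beta>) * of_real z - 0 * (of_real z)\<^sup>2 / 2 + complex_quasi_levy_integral \<nu> (lk_kernel z)) + (trig_series UNIV c 0 + fourier h 0))"
      unfolding F by (simp only:)
    also have "\<dots> = exp (\<i> * (\<gamma> + \<beta>) * of_real z - 0 * (of_real z)\<^sup>2 / 2 + complex_quasi_levy_integral \<nu> (lk_kernel z)) * exp (trig_series UNIV c 0 + fourier h 0)"
      by (rule exp_add)
    finally show ?thesis by (simp only: e0 mult_1_right)
  qed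
  then show ?thesis unfolding levy_khintchine_rep_iff_kernel using \<nu>(1) by blast
qed

text \<open>Inversion and logarithm for an arbitrary weight at once: the trivial weight yields the
  equivalences, the given one the additional claim.\<close>

lemma weighted_representations:
  assumes w: "is_weight \<omega>" and G: "GRS \<omega>"
    and a: "(\<lambda>y. \<omega> y * norm (a y)) summable_on UNIV" and f: "f \<in> L1_weighted \<omega>"
    and F: "\<And>z. F z = trig_series UNIV a z + fourier f z" and \<delta>: "\<delta> > 0" "\<And>z. norm (F z) \<ge> \<delta>"
  shows "\<exists>b g. (\<lambda>y. \<omega> y * norm (b y)) summable_on UNIV \<and> g \<in> L1_weighted \<omega> \<and>
      (\<forall>z. F z * (trig_series UNIV b z + fourier g z) = 1)"
    and "\<exists>(\<gamma>::real) c h (m::int). (\<lambda>y. \<omega> y * norm (c y)) summable_on UNIV \<and> h \<in> L1_weighted \<omega> \<and>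
      (\<forall>z. F z = exp (\<i> * \<gamma> * of_real z + (trig_series UNIV c z + fourier h z) + of_int m * winding_exponent z))"
proof -
  note D = trig_series_D_rep[OF a] and L = L_rep_of_L1_weighted[OF f]
  have R: "R_rep \<omega> F ((\<Sum>\<^sub>\<infinity>y. \<omega> y * norm (a y)) + (LINT x|lborel. \<omega> x * norm (f x)))"
    using R_rep_add[OF w R_rep_D[OF D] R_rep_L[OF L]] unfolding F[symmetric] .
  obtain K where K: "R_rep \<omega> (\<lambda>z. 1 / F z) K" using Wiener_R_rep[OF w G R \<delta>] by blast
  obtain b g where bg: "(\<lambda>y. \<omega> y * norm (b y)) summable_on UNIV" "g \<in> L1_weighted \<omega>"
    "\<And>z. 1 / F z = trig_series UNIV b z + fourier g z"
    by (rule R_rep_coefficients[OF w K]) (rule that)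
  have "F z * (trig_series UNIV b z + fourier g z) = 1" for z
    unfolding bg(3)[symmetric] using \<delta>(1) \<delta>(2)[of z] by auto
  with bg show "\<exists>b g. (\<lambda>y. \<omega> y * norm (b y)) summable_on UNIV \<and> g \<in> L1_weighted \<omega> \<and>
      (\<forall>z. F z * (trig_series UNIV b z + fourier g z) = 1)" by blast
  have "norm (trig_series UNIV a z + fourier f z) \<ge> \<delta>" for z using \<delta>(2)[of z] by (simp add: F)
  from R_rep_logarithm[OF w G D L \<delta>(1) this] obtain \<gamma> :: real and m :: int and H K where
    H: "R_rep \<omega> H K" "\<And>z. trig_series UNIV a z + fourier f z = exp (\<i> * \<gamma> * of_real z + H z + m * winding_exponent z)" by blast
  obtain c h where ch: "(\<lambda>y. \<omega> y * norm (c y)) summable_on UNIV" "h \<in> L1_weighted \<omega>"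
    "\<And>z. H z = trig_series UNIV c z + fourier h z"
    by (rule R_rep_coefficients[OF w H(1)]) (rule that)
  have "F z = exp (\<i> * \<gamma> * of_real z + (trig_series UNIV c z + fourier h z) + of_int m * winding_exponent z)" for z
    unfolding F H(2) ch(3) ..
  with ch(1,2) show "\<exists>(\<gamma>::real) c h (m::int). (\<lambda>y. \<omega> y * norm (c y)) summable_on UNIV \<and> h \<in> L1_weighted \<omega> \<and>
      (\<forall>z. F z = exp (\<i> * \<gamma> * of_real z + (trig_series UNIV c z + fourier h z) + of_int m * winding_exponent z))" by blast
qed

lemma levy_khintchine_rep_iff:
  assumes a: "(\<lambda>y. norm (a y)) summable_on UNIV" and y0: "a y0 \<noteq> 0" and f: "integrable lborel f"
    and F: "\<And>z. F z = trig_series UNIV a z + fourier f z"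
  shows "levy_khintchine_rep F \<longleftrightarrow> (\<exists>\<delta>>0. \<forall>z. norm (F z) \<ge> \<delta>) \<and> F 0 = 1"
proof
  assume L: "levy_khintchine_rep F"
  then show "(\<exists>\<delta>>0. \<forall>z. norm (F z) \<ge> \<delta>) \<and> F 0 = 1"
    using levy_khintchine_lower_bound[OF a y0 f F L] levy_khintchine_rep_at_0 by blast
next
  assume R: "(\<exists>\<delta>>0. \<forall>z. norm (F z) \<ge> \<delta>) \<and> F 0 = 1"
  then obtain \<delta> where \<delta>: "\<delta> > 0" "\<And>z. norm (F z) \<ge> \<delta>" by blast
  have a1: "(\<lambda>y. 1 * norm (a y)) summable_on UNIV" using a by simp
  have f1: "f \<in> L1_weighted (\<lambda>_. 1)" using f by (simp add: integrable_L1_weighted_one)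
  obtain \<gamma> :: real and c h and m :: int where c: "(\<lambda>y. 1 * norm (c y)) summable_on UNIV" and h: "h \<in> L1_weighted (\<lambda>_. 1)"
    and E: "\<And>z. F z = exp (\<i> * \<gamma> * of_real z + (trig_series UNIV c z + fourier h z) + of_int m * winding_exponent z)"
    using weighted_representations(2)[OF weight_one GRS_one a1 f1 F \<delta>] by blast
  show "levy_khintchine_rep F"
    by (rule levy_khintchine_of_exponent[OF _ _ E]) (use c h R in \<open>auto simp: integrable_L1_weighted_one\<close>)
qed

text \<open>Only the linear term of the exponent is unbounded. A nonreal \<open>\<gamma>\<close>
  would make the modulus of \<open>F\<close> grow exponentially in one direction, so boundedness of
  \<open>F\<close> forces \<open>\<gamma>\<close> to be real.\<close>

lemma exp_rep_lower_bound:
  assumes E: "exp_rep F \<gamma> C c h m" and M: "\<And>z. norm (F z) \<le> M"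
  shows "\<exists>\<delta>>0. \<forall>z. norm (F z) \<ge> \<delta>"
proof -
  have c: "(\<lambda>y. norm (c y)) summable_on C" and h: "integrable lborel h"
    and F: "\<And>z. F z = exp (\<i> * \<gamma> * of_real z + trig_series C c z + fourier h z + of_int m * winding_exponent z)"
    using E by (auto simp: exp_rep_def discrete_coeffs_def winding_exponent_def)
  define u where "u z = trig_series C c z + fourier h z + of_int m * winding_exponent z" for z
  define K where "K = (\<Sum>\<^sub>\<infinity>y\<in>C. norm (c y)) + (LINT x|lborel. norm (h x)) + norm (of_int m :: complex) * pi"
  have uK: "norm (u z) \<le> K" for z
  proof -
    have "norm (winding_exponent z) \<le> pi"
      using arctan_lbound[of z] arctan_ubound[of z] by (simp add: winding_exponent_eq norm_mult)
    then have "norm (of_int m * winding_exponent z) \<le> norm (of_int m :: complex) * pi" unfolding norm_mult by (rule mult_left_mono) simp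
    then show ?thesis unfolding u_def K_def
      by (intro order_trans[OF norm_triangle_ineq] add_mono norm_trig_series_le[OF c] norm_fourier_le)
  qed
  have nF: "norm (F z) = exp (- Im \<gamma> * z + Re (u z))" for z
    by (simp add: F u_def add.assoc)
  have Ru: "\<bar>Re (u z)\<bar> \<le> K" for z using abs_Re_le_cmod[of "u z"] uK[of z] by linarith
  have "Im \<gamma> = 0"
  proof (rule ccontr)
    assume ne: "Im \<gamma> \<noteq> 0"
    \<comment> \<open>At this point the linear term contributes \<open>\<bar>M\<bar> + K + 1\<close>
      to the real part of the exponent, of which the other terms can cancel at most
      \<open>K\<close>.\<close>
    define z where "z = - (\<bar>M\<bar> + K + 1) / Im \<gamma>"
    have "\<bar>M\<bar> + 1 \<le> - Im \<gamma> * z + Re (u z)" using ne Ru[of z] by (simp add: z_def abs_if split: if_splits)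
    then have "exp (\<bar>M\<bar> + 1) \<le> norm (F z)" by (simp add: nF)
    moreover have "\<bar>M\<bar> + 1 < exp (\<bar>M\<bar> + 1)" using exp_ge_add_one_self[of "\<bar>M\<bar> + 1"] by linarith
    ultimately show False using M[of z] by linarith
  qed
  then have "exp (- K) \<le> norm (F z)" for z using Ru[of z] by (simp add: nF)
  then show ?thesis by (intro exI[of _ "exp (- K)"]) auto
qed

text \<open>The exponent in (v) vanishes at 0, so (v) is asserted for \<open>F z / F 0\<close>, and
  for \<open>F\<close> itself together with \<open>F 0 = 1\<close>. The last clause quantifies over
  all representations as in (iii) and (iv), which is where uniqueness enters.\<close>

theorem theorem2p1:
  fixes A :: "real set" and a :: "real \<Rightarrow> complex" and f F :: "real \<Rightarrow> complex"
  assumes "A \<noteq> {}" and "discrete_coeffs A a"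
    and "0 < (\<Sum>\<^sub>\<infinity>y\<in>A. norm (a y))"
    and "integrable lborel f"
    and "\<And>z. F z = trig_series A a z + fourier f z"
  shows
    "((INF z. norm (F z)) > 0 \<longleftrightarrow>
        (\<forall>z. F z \<noteq> 0) \<and> (INF z. norm (trig_series A a z)) > 0) \<and>
     ((INF z. norm (F z)) > 0 \<longleftrightarrow> (\<exists>B b g. inverse_rep F B b g)) \<and>
     ((INF z. norm (F z)) > 0 \<longleftrightarrow> (\<exists>\<gamma> C c h m. exp_rep F \<gamma> C c h m)) \<and>
     ((INF z. norm (F z)) > 0 \<longleftrightarrow>
        F 0 \<noteq> 0 \<and> levy_khintchine_rep (\<lambda>z. F z / F 0)) \<and>
     (levy_khintchine_rep F \<longleftrightarrow> (INF z. norm (F z)) > 0 \<and> F 0 = 1) \<and>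
     ((INF z. norm (F z)) > 0 \<longrightarrow>
        (\<forall>\<omega>. is_weight \<omega> \<and> GRS \<omega> \<and> f \<in> L1_weighted \<omega> \<and>
             (\<lambda>y. \<omega> y * norm (a y)) summable_on A \<longrightarrow>
          (\<forall>B b g. inverse_rep F B b g \<longrightarrow>
             g \<in> L1_weighted \<omega> \<and> (\<lambda>y. \<omega> y * norm (b y)) summable_on B) \<and>
          (\<forall>\<gamma> C c h m. exp_rep F \<gamma> C c h m \<longrightarrow>
             h \<in> L1_weighted \<omega> \<and> (\<lambda>y. \<omega> y * norm (c y)) summable_on C)))"
proof -
  note f = assms(4)
  \<comment> \<open>Extension by 0 replaces the index set by the whole line, as in the predicates
    for the algebra.\<close>
  define a' where "a' y = (if y \<in> A then a y else 0)" for y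
  have an: "(\<lambda>y. norm (a' y)) summable_on UNIV" unfolding a'_def by (rule discrete_coeffs_extend[OF assms(2)])
  have PA: "trig_series A a = trig_series UNIV a'" unfolding a'_def[abs_def] by (rule trig_series_restrict[symmetric])
  have F: "F z = trig_series UNIV a' z + fourier f z" for z using assms(5) by (simp add: PA)
  have "\<exists>y0. a' y0 \<noteq> 0"
  proof (rule ccontr)
    assume "\<not> (\<exists>y0. a' y0 \<noteq> 0)"
    then have "a y = 0" if "y \<in> A" for y using that unfolding a'_def by metis
    then have "(\<Sum>\<^sub>\<infinity>y\<in>A. norm (a y)) = 0" by (intro infsum_0) auto
    then show False using assms(3) by simp
  qed
  then obtain y0 where y0: "a' y0 \<noteq> 0" by blast
  have a1: "(\<lambda>y. 1 * norm (a' y)) summable_on UNIV" using an by simp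
  have f1: "f \<in> L1_weighted (\<lambda>_. 1)" using f by (simp add: integrable_L1_weighted_one)
  note D = trig_series_D_rep[OF a1] and RL = Riemann_Lebesgue[OF f]
  have FM: "norm (F z) \<le> (\<Sum>\<^sub>\<infinity>y. norm (a' y)) + (LINT x|lborel. norm (f x))" for z
    unfolding F by (intro order_trans[OF norm_triangle_ineq] add_mono norm_trig_series_le[OF an] norm_fourier_le)
  have Fc: "continuous_on UNIV F"
  proof -
    have "F = (\<lambda>z. trig_series UNIV a' z + fourier f z)" using F by auto
    then show ?thesis using trig_series_continuous[OF an] continuous_on_fourier[OF f] by (simp add: continuous_on_add)
  qed

  define LB where "LB G \<longleftrightarrow> (\<exists>\<delta>>0. \<forall>z. norm (G z) \<ge> \<delta>)" for G :: "real \<Rightarrow> complex"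
  have INF: "(INF z. norm (G z)) > 0 \<longleftrightarrow> LB G" for G :: "real \<Rightarrow> complex"
    unfolding LB_def by (rule INF_norm_pos_iff)

  have i_ii: "LB F \<longleftrightarrow> (\<forall>z. F z \<noteq> 0) \<and> LB (trig_series A a)"
  proof
    assume "LB F"
    then obtain \<delta> where \<delta>: "\<delta> > 0" "\<And>z. norm (F z) \<ge> \<delta>" unfolding LB_def by blast
    have "norm (trig_series UNIV a' z) \<ge> \<delta>" for z
      by (rule D_rep_lower_bound[OF weight_one D RL]) (use \<delta>(2) in \<open>simp add: F\<close>)
    moreover have "F z \<noteq> 0" for z using \<delta>(1) \<delta>(2)[of z] by auto
    ultimately show "(\<forall>z. F z \<noteq> 0) \<and> LB (trig_series A a)" unfolding LB_def PA using \<delta>(1) by blast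
  next
    assume R: "(\<forall>z. F z \<noteq> 0) \<and> LB (trig_series A a)"
    then obtain \<delta> where \<delta>: "\<delta> > 0" "\<And>z. norm (trig_series UNIV a' z) \<ge> \<delta>" unfolding LB_def PA by blast
    have "\<forall>\<^sub>F z in at_infinity. dist (fourier f z) 0 < \<delta> / 2" using RL by (rule tendstoD) (use \<delta> in simp)
    then have "\<forall>\<^sub>F z in at_infinity. norm (F z) \<ge> \<delta> / 2"
    proof eventually_elim
      case (elim z)
      show ?case using elim \<delta>(2)[of z] norm_triangle_ineq2[of "trig_series UNIV a' z" "- fourier f z"] by (simp add: F)
    qed
    moreover have "\<delta> / 2 > 0" using \<delta>(1) by simp
    ultimately show "LB F" unfolding LB_def using R lower_bound_from_infinity[OF Fc] by blast
  qed

  have i_iii: "LB F \<longleftrightarrow> (\<exists>B b g. inverse_rep F B b g)"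
  proof
    assume "LB F"
    then obtain \<delta> where \<delta>: "\<delta> > 0" "\<And>z. norm (F z) \<ge> \<delta>" unfolding LB_def by blast
    obtain b g where b: "(\<lambda>y. 1 * norm (b y)) summable_on UNIV" and g: "g \<in> L1_weighted (\<lambda>_. 1)"
      and E: "\<And>z. F z * (trig_series UNIV b z + fourier g z) = 1"
      using weighted_representations(1)[OF weight_one GRS_one a1 f1 F \<delta>] by blast
    have bn: "(\<lambda>y. norm (b y)) summable_on UNIV" using b by simp
    have "inverse_rep F {y. b y \<noteq> 0} b g"
      unfolding inverse_rep_def discrete_coeffs_support(2)[OF bn]
      using discrete_coeffs_support(1)[OF bn] g E by (simp add: integrable_L1_weighted_one)
    then show "\<exists>B b g. inverse_rep F B b g" by blast
  next
    assume "\<exists>B b g. inverse_rep F B b g"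
    then obtain B b g where b: "(\<lambda>y. norm (b y)) summable_on B" and E: "\<And>z. F z * (trig_series B b z + fourier g z) = 1"
      unfolding inverse_rep_def discrete_coeffs_def by blast
    define K where "K = (\<Sum>\<^sub>\<infinity>y\<in>B. norm (b y)) + (LINT x|lborel. norm (g x)) + 1"
    have K: "norm (trig_series B b z + fourier g z) \<le> K" for z
      using norm_triangle_ineq[of "trig_series B b z" "fourier g z"] norm_trig_series_le[OF b, of z] norm_fourier_le[of g z]
      unfolding K_def by linarith
    have K0: "K > 0" unfolding K_def by (intro add_nonneg_pos add_nonneg_nonneg infsum_nonneg) auto
    have "1 / K \<le> norm (F z)" for z
    proof -
      have "1 = norm (F z) * norm (trig_series B b z + fourier g z)" using E[of z] by (metis norm_mult norm_one)
      also have "\<dots> \<le> norm (F z) * K" by (intro mult_left_mono K) auto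
      finally show ?thesis using K0 by (simp add: field_simps)
    qed
    then show "LB F" unfolding LB_def using K0 by (intro exI[of _ "1 / K"]) auto
  qed

  have i_iv: "LB F \<longleftrightarrow> (\<exists>\<gamma> C c h m. exp_rep F \<gamma> C c h m)"
  proof
    assume "LB F"
    then obtain \<delta> where \<delta>: "\<delta> > 0" "\<And>z. norm (F z) \<ge> \<delta>" unfolding LB_def by blast
    obtain \<gamma> :: real and c h and m :: int where c: "(\<lambda>y. 1 * norm (c y)) summable_on UNIV" and h: "h \<in> L1_weighted (\<lambda>_. 1)"
      and E: "\<And>z. F z = exp (\<i> * \<gamma> * of_real z + (trig_series UNIV c z + fourier h z) + of_int m * winding_exponent z)"
      using weighted_representations(2)[OF weight_one GRS_one a1 f1 F \<delta>] by blast
    have cn: "(\<lambda>y. norm (c y)) summable_on UNIV" using c by simp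
    have "exp_rep F \<gamma> {y. c y \<noteq> 0} c h m"
      unfolding exp_rep_def discrete_coeffs_support(2)[OF cn] winding_exponent_def[symmetric]
      using discrete_coeffs_support(1)[OF cn] h E by (simp add: integrable_L1_weighted_one add.assoc)
    then show "\<exists>\<gamma> C c h m. exp_rep F \<gamma> C c h m" by blast
  next
    assume "\<exists>\<gamma> C c h m. exp_rep F \<gamma> C c h m"
    then obtain \<gamma> C c h m where "exp_rep F \<gamma> C c h m" by blast
    then show "LB F" unfolding LB_def by (rule exp_rep_lower_bound[OF _ FM])
  qed

  have levy: "levy_khintchine_rep F \<longleftrightarrow> LB F \<and> F 0 = 1"
    unfolding LB_def by (rule levy_khintchine_rep_iff[OF an y0 f F])

  \<comment> \<open>Division by \<open>F 0\<close> rescales the coefficients and \<open>f\<close>,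
    so the normalised equivalence applies to the quotient.\<close>
  have i_v: "LB F \<longleftrightarrow> F 0 \<noteq> 0 \<and> levy_khintchine_rep (\<lambda>z. F z / F 0)"
  proof (cases "F 0 = 0")
    case True
    then show ?thesis unfolding LB_def by (metis norm_zero not_less)
  next
    case False
    have 1: "(\<lambda>y. norm (1 / F 0 * a' y)) summable_on UNIV"
      unfolding norm_mult by (rule summable_on_cmult_right[OF an])
    have 2: "1 / F 0 * a' y0 \<noteq> 0" using y0 False by simp
    have 3: "integrable lborel (\<lambda>x. 1 / F 0 * f x)" using f by (rule integrable_mult_right)
    have 4: "F z / F 0 = trig_series UNIV (\<lambda>y. 1 / F 0 * a' y) z + fourier (\<lambda>x. 1 / F 0 * f x) z" for z
      unfolding trig_series_cmult fourier_cmult distrib_left[symmetric] F[symmetric] by simp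
    have "levy_khintchine_rep (\<lambda>z. F z / F 0) \<longleftrightarrow> (\<exists>\<delta>>0. \<forall>z. norm (F z / F 0) \<ge> \<delta>)"
      using levy_khintchine_rep_iff[OF 1 2 3 4] False by simp
    also have "\<dots> \<longleftrightarrow> LB F"
      unfolding LB_def
    proof
      assume "\<exists>\<delta>>0. \<forall>z. norm (F z / F 0) \<ge> \<delta>"
      then obtain \<delta> where "\<delta> > 0" "\<And>z. norm (F z / F 0) \<ge> \<delta>" by blast
      then show "\<exists>\<delta>>0. \<forall>z. norm (F z) \<ge> \<delta>"
        using False by (intro exI[of _ "\<delta> * norm (F 0)"]) (auto simp: norm_divide pos_le_divide_eq)
    next
      assume "\<exists>\<delta>>0. \<forall>z. norm (F z) \<ge> \<delta>"
      then obtain \<delta> where "\<delta> > 0" "\<And>z. norm (F z) \<ge> \<delta>" by blast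
      then show "\<exists>\<delta>>0. \<forall>z. norm (F z / F 0) \<ge> \<delta>"
        using False by (intro exI[of _ "\<delta> / norm (F 0)"]) (auto simp: norm_divide divide_right_mono)
    qed
    finally show ?thesis using False by simp
  qed

  have weights: "(\<forall>B b g. inverse_rep F B b g \<longrightarrow>
             g \<in> L1_weighted \<omega> \<and> (\<lambda>y. \<omega> y * norm (b y)) summable_on B) \<and>
          (\<forall>\<gamma> C c h m. exp_rep F \<gamma> C c h m \<longrightarrow>
             h \<in> L1_weighted \<omega> \<and> (\<lambda>y. \<omega> y * norm (c y)) summable_on C)"
    if LB: "LB F" and w: "is_weight \<omega>" and G: "GRS \<omega>" and f\<omega>: "f \<in> L1_weighted \<omega>"
      and a\<omega>: "(\<lambda>y. \<omega> y * norm (a y)) summable_on A" for \<omega>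
  proof -
    obtain \<delta> where \<delta>: "\<delta> > 0" "\<And>z. norm (F z) \<ge> \<delta>" using LB unfolding LB_def by blast
    have a'\<omega>: "(\<lambda>y. \<omega> y * norm (a' y)) summable_on UNIV"
      unfolding a'_def using a\<omega> weighted_summable_extend_iff by blast
    note ex = weighted_representations[OF w G a'\<omega> f\<omega> F \<delta>]
    have F0: "F z \<noteq> 0" for z using \<delta>(1) \<delta>(2)[of z] by auto
    show ?thesis
    proof (intro conjI allI impI)
      fix B b g assume "inverse_rep F B b g"
      then have b: "discrete_coeffs B b" and g: "integrable lborel g" and E: "\<And>z. F z * (trig_series B b z + fourier g z) = 1"
        unfolding inverse_rep_def by blast+
      obtain b2 g2 where b2: "(\<lambda>y. \<omega> y * norm (b2 y)) summable_on UNIV" "g2 \<in> L1_weighted \<omega>"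
        "\<And>z. F z * (trig_series UNIV b2 z + fourier g2 z) = 1" using ex(1) by blast
      have eq: "trig_series UNIV (\<lambda>y. if y \<in> B then b y else 0) z + fourier g z = trig_series UNIV b2 z + fourier g2 z + 0" for z
        unfolding trig_series_restrict using E[of z] b2(3)[of z] F0[of z] by (metis add.right_neutral mult_left_cancel)
      note R = representation_weights[OF w discrete_coeffs_extend[OF b] g b2(1,2) eq]
      show "g \<in> L1_weighted \<omega>" by (rule R(2))
      show "(\<lambda>y. \<omega> y * norm (b y)) summable_on B" using R(1) weighted_summable_extend_iff by blast
    next
      fix \<gamma> C c h m assume "exp_rep F \<gamma> C c h m"
      then have c: "discrete_coeffs C c" and h: "integrable lborel h"
        and E: "\<And>z. F z = exp (\<i> * \<gamma> * of_real z + trig_series C c z + fourier h z + of_int m * winding_exponent z)"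
        unfolding exp_rep_def winding_exponent_def by blast+
      obtain \<gamma>2 :: real and c2 h2 and m2 :: int where c2: "(\<lambda>y. \<omega> y * norm (c2 y)) summable_on UNIV" "h2 \<in> L1_weighted \<omega>"
        "\<And>z. F z = exp (\<i> * \<gamma>2 * of_real z + (trig_series UNIV c2 z + fourier h2 z) + of_int m2 * winding_exponent z)"
        using ex(2) by blast
      have eq: "exp (\<i> * \<gamma> * of_real z + trig_series UNIV (\<lambda>y. if y \<in> C then c y else 0) z + fourier h z + of_int m * winding_exponent z)
        = exp (\<i> * of_real \<gamma>2 * of_real z + trig_series UNIV c2 z + fourier h2 z + of_int m2 * winding_exponent z)" for z
        unfolding trig_series_restrict using E[of z] c2(3)[of z] by (simp only: add.assoc)
      \<comment> \<open>The given exponent and the constructed one have the same exponential, hence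
        the same measure up to an atom at 0, which does not affect the weighted bounds.\<close>
      obtain k where k: "\<And>z. trig_series UNIV (\<lambda>y. if y \<in> C then c y else 0) z + fourier h z = trig_series UNIV c2 z + fourier h2 z + k"
        by (rule exponent_unique[OF discrete_coeffs_extend[OF c] h weighted_summable_norm[OF w c2(1)] L1_weighted_integrable[OF w c2(2)] eq]) (rule that)
      note R = representation_weights[OF w discrete_coeffs_extend[OF c] h c2(1,2) k]
      show "h \<in> L1_weighted \<omega>" by (rule R(2))
      show "(\<lambda>y. \<omega> y * norm (c y)) summable_on C" using R(1) weighted_summable_extend_iff by blast
    qed
  qed
  show ?thesis
    unfolding INF using i_ii i_iii i_iv i_v levy weights by blast
qed

end
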